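(* Let $\lambda\in\mathbb{C}$, $T>0$, and let $u \in C([0,T] ; L^2(\mathbb{R}))$ be a strong solution to the cubic nonlinear Schrödinger equation $$i \partial_t u = -\partial_x^2 u - \lambda |u|^2 u \ \text{ in } [0,T] \times \mathbb{R},\qquad u(x,0) = u_0(x) \ \text{ on } \mathbb{R}.$$ Suppose additionally that $u_0, u(T) \in L^2(\mathbb{R},x^2 \, dx)$, and that $$u_0( \pm c_1 \log(1+n)^{\alpha}) = u(\pm c_2 \log(1+n)^{\alpha},T) = 0 \quad\text{for all integers } n \ge 0,$$ for some $\alpha \in (0,1)$ and some $c_1,c_2 >0$. Then $u \equiv 0$.
   Context: "Strong solution" is understood in the standard $L^2$ well-posedness class: $u\in C([0,T];L^2(\mathbb{R}))\cap L^4([0,T];L^\infty(\mathbb{R}))$ and $u(t) = e^{it\partial_x^2} u_0 +i \lambda \int_0^t e^{i (t-\tau)\partial_x^2} (|u|^2 u)(\tau)\, d \tau$ for all $t\in[0,T]$. Under the stated assumptions $u_0,u(T)\in H^1(\mathbb{R})$, and the pointwise conditions refer to their continuous representatives. $\log(1+n)^\alpha$ means $(\log(1+n))^\alpha$. *)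

theory Defs
  imports "HOL-Probability.Essential_Supremum"
begin

section \<open>The Hilbert space \<open>L\<^sup>2(\<real>; \<complex>)\<close>\<close>

definition square_int :: "(real \<Rightarrow> complex) \<Rightarrow> bool" where
  "square_int f \<longleftrightarrow> f \<in> borel_measurable lborel \<and> integrable lborel (\<lambda>x. (cmod (f x))\<^sup>2)"

definition L2_eq :: "(real \<Rightarrow> complex) \<Rightarrow> (real \<Rightarrow> complex) \<Rightarrow> bool" where
  "L2_eq f g \<longleftrightarrow> square_int f \<and> square_int g \<and> (AE x in lborel. f x = g x)"

lemma square_int_zero: "square_int (\<lambda>x. 0)"
  by (simp add: square_int_def)

lemma square_int_bound:
  assumes "f \<in> borel_measurable lborel" "integrable lborel h"
    and "\<And>x. (cmod (f x))\<^sup>2 \<le> h x"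
  shows "square_int f"
proof -
  have [measurable]: "f \<in> borel_measurable lborel" by fact
  have "integrable lborel (\<lambda>x. (cmod (f x))\<^sup>2)"
  proof (rule Bochner_Integration.integrable_bound[OF assms(2)])
    show "AE x in lborel. norm ((cmod (f x))\<^sup>2) \<le> norm (h x)"
    proof (intro AE_I2)
      fix x
      have "(cmod (f x))\<^sup>2 \<le> h x" by (rule assms(3))
      moreover have "0 \<le> (cmod (f x))\<^sup>2" by simp
      ultimately show "norm ((cmod (f x))\<^sup>2) \<le> norm (h x)"
        unfolding real_norm_def by linarith
    qed
  qed measurable
  then show ?thesis using assms(1) by (simp add: square_int_def)
qed

lemma cmod_add_sq: "(cmod (a + b))\<^sup>2 \<le> 2 * (cmod a)\<^sup>2 + 2 * (cmod b)\<^sup>2"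
proof -
  have "(cmod (a + b))\<^sup>2 \<le> (cmod a + cmod b)\<^sup>2"
    by (intro power_mono norm_triangle_ineq norm_ge_zero)
  also have "\<dots> \<le> 2 * (cmod a)\<^sup>2 + 2 * (cmod b)\<^sup>2"
    using sum_squares_bound[of "cmod a" "cmod b"] by (simp add: power2_sum)
  finally show ?thesis .
qed

lemma square_int_add:
  assumes "square_int f" "square_int g" shows "square_int (\<lambda>x. f x + g x)"
  by (rule square_int_bound[where h = "\<lambda>x. 2 * (cmod (f x))\<^sup>2 + 2 * (cmod (g x))\<^sup>2"])
    (use assms cmod_add_sq in \<open>auto simp: square_int_def\<close>)

lemma square_int_mult_const:
  assumes "square_int f" shows "square_int (\<lambda>x. c * f x)"
  using assms by (auto simp: square_int_def norm_mult power_mult_distrib)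

lemma square_int_inner:
  assumes "square_int f" "square_int g" shows "integrable lborel (\<lambda>x. f x \<bullet> g x)"
proof -
  have [measurable]: "f \<in> borel_measurable lborel" "g \<in> borel_measurable lborel"
    using assms by (auto simp: square_int_def)
  show ?thesis
  proof (rule Bochner_Integration.integrable_bound)
    show "integrable lborel (\<lambda>x. (cmod (f x))\<^sup>2 + (cmod (g x))\<^sup>2)"
      using assms by (auto simp: square_int_def)
    show "AE x in lborel. norm (f x \<bullet> g x) \<le> norm ((cmod (f x))\<^sup>2 + (cmod (g x))\<^sup>2)"
    proof (intro AE_I2)
      fix x
      have "\<bar>f x \<bullet> g x\<bar> \<le> cmod (f x) * cmod (g x)" by (rule Cauchy_Schwarz_ineq2)
      also have "\<dots> \<le> (cmod (f x))\<^sup>2 + (cmod (g x))\<^sup>2"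
        using sum_squares_bound[of "cmod (f x)" "cmod (g x)"]
          mult_nonneg_nonneg[OF norm_ge_zero[of "f x"] norm_ge_zero[of "g x"]] by linarith
      finally show "norm (f x \<bullet> g x) \<le> norm ((cmod (f x))\<^sup>2 + (cmod (g x))\<^sup>2)" by simp
    qed
  qed measurable
qed

quotient_type L2 = "real \<Rightarrow> complex" / partial: L2_eq
  morphisms fun_of abs_L2
proof (rule part_equivpI)
  show "\<exists>f. L2_eq f f" using square_int_zero by (auto simp: L2_eq_def)
  show "symp L2_eq" by (auto intro!: sympI simp: L2_eq_def)
  show "transp L2_eq" by (auto intro!: transpI simp: L2_eq_def)
qed

instantiation L2 :: real_inner
begin

lift_definition zero_L2 :: L2 is "\<lambda>x. 0"
  by (simp add: L2_eq_def square_int_zero)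

lift_definition plus_L2 :: "L2 \<Rightarrow> L2 \<Rightarrow> L2" is "\<lambda>f g x. f x + g x"
  by (auto simp: L2_eq_def square_int_add)

lift_definition uminus_L2 :: "L2 \<Rightarrow> L2" is "\<lambda>f x. - f x"
  using square_int_mult_const[of _ "-1"] by (auto simp: L2_eq_def)

definition minus_L2 :: "L2 \<Rightarrow> L2 \<Rightarrow> L2" where
  "minus_L2 f g = f + - g"

lift_definition scaleR_L2 :: "real \<Rightarrow> L2 \<Rightarrow> L2" is "\<lambda>r f x. r *\<^sub>R f x"
  unfolding scaleR_conv_of_real by (auto simp: L2_eq_def square_int_mult_const)

lift_definition inner_L2 :: "L2 \<Rightarrow> L2 \<Rightarrow> real" is "\<lambda>f g. LINT x|lborel. f x \<bullet> g x"
  by (rule integral_cong_AE) (auto simp: L2_eq_def square_int_def)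

definition norm_L2 :: "L2 \<Rightarrow> real" where "norm_L2 f = sqrt (f \<bullet> f)"

definition sgn_L2 :: "L2 \<Rightarrow> L2" where "sgn_L2 f = inverse (norm f) *\<^sub>R f"

definition dist_L2 :: "L2 \<Rightarrow> L2 \<Rightarrow> real" where "dist_L2 f g = norm (f - g)"

definition uniformity_L2 :: "(L2 \<times> L2) filter" where
  "uniformity_L2 = (INF e\<in>{0<..}. principal {(x, y). dist x y < e})"

definition open_L2 :: "L2 set \<Rightarrow> bool" where
  "open_L2 U = (\<forall>x\<in>U. \<forall>\<^sub>F (x', y) in uniformity. x' = x \<longrightarrow> y \<in> U)"

instance
proof
  fix a b c :: L2 and r s :: real
  show "a + b + c = a + (b + c)"
    by transfer (auto simp: L2_eq_def add.assoc intro!: square_int_add)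
  show "a + b = b + a"
    by transfer (auto simp: L2_eq_def add.commute intro!: square_int_add)
  show "0 + a = a"
    by transfer (auto simp: L2_eq_def)
  show "- a + a = 0"
    by transfer (auto simp: L2_eq_def square_int_zero)
  show "a - b = a + - b"
    by (rule minus_L2_def)
  show "r *\<^sub>R (a + b) = r *\<^sub>R a + r *\<^sub>R b"
    by transfer (auto simp: L2_eq_def scaleR_conv_of_real distrib_left
        intro!: square_int_add square_int_mult_const)
  show "(r + s) *\<^sub>R a = r *\<^sub>R a + s *\<^sub>R a"
    by transfer (auto simp: L2_eq_def scaleR_conv_of_real ring_distribs
        intro!: square_int_add square_int_mult_const)
  show "r *\<^sub>R s *\<^sub>R a = (r * s) *\<^sub>R a"
    by transfer (auto simp: L2_eq_def scaleR_conv_of_real mult.assoc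
        intro!: square_int_mult_const)
  show "1 *\<^sub>R a = a"
    by transfer (auto simp: L2_eq_def)
  show "sgn a = inverse (norm a) *\<^sub>R a"
    by (rule sgn_L2_def)
  show "dist a b = norm (a - b)"
    by (rule dist_L2_def)
  show "uniformity = (INF e\<in>{0<..}. principal {(x, y :: L2). dist x y < e})"
    by (rule uniformity_L2_def)
  show "open U = (\<forall>x\<in>U. \<forall>\<^sub>F (x', y) in uniformity. x' = x \<longrightarrow> y \<in> U)" for U :: "L2 set"
    by (rule open_L2_def)
  show "a \<bullet> b = b \<bullet> a"
    by transfer (simp add: inner_commute)
  show "(a + b) \<bullet> c = a \<bullet> c + b \<bullet> c"
    by transfer (simp add: inner_add_left L2_eq_def square_int_inner)
  show "(r *\<^sub>R a) \<bullet> b = r * (a \<bullet> b)"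
    by transfer simp
  show "0 \<le> a \<bullet> a"
    by transfer simp
  show "a \<bullet> a = 0 \<longleftrightarrow> a = 0"
  proof (transfer)
    fix f assume "L2_eq f f"
    then have f: "square_int f" by (simp add: L2_eq_def)
    have "(LINT x|lborel. f x \<bullet> f x) = 0 \<longleftrightarrow> (AE x in lborel. f x \<bullet> f x = 0)"
      by (rule integral_nonneg_eq_0_iff_AE) (simp_all add: square_int_inner f)
    then show "(LINT x|lborel. f x \<bullet> f x) = 0 \<longleftrightarrow> L2_eq f (\<lambda>x. 0)"
      by (simp add: L2_eq_def f square_int_zero)
  qed
  show "norm a = sqrt (a \<bullet> a)"
    by (rule norm_L2_def)
qed

end

text \<open>Functions that are not square integrable are sent to \<open>0\<close>.\<close>

definition L2_of :: "(real \<Rightarrow> complex) \<Rightarrow> L2" where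
  "L2_of f = (if square_int f then abs_L2 f else 0)"

lemma square_int_fun_of: "square_int (fun_of f)"
  using Quotient3_rep_reflp[OF Quotient3_L2, of f] by (simp add: L2_eq_def)

lemma L2_of_fun_of: "L2_of (fun_of f) = f"
  by (simp add: L2_of_def square_int_fun_of Quotient3_abs_rep[OF Quotient3_L2])

lemma fun_of_L2_of: "square_int f \<Longrightarrow> AE x in lborel. fun_of (L2_of f) x = f x"
  using Quotient3_rep_abs[OF Quotient3_L2, of f] by (simp add: L2_eq_def L2_of_def)

lemma L2_of_eq_iff:
  "square_int f \<Longrightarrow> square_int g \<Longrightarrow> L2_of f = L2_of g \<longleftrightarrow> (AE x in lborel. f x = g x)"
  using Quotient3_rel[OF Quotient3_L2, of f g] by (simp add: L2_of_def L2_eq_def)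

lemma L2_of_add: "square_int f \<Longrightarrow> square_int g \<Longrightarrow> L2_of f + L2_of g = L2_of (\<lambda>x. f x + g x)"
  by (simp add: L2_of_def square_int_add plus_L2.abs_eq L2_eq_def)

lemma L2_of_scaleR: "square_int f \<Longrightarrow> r *\<^sub>R L2_of f = L2_of (\<lambda>x. r *\<^sub>R f x)"
  using square_int_mult_const[of f "of_real r"]
  by (simp add: L2_of_def scaleR_L2.abs_eq L2_eq_def scaleR_conv_of_real)

lemma L2_of_zero: "L2_of (\<lambda>x. 0) = 0"
  by (simp add: L2_of_def square_int_zero zero_L2.abs_eq)

lemma square_int_diff: "square_int f \<Longrightarrow> square_int g \<Longrightarrow> square_int (\<lambda>x. f x - g x)"
  using square_int_add[of f "\<lambda>x. (-1) * g x"] square_int_mult_const[of g "-1"] by simp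

lemma L2_of_diff: "square_int f \<Longrightarrow> square_int g \<Longrightarrow> L2_of f - L2_of g = L2_of (\<lambda>x. f x - g x)"
  using L2_of_add[of "\<lambda>x. f x - g x" g] square_int_diff[of f g] by (simp add: diff_eq_eq)

lemma norm_L2_of: "square_int f \<Longrightarrow> (norm (L2_of f))\<^sup>2 = (LINT x|lborel. (cmod (f x))\<^sup>2)"
  by (simp add: L2_of_def power2_norm_eq_inner inner_L2.abs_eq L2_eq_def)

subsection \<open>Completeness\<close>

instance L2 :: banach
proof
  fix X :: "nat \<Rightarrow> L2"
  assume X: "Cauchy X"
  define F where "F = (\<lambda>n. fun_of (X n))"
  have F: "square_int (F n)" for n by (simp add: F_def square_int_fun_of)
  have [measurable]: "F n \<in> borel_measurable lborel" for n
    using F by (simp add: square_int_def)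
  have XF: "X n = L2_of (F n)" for n by (simp add: F_def L2_of_fun_of)
  have nrm: "(norm (X m - X n))\<^sup>2 = (LINT x|lborel. (cmod (F m x - F n x))\<^sup>2)" for m n
    by (simp add: XF L2_of_diff F square_int_diff norm_L2_of)
  have nnrm: "(\<integral>\<^sup>+x. ennreal ((cmod (F m x - F n x))\<^sup>2) \<partial>lborel) = ennreal ((norm (X m - X n))\<^sup>2)" for m n
    unfolding nrm using square_int_diff[OF F F, of m n]
    by (intro nn_integral_eq_integral) (auto simp: square_int_def)
  have "\<forall>k. \<exists>N. \<forall>m\<ge>N. \<forall>n\<ge>N. norm (X m - X n) < (1/2)^k"
    using X by (auto simp: Cauchy_iff)
  then obtain N where N: "\<And>k m n. m \<ge> N k \<Longrightarrow> n \<ge> N k \<Longrightarrow> norm (X m - X n) < (1/2)^k"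
    by metis
  define r where "r = rec_nat (N 0) (\<lambda>k p. max (Suc p) (N (Suc k)))"
  have r0: "r 0 = N 0" and rS: "r (Suc k) = max (Suc (r k)) (N (Suc k))" for k
    by (simp_all add: r_def)
  have r: "strict_mono r" by (rule strict_monoI_Suc) (simp add: rS less_max_iff_disj)
  have rN: "r k \<ge> N k" for k by (cases k) (simp_all add: r0 rS)
  have step: "norm (X (r (Suc k)) - X (r k)) < (1/2)^k" for k
    using N rN strict_mono_less_eq[OF r, of k "Suc k"] le_trans by (metis le_SucI order_refl)
  define G where "G = (\<lambda>k x. F (r (Suc k)) x - F (r k) x)"
  have [measurable]: "G k \<in> borel_measurable lborel" for k unfolding G_def by measurable
  have "(\<integral>\<^sup>+x. (\<Sum>k. ennreal (2^k * (cmod (G k x))\<^sup>2)) \<partial>lborel)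
      = (\<Sum>k. \<integral>\<^sup>+x. ennreal (2^k * (cmod (G k x))\<^sup>2) \<partial>lborel)"
    by (intro nn_integral_suminf) measurable
  also have "\<dots> = (\<Sum>k. ennreal (2^k * (norm (X (r (Suc k)) - X (r k)))\<^sup>2))"
    by (simp add: ennreal_mult nn_integral_cmult G_def nnrm)
  also have "\<dots> \<le> (\<Sum>k. ennreal ((1/2)^k))"
  proof (intro suminf_le allI ennreal_leI)
    fix k
    have "(norm (X (r (Suc k)) - X (r k)))\<^sup>2 \<le> ((1/2)^k)\<^sup>2"
      using step[of k] by (intro power_mono) auto
    then have "2^k * (norm (X (r (Suc k)) - X (r k)))\<^sup>2 \<le> 2^k * ((1/2)^k)\<^sup>2"
      by (intro mult_left_mono) auto
    also have "\<dots> = (1/2)^k" by (simp add: power2_eq_square power_one_over)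
    finally show "2^k * (norm (X (r (Suc k)) - X (r k)))\<^sup>2 \<le> (1/2)^k" .
  qed simp_all
  also have "\<dots> < \<infinity>"
    by (subst suminf_ennreal2) (auto intro!: summable_geometric)
  finally have "AE x in lborel. (\<Sum>k. ennreal (2^k * (cmod (G k x))\<^sup>2)) \<noteq> \<infinity>"
    by (intro nn_integral_PInf_AE) auto
  then have "AE x in lborel. convergent (\<lambda>k. F (r k) x)"
  proof eventually_elim
    fix x assume "(\<Sum>k. ennreal (2^k * (cmod (G k x))\<^sup>2)) \<noteq> \<infinity>"
    then have "summable (\<lambda>k. 2^k * (cmod (G k x))\<^sup>2)"
      by (intro summable_suminf_not_top) (auto simp: top.not_eq_extremum)
    then have "(\<lambda>k. 2^k * (cmod (G k x))\<^sup>2) \<longlonglongrightarrow> 0" by (rule summable_LIMSEQ_zero)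
    then have "\<forall>\<^sub>F k in sequentially. 2^k * (cmod (G k x))\<^sup>2 < 1"
      by (rule order_tendstoD) simp
    then have ev: "\<forall>\<^sub>F k in sequentially. norm (G k x) \<le> (sqrt (1/2))^k"
    proof eventually_elim
      case (elim k)
      have "((sqrt (1/2))^k)\<^sup>2 = ((sqrt (1/2))\<^sup>2)^k"
        by (simp only: power_mult[symmetric] mult.commute)
      also have "\<dots> = 1 / 2^k" by (simp add: power_one_over)
      finally have "(cmod (G k x))\<^sup>2 \<le> ((sqrt (1/2))^k)\<^sup>2"
        using elim pos_le_divide_eq[of "2^k" "(cmod (G k x))\<^sup>2" 1] by (simp add: mult.commute)
      then show ?case by (rule power2_le_imp_le) simp
    qed
    have "sqrt (1/2) < (1::real)" by (subst real_sqrt_lt_1_iff) simp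
    then have "summable (\<lambda>k. (sqrt (1/2))^k)" by (intro summable_geometric) simp
    then have "summable (\<lambda>k. G k x)" by (rule summable_comparison_test_ev[OF ev])
    then have "convergent (\<lambda>n. \<Sum>k<n. G k x)" by (simp add: summable_iff_convergent)
    moreover have "(\<Sum>k<n. G k x) = F (r n) x - F (r 0) x" for n
      unfolding G_def by (rule sum_lessThan_telescope)
    ultimately have "convergent (\<lambda>n. F (r n) x - F (r 0) x)" by simp
    then show "convergent (\<lambda>k. F (r k) x)" by (simp add: convergent_diff_const_right_iff)
  qed
  then have lim: "AE x in lborel. (\<lambda>k. F (r k) x) \<longlonglongrightarrow> lim (\<lambda>k. F (r k) x)"
    by eventually_elim (simp add: convergent_LIMSEQ_iff)
  define f where "f = (\<lambda>x. lim (\<lambda>k. F (r k) x))"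
  have [measurable]: "f \<in> borel_measurable lborel" unfolding f_def by measurable
  have fatou: "(\<integral>\<^sup>+x. ennreal ((cmod (f x - F (r k) x))\<^sup>2) \<partial>lborel) \<le> ennreal (((1/2)^k)\<^sup>2)" for k
  proof -
    have "(\<integral>\<^sup>+x. ennreal ((cmod (f x - F (r k) x))\<^sup>2) \<partial>lborel)
        = (\<integral>\<^sup>+x. liminf (\<lambda>m. ennreal ((cmod (F (r m) x - F (r k) x))\<^sup>2)) \<partial>lborel)"
    proof (intro nn_integral_cong_AE, use lim in eventually_elim)
      case (elim x)
      then have "(\<lambda>m. ennreal ((cmod (F (r m) x - F (r k) x))\<^sup>2)) \<longlonglongrightarrow> ennreal ((cmod (f x - F (r k) x))\<^sup>2)"
        unfolding f_def by (intro tendsto_intros)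
      then show ?case by (rule lim_imp_Liminf[OF trivial_limit_sequentially, symmetric])
    qed
    also have "\<dots> \<le> liminf (\<lambda>m. \<integral>\<^sup>+x. ennreal ((cmod (F (r m) x - F (r k) x))\<^sup>2) \<partial>lborel)"
      by (intro nn_integral_liminf) measurable
    also have "\<dots> \<le> ennreal (((1/2)^k)\<^sup>2)"
    proof -
      have "\<forall>\<^sub>F m in sequentially. (\<integral>\<^sup>+x. ennreal ((cmod (F (r m) x - F (r k) x))\<^sup>2) \<partial>lborel) \<le> ennreal (((1/2)^k)\<^sup>2)"
      proof (rule eventually_sequentiallyI)
        fix m assume "k \<le> m"
        then have "r m \<ge> N k" using rN[of k] strict_mono_less_eq[OF r, of k m] by simp
        then have "norm (X (r m) - X (r k)) < (1/2)^k" using N rN by blast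
        then show "(\<integral>\<^sup>+x. ennreal ((cmod (F (r m) x - F (r k) x))\<^sup>2) \<partial>lborel) \<le> ennreal (((1/2)^k)\<^sup>2)"
          unfolding nnrm by (intro ennreal_leI power_mono) auto
      qed
      then have "liminf (\<lambda>m. \<integral>\<^sup>+x. ennreal ((cmod (F (r m) x - F (r k) x))\<^sup>2) \<partial>lborel)
          \<le> liminf (\<lambda>m::nat. ennreal (((1/2)^k)\<^sup>2))"
        by (rule Liminf_mono)
      then show ?thesis by (simp add: Liminf_const)
    qed
    finally show ?thesis .
  qed
  have fk: "square_int (\<lambda>x. f x - F (r k) x)" for k
    unfolding square_int_def
  proof (intro conjI integrableI_bounded)
    show "(\<integral>\<^sup>+x. ennreal (norm ((cmod (f x - F (r k) x))\<^sup>2)) \<partial>lborel) < \<infinity>"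
      using fatou[of k] by (simp add: le_less_trans)
  qed measurable
  have f: "square_int f" using square_int_add[OF fk F, of 0 "r 0"] by simp
  have "norm (X (r k) - L2_of f) \<le> (1/2)^k" for k
  proof -
    have "(norm (L2_of f - X (r k)))\<^sup>2 = (LINT x|lborel. (cmod (f x - F (r k) x))\<^sup>2)"
      by (simp add: XF L2_of_diff f F norm_L2_of square_int_diff)
    moreover have "ennreal (LINT x|lborel. (cmod (f x - F (r k) x))\<^sup>2)
        = (\<integral>\<^sup>+x. ennreal ((cmod (f x - F (r k) x))\<^sup>2) \<partial>lborel)"
      using fk[of k] by (intro nn_integral_eq_integral[symmetric]) (auto simp: square_int_def)
    ultimately have "ennreal ((norm (L2_of f - X (r k)))\<^sup>2) \<le> ennreal (((1/2)^k)\<^sup>2)"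
      using fatou[of k] by simp
    then have "(norm (L2_of f - X (r k)))\<^sup>2 \<le> ((1/2)^k)\<^sup>2"
      by (subst (asm) ennreal_le_iff) auto
    then show ?thesis by (subst norm_minus_commute) (rule power2_le_imp_le, auto)
  qed
  then have ev: "\<forall>\<^sub>F k in sequentially. norm (X (r k) - L2_of f) \<le> (1/2)^k"
    by (intro always_eventually allI)
  have "(\<lambda>k. (1/2::real)^k) \<longlonglongrightarrow> 0" by (rule LIMSEQ_power_zero) simp
  then have "(\<lambda>k. X (r k) - L2_of f) \<longlonglongrightarrow> 0"
    by (rule Lim_null_comparison[OF ev])
  then have "(X \<circ> r) \<longlonglongrightarrow> L2_of f" by (simp add: o_def LIM_zero_iff)
  then show "convergent X"
    using Cauchy_converges_subseq[OF X r] by (auto simp: convergent_def)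
qed

subsection \<open>Separability\<close>

lemma L2_dominated_convergence:
  assumes [measurable]: "\<And>n. f n \<in> borel_measurable lborel"
    and h: "integrable lborel (\<lambda>x. (h x)\<^sup>2)"
    and bound: "\<And>n x. cmod (f n x) \<le> h x"
    and lim: "\<And>x. (\<lambda>n. f n x) \<longlonglongrightarrow> g x"
  shows "square_int (f n)" "square_int g" "(\<lambda>n. L2_of (f n)) \<longlonglongrightarrow> L2_of g"
proof -
  have g[measurable]: "g \<in> borel_measurable lborel"
    by (rule borel_measurable_LIMSEQ_metric[where f = f]) (simp_all add: lim)
  have gb: "cmod (g x) \<le> h x" for x
    by (rule LIMSEQ_le_const2[OF tendsto_norm[OF lim]]) (auto intro: bound)
  show f: "square_int (f n)" for n
    by (rule square_int_bound[OF _ h]) (auto intro!: power_mono bound)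
  show g: "square_int g"
    by (rule square_int_bound[OF _ h]) (auto intro!: power_mono gb)
  have "(\<lambda>n. LINT x|lborel. (cmod (f n x - g x))\<^sup>2) \<longlonglongrightarrow> (LINT x|(lborel :: real measure). 0)"
  proof (rule integral_dominated_convergence[where w = "\<lambda>x. 4 * (h x)\<^sup>2"
        and s = "\<lambda>n x. (cmod (f n x - g x))\<^sup>2" and f = "\<lambda>x. 0"])
    show "AE x in lborel. (\<lambda>n. (cmod (f n x - g x))\<^sup>2) \<longlonglongrightarrow> 0"
    proof (intro AE_I2)
      fix x
      have "(\<lambda>n. (cmod (f n x - g x))\<^sup>2) \<longlonglongrightarrow> (cmod (g x - g x))\<^sup>2"
        by (intro tendsto_intros lim)
      then show "(\<lambda>n. (cmod (f n x - g x))\<^sup>2) \<longlonglongrightarrow> 0" by simp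
    qed
    show "AE x in lborel. norm ((cmod (f n x - g x))\<^sup>2) \<le> 4 * (h x)\<^sup>2" for n
    proof (intro AE_I2)
      fix x
      have "cmod (f n x - g x) \<le> 2 * h x"
        using norm_triangle_ineq4[of "f n x" "g x"] bound[of n x] gb[of x] by linarith
      then have "(cmod (f n x - g x))\<^sup>2 \<le> (2 * h x)\<^sup>2" by (intro power_mono) auto
      then show "norm ((cmod (f n x - g x))\<^sup>2) \<le> 4 * (h x)\<^sup>2" by (simp add: power_mult_distrib)
    qed
  qed (use h in simp_all)
  then have "(\<lambda>n. (norm (L2_of (f n) - L2_of g))\<^sup>2) \<longlonglongrightarrow> 0"
    by (simp add: L2_of_diff f g norm_L2_of square_int_diff)
  then have "(\<lambda>n. sqrt ((norm (L2_of (f n) - L2_of g))\<^sup>2)) \<longlonglongrightarrow> sqrt 0"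
    by (rule tendsto_real_sqrt)
  then have "(\<lambda>n. norm (L2_of (f n) - L2_of g)) \<longlonglongrightarrow> 0" by simp
  then show "(\<lambda>n. L2_of (f n)) \<longlonglongrightarrow> L2_of g"
    by (simp add: tendsto_norm_zero_iff LIM_zero_iff)
qed

definition L2_ind :: "complex \<Rightarrow> real set \<Rightarrow> L2" where
  "L2_ind c A = L2_of (\<lambda>x. indicator A x *\<^sub>R c)"

lemma square_int_ind:
  assumes "A \<in> sets borel" "A \<subseteq> {a..b}"
  shows "square_int (\<lambda>x. indicator A x *\<^sub>R c)"
proof (rule square_int_bound)
  show "integrable lborel (\<lambda>x. indicator {a..b} x *\<^sub>R (cmod c)\<^sup>2)"
    by (intro integrable_scaleR_left integrable_real_indicator) (auto simp: emeasure_lborel_Icc_eq)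
  show "(cmod (indicator A x *\<^sub>R c))\<^sup>2 \<le> indicator {a..b} x *\<^sub>R (cmod c)\<^sup>2" for x
    using assms(2) by (auto simp: indicator_def)
qed (use assms(1) in auto)

lemma L2_ind_tendsto:
  assumes "\<And>n. A n \<in> sets borel" "\<And>n. A n \<subseteq> {a..b}"
    and "\<And>x. (\<lambda>n. indicator (A n) x :: real) \<longlonglongrightarrow> indicator B x"
  shows "(\<lambda>n. L2_ind c (A n)) \<longlonglongrightarrow> L2_ind c B"
  unfolding L2_ind_def
proof (rule L2_dominated_convergence(3)[where h = "\<lambda>x. indicator {a..b} x *\<^sub>R cmod c"])
  have "integrable lborel (\<lambda>x. indicator {a..b} x *\<^sub>R (cmod c)\<^sup>2)"
    by (intro integrable_scaleR_left integrable_real_indicator) (auto simp: emeasure_lborel_Icc_eq)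
  moreover have "(indicator {a..b} x *\<^sub>R cmod c)\<^sup>2 = indicator {a..b} x *\<^sub>R (cmod c)\<^sup>2" for x :: real
    by (auto simp: indicator_def)
  ultimately show "integrable lborel (\<lambda>x. (indicator {a..b} x *\<^sub>R cmod c)\<^sup>2)" by simp
  show "cmod (indicator (A n) x *\<^sub>R c) \<le> indicator {a..b} x *\<^sub>R cmod c" for n x
    using assms(2)[of n] by (auto simp: indicator_def)
  show "(\<lambda>n. indicator (A n) x *\<^sub>R c) \<longlonglongrightarrow> indicator B x *\<^sub>R c" for x
    by (intro tendsto_intros assms)
qed (use assms(1) in auto)

lemma L2_closed_subspace_UNIV:
  assumes V: "subspace V" "closed V"
    and I: "\<And>a b c. a \<in> \<rat> \<Longrightarrow> b \<in> \<rat> \<Longrightarrow> c \<in> {1, \<i>} \<Longrightarrow> L2_ind c {a..b} \<in> V"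
  shows "V = UNIV"
proof -
  have lim: "l \<in> V" if "\<And>n. s n \<in> V" "s \<longlonglongrightarrow> l" for s l
    using V(2) that closed_sequentially by blast
  have int: "L2_ind c {a..b} \<in> V" if c: "c \<in> {1, \<i>}" and "a \<le> b" for a b c
  proof -
    have "\<exists>q\<in>\<rat>. a - 1 / Suc n < q \<and> q < a" "\<exists>q\<in>\<rat>. b < q \<and> q < b + 1 / Suc n" for n
      by (intro Rats_dense_in_real; simp)+
    then obtain p q where p: "\<And>n. p n \<in> \<rat>" "\<And>n. a - 1 / Suc n < p n" "\<And>n. p n < a"
      and q: "\<And>n. q n \<in> \<rat>" "\<And>n. b < q n" "\<And>n. q n < b + 1 / Suc n"
      by metis
    have pl: "p \<longlonglongrightarrow> a"
    proof (rule tendsto_sandwich[where f = "\<lambda>n. a - 1 / real (Suc n)" and h = "\<lambda>n. a"])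
      show "(\<lambda>n. a - 1 / Suc n) \<longlonglongrightarrow> a" 
        using tendsto_diff[OF tendsto_const LIMSEQ_Suc[OF lim_1_over_n], of a] by simp
      show "(\<lambda>n. a) \<longlonglongrightarrow> a" by simp
      show "\<forall>\<^sub>F n in sequentially. a - 1 / Suc n \<le> p n" "\<forall>\<^sub>F n in sequentially. p n \<le> a"
        by (intro always_eventually allI less_imp_le p)+
    qed
    have ql: "q \<longlonglongrightarrow> b"
    proof (rule tendsto_sandwich[where f = "\<lambda>n. b" and h = "\<lambda>n. b + 1 / real (Suc n)"])
      show "(\<lambda>n. b + 1 / Suc n) \<longlonglongrightarrow> b" 
        using tendsto_add[OF tendsto_const LIMSEQ_Suc[OF lim_1_over_n], of b] by simp
      show "(\<lambda>n. b) \<longlonglongrightarrow> b" by simp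
      show "\<forall>\<^sub>F n in sequentially. q n \<le> b + 1 / Suc n" "\<forall>\<^sub>F n in sequentially. b \<le> q n"
        by (intro always_eventually allI less_imp_le q)+
    qed
    have "(\<lambda>n. L2_ind c {p n..q n}) \<longlonglongrightarrow> L2_ind c {a..b}"
    proof (rule L2_ind_tendsto[where a = "a - 1" and b = "b + 1"])
      show "{p n..q n} \<subseteq> {a - 1..b + 1}" for n
      proof -
        have "1 / real (Suc n) \<le> 1" by simp
        then have "a - 1 \<le> p n" "q n \<le> b + 1" using p(2)[of n] q(3)[of n] by linarith+
        then show ?thesis by auto
      qed
      fix x
      have "\<forall>\<^sub>F n in sequentially. (indicator {p n..q n} x :: real) = indicator {a..b} x"
      proof -
        consider "x < a" | "x > b" | "a \<le> x" "x \<le> b" by linarith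
        then show ?thesis
        proof cases
          case 1 then show ?thesis
            using order_tendstoD(1)[OF pl, of x] by (auto elim!: eventually_mono simp: indicator_def)
        next
          case 2 then show ?thesis
            using order_tendstoD(2)[OF ql, of x] by (auto elim!: eventually_mono simp: indicator_def)
        next
          case 3 
          have "p n \<le> x \<and> x \<le> q n" for n using 3 p(3)[of n] q(2)[of n] by linarith
          then show ?thesis using 3 by (auto simp: indicator_def)
        qed
      qed
      then show "(\<lambda>n. indicator {p n..q n} x :: real) \<longlonglongrightarrow> indicator {a..b} x"
        by (rule tendsto_eventually)
    qed auto
    then show ?thesis by (rule lim[rotated]) (intro I p q c)
  qed
  have borel: "L2_ind c (A \<inter> {- real n..real n}) \<in> V" if c: "c \<in> {1, \<i>}" and "A \<in> sets borel" for A c n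
    using that(2)
  proof (induction rule: borel_set_induct)
    case empty
    then show ?case using subspace_0[OF V(1)] by (simp add: L2_ind_def L2_of_zero)
  next
    case (interval a b)
    show ?case
    proof (cases "max a (- real n) \<le> min b (real n)")
      case True
      then show ?thesis using int[OF c True] by (simp add: Int_atLeastAtMost)
    next
      case False
      then have "{a..b} \<inter> {- real n..real n} = {}" by auto
      then show ?thesis using subspace_0[OF V(1)] by (simp add: L2_ind_def L2_of_zero)
    qed
  next
    case (compl A)
    have "L2_ind c (- A \<inter> {- real n..real n})
        = L2_ind c {- real n..real n} - L2_ind c (A \<inter> {- real n..real n})"
      unfolding L2_ind_def using compl(1)
      by (subst L2_of_diff) (auto intro!: square_int_ind[where a = "- real n" and b = "real n"],
          auto intro!: arg_cong[where f = L2_of] simp: fun_eq_iff indicator_def)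
    then show ?case using int[OF c, of "- real n" "real n"] compl(2) subspace_diff[OF V(1)] by simp
  next
    case (union f)
    define A where "A = (\<lambda>m. (\<Union>i<m. f i) \<inter> {- real n..real n})"
    have A: "A m \<in> sets borel" for m unfolding A_def using union(2) by auto
    have "L2_ind c (A m) \<in> V" for m
    proof (induction m)
      case 0
      then show ?case using subspace_0[OF V(1)] by (simp add: A_def L2_ind_def L2_of_zero)
    next
      case (Suc m)
      have dj: "x \<notin> f m" if "x \<in> f i" "i < m" for x i
        using that disjoint_family_onD[OF union(1), of i m] by auto
      let ?B = "f m \<inter> {- real n..real n}"
      have "A m \<inter> ?B = {}" "A (Suc m) = A m \<union> ?B"
        using dj by (auto simp: A_def less_Suc_eq)
      then have "indicator (A (Suc m)) x *\<^sub>R c = indicator (A m) x *\<^sub>R c + indicator ?B x *\<^sub>R c" for x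
        by (simp add: indicator_add[symmetric] scaleR_left_distrib)
      then have "L2_ind c (A (Suc m)) = L2_ind c (A m) + L2_ind c ?B"
        unfolding L2_ind_def using A[of m] union(2)
        by (subst L2_of_add) (auto intro!: square_int_ind[where a = "- real n" and b = "real n"] simp: A_def)
      then show ?case using Suc union(3) subspace_add[OF V(1)] by simp
    qed
    moreover have "(\<lambda>m. L2_ind c (A m)) \<longlonglongrightarrow> L2_ind c ((\<Union>i. f i) \<inter> {- real n..real n})"
    proof (rule L2_ind_tendsto[where a = "- real n" and b = "real n"])
      fix x
      show "(\<lambda>m. indicator (A m) x :: real) \<longlonglongrightarrow> indicator ((\<Union>i. f i) \<inter> {- real n..real n}) x"
      proof (cases "x \<in> (\<Union>i. f i) \<inter> {- real n..real n}")
        case True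
        then obtain i where "x \<in> f i" by auto
        then have "\<forall>\<^sub>F m in sequentially. (indicator (A m) x :: real) = 1"
          using True by (intro eventually_sequentiallyI[of "Suc i"]) (auto simp: A_def indicator_def)
        then show ?thesis using True by (simp add: tendsto_eventually)
      next
        case False
        then have "x \<notin> A m" for m by (auto simp: A_def)
        then show ?thesis unfolding indicator_simps(2)[OF False] by simp
      qed
    qed (use A in \<open>auto simp: A_def\<close>)
    ultimately show ?case by (rule lim)
  qed
  have borel': "L2_ind y (A \<inter> {- real n..real n}) \<in> V" if A: "A \<in> sets borel" for A y n
  proof -
    let ?A = "A \<inter> {- real n..real n}"
    have si: "square_int (\<lambda>x. indicator ?A x *\<^sub>R c)" for c
      using A by (intro square_int_ind[where a = "- real n" and b = "real n"]) auto
    have sc: "r *\<^sub>R L2_ind c ?A = L2_ind (r *\<^sub>R c) ?A" for r c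
      unfolding L2_ind_def L2_of_scaleR[OF si] by (simp add: mult.commute)
    have ad: "L2_ind c ?A + L2_ind d ?A = L2_ind (c + d) ?A" for c d
      unfolding L2_ind_def L2_of_add[OF si si] by (simp only: scaleR_right_distrib)
    have "L2_ind y ?A = Re y *\<^sub>R L2_ind 1 ?A + Im y *\<^sub>R L2_ind \<i> ?A"
      unfolding sc ad by (rule arg_cong[where f = "\<lambda>c. L2_ind c ?A"]) (simp add: complex_eq_iff)
    then show ?thesis using borel[OF _ A] subspace_add[OF V(1)] subspace_scale[OF V(1)] by simp
  qed
  have "f \<in> V" for f
  proof -
    have ff: "square_int (fun_of f)" by (rule square_int_fun_of)
    then have [measurable]: "fun_of f \<in> borel_measurable borel" by (simp add: square_int_def)
    obtain s where s: "\<And>i. simple_function lborel (s i)" "\<And>x. (\<lambda>i. s i x) \<longlonglongrightarrow> fun_of f x"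
      "\<And>i x. cmod (s i x) \<le> 2 * cmod (fun_of f x)"
      using borel_measurable_implies_sequence_metric[of "fun_of f" lborel 0] by auto
    have [measurable]: "s i \<in> borel_measurable borel" for i
      using borel_measurable_simple_function[OF s(1)] by simp
    define g where "g = (\<lambda>i x. indicator {- real i..real i} x *\<^sub>R s i x)"
    have gV: "L2_of (g i) \<in> V" for i
    proof -
      have fin: "finite (range (s i))" using s(1)[of i] by (simp add: simple_function_def)
      define A where "A = (\<lambda>y. s i -` {y})"
      have A: "A y \<in> sets borel" for y
        using measurable_sets[of "s i" borel borel "{y}"] by (simp add: A_def)
      define h where "h = (\<lambda>y x. indicator (A y \<inter> {- real i..real i}) x *\<^sub>R y)"
      have h: "square_int (h y)" for y
        unfolding h_def using A by (intro square_int_ind[where a = "- real i" and b = "real i"]) auto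
      have hV: "L2_of (h y) \<in> V" for y
        using borel'[OF A[of y], of y i] by (simp add: L2_ind_def h_def)
      have "L2_of (\<lambda>x. \<Sum>y\<in>Y. h y x) \<in> V \<and> square_int (\<lambda>x. \<Sum>y\<in>Y. h y x)" if "finite Y" for Y
        using that
      proof (induction Y)
        case empty
        then show ?case using subspace_0[OF V(1)] by (simp add: L2_of_zero square_int_zero)
      next
        case (insert y Y)
        then show ?case
          using subspace_add[OF V(1) hV[of y]]
          by (simp add: L2_of_add[symmetric] h square_int_add)
      qed
      moreover have "g i = (\<lambda>x. \<Sum>y\<in>range (s i). h y x)"
      proof
        fix x
        have "(\<Sum>y\<in>range (s i). h y x) = (\<Sum>y\<in>range (s i). if y = s i x then g i x else 0)"
          by (intro sum.cong) (auto simp: g_def A_def h_def indicator_def)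
        then show "g i x = (\<Sum>y\<in>range (s i). h y x)" using fin by simp
      qed
      ultimately show ?thesis using fin by simp
    qed
    have "(\<lambda>i. L2_of (g i)) \<longlonglongrightarrow> L2_of (fun_of f)"
    proof (rule L2_dominated_convergence(3)[where h = "\<lambda>x. 2 * cmod (fun_of f x)"])
      show "g n \<in> borel_measurable lborel" for n unfolding g_def by measurable
      show "integrable lborel (\<lambda>x. (2 * cmod (fun_of f x))\<^sup>2)"
        using ff by (simp add: square_int_def power_mult_distrib)
      show "cmod (g n x) \<le> 2 * cmod (fun_of f x)" for n x
        using s(3)[of n x] by (auto simp: g_def indicator_def)
      show "(\<lambda>n. g n x) \<longlonglongrightarrow> fun_of f x" for x
      proof (rule Lim_transform_eventually[OF s(2)])
        obtain m where "\<bar>x\<bar> \<le> real m" using real_arch_simple by blast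
        then show "\<forall>\<^sub>F n in sequentially. s n x = g n x"
          by (intro eventually_sequentiallyI[of m]) (auto simp: g_def indicator_def)
      qed
    qed
    then show ?thesis using lim[OF gV] by (simp add: L2_of_fun_of)
  qed
  then show ?thesis by auto
qed

lemma countable_dense_imp_subbasis:
  fixes D :: "'a :: metric_space set"
  assumes "countable D" "closure D = UNIV"
  shows "\<exists>B :: 'a set set. countable B \<and> open = generate_topology B"
proof (intro exI conjI)
  let ?B = "(\<lambda>(d, n). ball d (1 / real (Suc n))) ` (D \<times> UNIV)"
  show "countable ?B" using assms(1) by auto
  show "open = generate_topology ?B"
  proof (intro topological_basis_imp_subbasis topological_basisI)
    fix U :: "'a set" and x assume U: "open U" "x \<in> U"
    then obtain e where e: "e > 0" "ball x e \<subseteq> U" by (meson openE)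
    then obtain n where n: "1 / real (Suc n) < e / 2"
      using reals_Archimedean[of "e / 2"] by (auto simp: inverse_eq_divide)
    have "x \<in> closure D" using assms(2) by simp
    then obtain d where d: "d \<in> D" "dist d x < 1 / real (Suc n)"
      unfolding closure_approachable by (meson of_nat_0_less_iff zero_less_Suc zero_less_divide_1_iff)
    have "ball d (1 / real (Suc n)) \<subseteq> U"
    proof
      fix y assume "y \<in> ball d (1 / real (Suc n))"
      then have "dist x y < e" using d(2) n dist_triangle[of x y d] by (simp add: dist_commute)
      then show "y \<in> U" using e(2) by auto
    qed
    moreover have "x \<in> ball d (1 / real (Suc n))" using d(2) by simp
    ultimately show "\<exists>B'\<in>?B. x \<in> B' \<and> B' \<subseteq> U" using d(1) by blast
  qed auto
qed

instance L2 :: second_countable_topology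
proof (intro_classes, rule countable_dense_imp_subbasis)
  define G where "G = (\<lambda>(c, a, b). L2_ind c {a..b}) ` ({1, \<i>} \<times> \<rat> \<times> (\<rat> :: real set))"
  define D where "D = (\<lambda>ps. \<Sum>(q, g)\<leftarrow>ps. of_rat q *\<^sub>R g) ` lists (UNIV \<times> G)"
  have "countable G" unfolding G_def by (intro countable_image countable_SIGMA countable_rat) auto
  then show "countable D" unfolding D_def by (intro countable_image countable_lists countable_SIGMA) auto
  have D0: "0 \<in> D" unfolding D_def by (rule image_eqI[of _ _ "[]"]) auto
  have Dadd: "x + y \<in> D" if xy: "x \<in> D" "y \<in> D" for x y
  proof -
    obtain ps qs where "ps \<in> lists (UNIV \<times> G)" "x = (\<Sum>(q, g)\<leftarrow>ps. of_rat q *\<^sub>R g)"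
      "qs \<in> lists (UNIV \<times> G)" "y = (\<Sum>(q, g)\<leftarrow>qs. of_rat q *\<^sub>R g)"
      using xy unfolding D_def by blast
    then show ?thesis unfolding D_def by (intro image_eqI[of _ _ "ps @ qs"]) auto
  qed
  have Dscale: "of_rat r *\<^sub>R x \<in> D" if x: "x \<in> D" for r x
  proof -
    obtain ps where ps: "ps \<in> lists (UNIV \<times> G)" "x = (\<Sum>(q, g)\<leftarrow>ps. of_rat q *\<^sub>R g)"
      using x unfolding D_def by blast
    have "of_rat r *\<^sub>R (\<Sum>(q, g)\<leftarrow>ps. of_rat q *\<^sub>R g)
        = (\<Sum>(q, g)\<leftarrow>map (\<lambda>(q, g). (r * q, g)) ps. of_rat q *\<^sub>R (g :: L2))"
      by (induction ps) (auto simp: scaleR_right_distrib of_rat_mult)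
    moreover have "map (\<lambda>(q, g). (r * q, g)) ps \<in> lists (UNIV \<times> G)"
      using ps(1) by (auto simp: in_lists_conv_set)
    ultimately show ?thesis unfolding D_def ps(2) by blast
  qed
  show "closure D = UNIV"
  proof (rule L2_closed_subspace_UNIV)
    show "subspace (closure D)"
      unfolding subspace_def
    proof (intro conjI ballI allI)
      show "0 \<in> closure D" using D0 closure_subset by blast
    next
      fix x y assume "x \<in> closure D" "y \<in> closure D"
      then obtain s t where "\<And>n. s n \<in> D" "s \<longlonglongrightarrow> x" "\<And>n. t n \<in> D" "t \<longlonglongrightarrow> y"
        unfolding closure_sequential by blast
      then show "x + y \<in> closure D"
        unfolding closure_sequential by (intro exI[of _ "\<lambda>n. s n + t n"]) (auto intro: Dadd tendsto_intros)
    next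
      fix c :: real and x assume "x \<in> closure D"
      then obtain s where s: "\<And>n. s n \<in> D" "s \<longlonglongrightarrow> x"
        unfolding closure_sequential by blast
      have "c \<in> closure \<rat>" by (simp add: Rats_closure_real)
      then obtain r where r: "\<And>n. r n \<in> \<rat>" "r \<longlonglongrightarrow> c" 
        unfolding closure_sequential by blast
      have "r n *\<^sub>R s n \<in> D" for n
        using r(1)[of n] Dscale[OF s(1)[of n]] by (auto elim!: Rats_cases)
      then show "c *\<^sub>R x \<in> closure D"
        unfolding closure_sequential by (intro exI[of _ "\<lambda>n. r n *\<^sub>R s n"]) (auto intro: tendsto_intros r s)
    qed
    fix a b :: real and c :: complex assume "a \<in> \<rat>" "b \<in> \<rat>" "c \<in> {1, \<i>}"
    then have "L2_ind c {a..b} \<in> G" unfolding G_def by (intro image_eqI[of _ _ "(c, a, b)"]) auto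
    then have "L2_ind c {a..b} \<in> D" 
      unfolding D_def by (intro image_eqI[of _ _ "[(1, L2_ind c {a..b})]"]) auto
    then show "L2_ind c {a..b} \<in> closure D" using closure_subset by blast
  qed simp
qed

section \<open>The cubic nonlinear Schroedinger equation\<close>

definition mult_L2 :: "(real \<Rightarrow> complex) \<Rightarrow> L2 \<Rightarrow> L2" where
  "mult_L2 m f = L2_of (\<lambda>x. m x * fun_of f x)"

text \<open>The unitary Fourier transform on \<open>L\<^sup>2\<close>. The integrals over the truncated domains are
  classical, and by Plancherel's theorem they converge in the norm of \<open>L\<^sup>2\<close>.\<close>

definition fourier_L2 :: "L2 \<Rightarrow> L2" where
  "fourier_L2 f = lim (\<lambda>n. L2_of (\<lambda>\<xi>.
     (1 / sqrt (2 * pi)) *\<^sub>R (LINT x:{- real n..real n}|lborel. exp (- (\<i> * of_real (\<xi> * x))) * fun_of f x)))"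

text \<open>The operator \<open>exp (i t \<partial>\<^sub>x\<^sup>2)\<close>, the Fourier multiplier with symbol \<open>exp (- i t \<xi>\<^sup>2)\<close>.\<close>

definition schroedinger_group :: "real \<Rightarrow> L2 \<Rightarrow> L2" where
  "schroedinger_group t f =
     inv fourier_L2 (mult_L2 (\<lambda>\<xi>. exp (- (\<i> * of_real (t * \<xi>\<^sup>2)))) (fourier_L2 f))"

text \<open>The nonlinearity \<open>|f|\<^sup>2 f\<close>. It is square integrable whenever \<open>f\<close> is also essentially bounded,
  so for a function in \<open>L\<^sup>4([0, T]; L\<^sup>\<infinity>)\<close> the default value \<open>0\<close> can only occur
  on a null set of times.\<close>

definition cubic :: "L2 \<Rightarrow> L2" where
  "cubic f = L2_of (\<lambda>x. of_real ((cmod (fun_of f x))\<^sup>2) * fun_of f x)"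

definition Linf_norm :: "L2 \<Rightarrow> ennreal" where
  "Linf_norm f = esssup lborel (\<lambda>x. ennreal (cmod (fun_of f x)))"

text \<open>Solutions of \<open>i \<partial>\<^sub>t u = - \<partial>\<^sub>x\<^sup>2 u - \<lambda> |u|\<^sup>2 u\<close> with initial datum \<open>u0\<close>, in the class
  \<open>C([0, T]; L\<^sup>2) \<inter> L\<^sup>4([0, T]; L\<^sup>\<infinity>)\<close>. The integral in Duhamel's formula is the Bochner integral in \<open>L2\<close>;
  the integrand is integrable for every \<open>u\<close> in this class.\<close>

definition nls_strong_solution :: "complex \<Rightarrow> real \<Rightarrow> L2 \<Rightarrow> (real \<Rightarrow> L2) \<Rightarrow> bool" where
  "nls_strong_solution lam T u0 u \<longleftrightarrow>
     continuous_on {0..T} u \<and>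
     (\<integral>\<^sup>+t\<in>{0..T}. (Linf_norm (u t)) ^ 4 \<partial>lborel) < \<infinity> \<and>
     (\<forall>t\<in>{0..T}. u t = schroedinger_group t u0 +
        mult_L2 (\<lambda>_. \<i> * lam) (LINT \<tau>:{0..t}|lborel. schroedinger_group (t - \<tau>) (cubic (u \<tau>))))"

text \<open>Membership in \<open>L\<^sup>2(\<real>, x\<^sup>2 dx)\<close>.\<close>

definition weighted_L2 :: "L2 \<Rightarrow> bool" where
  "weighted_L2 f \<longleftrightarrow> integrable lborel (\<lambda>x. x\<^sup>2 * (cmod (fun_of f x))\<^sup>2)"

text \<open>The continuous representative, e.g. of an element of \<open>H\<^sup>1\<close>; unspecified if there is none.\<close>

definition continuous_rep :: "L2 \<Rightarrow> real \<Rightarrow> complex" where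
  "continuous_rep f = (THE v. continuous_on UNIV v \<and> (AE x in lborel. v x = fun_of f x))"

lemma continuous_rep_eq:
  assumes v: "continuous_on UNIV v" "AE x in lborel. v x = fun_of f x"
  shows "continuous_rep f = v"
  unfolding continuous_rep_def
proof (rule the_equality)
  fix w assume w: "continuous_on UNIV w \<and> (AE x in lborel. w x = fun_of f x)"
  have "AE x in lborel. x \<notin> {x. w x \<noteq> v x}"
    using v(2) w[THEN conjunct2] by eventually_elim simp
  moreover have op: "open {x. w x \<noteq> v x}"
    using v(1) w by (intro open_Collect_neq) auto
  ultimately have "{x. w x \<noteq> v x} \<in> null_sets lborel"
    by (subst AE_iff_null_sets) auto
  then have "negligible {x. w x \<noteq> v x}"
    by (simp add: negligible_iff_null_sets null_sets_completionI)
  then have "{x. w x \<noteq> v x} = {}"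
    using open_not_negligible[OF op] by blast
  then show "w = v" by auto
qed (use v in blast)

end

theory Submission
  imports Defs "HOL-Probability.Probability" "HOL-Complex_Analysis.Complex_Analysis"
begin

text \<open>The zeros of \<open>u0\<close> have gaps that shrink at least exponentially, so the Hoelder continuity that comes from
  \<open>u0 \<in> H\<^sup>1\<close> forces exponential decay of \<open>u0\<close>. A Galilean boost acts on the profile
  \<open>exp (- i t \<partial>\<^sub>x\<^sup>2) u(t)\<close> as multiplication by \<open>exp (i e x)\<close>, and the equation is invariant under
  boosts. Estimating the iterated differences with respect to \<open>e\<close> in the Wiener algebra therefore
  propagates factorial bounds on the moments, that is, exponential decay, from \<open>u0\<close> to the profile at time \<open>T\<close>.
  Up to the factor \<open>exp (i x\<^sup>2 / 4T)\<close>, \<open>u(T)\<close> is a rescaled Fourier transform of \<open>exp (i y\<^sup>2 / 4T)\<close> times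
  the profile and thus extends to a bounded holomorphic function on a strip. In the disc, the points
  \<open>c2 log (1 + n)\<^sup>\<alpha>\<close> with \<open>\<alpha> < 1\<close> violate the Blaschke condition, so \<open>u(T) = 0\<close>,
  and \<open>u = 0\<close> by uniqueness.\<close>

section \<open>Multipliers and translations on \<open>L\<^sup>2\<close>\<close>

text \<open>Solutions of this class come without derivatives or weights, and exponential decay of
  u(t) itself need not survive the free flow. Boosts avoid both problems: they are exact isometries
  compatible with the flow and with the cubic term, so their differences are estimated at fixed e,
  with bounds n! rho (R e)^n uniform in e, and e tends to 0 only at the end. The norm must be
  invariant under the free flow and under boosts and must control products: the sup norm fails the
  first, the H^1 norm the second, and the L^1 norm of the Fourier transform meets all three. It is
  finite because u(t) lies in H^1, which has to be proved: the boosts that start at time 0 and at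
  time T are controlled by the two weighted data, and their quotient on the Fourier side is a phase
  close to 2 T e xi. The condition \<alpha> < 1 enters twice. The grid gaps are O(exp (-x/c1)), and
  A (log n)^\<alpha> <= log n eventually for every A, so the zeros of u(T) violate the Blaschke
  condition in a strip of any width. Hence it does not matter how small the propagated decay rate
  is.\<close>

lemma L2_cases [case_names L2_of]:
  obtains F where "square_int F" "f = L2_of F"
  using square_int_fun_of L2_of_fun_of by metis

lemma square_int_measurable [measurable_dest]: "square_int f \<Longrightarrow> f \<in> borel_measurable borel"
  by (simp add: square_int_def)

lemma square_intD: "square_int f \<Longrightarrow> integrable lborel (\<lambda>x. (cmod (f x))\<^sup>2)"
  by (simp add: square_int_def)

lemma fun_of_measurable [measurable]: "fun_of f \<in> borel_measurable borel"
  using square_int_fun_of[of f] by measurable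

lemma square_int_AE_bound:
  assumes [measurable]: "f \<in> borel_measurable borel" and "integrable lborel h"
    and "AE x in lborel. (cmod (f x))\<^sup>2 \<le> h x"
  shows "square_int f"
  unfolding square_int_def
proof
  show "integrable lborel (\<lambda>x. (cmod (f x))\<^sup>2)"
    by (rule Bochner_Integration.integrable_bound[OF assms(2)]) (use assms(3) in \<open>auto elim!: eventually_mono\<close>)
qed simp

lemma L2_of_cong:
  assumes "square_int f" "square_int g" "AE x in lborel. f x = g x"
  shows "L2_of f = L2_of g"
  using L2_of_eq_iff[OF assms(1,2)] assms(3) by simp

lemma square_int_cong:
  assumes "square_int f" "g \<in> borel_measurable borel" "AE x in lborel. f x = g x"
  shows "square_int g"
  by (rule square_int_AE_bound[OF assms(2) square_intD[OF assms(1)]])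
     (use assms(3) in \<open>auto elim!: eventually_mono\<close>)

lemma inner_L2_of:
  "square_int f \<Longrightarrow> square_int g \<Longrightarrow> L2_of f \<bullet> L2_of g = (LINT x|lborel. f x \<bullet> g x)"
  by (simp add: L2_of_def inner_L2.abs_eq L2_eq_def)

lemma norm_L2_of_mono:
  assumes "square_int f" "square_int g" "AE x in lborel. cmod (f x) \<le> B * cmod (g x)" "B \<ge> 0"
  shows "norm (L2_of f) \<le> B * norm (L2_of g)"
proof (rule power2_le_imp_le)
  have "(norm (L2_of f))\<^sup>2 \<le> (LINT x|lborel. B\<^sup>2 * (cmod (g x))\<^sup>2)"
    unfolding norm_L2_of[OF assms(1)]
  proof (rule integral_mono_AE)
    show "AE x in lborel. (cmod (f x))\<^sup>2 \<le> B\<^sup>2 * (cmod (g x))\<^sup>2"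
      using assms(3)
    proof eventually_elim
      fix x assume "cmod (f x) \<le> B * cmod (g x)"
      from power_mono[OF this, of 2] show "(cmod (f x))\<^sup>2 \<le> B\<^sup>2 * (cmod (g x))\<^sup>2"
        by (simp add: power_mult_distrib)
    qed
  qed (use assms square_intD in auto)
  then show "(norm (L2_of f))\<^sup>2 \<le> (B * norm (L2_of g))\<^sup>2"
    by (simp add: power_mult_distrib norm_L2_of[OF assms(2)])
qed (use assms in auto)

definition bounded_mult :: "(real \<Rightarrow> complex) \<Rightarrow> bool" where
  "bounded_mult m \<longleftrightarrow> m \<in> borel_measurable borel \<and> (\<exists>B. \<forall>x. cmod (m x) \<le> B)"

lemma bounded_multI: "m \<in> borel_measurable borel \<Longrightarrow> (\<And>x. cmod (m x) \<le> B) \<Longrightarrow> bounded_mult m"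
  by (auto simp: bounded_mult_def)

lemma bounded_mult_const [simp]: "bounded_mult (\<lambda>_. c)"
  by (rule bounded_multI[where B = "cmod c"]) auto

lemma bounded_mult_measurable [measurable_dest]: "bounded_mult m \<Longrightarrow> m \<in> borel_measurable borel"
  by (simp add: bounded_mult_def)

lemma bounded_mult_mult: "bounded_mult m \<Longrightarrow> bounded_mult n \<Longrightarrow> bounded_mult (\<lambda>x. m x * n x)"
proof -
  assume "bounded_mult m" "bounded_mult n"
  then obtain A B where "m \<in> borel_measurable borel" "n \<in> borel_measurable borel"
    "\<And>x. cmod (m x) \<le> A" "\<And>x. cmod (n x) \<le> B" unfolding bounded_mult_def by auto
  then show ?thesis
    by (intro bounded_multI[where B = "A * B"]) (auto simp: norm_mult intro!: mult_mono' order_trans[OF norm_ge_zero])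
qed

lemma bounded_mult_diff: "bounded_mult m \<Longrightarrow> bounded_mult n \<Longrightarrow> bounded_mult (\<lambda>x. m x - n x)"
proof -
  assume "bounded_mult m" "bounded_mult n"
  then obtain A B where "m \<in> borel_measurable borel" "n \<in> borel_measurable borel"
    "\<And>x. cmod (m x) \<le> A" "\<And>x. cmod (n x) \<le> B" unfolding bounded_mult_def by auto
  then show ?thesis
    by (intro bounded_multI[where B = "A + B"]) (auto intro!: order_trans[OF norm_triangle_ineq4] add_mono)
qed

lemma square_int_mult:
  assumes "bounded_mult m" "square_int f"
  shows "square_int (\<lambda>x. m x * f x)"
proof -
  obtain B where B: "\<And>x. cmod (m x) \<le> B" and [measurable]: "m \<in> borel_measurable borel"
    using assms(1) by (auto simp: bounded_mult_def)
  have [measurable]: "f \<in> borel_measurable borel" using assms(2) by measurable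
  show ?thesis
  proof (rule square_int_bound[where h = "\<lambda>x. B\<^sup>2 * (cmod (f x))\<^sup>2"])
    show "(cmod (m x * f x))\<^sup>2 \<le> B\<^sup>2 * (cmod (f x))\<^sup>2" for x
      using B[of x] by (auto simp: norm_mult power_mult_distrib intro!: mult_right_mono power_mono)
  qed (use square_intD[OF assms(2)] in auto)
qed

lemma mult_L2_of:
  assumes "bounded_mult m" "square_int f"
  shows "mult_L2 m (L2_of f) = L2_of (\<lambda>x. m x * f x)"
  unfolding mult_L2_def
  by (rule L2_of_cong) (use fun_of_L2_of[OF assms(2)] in
      \<open>auto intro!: square_int_mult assms square_int_fun_of elim!: eventually_mono\<close>)

lemma norm_mult_L2_le:
  assumes "bounded_mult m" "\<And>x. cmod (m x) \<le> B"
  shows "norm (mult_L2 m f) \<le> B * norm f"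
proof (cases f rule: L2_cases)
  case (L2_of F)
  have "B \<ge> 0" using assms(2)[of 0] norm_ge_zero[of "m 0"] by linarith
  then show ?thesis
    using L2_of assms by (auto simp: mult_L2_of norm_mult intro!: norm_L2_of_mono square_int_mult mult_right_mono AE_I2)
qed

lemma bounded_linear_mult_L2:
  assumes "bounded_mult m"
  shows "bounded_linear (mult_L2 m)"
proof -
  obtain B where B: "\<And>x. cmod (m x) \<le> B" using assms by (auto simp: bounded_mult_def)
  show ?thesis
  proof (rule bounded_linear_intro[where K = B])
    fix f g :: L2 and r :: real
    obtain F G where FG: "square_int F" "f = L2_of F" "square_int G" "g = L2_of G"
      by (metis L2_cases)
    show "mult_L2 m (f + g) = mult_L2 m f + mult_L2 m g"
      using FG assms by (simp add: mult_L2_of L2_of_add square_int_add square_int_mult distrib_left)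
    show "mult_L2 m (r *\<^sub>R f) = r *\<^sub>R mult_L2 m f"
      using FG assms square_int_mult_const[of F "of_real r"] L2_of_scaleR[OF square_int_mult[OF assms FG(1)], of r]
      by (simp add: mult_L2_of L2_of_scaleR scaleR_conv_of_real mult.left_commute)
    show "norm (mult_L2 m f) \<le> norm f * B"
      using norm_mult_L2_le[OF assms B] by (simp add: mult.commute)
  qed
qed

lemma mult_L2_mult:
  assumes "bounded_mult m" "bounded_mult n"
  shows "mult_L2 m (mult_L2 n f) = mult_L2 (\<lambda>x. m x * n x) f"
  by (cases f rule: L2_cases) (use assms in \<open>simp add: mult_L2_of square_int_mult bounded_mult_mult mult.assoc\<close>)

lemma mult_L2_one [simp]: "mult_L2 (\<lambda>_. 1) f = f"
  by (simp add: mult_L2_def L2_of_fun_of)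

lemma mult_L2_diff_left:
  assumes "bounded_mult m" "bounded_mult n"
  shows "mult_L2 (\<lambda>x. m x - n x) f = mult_L2 m f - mult_L2 n f"
  by (cases f rule: L2_cases) (use assms in \<open>simp add: mult_L2_of square_int_mult bounded_mult_diff L2_of_diff left_diff_distrib\<close>)

definition unimod :: "(real \<Rightarrow> complex) \<Rightarrow> bool" where
  "unimod m \<longleftrightarrow> m \<in> borel_measurable borel \<and> (\<forall>x. cmod (m x) = 1)"

lemma unimod_bounded [simp]: "unimod m \<Longrightarrow> bounded_mult m"
  by (auto simp: unimod_def bounded_mult_def)

lemma unimod_exp [simp]:
  assumes "p \<in> borel_measurable borel"
  shows "unimod (\<lambda>x. exp (\<i> * of_real (p x)))" "unimod (\<lambda>x. exp (- (\<i> * of_real (p x))))"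
  using assms by (auto simp: unimod_def)

lemma norm_mult_L2_unimod [simp]:
  assumes "unimod m"
  shows "norm (mult_L2 m f) = norm f"
proof (cases f rule: L2_cases)
  case (L2_of F)
  have "(norm (mult_L2 m f))\<^sup>2 = (norm f)\<^sup>2"
    using L2_of assms by (simp add: mult_L2_of square_int_mult norm_L2_of norm_mult unimod_def)
  then show ?thesis by simp
qed

lemma norm_mult_L2_const [simp]: "norm (mult_L2 (\<lambda>_. c) f) = cmod c * norm f"
proof (cases f rule: L2_cases)
  case (L2_of F)
  have "(norm (mult_L2 (\<lambda>_. c) f))\<^sup>2 = (cmod c * norm f)\<^sup>2"
    using L2_of by (simp add: mult_L2_of square_int_mult norm_L2_of norm_mult power_mult_distrib)
  then show ?thesis by simp
qed

lemma mult_L2_commute: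
  assumes "bounded_mult m" "bounded_mult n"
  shows "mult_L2 m (mult_L2 n f) = mult_L2 n (mult_L2 m f)"
  using assms by (simp add: mult_L2_mult mult.commute)

definition trans_L2 :: "real \<Rightarrow> L2 \<Rightarrow> L2" where
  "trans_L2 h f = L2_of (\<lambda>x. fun_of f (x - h))"

definition refl_L2 :: "L2 \<Rightarrow> L2" where
  "refl_L2 f = L2_of (\<lambda>x. fun_of f (- x))"

lemma AE_translate:
  fixes h :: real
  assumes "AE x in lborel. P x"
  shows "AE x in lborel. P (x - h)"
proof -
  have "AE x in distr lborel borel ((+) (- h)). P x"
    unfolding lborel_distr_plus by (rule assms)
  then have "AE x in lborel. P (- h + x)"
    by (rule AE_distrD[rotated]) auto
  then show ?thesis by simp
qed

lemma AE_reflect: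
  assumes "AE x in lborel. P (x::real)"
  shows "AE x in lborel. P (- x)"
proof -
  have "AE x in distr lborel borel uminus. P (x::real)"
    unfolding lborel_distr_uminus by (rule assms)
  then show ?thesis by (rule AE_distrD[rotated]) auto
qed

lemma integral_translate:
  fixes f :: "real \<Rightarrow> 'a :: {banach, second_countable_topology}"
  shows "(LINT x|lborel. f (x - h)) = (LINT x|lborel. f x)"
    and "integrable lborel f \<Longrightarrow> integrable lborel (\<lambda>x. f (x - h))"
  using lborel_integral_real_affine[of 1 f "- h"] lborel_integrable_real_affine[of f 1 "- h"]
  by simp_all

lemma integral_reflect_lborel:
  fixes f :: "real \<Rightarrow> 'a :: {banach, second_countable_topology}"
  shows "(LINT x|lborel. f (- x)) = (LINT x|lborel. f x)"
    and "integrable lborel f \<Longrightarrow> integrable lborel (\<lambda>x. f (- x))"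
  using lborel_integral_real_affine[of "-1" f 0] lborel_integrable_real_affine[of f "-1" 0]
  by simp_all

lemma square_int_translate: "square_int f \<Longrightarrow> square_int (\<lambda>x. f (x - h))"
  unfolding square_int_def using integral_translate(2)[of "\<lambda>x. (cmod (f x))\<^sup>2" h] by auto

lemma square_int_reflect: "square_int f \<Longrightarrow> square_int (\<lambda>x. f (- x))"
  unfolding square_int_def using integral_reflect_lborel(2)[of "\<lambda>x. (cmod (f x))\<^sup>2"] by auto

lemma trans_L2_of: "square_int f \<Longrightarrow> trans_L2 h (L2_of f) = L2_of (\<lambda>x. f (x - h))"
  unfolding trans_L2_def
  by (rule L2_of_cong) (auto intro: square_int_translate square_int_fun_of AE_translate fun_of_L2_of)

lemma refl_L2_of: "square_int f \<Longrightarrow> refl_L2 (L2_of f) = L2_of (\<lambda>x. f (- x))"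
  unfolding refl_L2_def
  by (rule L2_of_cong) (auto intro: square_int_reflect square_int_fun_of AE_reflect fun_of_L2_of)

lemma norm_trans_L2 [simp]: "norm (trans_L2 h f) = norm f"
proof (cases f rule: L2_cases)
  case (L2_of F)
  have "(norm (trans_L2 h f))\<^sup>2 = (norm f)\<^sup>2"
    using L2_of integral_translate(1)[of "\<lambda>x. (cmod (F x))\<^sup>2" h]
    by (simp add: trans_L2_of square_int_translate norm_L2_of)
  then show ?thesis by simp
qed

lemma norm_refl_L2 [simp]: "norm (refl_L2 f) = norm f"
proof (cases f rule: L2_cases)
  case (L2_of F)
  have "(norm (refl_L2 f))\<^sup>2 = (norm f)\<^sup>2"
    using L2_of integral_reflect_lborel(1)[of "\<lambda>x. (cmod (F x))\<^sup>2"]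
    by (simp add: refl_L2_of square_int_reflect norm_L2_of)
  then show ?thesis by simp
qed

lemma bounded_linear_trans_L2: "bounded_linear (trans_L2 h)"
proof (rule bounded_linear_intro[where K = 1])
  fix f g :: L2 and r :: real
  obtain F G where FG: "square_int F" "f = L2_of F" "square_int G" "g = L2_of G"
    by (metis L2_cases)
  show "trans_L2 h (f + g) = trans_L2 h f + trans_L2 h g"
    using FG by (simp add: trans_L2_of L2_of_add square_int_add square_int_translate)
  show "trans_L2 h (r *\<^sub>R f) = r *\<^sub>R trans_L2 h f"
    using FG square_int_mult_const[of F "of_real r"]
    by (simp add: trans_L2_of L2_of_scaleR square_int_translate scaleR_conv_of_real)
qed simp

lemma bounded_linear_refl_L2: "bounded_linear refl_L2"
proof (rule bounded_linear_intro[where K = 1])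
  fix f g :: L2 and r :: real
  obtain F G where FG: "square_int F" "f = L2_of F" "square_int G" "g = L2_of G"
    by (metis L2_cases)
  show "refl_L2 (f + g) = refl_L2 f + refl_L2 g"
    using FG by (simp add: refl_L2_of L2_of_add square_int_add square_int_reflect)
  show "refl_L2 (r *\<^sub>R f) = r *\<^sub>R refl_L2 f"
    using FG square_int_mult_const[of F "of_real r"]
    by (simp add: refl_L2_of L2_of_scaleR square_int_reflect scaleR_conv_of_real)
qed simp

lemma refl_L2_refl [simp]: "refl_L2 (refl_L2 f) = f"
  by (cases f rule: L2_cases) (simp add: refl_L2_of square_int_reflect)

lemma trans_L2_0 [simp]: "trans_L2 0 f = f"
  by (cases f rule: L2_cases) (simp add: trans_L2_of)

lemma trans_mult_L2:
  assumes "bounded_mult m"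
  shows "trans_L2 h (mult_L2 m f) = mult_L2 (\<lambda>x. m (x - h)) (trans_L2 h f)"
proof (cases f rule: L2_cases)
  case (L2_of F)
  have "bounded_mult (\<lambda>x. m (x - h))" using assms by (auto simp: bounded_mult_def)
  then show ?thesis using L2_of assms
    by (simp add: trans_L2_of mult_L2_of square_int_translate square_int_mult)
qed

lemma L2_dominated_convergence_AE:
  assumes [measurable]: "\<And>n. f n \<in> borel_measurable borel" "g \<in> borel_measurable borel"
    and h: "integrable lborel (\<lambda>x. (h x)\<^sup>2)"
    and bound: "\<And>n. AE x in lborel. cmod (f n x) \<le> h x"
    and lim: "AE x in lborel. (\<lambda>n. f n x) \<longlonglongrightarrow> g x"
  shows "square_int (f n)" "square_int g" "(\<lambda>n. L2_of (f n)) \<longlonglongrightarrow> L2_of g"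
proof -
  have ball: "AE x in lborel. \<forall>n. cmod (f n x) \<le> h x" using bound by (simp add: AE_all_countable)
  have gb: "AE x in lborel. cmod (g x) \<le> h x"
    using ball lim
  proof eventually_elim
    fix x assume "\<forall>n. cmod (f n x) \<le> h x" "(\<lambda>n. f n x) \<longlonglongrightarrow> g x"
    then show "cmod (g x) \<le> h x" by (intro LIMSEQ_le_const2[OF tendsto_norm]) auto
  qed
  show f: "square_int (f n)" for n
    by (rule square_int_AE_bound[OF _ h]) (use bound[of n] in \<open>auto elim!: eventually_mono intro!: power_mono\<close>)
  show g: "square_int g"
    by (rule square_int_AE_bound[OF _ h]) (use gb in \<open>auto elim!: eventually_mono intro!: power_mono\<close>)
  have "(\<lambda>n. LINT x|lborel. (cmod (f n x - g x))\<^sup>2) \<longlonglongrightarrow> (LINT x|(lborel :: real measure). 0)"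
  proof (rule integral_dominated_convergence[where w = "\<lambda>x. 4 * (h x)\<^sup>2"
        and s = "\<lambda>n x. (cmod (f n x - g x))\<^sup>2" and f = "\<lambda>x. 0"])
    show "AE x in lborel. (\<lambda>n. (cmod (f n x - g x))\<^sup>2) \<longlonglongrightarrow> 0"
      using lim
    proof eventually_elim
      fix x assume "(\<lambda>n. f n x) \<longlonglongrightarrow> g x"
      then have "(\<lambda>n. (cmod (f n x - g x))\<^sup>2) \<longlonglongrightarrow> (cmod (g x - g x))\<^sup>2"
        by (intro tendsto_intros)
      then show "(\<lambda>n. (cmod (f n x - g x))\<^sup>2) \<longlonglongrightarrow> 0" by simp
    qed
    show "AE x in lborel. norm ((cmod (f n x - g x))\<^sup>2) \<le> 4 * (h x)\<^sup>2" for n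
      using gb bound[of n]
    proof eventually_elim
      fix x assume "cmod (g x) \<le> h x" "cmod (f n x) \<le> h x"
      then have "cmod (f n x - g x) \<le> 2 * h x"
        using norm_triangle_ineq4[of "f n x" "g x"] by linarith
      then have "(cmod (f n x - g x))\<^sup>2 \<le> (2 * h x)\<^sup>2" by (intro power_mono) auto
      then show "norm ((cmod (f n x - g x))\<^sup>2) \<le> 4 * (h x)\<^sup>2" by (simp add: power_mult_distrib)
    qed
  qed (use h in simp_all)
  then have "(\<lambda>n. (norm (L2_of (f n) - L2_of g))\<^sup>2) \<longlonglongrightarrow> 0"
    by (simp add: L2_of_diff f g norm_L2_of square_int_diff)
  then have "(\<lambda>n. sqrt ((norm (L2_of (f n) - L2_of g))\<^sup>2)) \<longlonglongrightarrow> sqrt 0"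
    by (rule tendsto_real_sqrt)
  then show "(\<lambda>n. L2_of (f n)) \<longlonglongrightarrow> L2_of g"
    by (simp add: tendsto_norm_zero_iff LIM_zero_iff)
qed

text \<open>The truncations to [-n, n] used in the definition of \<open>fourier_L2\<close>. A
  truncated square integrable function is integrable, so the classical integral applies to
  it.\<close>

definition cutoff :: "nat \<Rightarrow> (real \<Rightarrow> complex) \<Rightarrow> real \<Rightarrow> complex" where
  "cutoff n f x = indicator {- real n..real n} x *\<^sub>R f x"

lemma norm_cutoff_le: "cmod (cutoff n f x) \<le> cmod (f x)"
  by (auto simp: cutoff_def indicator_def)

lemma measurable_cutoff [measurable]: "f \<in> borel_measurable borel \<Longrightarrow> cutoff n f \<in> borel_measurable borel"
  unfolding cutoff_def by measurable

lemma cutoff_tendsto: "(\<lambda>n. cutoff n f x) \<longlonglongrightarrow> f x"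
proof (rule tendsto_eventually)
  obtain m where "\<bar>x\<bar> \<le> real m" using real_arch_simple by blast
  then show "\<forall>\<^sub>F n in sequentially. cutoff n f x = f x"
    by (intro eventually_sequentiallyI[of m]) (auto simp: cutoff_def indicator_def)
qed

lemma square_int_cutoff: "square_int f \<Longrightarrow> square_int (cutoff n f)"
  by (rule square_int_bound[where h = "\<lambda>x. (cmod (f x))\<^sup>2"])
     (auto simp: square_int_def intro!: power_mono norm_cutoff_le)

lemma integrable_cutoff:
  assumes "square_int f"
  shows "integrable lborel (cutoff n f)"
proof (rule Bochner_Integration.integrable_bound)
  have [measurable]: "f \<in> borel_measurable borel" using assms by measurable
  show "integrable lborel (\<lambda>x. indicator {- real n..real n} x + (cmod (f x))\<^sup>2)"
    using square_intD[OF assms] by (auto intro!: integrable_real_indicator simp: emeasure_lborel_Icc_eq)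
  have "a \<le> 1 + a\<^sup>2" for a :: real
    using zero_le_power2[of "a - 1/2"] by (simp add: power2_eq_square algebra_simps)
  then show "AE x in lborel. norm (cutoff n f x) \<le> norm (indicator {- real n..real n} x + (cmod (f x))\<^sup>2)"
    by (auto simp: cutoff_def indicator_def)
  show "cutoff n f \<in> borel_measurable lborel" by simp
qed

lemma L2_of_cutoff_tendsto:
  assumes "square_int f"
  shows "(\<lambda>n. L2_of (cutoff n f)) \<longlonglongrightarrow> L2_of f"
proof -
  have [measurable]: "f \<in> borel_measurable borel" using assms by measurable
  show ?thesis
    by (rule L2_dominated_convergence(3)[where h = "\<lambda>x. cmod (f x)"])
       (use square_intD[OF assms] in \<open>auto intro: norm_cutoff_le cutoff_tendsto\<close>)
qed

text \<open>Density of the integrable functions in L2, by truncation. All operator identities for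
  \<open>fourier_L2\<close> below are reduced by this rule to computations with the classical
  integral.\<close>

lemma L2_bounded_linear_eqI:
  assumes A: "bounded_linear A" and B: "bounded_linear B"
    and eq: "\<And>f. square_int f \<Longrightarrow> integrable lborel f \<Longrightarrow> A (L2_of f) = B (L2_of f)"
  shows "A f = (B f :: 'a :: real_normed_vector)"
proof (cases f rule: L2_cases)
  case (L2_of F)
  note lim = L2_of_cutoff_tendsto[OF L2_of(1)]
  have "(\<lambda>n. A (L2_of (cutoff n F))) \<longlonglongrightarrow> A f" "(\<lambda>n. B (L2_of (cutoff n F))) \<longlonglongrightarrow> B f"
    using bounded_linear.tendsto[OF A lim] bounded_linear.tendsto[OF B lim] L2_of(2) by auto
  moreover have "A (L2_of (cutoff n F)) = B (L2_of (cutoff n F))" for n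
    by (intro eq square_int_cutoff integrable_cutoff L2_of)
  ultimately show ?thesis using LIMSEQ_unique by simp
qed

text \<open>The f with this property form a subspace, closed because translations are isometries (an
  argument with three thirds of r). It contains indicators of intervals, whose translates converge
  off the two endpoints, and such subspaces are everything by
  \<open>L2_closed_subspace_UNIV\<close>.\<close>

lemma trans_L2_tendsto:
  assumes "h \<longlonglongrightarrow> 0"
  shows "(\<lambda>n. trans_L2 (h n) f) \<longlonglongrightarrow> f"
proof -
  define V where "V = {f. (\<lambda>n. trans_L2 (h n) f) \<longlonglongrightarrow> f}"
  interpret T: bounded_linear "trans_L2 a" for a by (rule bounded_linear_trans_L2)
  have "V = UNIV"
  proof (rule L2_closed_subspace_UNIV)
    show "subspace V" unfolding V_def subspace_def
      by (auto simp: T.add T.scaleR intro: tendsto_intros)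
    show "closed V"
      unfolding closed_sequential_limits
    proof safe
      fix s l assume s: "\<forall>n. s n \<in> V" "s \<longlonglongrightarrow> l"
      show "l \<in> V" unfolding V_def mem_Collect_eq
      proof (rule LIMSEQ_I)
        fix r :: real assume r: "r > 0"
        then obtain k where k: "norm (s k - l) < r / 3"
          using LIMSEQ_D[OF s(2), of "r/3"] by auto
        from s(1) have "(\<lambda>n. trans_L2 (h n) (s k)) \<longlonglongrightarrow> s k" by (simp add: V_def)
        with r obtain N where N: "\<And>n. n \<ge> N \<Longrightarrow> norm (trans_L2 (h n) (s k) - s k) < r / 3"
          using LIMSEQ_D[of _ "s k" "r/3"] by (metis divide_pos_pos zero_less_numeral)
        have "norm (trans_L2 (h n) l - l) < r" if "n \<ge> N" for n
        proof -
          have "trans_L2 (h n) l - l = trans_L2 (h n) (l - s k) + (trans_L2 (h n) (s k) - s k) + (s k - l)"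
            by (simp add: T.diff)
          also have "norm \<dots> \<le> norm (trans_L2 (h n) (l - s k)) + norm (trans_L2 (h n) (s k) - s k) + norm (s k - l)"
            by (intro norm_triangle_mono order_refl)
          finally have "norm (trans_L2 (h n) l - l) \<le> norm (l - s k) + norm (trans_L2 (h n) (s k) - s k) + norm (s k - l)"
            by (simp only: norm_trans_L2)
          then show ?thesis using N[OF that] k by (simp add: norm_minus_commute)
        qed
        then show "\<exists>N. \<forall>n\<ge>N. norm (trans_L2 (h n) l - l) < r" by blast
      qed
    qed
  next
    fix a b :: real and c :: complex
    have si: "square_int (\<lambda>x. indicator {a..b} x *\<^sub>R c)" by (rule square_int_ind[where a = a and b = b]) auto
    obtain B where B: "\<And>n. \<bar>h n\<bar> \<le> B" using convergent_imp_Bseq[of h] assms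
      by (auto simp: convergent_def Bseq_def)
    have "integrable lborel (\<lambda>x. indicator {a - B..b + B} x *\<^sub>R (cmod c)\<^sup>2)"
      by (intro integrable_scaleR_left integrable_real_indicator) (auto simp: emeasure_lborel_Icc_eq)
    moreover have "(indicator {a - B..b + B} x *\<^sub>R cmod c)\<^sup>2 = indicator {a - B..b + B} x *\<^sub>R (cmod c)\<^sup>2" for x :: real
      by (auto simp: indicator_def)
    ultimately have int: "integrable lborel (\<lambda>x. (indicator {a - B..b + B} x *\<^sub>R cmod c)\<^sup>2)" by simp
    have "(\<lambda>n. L2_of (\<lambda>x. indicator {a..b} (x - h n) *\<^sub>R c)) \<longlonglongrightarrow> L2_of (\<lambda>x. indicator {a..b} x *\<^sub>R c)"
    proof (rule L2_dominated_convergence_AE(3)[OF _ _ int])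
      show "AE x in lborel. cmod (indicator {a..b} (x - h n) *\<^sub>R c) \<le> indicator {a - B..b + B} x *\<^sub>R cmod c" for n
        using B[of n] by (auto simp: indicator_def)
      have "AE x in lborel. x \<noteq> a \<and> x \<noteq> b" using AE_lborel_singleton[of a] AE_lborel_singleton[of b] by auto
      then show "AE x in lborel. (\<lambda>n. indicator {a..b} (x - h n) *\<^sub>R c) \<longlonglongrightarrow> indicator {a..b} x *\<^sub>R c"
      proof eventually_elim
        case (elim x)
        have l: "(\<lambda>n. x - h n) \<longlonglongrightarrow> x" using tendsto_diff[OF tendsto_const assms, of x] by simp
        consider "x < a" | "x > b" | "a < x" "x < b" using elim by linarith
        then have "\<forall>\<^sub>F n in sequentially. (indicator {a..b} (x - h n) :: real) = indicator {a..b} x"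
        proof cases
          case 1 then show ?thesis using order_tendstoD(2)[OF l, of a] by (auto elim!: eventually_mono simp: indicator_def)
        next
          case 2 then show ?thesis using order_tendstoD(1)[OF l, of b] by (auto elim!: eventually_mono simp: indicator_def)
        next
          case 3 then show ?thesis
            using eventually_conj[OF order_tendstoD(1)[OF l 3(1)] order_tendstoD(2)[OF l 3(2)]]
            by (auto elim!: eventually_mono simp: indicator_def)
        qed
        then show ?case by (intro tendsto_intros tendsto_eventually)
      qed
    qed auto
    then show "L2_ind c {a..b} \<in> V"
      by (simp add: V_def L2_ind_def trans_L2_of[OF si])
  qed
  then show ?thesis by (auto simp: V_def)
qed

section \<open>Plancherel's theorem\<close>

lemma borel_measurable_cnj [measurable (raw)]:
  "f \<in> borel_measurable M \<Longrightarrow> (\<lambda>x. cnj (f x)) \<in> borel_measurable M"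
  using measurable_compose[OF _ borel_measurable_continuous_onI[of cnj]] by (simp add: continuous_on_cnj)

lemma Fubini_lborel:
  fixes f :: "real \<Rightarrow> real \<Rightarrow> 'a :: {banach, second_countable_topology}"
  assumes [measurable]: "(\<lambda>(x, y). f x y) \<in> borel_measurable (borel \<Otimes>\<^sub>M borel)"
    and "integrable lborel (\<lambda>x. LINT y|lborel. norm (f x y))"
    and "\<And>x. integrable lborel (f x)"
  shows "(LINT x|lborel. LINT y|lborel. f x y) = (LINT y|lborel. LINT x|lborel. f x y)"
    and "integrable lborel (\<lambda>y. LINT x|lborel. f x y)"
    and "AE y in lborel. integrable lborel (\<lambda>x. f x y)"
proof -
  have int: "integrable (lborel \<Otimes>\<^sub>M lborel) (\<lambda>(x, y). f x y)"
    by (rule lborel_pair.Fubini_integrable) (use assms in auto)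
  from lborel_pair.Fubini_integral[OF int]
  show "(LINT x|lborel. LINT y|lborel. f x y) = (LINT y|lborel. LINT x|lborel. f x y)" by simp
  from lborel_pair.integrable_snd[OF int]
  show "integrable lborel (\<lambda>y. LINT x|lborel. f x y)" by simp
  from lborel_pair.AE_integrable_snd[OF int]
  show "AE y in lborel. integrable lborel (\<lambda>x. f x y)" by simp
qed

lemma square_int_cmod: "square_int f \<Longrightarrow> square_int (\<lambda>x. complex_of_real (cmod (f x)))"
  by (auto simp: square_int_def)

lemma L2_Cauchy_Schwarz:
  assumes f: "square_int f" and g: "square_int g"
  shows "integrable lborel (\<lambda>x. cmod (f x) * cmod (g x))" (is ?A)
    and "(LINT x|lborel. cmod (f x) * cmod (g x)) \<le> norm (L2_of f) * norm (L2_of g)" (is ?B)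
    and "integrable lborel (\<lambda>x. f x * g x)" (is ?C)
    and "integrable lborel (\<lambda>x. f x * cnj (g x))" (is ?D)
    and "cmod (LINT x|lborel. f x * cnj (g x)) \<le> norm (L2_of f) * norm (L2_of g)" (is ?E)
proof -
  have [measurable]: "f \<in> borel_measurable borel" "g \<in> borel_measurable borel"
    using assms by measurable
  note fc = square_int_cmod[OF f] and gc = square_int_cmod[OF g]
  have eq: "complex_of_real (cmod (f x)) \<bullet> complex_of_real (cmod (g x)) = cmod (f x) * cmod (g x)" for x
    by (simp add: inner_complex_def)
  have n: "norm (L2_of (\<lambda>x. complex_of_real (cmod (h x)))) = norm (L2_of h)" if "square_int h" for h
  proof -
    have "(norm (L2_of (\<lambda>x. complex_of_real (cmod (h x)))))\<^sup>2 = (norm (L2_of h))\<^sup>2"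
      using norm_L2_of[OF that] norm_L2_of[OF square_int_cmod[OF that]] by simp
    then show ?thesis by simp
  qed
  show ?A using square_int_inner[OF fc gc] by (simp add: eq)
  show ?B using norm_cauchy_schwarz[of "L2_of (\<lambda>x. complex_of_real (cmod (f x)))" "L2_of (\<lambda>x. complex_of_real (cmod (g x)))"]
    by (simp add: inner_L2_of[OF fc gc] eq n f g)
  show ?C by (rule Bochner_Integration.integrable_bound[OF \<open>?A\<close>]) (auto simp: norm_mult)
  show ?D by (rule Bochner_Integration.integrable_bound[OF \<open>?A\<close>]) (auto simp: norm_mult)
  have "cmod (LINT x|lborel. f x * cnj (g x)) \<le> (LINT x|lborel. cmod (f x * cnj (g x)))"
    by (rule integral_norm_bound)
  then show ?E using \<open>?B\<close> by (simp add: norm_mult)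
qed

section \<open>The classical Fourier integral and Plancherel's identity on integrable
  functions\<close>

definition ft :: "(real \<Rightarrow> complex) \<Rightarrow> real \<Rightarrow> complex" where
  "ft f \<xi> = (1 / sqrt (2 * pi)) *\<^sub>R (LINT x|lborel. exp (- (\<i> * of_real (\<xi> * x))) * f x)"

lemma integrable_ft_integrand:
  assumes "integrable lborel f"
  shows "integrable lborel (\<lambda>x. exp (- (\<i> * complex_of_real (\<xi> * x))) * f x)"
    "integrable lborel (\<lambda>x. exp (\<i> * complex_of_real (\<xi> * x)) * f x)"
  by (rule Bochner_Integration.integrable_bound[OF assms], use assms in \<open>auto simp: norm_mult\<close>)+

lemma ft_measurable [measurable]:
  assumes [measurable]: "f \<in> borel_measurable borel"
  shows "ft f \<in> borel_measurable borel"
  unfolding ft_def by measurable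

lemma cmod_ft_le:
  assumes "integrable lborel f"
  shows "cmod (ft f \<xi>) \<le> (1 / sqrt (2 * pi)) * (LINT x|lborel. cmod (f x))"
proof -
  have "cmod (LINT x|lborel. exp (- (\<i> * complex_of_real (\<xi> * x))) * f x)
      \<le> (LINT x|lborel. cmod (exp (- (\<i> * complex_of_real (\<xi> * x))) * f x))"
    by (rule integral_norm_bound)
  then show ?thesis by (simp add: ft_def norm_mult divide_right_mono)
qed

lemma ft_add: "integrable lborel f \<Longrightarrow> integrable lborel g \<Longrightarrow> ft (\<lambda>x. f x + g x) \<xi> = ft f \<xi> + ft g \<xi>"
  using integrable_ft_integrand[of f \<xi>] integrable_ft_integrand[of g \<xi>]
  by (simp add: ft_def distrib_left scaleR_right_distrib)

lemma ft_diff: "integrable lborel f \<Longrightarrow> integrable lborel g \<Longrightarrow> ft (\<lambda>x. f x - g x) \<xi> = ft f \<xi> - ft g \<xi>"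
  using integrable_ft_integrand[of f \<xi>] integrable_ft_integrand[of g \<xi>]
  by (simp add: ft_def right_diff_distrib scaleR_right_diff_distrib)

lemma ft_cmult: "ft (\<lambda>x. c * f x) \<xi> = c * ft f \<xi>"
  by (simp add: ft_def mult.left_commute[of _ c])

lemma ft_cong_AE:
  assumes "f \<in> borel_measurable borel" "g \<in> borel_measurable borel" "AE x in lborel. f x = g x"
  shows "ft f \<xi> = ft g \<xi>"
  unfolding ft_def
  by (intro arg_cong[where f = "\<lambda>z. _ *\<^sub>R z"] integral_cong_AE) (use assms in \<open>auto elim!: eventually_mono\<close>)

text \<open>The characteristic function of the standard normal distribution, evaluated at
  \<open>- s / \<epsilon>\<close> and rescaled by \<open>\<epsilon>\<close>.\<close>

lemma gaussian_ft:
  fixes s \<epsilon> :: real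
  assumes "\<epsilon> > 0"
  shows "integrable lborel (\<lambda>\<xi>. exp (- \<epsilon>\<^sup>2 * \<xi>\<^sup>2 / 2))"
    and "(LINT \<xi>|lborel. exp (- (\<i> * complex_of_real (\<xi> * s))) * of_real (exp (- \<epsilon>\<^sup>2 * \<xi>\<^sup>2 / 2)))
      = of_real (sqrt (2 * pi) / \<epsilon> * exp (- s\<^sup>2 / (2 * \<epsilon>\<^sup>2)))"
proof -
  have i: "integrable lborel (normal_density 0 1)" by (rule integrable_normal_density) simp
  from lborel_integrable_real_affine[OF i, of \<epsilon> 0] assms
  have "integrable lborel (\<lambda>x. sqrt (2 * pi) * std_normal_density (\<epsilon> * x))" by simp
  then show "integrable lborel (\<lambda>\<xi>. exp (- \<epsilon>\<^sup>2 * \<xi>\<^sup>2 / 2))"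
    by (simp add: std_normal_density_def power_mult_distrib)
  have "complex_of_real (exp (- (s / \<epsilon>)\<^sup>2 / 2)) = char std_normal_distribution (- s / \<epsilon>)"
    by (simp add: char_std_normal_distribution)
  also have "\<dots> = (LINT x|lborel. std_normal_density x *\<^sub>R iexp (- s / \<epsilon> * x))"
    unfolding char_def by (subst integral_density) auto
  also have "\<dots> = \<bar>\<epsilon>\<bar> *\<^sub>R (LINT x|lborel. std_normal_density (0 + \<epsilon> * x) *\<^sub>R iexp (- s / \<epsilon> * (0 + \<epsilon> * x)))"
    by (rule lborel_integral_real_affine) (use assms in simp)
  also have "(\<lambda>x. std_normal_density (0 + \<epsilon> * x) *\<^sub>R iexp (- s / \<epsilon> * (0 + \<epsilon> * x)))
      = (\<lambda>x. of_real (1 / sqrt (2 * pi)) * (exp (- (\<i> * complex_of_real (x * s))) * of_real (exp (- \<epsilon>\<^sup>2 * x\<^sup>2 / 2))))"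
    using assms by (auto simp: fun_eq_iff std_normal_density_def scaleR_conv_of_real power_mult_distrib mult_ac)
  finally have *: "complex_of_real (exp (- (s / \<epsilon>)\<^sup>2 / 2))
    = \<bar>\<epsilon>\<bar> *\<^sub>R (of_real (1 / sqrt (2 * pi)) * (LINT \<xi>|lborel. exp (- (\<i> * complex_of_real (\<xi> * s))) * of_real (exp (- \<epsilon>\<^sup>2 * \<xi>\<^sup>2 / 2))))"
    (is "_ = _ *\<^sub>R (_ * ?I)") by simp
  have "?I = of_real (sqrt (2 * pi) / \<epsilon>) * complex_of_real (exp (- (s / \<epsilon>)\<^sup>2 / 2))"
    unfolding * using assms by (simp add: scaleR_conv_of_real)
  then show "?I = of_real (sqrt (2 * pi) / \<epsilon> * exp (- s\<^sup>2 / (2 * \<epsilon>\<^sup>2)))"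
    by (simp add: power_divide)
qed

text \<open>The autocorrelation, whose Fourier transform is \<open>|ft f|\<^sup>2\<close>.\<close>

definition autocor :: "(real \<Rightarrow> complex) \<Rightarrow> real \<Rightarrow> complex" where
  "autocor f s = (LINT y|lborel. f (y + s) * cnj (f y))"

lemma autocor_measurable [measurable]:
  assumes [measurable]: "f \<in> borel_measurable borel"
  shows "autocor f \<in> borel_measurable borel"
  unfolding autocor_def by measurable

lemma integrable_cmod: "integrable M f \<Longrightarrow> integrable M (\<lambda>x. cmod (f x))"
  by (rule integrable_norm)

text \<open>Fubini for exp(-i xi s) f(y + s) cnj (f y): integrating over y first gives the transform
  of the autocorrelation, while integrating over s first and substituting x = y + s splits the
  double integral into the transform of f and its conjugate.\<close>

lemma autocor_integrable:
  assumes f: "integrable lborel f"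
  shows "integrable lborel (autocor f)"
    and "ft f \<xi> * cnj (ft f \<xi>) = (1 / (2 * pi)) *\<^sub>R (LINT s|lborel. exp (- (\<i> * of_real (\<xi> * s))) * autocor f s)"
proof -
  have [measurable]: "f \<in> borel_measurable borel" using borel_measurable_integrable[OF f] by simp
  define K where "K = (\<lambda>\<xi> y s. exp (- (\<i> * complex_of_real (\<xi> * s))) * (f (y + s) * cnj (f y)))"
  have sh: "integrable lborel (\<lambda>s. f (y + s))" for y
    using integral_translate(2)[OF f, of "- y"] by (simp add: add.commute)
  have meas: "(\<lambda>(y, s). K \<xi> y s) \<in> borel_measurable (borel \<Otimes>\<^sub>M borel)" for \<xi>
    unfolding K_def by measurable
  have nrm: "(LINT s|lborel. norm (K \<xi> y s)) = (LINT s|lborel. cmod (f s)) * cmod (f y)" for \<xi> y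
    using integral_translate(1)[of "\<lambda>s. cmod (f s)" "- y"] by (simp add: K_def norm_mult add.commute)
  have i2: "integrable lborel (K \<xi> y)" for \<xi> y
  proof -
    have "K \<xi> y = (\<lambda>s. exp (- (\<i> * complex_of_real (\<xi> * s))) * (cnj (f y) * f (y + s)))"
      by (simp add: K_def fun_eq_iff mult.commute)
    then show ?thesis using integrable_ft_integrand(1)[of "\<lambda>s. cnj (f y) * f (y + s)" \<xi>] sh by simp
  qed
  note fub = Fubini_lborel[OF meas, OF _ i2]
  have i1: "integrable lborel (\<lambda>y. LINT s|lborel. norm (K \<xi> y s))" for \<xi>
    unfolding nrm using integrable_cmod[OF f] by simp
  from fub(2)[OF i1, of 0] show "integrable lborel (autocor f)"
    by (simp add: K_def autocor_def[abs_def])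
  have c: "(LINT y|lborel. LINT s|lborel. K \<xi> y s) = (LINT s|lborel. exp (- (\<i> * of_real (\<xi> * s))) * autocor f s)"
    unfolding fub(1)[OF i1] by (simp add: K_def autocor_def)
  have "(LINT s|lborel. K \<xi> y s) = (LINT x|lborel. exp (- (\<i> * complex_of_real (\<xi> * x))) * f x) * (exp (\<i> * complex_of_real (\<xi> * y)) * cnj (f y))" for y
  proof -
    have "K \<xi> y = (\<lambda>s. (\<lambda>x. exp (- (\<i> * complex_of_real (\<xi> * x))) * f x) (s - (- y)) * (exp (\<i> * complex_of_real (\<xi> * y)) * cnj (f y)))"
      by (auto simp: K_def fun_eq_iff distrib_left exp_add exp_diff exp_minus field_simps add.commute)
    then have "(LINT s|lborel. K \<xi> y s) = (LINT s|lborel. (\<lambda>x. exp (- (\<i> * complex_of_real (\<xi> * x))) * f x) (s - (- y))) * (exp (\<i> * complex_of_real (\<xi> * y)) * cnj (f y))"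
      by (simp del: diff_minus_eq_add)
    then show ?thesis by (subst (asm) integral_translate(1)) 
  qed
  then have "(LINT y|lborel. LINT s|lborel. K \<xi> y s)
      = (LINT x|lborel. exp (- (\<i> * complex_of_real (\<xi> * x))) * f x) * (LINT y|lborel. exp (\<i> * complex_of_real (\<xi> * y)) * cnj (f y))"
    by simp
  also have "(LINT y|lborel. exp (\<i> * complex_of_real (\<xi> * y)) * cnj (f y)) = cnj (LINT x|lborel. exp (- (\<i> * complex_of_real (\<xi> * x))) * f x)"
    unfolding Bochner_Integration.integral_cnj[symmetric] by (simp add: exp_cnj)
  finally show "ft f \<xi> * cnj (ft f \<xi>) = (1 / (2 * pi)) *\<^sub>R (LINT s|lborel. exp (- (\<i> * of_real (\<xi> * s))) * autocor f s)"
    unfolding c ft_def by (simp add: complex_cnj_scaleR)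
qed

lemma cmod_autocor_le:
  assumes "square_int f"
  shows "cmod (autocor f s) \<le> (norm (L2_of f))\<^sup>2"
proof -
  have "autocor f s = (LINT y|lborel. f (y - (- s)) * cnj (f y))" by (simp add: autocor_def)
  also have "cmod \<dots> \<le> norm (L2_of (\<lambda>y. f (y - (- s)))) * norm (L2_of f)"
    by (rule L2_Cauchy_Schwarz) (intro square_int_translate assms)+
  also have "norm (L2_of (\<lambda>y. f (y - (- s)))) = norm (L2_of f)"
    unfolding trans_L2_of[OF assms, symmetric] by simp
  finally show ?thesis by (simp add: power2_eq_square)
qed

lemma autocor_tendsto:
  assumes f: "square_int f" and s: "s \<longlonglongrightarrow> 0"
  shows "(\<lambda>n. autocor f (s n)) \<longlonglongrightarrow> of_real ((norm (L2_of f))\<^sup>2)"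
proof -
  have 0: "of_real ((norm (L2_of f))\<^sup>2) = (LINT y|lborel. f y * cnj (f y))"
    unfolding norm_L2_of[OF f] complex_norm_square[symmetric] of_real_power[symmetric]
      integral_complex_of_real ..
  have "cmod (autocor f t - of_real ((norm (L2_of f))\<^sup>2)) \<le> norm (trans_L2 (- t) (L2_of f) - L2_of f) * norm (L2_of f)" for t
  proof -
    have sh: "square_int (\<lambda>y. f (y + t))" using square_int_translate[OF f, of "- t"] by simp
    have "autocor f t - of_real ((norm (L2_of f))\<^sup>2) = (LINT y|lborel. (f (y + t) - f y) * cnj (f y))"
      unfolding 0 autocor_def left_diff_distrib
      by (rule Bochner_Integration.integral_diff[symmetric]) (intro L2_Cauchy_Schwarz sh f)+
    also have "cmod \<dots> \<le> norm (L2_of (\<lambda>y. f (y + t) - f y)) * norm (L2_of f)"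
      by (rule L2_Cauchy_Schwarz) (intro square_int_diff sh f)+
    finally show ?thesis using trans_L2_of[OF f, of "- t"] by (simp add: L2_of_diff f sh)
  qed
  then have ev: "\<forall>\<^sub>F n in sequentially. cmod (autocor f (s n) - of_real ((norm (L2_of f))\<^sup>2)) \<le> norm (trans_L2 (- s n) (L2_of f) - L2_of f) * norm (L2_of f)"
    by (intro always_eventually allI)
  have "(\<lambda>n. norm (trans_L2 (- s n) (L2_of f) - L2_of f) * norm (L2_of f)) \<longlonglongrightarrow> norm (L2_of f - L2_of f) * norm (L2_of f)"
    using tendsto_minus[OF s] by (intro tendsto_intros trans_L2_tendsto) simp
  then have "(\<lambda>n. norm (trans_L2 (- s n) (L2_of f) - L2_of f) * norm (L2_of f)) \<longlonglongrightarrow> 0" by simp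
  from Lim_null_comparison[OF ev this]
  have "(\<lambda>n. autocor f (s n) - of_real ((norm (L2_of f))\<^sup>2)) \<longlonglongrightarrow> 0" .
  then show ?thesis by (simp add: LIM_zero_iff)
qed

text \<open>Gaussian regularisation makes the squared transform integrable before square
  integrability of \<open>ft f\<close> is known. Since the transform of a Gaussian is a Gaussian,
  the regularised integral is an average of the autocorrelation at scale \<open>\<epsilon>\<close>,
  which concentrates at 0.\<close>

lemma gaussian_ft_norm:
  assumes f: "integrable lborel f" and \<epsilon>: "\<epsilon> > 0"
  shows "integrable lborel (\<lambda>\<xi>. (cmod (ft f \<xi>))\<^sup>2 * exp (- \<epsilon>\<^sup>2 * \<xi>\<^sup>2 / 2))"
    and "complex_of_real (LINT \<xi>|lborel. (cmod (ft f \<xi>))\<^sup>2 * exp (- \<epsilon>\<^sup>2 * \<xi>\<^sup>2 / 2))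
      = (LINT z|lborel. autocor f (\<epsilon> * z) * of_real (std_normal_density z))"
proof -
  have [measurable]: "f \<in> borel_measurable borel" using borel_measurable_integrable[OF f] by simp
  define N where "N = (1 / sqrt (2 * pi)) * (LINT x|lborel. cmod (f x))"
  have N: "cmod (ft f \<xi>) \<le> N" for \<xi> unfolding N_def by (rule cmod_ft_le[OF f])
  define g where "g = (\<lambda>\<xi>::real. exp (- \<epsilon>\<^sup>2 * \<xi>\<^sup>2 / 2))"
  have g: "integrable lborel g" unfolding g_def by (rule gaussian_ft(1)[OF \<epsilon>])
  have [measurable]: "g \<in> borel_measurable borel" unfolding g_def by measurable
  show "integrable lborel (\<lambda>\<xi>. (cmod (ft f \<xi>))\<^sup>2 * exp (- \<epsilon>\<^sup>2 * \<xi>\<^sup>2 / 2))"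
  proof (rule Bochner_Integration.integrable_bound[where f = "\<lambda>\<xi>. N\<^sup>2 * g \<xi>"])
    show "AE x in lborel. norm ((cmod (ft f x))\<^sup>2 * exp (- \<epsilon>\<^sup>2 * x\<^sup>2 / 2)) \<le> norm (N\<^sup>2 * g x)"
      unfolding g_def using N by (auto simp: abs_mult intro!: AE_I2 mult_right_mono power_mono)
  qed (use g in auto)
  define K where "K = (\<lambda>\<xi> s. of_real (g \<xi>) * (exp (- (\<i> * of_real (\<xi> * s))) * autocor f s))"
  have K2: "integrable lborel (K \<xi>)" for \<xi>
    unfolding K_def by (intro integrable_mult_right integrable_ft_integrand autocor_integrable f)
  have "(LINT s|lborel. norm (K \<xi> s)) = g \<xi> * (LINT s|lborel. cmod (autocor f s))" for \<xi>
    by (simp add: K_def norm_mult g_def)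
  then have K1: "integrable lborel (\<lambda>\<xi>. LINT s|lborel. norm (K \<xi> s))" using g by simp
  have "(\<lambda>(\<xi>, s). K \<xi> s) \<in> borel_measurable (borel \<Otimes>\<^sub>M borel)" unfolding K_def by measurable
  note fub = Fubini_lborel(1)[OF this K1 K2]
  have "complex_of_real (LINT \<xi>|lborel. (cmod (ft f \<xi>))\<^sup>2 * exp (- \<epsilon>\<^sup>2 * \<xi>\<^sup>2 / 2))
      = (LINT \<xi>|lborel. of_real (g \<xi>) * (ft f \<xi> * cnj (ft f \<xi>)))"
    unfolding integral_complex_of_real[symmetric] g_def
    by (simp add: complex_norm_square[symmetric] mult.commute)
  also have "\<dots> = (1 / (2 * pi)) *\<^sub>R (LINT \<xi>|lborel. LINT s|lborel. K \<xi> s)"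
    unfolding autocor_integrable(2)[OF f] K_def by simp
  also have "(LINT \<xi>|lborel. LINT s|lborel. K \<xi> s) = (LINT s|lborel. of_real (sqrt (2 * pi) / \<epsilon> * exp (- s\<^sup>2 / (2 * \<epsilon>\<^sup>2))) * autocor f s)"
    unfolding fub
  proof (intro Bochner_Integration.integral_cong refl)
    fix s :: real
    have "(LINT \<xi>|lborel. K \<xi> s) = (LINT \<xi>|lborel. exp (- (\<i> * complex_of_real (\<xi> * s))) * of_real (g \<xi>) * autocor f s)"
      by (simp add: K_def mult_ac)
    also have "\<dots> = (LINT \<xi>|lborel. exp (- (\<i> * complex_of_real (\<xi> * s))) * of_real (g \<xi>)) * autocor f s"
      by simp
    finally show "(LINT \<xi>|lborel. K \<xi> s) = of_real (sqrt (2 * pi) / \<epsilon> * exp (- s\<^sup>2 / (2 * \<epsilon>\<^sup>2))) * autocor f s"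
      unfolding g_def gaussian_ft(2)[OF \<epsilon>] .
  qed
  also have "\<dots> = \<bar>\<epsilon>\<bar> *\<^sub>R (LINT s|lborel. of_real (sqrt (2 * pi) / \<epsilon> * exp (- (0 + \<epsilon> * s)\<^sup>2 / (2 * \<epsilon>\<^sup>2))) * autocor f (0 + \<epsilon> * s))"
    by (rule lborel_integral_real_affine) (use \<epsilon> in simp)
  also have "(\<lambda>s. of_real (sqrt (2 * pi) / \<epsilon> * exp (- (0 + \<epsilon> * s)\<^sup>2 / (2 * \<epsilon>\<^sup>2))) * autocor f (0 + \<epsilon> * s))
      = (\<lambda>s. of_real (2 * pi / \<epsilon>) * (autocor f (\<epsilon> * s) * of_real (std_normal_density s)))"
  proof
    fix s
    have "sqrt (2 * pi) / \<epsilon> * exp (- (0 + \<epsilon> * s)\<^sup>2 / (2 * \<epsilon>\<^sup>2)) = (2 * pi / \<epsilon>) * std_normal_density s"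
      using \<epsilon> by (simp add: std_normal_density_def power_mult_distrib field_simps flip: real_sqrt_mult)
    then show "of_real (sqrt (2 * pi) / \<epsilon> * exp (- (0 + \<epsilon> * s)\<^sup>2 / (2 * \<epsilon>\<^sup>2))) * autocor f (0 + \<epsilon> * s)
      = of_real (2 * pi / \<epsilon>) * (autocor f (\<epsilon> * s) * of_real (std_normal_density s))"
      by (simp only: of_real_mult mult_ac add_0)
  qed
  finally show "complex_of_real (LINT \<xi>|lborel. (cmod (ft f \<xi>))\<^sup>2 * exp (- \<epsilon>\<^sup>2 * \<xi>\<^sup>2 / 2))
      = (LINT z|lborel. autocor f (\<epsilon> * z) * of_real (std_normal_density z))"
    using \<epsilon> by (simp add: scaleR_conv_of_real)
qed

text \<open>Let the regularisation tend to 0 in \<open>gaussian_ft_norm\<close>. The averages of the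
  autocorrelation converge to its value at 0, the squared norm, by dominated convergence; the
  regularised integrals increase, so monotone convergence yields integrability and the value
  together.\<close>

theorem Plancherel_L1_L2:
  assumes f: "square_int f" "integrable lborel f"
  shows "square_int (ft f)" and "norm (L2_of (ft f)) = norm (L2_of f)"
proof -
  have [measurable]: "f \<in> borel_measurable borel" using f by measurable
  define \<epsilon> where "\<epsilon> = (\<lambda>n. 1 / real (Suc n))"
  have \<epsilon>: "\<epsilon> n > 0" "\<epsilon> \<longlonglongrightarrow> 0" for n
    unfolding \<epsilon>_def using LIMSEQ_Suc[OF lim_1_over_n] by auto
  define h where "h = (\<lambda>n \<xi>. (cmod (ft f \<xi>))\<^sup>2 * exp (- (\<epsilon> n)\<^sup>2 * \<xi>\<^sup>2 / 2))"
  have "(\<lambda>n. LINT z|lborel. autocor f (\<epsilon> n * z) * of_real (std_normal_density z))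
     \<longlonglongrightarrow> (LINT z|lborel. of_real ((norm (L2_of f))\<^sup>2) * of_real (std_normal_density z))"
  proof (rule integral_dominated_convergence[where w = "\<lambda>z. (norm (L2_of f))\<^sup>2 * std_normal_density z"])
    show "integrable lborel (\<lambda>z. (norm (L2_of f))\<^sup>2 * std_normal_density z)"
      by (intro integrable_mult_right integrable_normal_density) simp
    show "AE z in lborel. (\<lambda>n. autocor f (\<epsilon> n * z) * of_real (std_normal_density z)) \<longlonglongrightarrow> of_real ((norm (L2_of f))\<^sup>2) * of_real (std_normal_density z)"
      by (intro AE_I2 tendsto_intros autocor_tendsto f tendsto_mult_left_zero \<epsilon>)
    show "AE z in lborel. norm (autocor f (\<epsilon> n * z) * of_real (std_normal_density z)) \<le> (norm (L2_of f))\<^sup>2 * std_normal_density z" for n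
      by (intro AE_I2) (auto simp: norm_mult intro!: mult_right_mono cmod_autocor_le f)
  qed auto
  also have "(LINT z|lborel. of_real ((norm (L2_of f))\<^sup>2) * of_real (std_normal_density z)) = complex_of_real ((norm (L2_of f))\<^sup>2)"
    using integral_normal_density[of 1 0] by simp
  finally have "(\<lambda>n. complex_of_real (LINT \<xi>|lborel. h n \<xi>)) \<longlonglongrightarrow> complex_of_real ((norm (L2_of f))\<^sup>2)"
    unfolding h_def gaussian_ft_norm(2)[OF f(2) \<epsilon>(1)] .
  then have lim: "(\<lambda>n. LINT \<xi>|lborel. h n \<xi>) \<longlonglongrightarrow> (norm (L2_of f))\<^sup>2"
    by (simp only: tendsto_of_real_iff)
  have int: "integrable lborel (h n)" for n
    unfolding h_def by (rule gaussian_ft_norm(1)[OF f(2) \<epsilon>(1)])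
  have mono: "mono (\<lambda>n. h n \<xi>)" for \<xi>
  proof (rule monoI)
    fix m n :: nat assume "m \<le> n"
    then have "\<epsilon> n \<le> \<epsilon> m" by (simp add: \<epsilon>_def field_simps)
    then have "(\<epsilon> n)\<^sup>2 \<le> (\<epsilon> m)\<^sup>2" using \<epsilon>(1)[of n] by (intro power_mono) auto
    then have "(\<epsilon> n)\<^sup>2 * \<xi>\<^sup>2 \<le> (\<epsilon> m)\<^sup>2 * \<xi>\<^sup>2" by (intro mult_right_mono) auto
    then show "h m \<xi> \<le> h n \<xi>" unfolding h_def by (intro mult_left_mono) auto
  qed
  have hlim: "(\<lambda>n. h n \<xi>) \<longlonglongrightarrow> (cmod (ft f \<xi>))\<^sup>2" for \<xi>
    unfolding h_def by (rule tendsto_eq_intros refl \<epsilon>(2) | simp)+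
  have "integrable lborel (\<lambda>\<xi>. (cmod (ft f \<xi>))\<^sup>2)" "(LINT \<xi>|lborel. (cmod (ft f \<xi>))\<^sup>2) = (norm (L2_of f))\<^sup>2"
    by (rule integral_monotone_convergence_nonneg[OF int AE_I2[OF mono] _ AE_I2[OF hlim] lim]; simp add: h_def)+
  then show si: "square_int (ft f)" by (simp add: square_int_def)
  have "(norm (L2_of (ft f)))\<^sup>2 = (norm (L2_of f))\<^sup>2"
    unfolding norm_L2_of[OF si] by fact
  then show "norm (L2_of (ft f)) = norm (L2_of f)" by simp
qed

lemma ft_duality:
  assumes f: "integrable lborel f" and g: "integrable lborel g"
  shows "(LINT \<xi>|lborel. ft f \<xi> * g \<xi>) = (LINT x|lborel. f x * ft g x)"
proof -
  have [measurable]: "f \<in> borel_measurable borel" "g \<in> borel_measurable borel"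
    using borel_measurable_integrable[OF f] borel_measurable_integrable[OF g] by simp_all
  define K where "K = (\<lambda>\<xi> x. exp (- (\<i> * complex_of_real (\<xi> * x))) * f x * g \<xi>)"
  have K2: "integrable lborel (K \<xi>)" for \<xi>
    unfolding K_def by (intro integrable_mult_left integrable_ft_integrand f)
  have "(LINT x|lborel. norm (K \<xi> x)) = (LINT x|lborel. cmod (f x)) * cmod (g \<xi>)" for \<xi>
    by (simp add: K_def norm_mult)
  then have K1: "integrable lborel (\<lambda>\<xi>. LINT x|lborel. norm (K \<xi> x))" using integrable_cmod[OF g] by simp
  have "(\<lambda>(\<xi>, x). K \<xi> x) \<in> borel_measurable (borel \<Otimes>\<^sub>M borel)" unfolding K_def by measurable
  note fub = Fubini_lborel(1)[OF this K1 K2]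
  have "(LINT \<xi>|lborel. ft f \<xi> * g \<xi>) = (1 / sqrt (2 * pi)) *\<^sub>R (LINT \<xi>|lborel. LINT x|lborel. K \<xi> x)"
    by (simp add: ft_def K_def)
  also have "\<dots> = (1 / sqrt (2 * pi)) *\<^sub>R (LINT x|lborel. LINT \<xi>|lborel. f x * (exp (- (\<i> * complex_of_real (x * \<xi>))) * g \<xi>))"
    unfolding fub by (simp add: K_def mult_ac)
  also have "\<dots> = (LINT x|lborel. f x * ft g x)"
    by (simp add: ft_def)
  finally show ?thesis .
qed

text \<open>The \<open>lim\<close> in the definition of \<open>fourier_L2\<close> is a genuine
  limit: the truncations converge in L2 and \<open>ft\<close> is isometric on their differences, so
  the transforms form a Cauchy sequence. Replacing \<open>fun_of (L2_of F)\<close> by F is harmless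
  since the two agree almost everywhere.\<close>

lemma fourier_L2_limit:
  assumes F: "square_int F"
  shows "(\<lambda>n. L2_of (ft (cutoff n F))) \<longlonglongrightarrow> fourier_L2 (L2_of F)"
proof -
  define C X where "C = (\<lambda>n. L2_of (cutoff n F))" and "X = (\<lambda>n. L2_of (ft (cutoff n F)))"
  have [measurable]: "F \<in> borel_measurable borel" using F by measurable
  note c = square_int_cutoff[OF F] integrable_cutoff[OF F]
  have "dist (X m) (X n) = dist (C m) (C n)" for m n
    using Plancherel_L1_L2[OF square_int_diff[OF c(1)[of m] c(1)[of n]] Bochner_Integration.integrable_diff[OF c(2) c(2)]]
    unfolding dist_norm X_def C_def L2_of_diff[OF c(1) c(1)] L2_of_diff[OF Plancherel_L1_L2(1)[OF c] Plancherel_L1_L2(1)[OF c]]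
    by (simp only: ft_diff[OF c(2) c(2), abs_def])
  moreover have "Cauchy C"
    using L2_of_cutoff_tendsto[OF F] LIMSEQ_imp_Cauchy by (auto simp: C_def)
  ultimately have "Cauchy X" by (simp add: Cauchy_def)
  then have X: "X \<longlonglongrightarrow> lim X" by (simp add: Cauchy_convergent_iff convergent_LIMSEQ_iff)
  have "ft (cutoff n F) \<xi> = (1 / sqrt (2 * pi)) *\<^sub>R (LINT x:{- real n..real n}|lborel. exp (- (\<i> * of_real (\<xi> * x))) * fun_of (L2_of F) x)" for n \<xi>
  proof -
    have "AE x in lborel. cutoff n F x = cutoff n (fun_of (L2_of F)) x"
      using fun_of_L2_of[OF F] by eventually_elim (simp add: cutoff_def)
    then have "ft (cutoff n F) \<xi> = ft (cutoff n (fun_of (L2_of F))) \<xi>"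
      by (intro ft_cong_AE) auto
    then show ?thesis by (simp add: ft_def set_lebesgue_integral_def cutoff_def[abs_def])
  qed
  then have "fourier_L2 (L2_of F) = lim X" by (simp add: fourier_L2_def X_def ft_def[abs_def])
  with X show ?thesis by (simp add: X_def)
qed

lemma norm_fourier_L2 [simp]: "norm (fourier_L2 f) = norm f"
proof (cases f rule: L2_cases)
  case (L2_of F)
  have "(\<lambda>n. norm (L2_of (ft (cutoff n F)))) \<longlonglongrightarrow> norm (fourier_L2 f)"
    unfolding L2_of by (intro tendsto_norm fourier_L2_limit L2_of)
  moreover have "norm (L2_of (ft (cutoff n F))) = norm (L2_of (cutoff n F))" for n
    by (intro Plancherel_L1_L2 square_int_cutoff integrable_cutoff L2_of)
  moreover have "(\<lambda>n. norm (L2_of (cutoff n F))) \<longlonglongrightarrow> norm f"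
    unfolding L2_of by (intro tendsto_norm L2_of_cutoff_tendsto L2_of)
  ultimately show ?thesis using LIMSEQ_unique by simp
qed

lemma bounded_linear_fourier_L2: "bounded_linear fourier_L2"
proof (rule bounded_linear_intro[where K = 1])
  fix f g :: L2 and r :: real
  obtain F G where FG: "square_int F" "f = L2_of F" "square_int G" "g = L2_of G"
    by (metis L2_cases)
  note c = square_int_cutoff integrable_cutoff
  note PF = Plancherel_L1_L2(1)[OF c[OF FG(1)]] and PG = Plancherel_L1_L2(1)[OF c[OF FG(3)]]
  have "cutoff n (\<lambda>x. F x + G x) = (\<lambda>x. cutoff n F x + cutoff n G x)" for n
    by (simp add: cutoff_def fun_eq_iff scaleR_right_distrib)
  then have "L2_of (ft (cutoff n (\<lambda>x. F x + G x))) = L2_of (ft (cutoff n F)) + L2_of (ft (cutoff n G))" for n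
    unfolding L2_of_add[OF PF PG] by (simp add: ft_add[OF c(2)[OF FG(1)] c(2)[OF FG(3)], abs_def])
  moreover have "(\<lambda>n. L2_of (ft (cutoff n F)) + L2_of (ft (cutoff n G))) \<longlonglongrightarrow> fourier_L2 f + fourier_L2 g"
    unfolding FG by (intro tendsto_intros fourier_L2_limit FG)
  ultimately show "fourier_L2 (f + g) = fourier_L2 f + fourier_L2 g"
    using fourier_L2_limit[OF square_int_add[OF FG(1,3)]] LIMSEQ_unique FG by (simp add: L2_of_add)
  have sc: "square_int (\<lambda>x. r *\<^sub>R F x)" using square_int_mult_const[OF FG(1), of "of_real r"] by (simp add: scaleR_conv_of_real)
  have "cutoff n (\<lambda>x. r *\<^sub>R F x) = (\<lambda>x. of_real r * cutoff n F x)" for n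
    by (simp add: cutoff_def fun_eq_iff scaleR_conv_of_real)
  then have "L2_of (ft (cutoff n (\<lambda>x. r *\<^sub>R F x))) = r *\<^sub>R L2_of (ft (cutoff n F))" for n
    unfolding L2_of_scaleR[OF PF] by (simp add: ft_cmult[abs_def] scaleR_conv_of_real)
  moreover have "(\<lambda>n. r *\<^sub>R L2_of (ft (cutoff n F))) \<longlonglongrightarrow> r *\<^sub>R fourier_L2 f"
    unfolding FG by (intro tendsto_intros fourier_L2_limit FG)
  ultimately show "fourier_L2 (r *\<^sub>R f) = r *\<^sub>R fourier_L2 f"
    using fourier_L2_limit[OF sc] LIMSEQ_unique FG by (simp add: L2_of_scaleR)
qed simp

lemma fourier_L2_of:
  assumes F: "square_int F" "integrable lborel F"
  shows "fourier_L2 (L2_of F) = L2_of (ft F)"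
proof -
  note c = square_int_cutoff[OF F(1)] integrable_cutoff[OF F(1)]
  have "norm (L2_of (ft (cutoff n F)) - L2_of (ft F)) = norm (L2_of (cutoff n F) - L2_of F)" for n
    using Plancherel_L1_L2[OF square_int_diff[OF c(1) F(1)] Bochner_Integration.integrable_diff[OF c(2) F(2)], of n]
    unfolding L2_of_diff[OF c(1) F(1)] L2_of_diff[OF Plancherel_L1_L2(1)[OF c] Plancherel_L1_L2(1)[OF F]]
    by (simp only: ft_diff[OF c(2) F(2), abs_def])
  moreover have "(\<lambda>n. norm (L2_of (cutoff n F) - L2_of F)) \<longlonglongrightarrow> 0"
    using L2_of_cutoff_tendsto[OF F(1)] by (simp add: tendsto_norm_zero_iff LIM_zero_iff)
  ultimately have "(\<lambda>n. norm (L2_of (ft (cutoff n F)) - L2_of (ft F))) \<longlonglongrightarrow> 0" by simp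
  then have "(\<lambda>n. L2_of (ft (cutoff n F))) \<longlonglongrightarrow> L2_of (ft F)"
    by (rule LIM_zero_cancel[OF tendsto_norm_zero_cancel])
  then show ?thesis using fourier_L2_limit[OF F(1)] LIMSEQ_unique by blast
qed

lemma fourier_refl_L2: "fourier_L2 (refl_L2 f) = refl_L2 (fourier_L2 f)"
proof (rule L2_bounded_linear_eqI[where A = "\<lambda>f. fourier_L2 (refl_L2 f)" and B = "\<lambda>f. refl_L2 (fourier_L2 f)"])
  fix F assume F: "square_int F" "integrable lborel F"
  have ftr: "ft (\<lambda>x. F (- x)) = (\<lambda>\<xi>. ft F (- \<xi>))"
    using integral_reflect_lborel(1)[of "\<lambda>x. exp (- (\<i> * complex_of_real (- \<xi> * x))) * F x" for \<xi>]
    by (simp add: ft_def fun_eq_iff)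
  show "fourier_L2 (refl_L2 (L2_of F)) = refl_L2 (fourier_L2 (L2_of F))"
    using F by (simp add: refl_L2_of fourier_L2_of square_int_reflect integral_reflect_lborel Plancherel_L1_L2 ftr)
qed (intro bounded_linear_compose[OF bounded_linear_fourier_L2] bounded_linear_compose[OF bounded_linear_refl_L2]
      bounded_linear_fourier_L2 bounded_linear_refl_L2)+

text \<open>The inner product of \<open>L2\<close> is the real part of the Hermitian one. The
  identity is therefore the real part of the duality formula for \<open>ft\<close>, with the
  conjugate moved through the transform as a reflection, and density applied in each
  argument.\<close>

lemma fourier_L2_adjoint: "fourier_L2 f \<bullet> g = f \<bullet> refl_L2 (fourier_L2 g)"
proof (rule L2_bounded_linear_eqI[where A = "\<lambda>f. fourier_L2 f \<bullet> g" and B = "\<lambda>f. f \<bullet> refl_L2 (fourier_L2 g)"])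
  fix F assume F: "square_int F" "integrable lborel F"
  show "fourier_L2 (L2_of F) \<bullet> g = L2_of F \<bullet> refl_L2 (fourier_L2 g)"
  proof (rule L2_bounded_linear_eqI[where A = "\<lambda>g. fourier_L2 (L2_of F) \<bullet> g" and B = "\<lambda>g. L2_of F \<bullet> refl_L2 (fourier_L2 g)"])
    fix G assume G: "square_int G" "integrable lborel G"
    note PF = Plancherel_L1_L2(1)[OF F] and PG = Plancherel_L1_L2(1)[OF G]
    have ip: "a \<bullet> b = Re (a * cnj b)" for a b :: complex by (simp add: inner_complex_def)
    have c: "ft (\<lambda>x. cnj (G x)) x = cnj (ft G (- x))" for x
      unfolding ft_def by (simp add: exp_cnj flip: Bochner_Integration.integral_cnj)
    have cG: "integrable lborel (\<lambda>x. cnj (G x))" using G(2) by simp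
    have "fourier_L2 (L2_of F) \<bullet> L2_of G = (LINT x|lborel. Re (ft F x * cnj (G x)))"
      by (simp add: fourier_L2_of F G PF inner_L2_of ip)
    also have "\<dots> = Re (LINT x|lborel. ft F x * cnj (G x))"
      by (rule integral_Re) (intro L2_Cauchy_Schwarz PF G)
    also have "\<dots> = Re (LINT x|lborel. F x * cnj (ft G (- x)))"
      unfolding ft_duality[OF F(2) cG] c ..
    also have "\<dots> = (LINT x|lborel. Re (F x * cnj (ft G (- x))))"
      by (rule integral_Re[symmetric]) (intro L2_Cauchy_Schwarz(4)[where g = "\<lambda>x. ft G (- x)"] square_int_reflect PG F)
    also have "\<dots> = L2_of F \<bullet> refl_L2 (fourier_L2 (L2_of G))"
      by (simp add: fourier_L2_of F G PG refl_L2_of square_int_reflect inner_L2_of ip)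
    finally show "fourier_L2 (L2_of F) \<bullet> L2_of G = L2_of F \<bullet> refl_L2 (fourier_L2 (L2_of G))" .
  qed (intro bounded_linear_inner_right_comp bounded_linear_compose[OF bounded_linear_inner_right]
      bounded_linear_compose[OF bounded_linear_refl_L2] bounded_linear_fourier_L2 bounded_linear_ident)+
qed (intro bounded_linear_compose[OF bounded_linear_inner_left] bounded_linear_fourier_L2 bounded_linear_ident)+

text \<open>Inversion without any computation of integrals: by polarisation an isometry preserves
  inner products, so the adjoint of \<open>fourier_L2\<close> composed with
  \<open>fourier_L2\<close> is the identity, and the adjoint is already known.\<close>

lemma refl_fourier_fourier_L2: "refl_L2 (fourier_L2 (fourier_L2 h)) = h"
proof -
  interpret F: bounded_linear fourier_L2 by (rule bounded_linear_fourier_L2)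
  have polar: "x \<bullet> y = ((norm (x + y))\<^sup>2 - (norm x)\<^sup>2 - (norm y)\<^sup>2) / 2" for x y :: L2
    by (simp add: power2_norm_eq_inner inner_add_left inner_add_right inner_commute)
  have "fourier_L2 f \<bullet> fourier_L2 h = f \<bullet> h" for f
    unfolding polar F.add[symmetric] norm_fourier_L2 ..
  then have "f \<bullet> (refl_L2 (fourier_L2 (fourier_L2 h)) - h) = 0" for f
    by (simp add: fourier_L2_adjoint[symmetric] inner_diff_right)
  from this[of "refl_L2 (fourier_L2 (fourier_L2 h)) - h"] show ?thesis by simp
qed

lemma fourier_refl_fourier_L2 [simp]: "fourier_L2 (refl_L2 (fourier_L2 g)) = g"
  by (simp add: fourier_refl_L2 refl_fourier_fourier_L2)

lemma fourier_L2_inject: "fourier_L2 f = fourier_L2 g \<Longrightarrow> f = g"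
  using refl_fourier_fourier_L2 by metis

text \<open>Together with \<open>fourier_L2_inject\<close> this shows that \<open>fourier_L2\<close>
  is a bijection, so that \<open>inv\<close> in the definition of \<open>schroedinger_group\<close>
  denotes the true inverse.\<close>

lemma inv_fourier_L2: "inv fourier_L2 g = refl_L2 (fourier_L2 g)"
  by (intro inv_f_eq injI) (auto dest: fourier_L2_inject)

section \<open>Fourier transforms of modulated, translated and scaled functions\<close>

lemma unimod_boost [simp]: "unimod (\<lambda>x. exp (\<i> * of_real (e * x - e\<^sup>2 * s)))"
  by (intro unimod_exp) measurable

lemma unimod_lin [simp]: "unimod (\<lambda>x. exp (- (\<i> * of_real (e * x))))" "unimod (\<lambda>x. exp (\<i> * of_real (e * x)))"
  by (intro unimod_exp; measurable)+

lemma exp_mult_eq: "a + b = c \<Longrightarrow> exp a * exp b = exp (c :: complex)"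
  by (metis exp_add)

lemma fourier_mult_exp:
  "fourier_L2 (mult_L2 (\<lambda>x. exp (\<i> * of_real (e * x))) f) = trans_L2 e (fourier_L2 f)"
proof (rule L2_bounded_linear_eqI[where A = "\<lambda>f. fourier_L2 (mult_L2 (\<lambda>x. exp (\<i> * of_real (e * x))) f)"
      and B = "\<lambda>f. trans_L2 e (fourier_L2 f)"])
  fix F assume F: "square_int F" "integrable lborel F"
  have e: "exp (- (\<i> * complex_of_real (\<xi> * x))) * (exp (\<i> * of_real (e * x)) * F x) = exp (- (\<i> * of_real ((\<xi> - e) * x))) * F x" for \<xi> x
    unfolding mult.assoc[symmetric] by (subst exp_mult_eq) (auto simp: algebra_simps)
  have ftm: "ft (\<lambda>x. exp (\<i> * of_real (e * x)) * F x) = (\<lambda>\<xi>. ft F (\<xi> - e))"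
    unfolding ft_def[abs_def] e ..
  show "fourier_L2 (mult_L2 (\<lambda>x. exp (\<i> * of_real (e * x))) (L2_of F)) = trans_L2 e (fourier_L2 (L2_of F))"
    using F by (simp add: mult_L2_of fourier_L2_of square_int_mult integrable_ft_integrand trans_L2_of Plancherel_L1_L2 ftm del: of_real_mult)
qed (intro bounded_linear_compose[OF bounded_linear_fourier_L2] bounded_linear_compose[OF bounded_linear_trans_L2]
      bounded_linear_fourier_L2 bounded_linear_mult_L2 unimod_bounded unimod_lin)+

lemma fourier_trans_L2:
  "fourier_L2 (trans_L2 h f) = mult_L2 (\<lambda>\<xi>. exp (- (\<i> * of_real (h * \<xi>)))) (fourier_L2 f)"
proof (rule L2_bounded_linear_eqI[where A = "\<lambda>f. fourier_L2 (trans_L2 h f)"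
      and B = "\<lambda>f. mult_L2 (\<lambda>\<xi>. exp (- (\<i> * of_real (h * \<xi>)))) (fourier_L2 f)"])
  fix F assume F: "square_int F" "integrable lborel F"
  have ftt: "ft (\<lambda>x. F (x - h)) = (\<lambda>\<xi>. exp (- (\<i> * of_real (h * \<xi>))) * ft F \<xi>)"
  proof
    fix \<xi>
    have e: "exp (- (\<i> * of_real (h * \<xi>))) * (exp (- (\<i> * complex_of_real (\<xi> * (x - h)))) * F (x - h))
        = exp (- (\<i> * complex_of_real (\<xi> * x))) * F (x - h)" for x
      unfolding mult.assoc[symmetric] by (subst exp_mult_eq) (auto simp: algebra_simps)
    have "(LINT x|lborel. exp (- (\<i> * complex_of_real (\<xi> * x))) * F (x - h))
      = (LINT x|lborel. (\<lambda>y. exp (- (\<i> * of_real (h * \<xi>))) * (exp (- (\<i> * complex_of_real (\<xi> * y))) * F y)) (x - h))"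
      unfolding e ..
    also have "\<dots> = (LINT y|lborel. exp (- (\<i> * of_real (h * \<xi>))) * (exp (- (\<i> * complex_of_real (\<xi> * y))) * F y))"
      by (rule integral_translate(1))
    finally show "ft (\<lambda>x. F (x - h)) \<xi> = exp (- (\<i> * of_real (h * \<xi>))) * ft F \<xi>"
      by (simp add: ft_def)
  qed
  show "fourier_L2 (trans_L2 h (L2_of F)) = mult_L2 (\<lambda>\<xi>. exp (- (\<i> * of_real (h * \<xi>)))) (fourier_L2 (L2_of F))"
    using F by (simp add: mult_L2_of fourier_L2_of square_int_translate integral_translate trans_L2_of Plancherel_L1_L2 ftt del: of_real_mult)
qed (intro bounded_linear_compose[OF bounded_linear_fourier_L2] bounded_linear_compose[OF bounded_linear_mult_L2]
      bounded_linear_fourier_L2 bounded_linear_trans_L2 unimod_bounded unimod_lin)+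

lemma fourier_mult_const: "fourier_L2 (mult_L2 (\<lambda>_. c) f) = mult_L2 (\<lambda>_. c) (fourier_L2 f)"
proof (rule L2_bounded_linear_eqI[where A = "\<lambda>f. fourier_L2 (mult_L2 (\<lambda>_. c) f)"
      and B = "\<lambda>f. mult_L2 (\<lambda>_. c) (fourier_L2 f)"])
  fix F assume F: "square_int F" "integrable lborel F"
  then show "fourier_L2 (mult_L2 (\<lambda>_. c) (L2_of F)) = mult_L2 (\<lambda>_. c) (fourier_L2 (L2_of F))"
    by (simp add: mult_L2_of fourier_L2_of square_int_mult_const Plancherel_L1_L2 ft_cmult[abs_def])
qed (intro bounded_linear_compose[OF bounded_linear_fourier_L2] bounded_linear_compose[OF bounded_linear_mult_L2]
      bounded_linear_fourier_L2 bounded_linear_mult_L2 bounded_mult_const)+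

section \<open>The Schroedinger group and Galilean boosts\<close>

lemma fourier_schroedinger:
  "fourier_L2 (schroedinger_group t f) = mult_L2 (\<lambda>\<xi>. exp (- (\<i> * of_real (t * \<xi>\<^sup>2)))) (fourier_L2 f)"
  by (simp add: schroedinger_group_def inv_fourier_L2)

lemma unimod_schroedinger [simp]: "unimod (\<lambda>\<xi>. exp (- (\<i> * of_real (t * \<xi>\<^sup>2))))"
  by (intro unimod_exp) measurable

lemma norm_schroedinger [simp]: "norm (schroedinger_group t f) = norm f"
  by (simp add: schroedinger_group_def inv_fourier_L2 del: of_real_mult of_real_power)

lemma bounded_linear_schroedinger: "bounded_linear (schroedinger_group t)"
  unfolding schroedinger_group_def inv_fourier_L2
  by (intro bounded_linear_compose[OF bounded_linear_refl_L2] bounded_linear_compose[OF bounded_linear_fourier_L2]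
      bounded_linear_compose[OF bounded_linear_mult_L2] bounded_linear_fourier_L2 unimod_bounded unimod_schroedinger)

lemma schroedinger_add: "schroedinger_group s (schroedinger_group t f) = schroedinger_group (s + t) f"
proof (rule fourier_L2_inject)
  show "fourier_L2 (schroedinger_group s (schroedinger_group t f)) = fourier_L2 (schroedinger_group (s + t) f)"
    unfolding fourier_schroedinger
    by (subst mult_L2_mult[OF unimod_bounded unimod_bounded, OF unimod_schroedinger unimod_schroedinger],
        subst exp_mult_eq[OF refl]) (simp add: algebra_simps)
qed

lemma schroedinger_0 [simp]: "schroedinger_group 0 f = f"
  by (rule fourier_L2_inject) (simp add: fourier_schroedinger)

lemma schroedinger_mult_const:
  "schroedinger_group t (mult_L2 (\<lambda>_. c) f) = mult_L2 (\<lambda>_. c) (schroedinger_group t f)"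
  by (rule fourier_L2_inject)
     (simp add: fourier_schroedinger fourier_mult_const mult_L2_commute[of _ "\<lambda>_. c"] del: of_real_mult of_real_power)

text \<open>Joint continuity in time and function. The group is isometric, so the error in f is
  carried along unchanged, and for fixed g the multipliers converge pointwise with modulus 1. It is
  needed for the measurability of the Duhamel integrand.\<close>

lemma schroedinger_tendsto:
  assumes t: "s \<longlonglongrightarrow> t" and f: "f \<longlonglongrightarrow> g"
  shows "(\<lambda>n. schroedinger_group (s n) (f n)) \<longlonglongrightarrow> schroedinger_group t g"
proof -
  interpret S: bounded_linear "schroedinger_group a" for a by (rule bounded_linear_schroedinger)
  define F where "F = fun_of (fourier_L2 g)"
  have F: "square_int F" "fourier_L2 g = L2_of F" by (simp_all add: F_def square_int_fun_of L2_of_fun_of)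
  have [measurable]: "F \<in> borel_measurable borel" using F by measurable
  have "(\<lambda>n. L2_of (\<lambda>\<xi>. exp (- (\<i> * of_real (s n * \<xi>\<^sup>2))) * F \<xi>)) \<longlonglongrightarrow> L2_of (\<lambda>\<xi>. exp (- (\<i> * of_real (t * \<xi>\<^sup>2))) * F \<xi>)"
    by (rule L2_dominated_convergence(3)[where h = "\<lambda>x. cmod (F x)"])
       (use square_intD[OF F(1)] in \<open>auto simp: norm_mult intro!: tendsto_intros t\<close>)
  then have "(\<lambda>n. schroedinger_group (s n) g) \<longlonglongrightarrow> schroedinger_group t g"
    unfolding schroedinger_group_def inv_fourier_L2 F(2)
    using F(1) by (intro bounded_linear.tendsto[OF bounded_linear_refl_L2] bounded_linear.tendsto[OF bounded_linear_fourier_L2])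
      (simp add: mult_L2_of del: of_real_mult of_real_power)
  moreover have "(\<lambda>n. schroedinger_group (s n) (f n - g)) \<longlonglongrightarrow> 0"
    by (rule tendsto_norm_zero_cancel) (use tendsto_norm_zero[OF LIM_zero[OF f]] in simp)
  ultimately have "(\<lambda>n. schroedinger_group (s n) (f n - g) + schroedinger_group (s n) g) \<longlonglongrightarrow> 0 + schroedinger_group t g"
    by (intro tendsto_add)
  then show ?thesis by (simp add: S.diff)
qed

text \<open>The Galilean transformation with velocity 2e: if u(t) solves the equation, so does
  \<open>boost e t (u t)\<close>. The time parameter is often t - b, which makes the boost reduce to
  multiplication by exp (i e x) at time b instead of time 0.\<close>

definition boost :: "real \<Rightarrow> real \<Rightarrow> L2 \<Rightarrow> L2" where
  "boost e s f = mult_L2 (\<lambda>x. exp (\<i> * of_real (e * x - e\<^sup>2 * s))) (trans_L2 (2 * e * s) f)"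

lemma norm_boost [simp]: "norm (boost e s f) = norm f"
  unfolding boost_def norm_mult_L2_unimod[OF unimod_boost] by simp

lemma bounded_linear_boost: "bounded_linear (boost e s)"
  unfolding boost_def
  by (intro bounded_linear_compose[OF bounded_linear_mult_L2] bounded_linear_trans_L2 unimod_bounded unimod_boost)

lemma boost_0: "boost e 0 f = mult_L2 (\<lambda>x. exp (\<i> * of_real (e * x))) f"
  by (simp add: boost_def)

lemma fourier_boost:
  "fourier_L2 (boost e s f) = mult_L2 (\<lambda>\<xi>. exp (- (\<i> * of_real (2 * e * s * \<xi> - e\<^sup>2 * s)))) (trans_L2 e (fourier_L2 f))"
proof -
  have 1: "(\<lambda>x. exp (\<i> * of_real (e * x - e\<^sup>2 * s))) = (\<lambda>x. exp (- (\<i> * of_real (e\<^sup>2 * s))) * exp (\<i> * of_real (e * x)))"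
    by (subst exp_mult_eq[OF refl]) (simp add: algebra_simps)
  have "boost e s f = mult_L2 (\<lambda>_. exp (- (\<i> * of_real (e\<^sup>2 * s)))) (mult_L2 (\<lambda>x. exp (\<i> * of_real (e * x))) (trans_L2 (2 * e * s) f))"
    unfolding boost_def 1
    by (subst mult_L2_mult[OF bounded_mult_const unimod_bounded[OF unimod_lin(2)]]) (rule refl)
  then have "fourier_L2 (boost e s f) = mult_L2 (\<lambda>_. exp (- (\<i> * of_real (e\<^sup>2 * s))))
      (trans_L2 e (mult_L2 (\<lambda>\<xi>. exp (- (\<i> * of_real (2 * e * s * \<xi>)))) (fourier_L2 f)))"
    by (simp only: fourier_mult_const fourier_mult_exp fourier_trans_L2)
  also have "\<dots> = mult_L2 (\<lambda>_. exp (- (\<i> * of_real (e\<^sup>2 * s))))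
      (mult_L2 (\<lambda>\<xi>. exp (- (\<i> * of_real (2 * e * s * (\<xi> - e))))) (trans_L2 e (fourier_L2 f)))"
    by (subst trans_mult_L2[OF unimod_bounded[OF unimod_lin(1)]]) (rule refl)
  also have "\<dots> = mult_L2 (\<lambda>\<xi>. exp (- (\<i> * of_real (2 * e * s * \<xi> - e\<^sup>2 * s)))) (trans_L2 e (fourier_L2 f))"
  proof -
    have u: "unimod (\<lambda>\<xi>. exp (- (\<i> * of_real (2 * e * s * (\<xi> - e)))))" by (intro unimod_exp) measurable
    show ?thesis
      by (subst mult_L2_mult[OF bounded_mult_const unimod_bounded[OF u]], subst exp_mult_eq[OF refl])
         (simp add: algebra_simps power2_eq_square)
  qed
  finally show ?thesis .
qed

text \<open>On the Fourier side a boost is the translation by e followed by a phase linear in xi.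
  Conjugating a translation by the multiplier exp(-i s xi^2) produces just such a phase, because s
  xi^2 - s (xi - e)^2 = 2 e s xi - e^2 s.\<close>

lemma schroedinger_boost: "schroedinger_group s (boost e r f) = boost e (r + s) (schroedinger_group s f)"
proof (rule fourier_L2_inject)
  have u: "unimod (\<lambda>\<xi>. exp (- (\<i> * of_real (2 * e * r * \<xi> - e\<^sup>2 * r))))" for r by (intro unimod_exp) measurable
  have u2: "unimod (\<lambda>\<xi>. exp (- (\<i> * of_real (s * (\<xi> - e)\<^sup>2))))" by (intro unimod_exp) measurable
  note ub = unimod_bounded
  have "fourier_L2 (schroedinger_group s (boost e r f))
      = mult_L2 (\<lambda>\<xi>. exp (- (\<i> * of_real (s * \<xi>\<^sup>2)))) (mult_L2 (\<lambda>\<xi>. exp (- (\<i> * of_real (2 * e * r * \<xi> - e\<^sup>2 * r)))) (trans_L2 e (fourier_L2 f)))"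
    unfolding fourier_schroedinger fourier_boost ..
  also have "\<dots> = mult_L2 (\<lambda>\<xi>. exp (- (\<i> * of_real (2 * e * (r + s) * \<xi> - e\<^sup>2 * (r + s)))))
      (mult_L2 (\<lambda>\<xi>. exp (- (\<i> * of_real (s * (\<xi> - e)\<^sup>2)))) (trans_L2 e (fourier_L2 f)))"
    by (subst mult_L2_mult[OF ub[OF unimod_schroedinger] ub[OF u]], subst mult_L2_mult[OF ub[OF u] ub[OF u2]],
        subst exp_mult_eq[OF refl], subst exp_mult_eq[OF refl])
       (simp add: algebra_simps power2_eq_square)
  also have "\<dots> = fourier_L2 (boost e (r + s) (schroedinger_group s f))"
    unfolding fourier_schroedinger fourier_boost
    by (subst trans_mult_L2[OF ub[OF unimod_schroedinger]]) (rule refl)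
  finally show "fourier_L2 (schroedinger_group s (boost e r f)) = fourier_L2 (boost e (r + s) (schroedinger_group s f))" .
qed

section \<open>The nonlinearity\<close>

text \<open>Norm bounds survive almost everywhere limits. This is how bounds on difference
  quotients, uniform in the step, become bounds on moments without any a priori integrability of the
  limit.\<close>

lemma L2_Fatou:
  assumes f: "\<And>n. square_int (f n)" and C: "\<And>n. norm (L2_of (f n)) \<le> C"
    and lim: "AE x in lborel. (\<lambda>n. f n x) \<longlonglongrightarrow> g x" and [measurable]: "g \<in> borel_measurable borel"
  shows "square_int g" "norm (L2_of g) \<le> C"
proof -
  have [measurable]: "f n \<in> borel_measurable borel" for n using f[of n] by measurable
  have C0: "C \<ge> 0" using C[of 0] norm_ge_zero order_trans by blast
  have nn: "(\<integral>\<^sup>+x. ennreal ((cmod (f n x))\<^sup>2) \<partial>lborel) \<le> ennreal (C\<^sup>2)" for n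
  proof -
    have "(\<integral>\<^sup>+x. ennreal ((cmod (f n x))\<^sup>2) \<partial>lborel) = ennreal ((norm (L2_of (f n)))\<^sup>2)"
      unfolding norm_L2_of[OF f] by (intro nn_integral_eq_integral square_intD f) auto
    also have "\<dots> \<le> ennreal (C\<^sup>2)" using C[of n] by (intro ennreal_leI power_mono) auto
    finally show ?thesis .
  qed
  have "(\<integral>\<^sup>+x. ennreal ((cmod (g x))\<^sup>2) \<partial>lborel) = (\<integral>\<^sup>+x. liminf (\<lambda>n. ennreal ((cmod (f n x))\<^sup>2)) \<partial>lborel)"
  proof (intro nn_integral_cong_AE, use lim in eventually_elim)
    case (elim x)
    then have "(\<lambda>n. ennreal ((cmod (f n x))\<^sup>2)) \<longlonglongrightarrow> ennreal ((cmod (g x))\<^sup>2)"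
      by (intro tendsto_intros)
    then show ?case by (rule lim_imp_Liminf[OF trivial_limit_sequentially, symmetric])
  qed
  also have "\<dots> \<le> liminf (\<lambda>n. \<integral>\<^sup>+x. ennreal ((cmod (f n x))\<^sup>2) \<partial>lborel)"
    by (intro nn_integral_liminf) measurable
  also have "\<dots> \<le> liminf (\<lambda>n::nat. ennreal (C\<^sup>2))"
    by (intro Liminf_mono always_eventually allI nn)
  also have "\<dots> = ennreal (C\<^sup>2)" by (simp add: Liminf_const)
  finally have le: "(\<integral>\<^sup>+x. ennreal ((cmod (g x))\<^sup>2) \<partial>lborel) \<le> ennreal (C\<^sup>2)" .
  show g: "square_int g"
    unfolding square_int_def
  proof (intro conjI integrableI_bounded)
    show "(\<integral>\<^sup>+x. ennreal (norm ((cmod (g x))\<^sup>2)) \<partial>lborel) < \<infinity>"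
      using le by (simp add: le_less_trans)
  qed measurable
  have "ennreal ((norm (L2_of g))\<^sup>2) \<le> ennreal (C\<^sup>2)"
    unfolding norm_L2_of[OF g] using le by (subst nn_integral_eq_integral[symmetric]) (auto intro: square_intD g)
  then have "(norm (L2_of g))\<^sup>2 \<le> C\<^sup>2" by (subst (asm) ennreal_le_iff) auto
  then show "norm (L2_of g) \<le> C" by (rule power2_le_imp_le[OF _ C0])
qed

section \<open>Measurability of the essential supremum and of the cubic term\<close>

definition ess_bounded :: "L2 \<Rightarrow> real \<Rightarrow> bool" where
  "ess_bounded f c \<longleftrightarrow> (AE x in lborel. cmod (fun_of f x) \<le> c)"

lemma ess_bounded_L2_of: "square_int F \<Longrightarrow> ess_bounded (L2_of F) c \<longleftrightarrow> (AE x in lborel. cmod (F x) \<le> c)"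
  unfolding ess_bounded_def using fun_of_L2_of[of F] by (auto elim: AE_mp)

lemma Linf_norm_le_iff: "c \<ge> 0 \<Longrightarrow> Linf_norm f \<le> ennreal c \<longleftrightarrow> ess_bounded f c"
proof
  assume c: "c \<ge> 0" "Linf_norm f \<le> ennreal c"
  have "AE x in lborel. ennreal (cmod (fun_of f x)) \<le> Linf_norm f"
    unfolding Linf_norm_def by (rule esssup_AE)
  then show "ess_bounded f c" unfolding ess_bounded_def
  proof eventually_elim
    fix x assume "ennreal (cmod (fun_of f x)) \<le> Linf_norm f"
    with c have "ennreal (cmod (fun_of f x)) \<le> ennreal c" by (rule_tac order_trans)
    with c(1) show "cmod (fun_of f x) \<le> c" by (simp add: ennreal_le_iff)
  qed
next
  assume "ess_bounded f c"
  then show "Linf_norm f \<le> ennreal c"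
    unfolding Linf_norm_def ess_bounded_def by (intro esssup_I) (auto elim!: eventually_mono intro: ennreal_leI)
qed

text \<open>The overshoot max 0 (|l(x)| - c) is at most |l(x) - s_n(x)| almost everywhere for every
  member of the sequence, so its L2 norm is at most the distance to the sequence and vanishes.
  Closed sublevel sets make \<open>Linf_norm\<close> a Borel function on L2.\<close>

lemma closed_ess_bounded: "closed {f. ess_bounded f c}"
  unfolding closed_sequential_limits
proof safe
  fix s l assume s: "\<forall>n. s n \<in> {f. ess_bounded f c}" "s \<longlonglongrightarrow> l"
  define F where "F = fun_of l"
  have F: "square_int F" "l = L2_of F" by (simp_all add: F_def square_int_fun_of L2_of_fun_of)
  have [measurable]: "F \<in> borel_measurable borel" using F(1) by measurable
  define G where "G x = complex_of_real (max 0 (cmod (F x) - c))" for x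
  have G_le: "cmod (G x) \<le> cmod (F x - a)" if "cmod a \<le> c" for x a
    using norm_triangle_ineq2[of "F x" a] that by (auto simp: G_def)
  have [measurable]: "G \<in> borel_measurable borel" unfolding G_def by measurable
  have AEG: "AE x in lborel. cmod (G x) \<le> 1 * cmod (F x - fun_of (s n) x)" for n
    using s(1) unfolding mem_Collect_eq ess_bounded_def by (auto elim!: allE[of _ n] eventually_mono intro: G_le)
  have G: "square_int G"
    by (rule square_int_AE_bound[OF _ square_intD[OF square_int_diff[OF F(1) square_int_fun_of[of "s 0"]]]])
       (use AEG[of 0] in \<open>auto elim!: eventually_mono intro!: power_mono\<close>)
  have "norm (L2_of G) \<le> 1 * norm (l - s n)" for n
    using norm_L2_of_mono[OF G square_int_diff[OF F(1) square_int_fun_of] AEG, of n]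
    by (simp add: F L2_of_fun_of flip: L2_of_diff[OF F(1) square_int_fun_of])
  moreover have "(\<lambda>n. 1 * norm (l - s n)) \<longlonglongrightarrow> 1 * norm (l - l)" by (intro tendsto_intros s(2))
  ultimately have "norm (L2_of G) \<le> 0" by (intro LIMSEQ_le_const) auto
  then have "L2_of G = L2_of (\<lambda>_. 0)" by (simp add: L2_of_zero)
  then have "AE x in lborel. G x = 0" using L2_of_eq_iff[OF G square_int_zero] by simp
  then have "AE x in lborel. cmod (F x) \<le> c" by eventually_elim (simp add: G_def max_def split: if_splits)
  then show "ess_bounded l c" by (simp add: F ess_bounded_L2_of)
qed

lemma Linf_norm_measurable [measurable]: "Linf_norm \<in> borel_measurable borel"
proof (rule borel_measurableI_le)
  fix y :: ennreal
  show "{x \<in> space borel. Linf_norm x \<le> y} \<in> sets borel"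
  proof (cases y)
    case (real c)
    then have "{x \<in> space borel. Linf_norm x \<le> y} = {f. ess_bounded f c}" by (simp add: Linf_norm_le_iff)
    then show ?thesis using borel_closed[OF closed_ess_bounded, of c] by simp
  qed simp
qed

lemma cubic_diff_le:
  fixes a b :: complex
  assumes "cmod a \<le> m" "cmod b \<le> m"
  shows "cmod (of_real ((cmod a)\<^sup>2) * a - of_real ((cmod b)\<^sup>2) * b) \<le> 3 * m\<^sup>2 * cmod (a - b)"
proof -
  have m: "m \<ge> 0" using assms(1) norm_ge_zero order_trans by blast
  have "of_real ((cmod a)\<^sup>2) * a - of_real ((cmod b)\<^sup>2) * b
      = of_real ((cmod a)\<^sup>2) * (a - b) + of_real ((cmod a)\<^sup>2 - (cmod b)\<^sup>2) * b"
    by (simp add: algebra_simps)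
  also have "cmod \<dots> \<le> (cmod a)\<^sup>2 * cmod (a - b) + \<bar>(cmod a)\<^sup>2 - (cmod b)\<^sup>2\<bar> * cmod b"
    by (rule order_trans[OF norm_triangle_ineq]) (simp add: norm_mult del: of_real_diff of_real_power)
  also have "\<bar>(cmod a)\<^sup>2 - (cmod b)\<^sup>2\<bar> * cmod b \<le> (cmod (a - b) * (m + m)) * m"
  proof (intro mult_mono)
    have "\<bar>(cmod a)\<^sup>2 - (cmod b)\<^sup>2\<bar> = \<bar>cmod a - cmod b\<bar> * (cmod a + cmod b)"
      unfolding square_diff_square_factored power2_eq_square abs_mult by simp
    also have "\<dots> \<le> cmod (a - b) * (m + m)"
      using assms norm_triangle_ineq3[of a b] by (intro mult_mono) auto
    finally show "\<bar>(cmod a)\<^sup>2 - (cmod b)\<^sup>2\<bar> \<le> cmod (a - b) * (m + m)" .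
  qed (use assms m in auto)
  also have "(cmod a)\<^sup>2 * cmod (a - b) \<le> m\<^sup>2 * cmod (a - b)"
    using assms by (intro mult_right_mono power_mono) auto
  finally show ?thesis by (simp add: power2_eq_square algebra_simps)
qed

lemma cubic_trunc_diff_le:
  fixes a b :: complex and n :: real
  assumes n: "n \<ge> 0"
  shows "cmod (of_real (min ((cmod a)\<^sup>2) n) * a - of_real (min ((cmod b)\<^sup>2) n) * b) \<le> 3 * n * cmod (a - b)"
proof -
  have *: "cmod (of_real (min ((cmod a)\<^sup>2) n) * a - of_real (min ((cmod b)\<^sup>2) n) * b) \<le> 3 * n * cmod (a - b)"
    if ba: "cmod b \<le> cmod a" for a b :: complex
  proof -
    \<comment> \<open>The modulus of a capped at sqrt n, so that its truncated weight is s^2. If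
      |b|^2 <= n, then |b| <= s and s - |b| <= |a - b|, and the estimate is that of the untruncated
      cubic with s in place of |a|.\<close>
    define s where "s = min (cmod a) (sqrt n)"
    have sa: "min ((cmod a)\<^sup>2) n = s\<^sup>2"
    proof (cases "cmod a \<le> sqrt n")
      case True
      then have "(cmod a)\<^sup>2 \<le> n" using n power_mono[OF True, of 2] by simp
      then show ?thesis using True by (simp add: s_def)
    next
      case False
      then have "n \<le> (cmod a)\<^sup>2" using n power_mono[of "sqrt n" "cmod a" 2] by simp
      then show ?thesis using False n by (simp add: s_def)
    qed
    have s2: "s\<^sup>2 \<le> n" using sa by linarith
    have s0: "s \<ge> 0" using n by (simp add: s_def)
    show ?thesis
    proof (cases "(cmod b)\<^sup>2 \<le> n")
      case False
      moreover have "(cmod b)\<^sup>2 \<le> (cmod a)\<^sup>2" using ba by (intro power_mono) auto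
      ultimately have "min ((cmod a)\<^sup>2) n = n" "min ((cmod b)\<^sup>2) n = n" by linarith+
      then show ?thesis using n by (simp add: norm_mult mult_right_mono flip: right_diff_distrib)
    next
      case True
      then have "cmod b \<le> sqrt n" by (simp add: real_le_rsqrt)
      then have bs: "cmod b \<le> s" using ba by (simp add: s_def)
      have "of_real (s\<^sup>2) * a - of_real ((cmod b)\<^sup>2) * b = of_real (s\<^sup>2) * (a - b) + of_real (s\<^sup>2 - (cmod b)\<^sup>2) * b"
        by (simp add: algebra_simps)
      also have "cmod \<dots> \<le> s\<^sup>2 * cmod (a - b) + \<bar>s\<^sup>2 - (cmod b)\<^sup>2\<bar> * cmod b"
        by (rule order_trans[OF norm_triangle_ineq]) (simp add: norm_mult del: of_real_diff of_real_power)
      also have "\<bar>s\<^sup>2 - (cmod b)\<^sup>2\<bar> * cmod b \<le> (cmod (a - b) * (s + s)) * s"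
      proof (intro mult_mono)
        have "\<bar>s\<^sup>2 - (cmod b)\<^sup>2\<bar> = (s - cmod b) * (s + cmod b)"
          unfolding square_diff_square_factored power2_eq_square abs_mult using bs s0 by simp
        also have "\<dots> \<le> cmod (a - b) * (s + s)"
        proof (intro mult_mono)
          show "s - cmod b \<le> cmod (a - b)" using norm_triangle_ineq2[of a b] by (simp add: s_def)
        qed (use bs s0 in auto)
        finally show "\<bar>s\<^sup>2 - (cmod b)\<^sup>2\<bar> \<le> cmod (a - b) * (s + s)" .
      qed (use bs s0 in auto)
      also have "s\<^sup>2 * cmod (a - b) + (cmod (a - b) * (s + s)) * s = 3 * s\<^sup>2 * cmod (a - b)"
        by (simp add: power2_eq_square algebra_simps)
      also have "\<dots> \<le> 3 * n * cmod (a - b)" using s2 by (intro mult_right_mono) auto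
      finally show ?thesis using True sa by simp
    qed
  qed
  show ?thesis
  proof (cases "cmod b \<le> cmod a")
    case True then show ?thesis by (rule *)
  next
    case False then show ?thesis using *[of a b] by (simp add: norm_minus_commute)
  qed
qed

text \<open>The map \<open>cubic\<close> is not continuous on L2 and has a default value, so its
  measurability is not obvious. These truncations are globally Lipschitz on L2, and
  \<open>cubic_eq_lim\<close> recovers \<open>cubic\<close> from them.\<close>

definition cubic_trunc :: "nat \<Rightarrow> L2 \<Rightarrow> L2" where
  "cubic_trunc n f = L2_of (\<lambda>x. of_real (min ((cmod (fun_of f x))\<^sup>2) (real n)) * fun_of f x)"

lemma square_int_cubic_trunc:
  assumes "square_int F"
  shows "square_int (\<lambda>x. of_real (min ((cmod (F x))\<^sup>2) (real n)) * F x)"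
proof (rule square_int_bound[where h = "\<lambda>x. (real n)\<^sup>2 * (cmod (F x))\<^sup>2"])
  have [measurable]: "F \<in> borel_measurable borel" using assms by measurable
  show "(\<lambda>x. of_real (min ((cmod (F x))\<^sup>2) (real n)) * F x) \<in> borel_measurable lborel" by measurable
  show "(cmod (of_real (min ((cmod (F x))\<^sup>2) (real n)) * F x))\<^sup>2 \<le> (real n)\<^sup>2 * (cmod (F x))\<^sup>2" for x
    by (auto simp: norm_mult power_mult_distrib simp del: of_real_power intro!: mult_right_mono power_mono)
qed (use square_intD[OF assms] in auto)

lemma cubic_trunc_measurable [measurable]: "cubic_trunc n \<in> borel_measurable borel"
proof -
  have le: "dist (cubic_trunc n f) (cubic_trunc n g) \<le> 3 * real n * dist f g" for f g
  proof -
    note s = square_int_cubic_trunc[OF square_int_fun_of]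
    have "norm (cubic_trunc n f - cubic_trunc n g) \<le> 3 * real n * norm (L2_of (\<lambda>x. fun_of f x - fun_of g x))"
      unfolding cubic_trunc_def L2_of_diff[OF s s]
      by (rule norm_L2_of_mono) (auto intro!: AE_I2 square_int_diff s square_int_fun_of cubic_trunc_diff_le)
    then show ?thesis
      by (simp add: dist_norm L2_of_fun_of flip: L2_of_diff[OF square_int_fun_of square_int_fun_of])
  qed
  have "continuous_on UNIV (cubic_trunc n)"
    by (rule lipschitz_on_continuous_on[OF lipschitz_onI[OF le]]) auto
  then show ?thesis by (rule borel_measurable_continuous_onI)
qed

abbreviation cubic_fun :: "(real \<Rightarrow> complex) \<Rightarrow> real \<Rightarrow> complex" where
  "cubic_fun F x \<equiv> of_real ((cmod (F x))\<^sup>2) * F x"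

text \<open>If |f|^2 f is square integrable, it dominates the truncations and they converge.
  Otherwise they cannot be Cauchy: a bound on their norms would make |f|^2 f square integrable by
  Fatou. So the default value 0 occurs exactly where the limit fails to exist, and measurability
  follows.\<close>

lemma cubic_eq_lim:
  "cubic f = (if Cauchy (\<lambda>n. cubic_trunc n f) then lim (\<lambda>n. cubic_trunc n f) else 0)"
proof -
  define F where "F = fun_of f"
  have F: "square_int F" by (simp add: F_def square_int_fun_of)
  have [measurable]: "F \<in> borel_measurable borel" using F by measurable
  define c where "c = (\<lambda>n x. of_real (min ((cmod (F x))\<^sup>2) (real n)) * F x)"
  have c: "cubic_trunc n f = L2_of (c n)" "square_int (c n)" for n
    using square_int_cubic_trunc[OF F] by (simp_all add: c_def F_def cubic_trunc_def)
  have lim: "(\<lambda>n. c n x) \<longlonglongrightarrow> cubic_fun F x" for x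
  proof (rule tendsto_eventually)
    obtain m where "(cmod (F x))\<^sup>2 \<le> real m" using real_arch_simple by blast
    then show "\<forall>\<^sub>F n in sequentially. c n x = cubic_fun F x"
      by (intro eventually_sequentiallyI[of m]) (auto simp: c_def min_def)
  qed
  show ?thesis
  proof (cases "square_int (cubic_fun F)")
    case True
    have "(\<lambda>n. L2_of (c n)) \<longlonglongrightarrow> L2_of (cubic_fun F)"
    proof (rule L2_dominated_convergence(3)[where h = "\<lambda>x. cmod (cubic_fun F x)"])
      show "cmod (c n x) \<le> cmod (cubic_fun F x)" for n x
        by (auto simp: c_def norm_mult simp del: of_real_power intro!: mult_right_mono)
      show "c n \<in> borel_measurable lborel" for n using c(2)[of n] by measurable
    qed (use square_intD[OF True] lim in auto)
    then have l: "(\<lambda>n. cubic_trunc n f) \<longlonglongrightarrow> cubic f" by (simp add: c cubic_def F_def)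
    then show ?thesis using limI[OF l] LIMSEQ_imp_Cauchy[OF l] by simp
  next
    case False
    have "\<not> Cauchy (\<lambda>n. cubic_trunc n f)"
    proof
      assume "Cauchy (\<lambda>n. cubic_trunc n f)"
      then have "Bseq (\<lambda>n. cubic_trunc n f)" by (rule Cauchy_Bseq)
      then obtain K where "\<And>n. norm (cubic_trunc n f) \<le> K" unfolding Bseq_def by auto
      then have "norm (L2_of (c n)) \<le> K" for n by (simp only: c(1)[symmetric])
      moreover have "cubic_fun F \<in> borel_measurable borel" by measurable
      ultimately have "square_int (cubic_fun F)" by (rule L2_Fatou(1)[OF c(2) _ AE_I2[OF lim]])
      with False show False by simp
    qed
    then show ?thesis using False by (simp add: cubic_def L2_of_def F_def)
  qed
qed

lemma cubic_measurable [measurable]: "cubic \<in> borel_measurable borel"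
  unfolding cubic_eq_lim[abs_def] by measurable

lemma square_int_cubic_fun:
  assumes F: "square_int F" and b: "AE x in lborel. cmod (F x) \<le> m"
  shows "square_int (cubic_fun F)"
proof (rule square_int_AE_bound[where h = "\<lambda>x. (m\<^sup>2)\<^sup>2 * (cmod (F x))\<^sup>2"])
  have [measurable]: "F \<in> borel_measurable borel" using F by measurable
  show "cubic_fun F \<in> borel_measurable borel" by measurable
  show "AE x in lborel. (cmod (cubic_fun F x))\<^sup>2 \<le> (m\<^sup>2)\<^sup>2 * (cmod (F x))\<^sup>2"
    using b
  proof eventually_elim
    fix x assume m: "cmod (F x) \<le> m"
    have "(cmod (cubic_fun F x))\<^sup>2 = ((cmod (F x))\<^sup>2)\<^sup>2 * (cmod (F x))\<^sup>2"
      by (simp only: norm_mult power_mult_distrib norm_of_real abs_power2)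
    also have "\<dots> \<le> (m\<^sup>2)\<^sup>2 * (cmod (F x))\<^sup>2"
      using m by (intro mult_right_mono power_mono) auto
    finally show "(cmod (cubic_fun F x))\<^sup>2 \<le> (m\<^sup>2)\<^sup>2 * (cmod (F x))\<^sup>2" .
  qed
qed (use square_intD[OF F] in auto)

lemma cubic_L2_of:
  assumes F: "square_int F" and b: "AE x in lborel. cmod (F x) \<le> m"
  shows "cubic (L2_of F) = L2_of (cubic_fun F)"
  unfolding cubic_def
proof (rule L2_of_cong)
  show "square_int (cubic_fun (fun_of (L2_of F)))"
    by (rule square_int_cubic_fun[OF square_int_fun_of, where m = m])
       (use b fun_of_L2_of[OF F] in \<open>auto elim: AE_mp\<close>)
  show "AE x in lborel. cubic_fun (fun_of (L2_of F)) x = cubic_fun F x"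
    using fun_of_L2_of[OF F] by eventually_elim simp
qed (rule square_int_cubic_fun[OF F b])

lemma norm_cubic_diff_le:
  assumes f: "ess_bounded f m" and g: "ess_bounded g m"
  shows "norm (cubic f - cubic g) \<le> 3 * m\<^sup>2 * norm (f - g)"
proof -
  define F G where "F = fun_of f" and "G = fun_of g"
  have F: "square_int F" "f = L2_of F" and G: "square_int G" "g = L2_of G"
    by (simp_all add: F_def G_def square_int_fun_of L2_of_fun_of)
  have b: "AE x in lborel. cmod (F x) \<le> m" "AE x in lborel. cmod (G x) \<le> m"
    using f g by (simp_all add: F_def G_def ess_bounded_def)
  note c = square_int_cubic_fun[OF F(1) b(1)] square_int_cubic_fun[OF G(1) b(2)]
  have "norm (L2_of (\<lambda>x. cubic_fun F x - cubic_fun G x)) \<le> 3 * m\<^sup>2 * norm (L2_of (\<lambda>x. F x - G x))"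
  proof (rule norm_L2_of_mono)
    show "AE x in lborel. cmod (cubic_fun F x - cubic_fun G x) \<le> 3 * m\<^sup>2 * cmod (F x - G x)"
      using b by eventually_elim (rule cubic_diff_le)
  qed (use F G c in \<open>auto intro: square_int_diff\<close>)
  then show ?thesis
    by (simp only: F(2) G(2) cubic_L2_of[OF F(1) b(1)] cubic_L2_of[OF G(1) b(2)] L2_of_diff[OF c] L2_of_diff[OF F(1) G(1)])
qed

lemma cubic_0 [simp]: "cubic 0 = 0"
proof -
  have "cubic (L2_of (\<lambda>_. 0)) = L2_of (cubic_fun (\<lambda>_. 0))"
    by (rule cubic_L2_of[where m = 0]) (auto simp: square_int_zero)
  then show ?thesis by (simp add: L2_of_zero)
qed

lemma norm_cubic_le:
  assumes f: "ess_bounded f m"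
  shows "norm (cubic f) \<le> 3 * m\<^sup>2 * norm f"
proof -
  have "AE x::real in lborel. 0 \<le> m"
    using f unfolding ess_bounded_def by eventually_elim (rule order_trans[OF norm_ge_zero])
  then have "ess_bounded (L2_of (\<lambda>_. 0)) m" by (subst ess_bounded_L2_of) (auto simp: square_int_zero)
  then show ?thesis using norm_cubic_diff_le[OF f, of 0] by (simp add: L2_of_zero)
qed

lemma boost_L2_of:
  assumes F: "square_int F"
  shows "boost e s (L2_of F) = L2_of (\<lambda>x. exp (\<i> * of_real (e * x - e\<^sup>2 * s)) * F (x - 2 * e * s))"
  unfolding boost_def
  by (simp add: trans_L2_of[OF F] mult_L2_of[OF unimod_bounded[OF unimod_boost] square_int_translate[OF F]]
      del: of_real_mult of_real_diff of_real_power)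

lemma square_int_boost:
  assumes F: "square_int F"
  shows "square_int (\<lambda>x. exp (\<i> * of_real (e * x - e\<^sup>2 * s)) * F (x - 2 * e * s))"
  by (rule square_int_mult[OF unimod_bounded[OF unimod_boost] square_int_translate[OF F]])

lemma ess_bounded_boost:
  assumes "ess_bounded f m"
  shows "ess_bounded (boost e s f) m"
proof -
  define F where "F = fun_of f"
  have F: "square_int F" "f = L2_of F" by (simp_all add: F_def square_int_fun_of L2_of_fun_of)
  have b: "AE x in lborel. cmod (F x) \<le> m" using assms by (simp add: F_def ess_bounded_def)
  show ?thesis unfolding F(2) boost_L2_of[OF F(1)] ess_bounded_L2_of[OF square_int_boost[OF F(1)]]
    using AE_translate[OF b, of "2 * e * s"] by eventually_elim (simp add: norm_mult)
qed

lemma cubic_boost: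
  assumes "ess_bounded f m"
  shows "cubic (boost e s f) = boost e s (cubic f)"
proof -
  define F where "F = fun_of f"
  have F: "square_int F" "f = L2_of F" by (simp_all add: F_def square_int_fun_of L2_of_fun_of)
  have b: "AE x in lborel. cmod (F x) \<le> m" using assms by (simp add: F_def ess_bounded_def)
  have b': "AE x in lborel. cmod (exp (\<i> * of_real (e * x - e\<^sup>2 * s)) * F (x - 2 * e * s)) \<le> m"
    using AE_translate[OF b, of "2 * e * s"] by eventually_elim (simp add: norm_mult)
  show ?thesis
    unfolding F(2) boost_L2_of[OF F(1)] cubic_L2_of[OF F(1) b] cubic_L2_of[OF square_int_boost[OF F(1)] b']
      boost_L2_of[OF square_int_cubic_fun[OF F(1) b]]
    by (rule arg_cong[where f = L2_of]) (simp add: fun_eq_iff norm_mult)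
qed

lemma boost_mult_const: "boost e s (mult_L2 (\<lambda>_. c) f) = mult_L2 (\<lambda>_. c) (boost e s f)"
  unfolding boost_def trans_mult_L2[OF bounded_mult_const]
  by (rule mult_L2_commute[OF unimod_bounded[OF unimod_boost] bounded_mult_const])

section \<open>A Gronwall inequality\<close>

text \<open>The hypothesis uses a bound m on the interval rather than the integral of \<kappa> times
  \<phi>, so \<phi> need not be measurable. On a subinterval where \<kappa> has integral at most
  1/2, the supremum m satisfies m <= \<phi> p + m/2, so \<phi> at most doubles, in either direction
  of time. The constant depends on \<kappa> and T only, not on \<phi>.\<close>

lemma Gronwall_sup:
  fixes \<kappa> :: "real \<Rightarrow> real" and T :: real
  assumes \<kappa>: "integrable lborel \<kappa>" "\<And>x. \<kappa> x \<ge> 0" and T: "T \<ge> 0"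
  obtains C where "C > 0"
    "\<And>\<phi> s t. \<lbrakk>\<And>s t m. 0 \<le> s \<Longrightarrow> s \<le> t \<Longrightarrow> t \<le> T \<Longrightarrow> (\<And>\<tau>. s \<le> \<tau> \<Longrightarrow> \<tau> \<le> t \<Longrightarrow> \<phi> \<tau> \<le> m) \<Longrightarrow>
          \<bar>\<phi> t - \<phi> s\<bar> \<le> m * (LINT \<tau>:{s<..t}|lborel. \<kappa> \<tau>);
       \<And>t. 0 \<le> t \<Longrightarrow> t \<le> T \<Longrightarrow> 0 \<le> \<phi> t; \<exists>B. \<forall>t. 0 \<le> t \<longrightarrow> t \<le> T \<longrightarrow> \<phi> t \<le> B;
       0 \<le> s; s \<le> T; 0 \<le> t; t \<le> T\<rbrakk> \<Longrightarrow> \<phi> t \<le> C * \<phi> s"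
proof -
  have si: "set_integrable lborel A \<kappa>" if "A \<in> sets borel" for A
    unfolding set_integrable_def using integrable_mult_indicator[OF _ \<kappa>(1), of A] that by simp
  define K where "K t = integral {0..t} \<kappa>" for t
  have "\<kappa> integrable_on {0..T}" using set_borel_integral_eq_integral(1)[OF si, of "{0..T}"] by simp
  then have "continuous_on {0..T} K" unfolding K_def by (rule indefinite_integral_continuous_1)
  then have "uniformly_continuous_on {0..T} K" by (intro compact_uniformly_continuous) auto
  then obtain d where d: "d > 0" "\<And>s t. s \<in> {0..T} \<Longrightarrow> t \<in> {0..T} \<Longrightarrow> dist s t < d \<Longrightarrow> dist (K s) (K t) < 1/2"
    unfolding uniformly_continuous_on_def by (metis divide_pos_pos zero_less_numeral zero_less_one)
  have KL: "(LINT \<tau>:{s<..t}|lborel. \<kappa> \<tau>) = K t - K s" if "0 \<le> s" "s \<le> t" "t \<le> T" for s t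
  proof -
    have "K t = (LINT \<tau>:{0..t}|lborel. \<kappa> \<tau>)" "K s = (LINT \<tau>:{0..s}|lborel. \<kappa> \<tau>)"
      unfolding K_def by (intro set_borel_integral_eq_integral(2)[symmetric] si; simp)+
    moreover have "{0..t} = {0..s} \<union> {s<..t}" using that by auto
    then have "(LINT \<tau>:{0..t}|lborel. \<kappa> \<tau>) = (LINT \<tau>:{0..s}|lborel. \<kappa> \<tau>) + (LINT \<tau>:{s<..t}|lborel. \<kappa> \<tau>)"
      by (simp only:) (rule set_integral_Un; auto intro!: si)
    ultimately show ?thesis by simp
  qed
  obtain n0 where n0: "T \<le> real n0 * (d / 2)"
    using real_arch_simple[of "T / (d / 2)"] d(1) by (auto simp: field_simps)
  show ?thesis
  proof (rule that[of "2 ^ n0"])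
    fix \<phi> :: "real \<Rightarrow> real" and s t :: real
    assume step: "\<And>s t m. 0 \<le> s \<Longrightarrow> s \<le> t \<Longrightarrow> t \<le> T \<Longrightarrow> (\<And>\<tau>. s \<le> \<tau> \<Longrightarrow> \<tau> \<le> t \<Longrightarrow> \<phi> \<tau> \<le> m) \<Longrightarrow>
          \<bar>\<phi> t - \<phi> s\<bar> \<le> m * (LINT \<tau>:{s<..t}|lborel. \<kappa> \<tau>)"
      and nn: "\<And>t. 0 \<le> t \<Longrightarrow> t \<le> T \<Longrightarrow> 0 \<le> \<phi> t" and bd: "\<exists>B. \<forall>t. 0 \<le> t \<longrightarrow> t \<le> T \<longrightarrow> \<phi> t \<le> B"
      and st: "0 \<le> s" "s \<le> T" "0 \<le> t" "t \<le> T"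
    obtain B where B: "\<And>t. 0 \<le> t \<Longrightarrow> t \<le> T \<Longrightarrow> \<phi> t \<le> B" using bd by blast
    have close: "\<phi> q \<le> 2 * \<phi> p" if pq: "0 \<le> p" "p \<le> T" "0 \<le> q" "q \<le> T" "\<bar>p - q\<bar> < d" for p q
    proof -
      define I where "I = {min p q..max p q}"
      have I: "0 \<le> r \<and> r \<le> T" if "r \<in> I" for r using that pq by (auto simp: I_def min_def max_def split: if_splits)
      define m where "m = Sup (\<phi> ` I)"
      have bdd: "bdd_above (\<phi> ` I)" using B I by (auto intro!: bdd_aboveI[of _ B])
      have pI: "p \<in> I" "q \<in> I" by (auto simp: I_def)
      have le_m: "\<phi> r \<le> m" if "r \<in> I" for r unfolding m_def using bdd that by (intro cSup_upper) auto
      have m0: "m \<ge> 0" using le_m[OF pI(1)] nn[of p] pq by linarith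
      have diff: "\<bar>\<phi> r' - \<phi> r\<bar> \<le> m / 2" if "r \<in> I" "r' \<in> I" "r \<le> r'" for r r'
      proof -
        have rI: "\<tau> \<in> I" if "r \<le> \<tau>" "\<tau> \<le> r'" for \<tau> using that \<open>r \<in> I\<close> \<open>r' \<in> I\<close> by (auto simp: I_def)
        have rr: "0 \<le> r" "r \<le> r'" "r' \<le> T" using I that by auto
        have "dist r r' < d" using that pq by (auto simp: I_def dist_real_def min_def max_def split: if_splits)
        then have "dist (K r) (K r') < 1/2" using rr by (intro d(2)) auto
        then have "K r' - K r \<le> 1/2" unfolding dist_real_def by linarith
        have "\<bar>\<phi> r' - \<phi> r\<bar> \<le> m * (K r' - K r)"
          using step[OF rr, of m] le_m rI KL[OF rr] by simp
        also have "\<dots> \<le> m * (1/2)" using m0 \<open>K r' - K r \<le> 1/2\<close> by (intro mult_left_mono)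
        finally show ?thesis by simp
      qed
      have "\<phi> r \<le> \<phi> p + m / 2" if "r \<in> I" for r
      proof (cases "p \<le> r")
        case True then show ?thesis using diff[OF pI(1) that] by linarith
      next
        case False then show ?thesis using diff[OF that pI(1)] by linarith
      qed
      then have "m \<le> \<phi> p + m / 2" unfolding m_def using pI by (intro cSup_least) (auto simp: m_def)
      then have "m \<le> 2 * \<phi> p" by simp
      then show ?thesis using le_m[OF pI(2)] by simp
    qed
    have iter: "\<phi> q \<le> 2 ^ n * \<phi> p" if "0 \<le> p" "p \<le> T" "0 \<le> q" "q \<le> T" "\<bar>p - q\<bar> \<le> real n * (d / 2)" for n p q
      using that
    proof (induction n arbitrary: q)
      case 0
      then show ?case by simp
    next
      case (Suc n)
      \<comment> \<open>Cuts off the last of n + 1 equal pieces of the way from p to q: it has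
        length at most d/2, and \<open>close\<close> asks for less than d.\<close>
      define r where "r = p + (real n / real (Suc n)) * (q - p)"
      have lin: "p + x * (q - p) = (1 - x) * p + x * q" for x :: real by (simp add: algebra_simps)
      have th: "0 \<le> real n / real (Suc n)" "real n / real (Suc n) \<le> 1" by auto
      have r: "r = (1 - real n / real (Suc n)) * p + (real n / real (Suc n)) * q"
        using lin[of "real n / real (Suc n)"] by (simp only: r_def)
      have "r \<in> {0..T}"
        unfolding r using Suc.prems th convexD_alt[of "{0..T}" p q "real n / real (Suc n)"] by auto
      then have r0: "0 \<le> r" "r \<le> T" by auto
      have "\<bar>p - r\<bar> = (real n / real (Suc n)) * \<bar>p - q\<bar>" unfolding r_def by (simp add: abs_mult abs_minus_commute)
      also have "\<dots> \<le> (real n / real (Suc n)) * (real (Suc n) * (d / 2))" using Suc.prems th by (intro mult_left_mono) auto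
      finally have 1: "\<phi> r \<le> 2 ^ n * \<phi> p" using Suc.prems r0 by (intro Suc.IH) auto
      have "r - q = (1 / real (Suc n)) * (p - q)" by (simp add: r_def field_simps)
      then have "\<bar>r - q\<bar> = (1 / real (Suc n)) * \<bar>p - q\<bar>" by (simp add: abs_mult)
      also have "\<dots> \<le> (1 / real (Suc n)) * (real (Suc n) * (d / 2))" using Suc.prems by (intro mult_left_mono) auto
      also have "\<dots> = d / 2" by simp
      also have "\<dots> < d" using d(1) by simp
      finally have "\<phi> q \<le> 2 * \<phi> r" using Suc.prems r0 by (intro close) auto
      with 1 show ?case by simp
    qed
    have "\<bar>s - t\<bar> \<le> real n0 * (d / 2)" using st n0 by linarith
    with st show "\<phi> t \<le> 2 ^ n0 * \<phi> s" by (intro iter)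
  qed simp
qed

section \<open>A priori bounds for solutions\<close>

locale nls_solution =
  fixes lam :: complex and T :: real and u0 :: L2 and u :: "real \<Rightarrow> L2"
  assumes T: "T > 0" and solution: "nls_strong_solution lam T u0 u"
begin

text \<open>Extension by 0 makes u Borel measurable on the whole line; u itself is only known to be
  continuous on [0, T] and is arbitrary elsewhere.\<close>

definition uc :: "real \<Rightarrow> L2" where
  "uc \<tau> = indicator {0..T} \<tau> *\<^sub>R u \<tau>"

text \<open>Where the essential supremum is infinite, \<open>enn2real\<close> gives 0. Inside [0, T]
  this happens only on a null set of times, so \<open>AE_ess_bounded\<close> still holds.\<close>

definition Lnorm :: "real \<Rightarrow> real" where
  "Lnorm \<tau> = enn2real (Linf_norm (uc \<tau>))"

text \<open>The Lipschitz constant of \<open>cubic\<close> between two functions bounded by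
  \<open>Lnorm \<tau>\<close>, see \<open>norm_cubic_diff_le\<close>. A boosted solution has the
  same bound as the solution.\<close>

definition kap :: "real \<Rightarrow> real" where
  "kap \<tau> = indicator {0..T} \<tau> * (3 * (Lnorm \<tau>)\<^sup>2)"

definition forcing :: "real \<Rightarrow> L2" where
  "forcing \<tau> = indicator {0..T} \<tau> *\<^sub>R schroedinger_group (- \<tau>) (cubic (uc \<tau>))"

text \<open>The profile \<open>exp (- i t \<partial>\<^sub>x\<^sup>2) u(t)\<close>, on which boosts act as multiplication by \<open>exp (i e x)\<close>.\<close>

definition prof :: "real \<Rightarrow> L2" where
  "prof t = schroedinger_group (- t) (u t)"

lemma u_continuous: "continuous_on {0..T} u"
  using solution by (simp add: nls_strong_solution_def)

lemma uc_measurable [measurable]: "uc \<in> borel_measurable borel"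
  unfolding uc_def by (rule borel_measurable_continuous_on_indicator[OF _ u_continuous]) simp

lemma Linf_integral: "(\<integral>\<^sup>+t. (Linf_norm (uc t)) ^ 4 * indicator {0..T} t \<partial>lborel) < \<infinity>"
proof -
  have "(\<integral>\<^sup>+t. (Linf_norm (uc t)) ^ 4 * indicator {0..T} t \<partial>lborel)
     = (\<integral>\<^sup>+t\<in>{0..T}. (Linf_norm (u t)) ^ 4 \<partial>lborel)"
    by (intro nn_integral_cong) (auto simp: uc_def indicator_def)
  then show ?thesis using solution by (simp add: nls_strong_solution_def)
qed

lemma Lnorm_measurable [measurable]: "Lnorm \<in> borel_measurable borel"
  unfolding Lnorm_def by measurable

lemma AE_ess_bounded: "AE \<tau> in lborel. \<tau> \<in> {0..T} \<longrightarrow> ess_bounded (u \<tau>) (Lnorm \<tau>)"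
proof -
  have "AE \<tau> in lborel. (Linf_norm (uc \<tau>)) ^ 4 * indicator {0..T} \<tau> \<noteq> \<infinity>"
    using Linf_integral by (intro nn_integral_PInf_AE) auto
  then show ?thesis
  proof eventually_elim
    fix \<tau> assume *: "(Linf_norm (uc \<tau>)) ^ 4 * indicator {0..T} \<tau> \<noteq> \<infinity>"
    show "\<tau> \<in> {0..T} \<longrightarrow> ess_bounded (u \<tau>) (Lnorm \<tau>)"
    proof
      assume t: "\<tau> \<in> {0..T}"
      then have "Linf_norm (uc \<tau>) < top" using * by (cases "Linf_norm (uc \<tau>)") auto
      then have "Linf_norm (uc \<tau>) \<le> ennreal (Lnorm \<tau>)" by (simp add: Lnorm_def)
      then show "ess_bounded (u \<tau>) (Lnorm \<tau>)"
        using t by (subst (asm) Linf_norm_le_iff) (auto simp: Lnorm_def uc_def)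
    qed
  qed
qed

lemma kap_nonneg: "kap \<tau> \<ge> 0"
  by (simp add: kap_def)

text \<open>Fourth powers of \<open>Lnorm\<close> are integrable by the definition of a solution,
  and x^2 <= 1 + x^4 on the bounded interval.\<close>

lemma kap_integrable: "integrable lborel kap"
proof -
  have i4: "integrable lborel (\<lambda>\<tau>. indicator {0..T} \<tau> * (Lnorm \<tau>) ^ 4)"
  proof (rule integrableI_bounded)
    have "ennreal (norm (indicator {0..T} \<tau> * (Lnorm \<tau>) ^ 4)) \<le> (Linf_norm (uc \<tau>)) ^ 4 * indicator {0..T} \<tau>" for \<tau>
      by (cases "Linf_norm (uc \<tau>)") (auto simp: Lnorm_def indicator_def ennreal_power)
    then have "(\<integral>\<^sup>+\<tau>. ennreal (norm (indicator {0..T} \<tau> * (Lnorm \<tau>) ^ 4)) \<partial>lborel) \<le> (\<integral>\<^sup>+t. (Linf_norm (uc t)) ^ 4 * indicator {0..T} t \<partial>lborel)"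
      by (intro nn_integral_mono)
    then show "(\<integral>\<^sup>+\<tau>. ennreal (norm (indicator {0..T} \<tau> * (Lnorm \<tau>) ^ 4)) \<partial>lborel) < \<infinity>"
      using Linf_integral le_less_trans by blast
  qed measurable
  show ?thesis
  proof (rule Bochner_Integration.integrable_bound)
    show "integrable lborel (\<lambda>\<tau>. 3 * (indicator {0..T} \<tau> + indicator {0..T} \<tau> * (Lnorm \<tau>) ^ 4))"
      by (intro integrable_mult_right Bochner_Integration.integrable_add i4 integrable_real_indicator)
         (auto simp: emeasure_lborel_Icc_eq)
    show "kap \<in> borel_measurable lborel" unfolding kap_def by measurable
    have "x\<^sup>2 \<le> 1 + x ^ 4" for x :: real
    proof -
      have "x ^ 4 = (x\<^sup>2)\<^sup>2" by simp
      moreover have "0 \<le> (x\<^sup>2 - 1/2)\<^sup>2" by (rule zero_le_power2)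
      ultimately show ?thesis by (simp add: power2_diff power_divide)
    qed
    then have L4: "(Lnorm \<tau>)\<^sup>2 \<le> 1 + Lnorm \<tau> ^ 4" for \<tau> .
    have "kap \<tau> \<le> 3 * (indicator {0..T} \<tau> + indicator {0..T} \<tau> * (Lnorm \<tau>) ^ 4)" for \<tau>
      using L4[of \<tau>] by (simp add: kap_def indicator_def)
    then show "AE \<tau> in lborel. norm (kap \<tau>) \<le> norm (3 * (indicator {0..T} \<tau> + indicator {0..T} \<tau> * (Lnorm \<tau>) ^ 4))"
      using kap_nonneg by (auto intro!: AE_I2 order_trans[OF _ abs_ge_self])
  qed
qed

lemma u_bounded: "\<exists>B. \<forall>t. 0 \<le> t \<longrightarrow> t \<le> T \<longrightarrow> norm (u t) \<le> B"
  using compact_imp_bounded[OF compact_continuous_image[OF u_continuous]] unfolding bounded_iff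
  by (metis atLeastAtMost_iff compact_Icc image_eqI)

lemma forcing_integrable: "integrable lborel forcing"
proof -
  obtain B where B: "\<And>t. 0 \<le> t \<Longrightarrow> t \<le> T \<Longrightarrow> norm (u t) \<le> B" using u_bounded by blast
  \<comment> \<open>Joint continuity of the group lets the merely Borel map
    \<open>cubic (uc \<tau>)\<close> be inserted without losing measurability.\<close>
  have cont: "continuous_on UNIV (\<lambda>x. schroedinger_group (fst x) (snd x))"
  proof (rule continuous_on_sequentiallyI)
    fix s :: "nat \<Rightarrow> real \<times> L2" and a assume "s \<longlonglongrightarrow> a"
    then show "(\<lambda>n. schroedinger_group (fst (s n)) (snd (s n))) \<longlonglongrightarrow> schroedinger_group (fst a) (snd a)"
      by (intro schroedinger_tendsto tendsto_fst tendsto_snd)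
  qed
  have [measurable]: "(\<lambda>\<tau>. schroedinger_group (- \<tau>) (cubic (uc \<tau>))) \<in> borel_measurable borel"
    by (rule borel_measurable_continuous_Pair[OF _ _ cont]) measurable
  show ?thesis
  proof (rule Bochner_Integration.integrable_bound)
    show "integrable lborel (\<lambda>\<tau>. kap \<tau> * B)" using kap_integrable by simp
    show "forcing \<in> borel_measurable lborel" unfolding forcing_def by measurable
    show "AE \<tau> in lborel. norm (forcing \<tau>) \<le> norm (kap \<tau> * B)"
      using AE_ess_bounded
    proof eventually_elim
      fix \<tau> assume *: "\<tau> \<in> {0..T} \<longrightarrow> ess_bounded (u \<tau>) (Lnorm \<tau>)"
      show "norm (forcing \<tau>) \<le> norm (kap \<tau> * B)"
      proof (cases "\<tau> \<in> {0..T}")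
        case True
        have "norm (forcing \<tau>) = norm (cubic (u \<tau>))" using True by (simp add: forcing_def uc_def)
        also have "\<dots> \<le> 3 * (Lnorm \<tau>)\<^sup>2 * norm (u \<tau>)" using * True by (intro norm_cubic_le) simp
        also have "\<dots> \<le> 3 * (Lnorm \<tau>)\<^sup>2 * B" using True B by (intro mult_left_mono) auto
        finally show ?thesis using True by (simp add: kap_def)
      qed (simp add: forcing_def)
    qed
  qed
qed

text \<open>Applying the group at time -t to Duhamel's formula removes t from the integrand. The
  profile is then the indefinite integral of a fixed integrable function, so its increments are
  integrals over (s, t].\<close>

lemma prof_eq:
  assumes t: "0 \<le> t" "t \<le> T"
  shows "prof t = u0 + (LINT \<tau>:{0..t}|lborel. mult_L2 (\<lambda>_. \<i> * lam) (forcing \<tau>))"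
proof -
  interpret S: bounded_linear "schroedinger_group a" for a by (rule bounded_linear_schroedinger)
  interpret M: bounded_linear "mult_L2 (\<lambda>_. \<i> * lam)" by (rule bounded_linear_mult_L2[OF bounded_mult_const])
  define I where "I = (LINT \<tau>|lborel. indicator {0..t} \<tau> *\<^sub>R forcing \<tau>)"
  have int: "integrable lborel (\<lambda>\<tau>. indicator {0..t} \<tau> *\<^sub>R forcing \<tau>)"
    by (rule integrable_mult_indicator) (simp_all add: forcing_integrable)
  have "(LINT \<tau>:{0..t}|lborel. schroedinger_group (t - \<tau>) (cubic (u \<tau>)))
      = (LINT \<tau>|lborel. schroedinger_group t (indicator {0..t} \<tau> *\<^sub>R forcing \<tau>))"
    unfolding set_lebesgue_integral_def
  proof (intro Bochner_Integration.integral_cong refl)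
    fix \<tau>
    show "indicator {0..t} \<tau> *\<^sub>R schroedinger_group (t - \<tau>) (cubic (u \<tau>)) = schroedinger_group t (indicator {0..t} \<tau> *\<^sub>R forcing \<tau>)"
      using t by (auto simp: indicator_def forcing_def uc_def schroedinger_add S.zero)
  qed
  also have "\<dots> = schroedinger_group t I"
    unfolding I_def by (rule integral_bounded_linear[OF bounded_linear_schroedinger int])
  finally have "u t = schroedinger_group t u0 + mult_L2 (\<lambda>_. \<i> * lam) (schroedinger_group t I)"
    using solution t by (simp add: nls_strong_solution_def)
  then have "prof t = u0 + mult_L2 (\<lambda>_. \<i> * lam) I"
    by (simp add: prof_def S.add schroedinger_add schroedinger_mult_const)
  also have "mult_L2 (\<lambda>_. \<i> * lam) I = (LINT \<tau>|lborel. mult_L2 (\<lambda>_. \<i> * lam) (indicator {0..t} \<tau> *\<^sub>R forcing \<tau>))"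
    unfolding I_def by (rule integral_bounded_linear[OF bounded_linear_mult_L2[OF bounded_mult_const] int, symmetric])
  finally show ?thesis
    unfolding set_lebesgue_integral_def M.scaleR .
qed

lemma prof_0: "prof 0 = u0"
proof -
  have "(LINT \<tau>:{0..0}|lborel. mult_L2 (\<lambda>_. \<i> * lam) (forcing \<tau>)) = (LINT \<tau>|(lborel :: real measure). 0)"
    unfolding set_lebesgue_integral_def
  proof (rule integral_cong_AE)
    show "AE x in lborel. indicator {0..0} x *\<^sub>R mult_L2 (\<lambda>_. \<i> * lam) (forcing x) = 0"
      using AE_lborel_singleton[of 0] by eventually_elim (auto simp: indicator_def)
    have "integrable lborel (\<lambda>\<tau>. mult_L2 (\<lambda>_. \<i> * lam) (forcing \<tau>))"
      by (rule integrable_bounded_linear[OF bounded_linear_mult_L2[OF bounded_mult_const] forcing_integrable])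
    then show "(\<lambda>x. indicator {0..0} x *\<^sub>R mult_L2 (\<lambda>_. \<i> * lam) (forcing x)) \<in> borel_measurable lborel"
      by measurable
  qed simp
  then show ?thesis using prof_eq[of 0] T by simp
qed

lemma u_0: "u 0 = u0"
  using prof_0 by (simp add: prof_def)

lemma prof_diff:
  assumes st: "0 \<le> s" "s \<le> t" "t \<le> T" and L: "bounded_linear L"
  shows "set_integrable lborel {s<..t} (\<lambda>\<tau>. L (mult_L2 (\<lambda>_. \<i> * lam) (forcing \<tau>)))"
    and "L (prof t) - L (prof s) = (LINT \<tau>:{s<..t}|lborel. L (mult_L2 (\<lambda>_. \<i> * lam) (forcing \<tau>)))"
proof -
  interpret L: bounded_linear L by fact
  define f where "f = (\<lambda>\<tau>. mult_L2 (\<lambda>_. \<i> * lam) (forcing \<tau>))"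
  have f: "integrable lborel f" unfolding f_def
    by (rule integrable_bounded_linear[OF bounded_linear_mult_L2[OF bounded_mult_const] forcing_integrable])
  have fi: "set_integrable lborel A f" if "A \<in> sets borel" for A
    unfolding set_integrable_def using that f by (intro integrable_mult_indicator) auto
  have "{0..t} = {0..s} \<union> {s<..t}" using st by auto
  then have "(LINT \<tau>:{0..t}|lborel. f \<tau>) = (LINT \<tau>:{0..s}|lborel. f \<tau>) + (LINT \<tau>:{s<..t}|lborel. f \<tau>)"
    by (simp only:) (rule set_integral_Un; auto intro!: fi)
  then have "prof t - prof s = (LINT \<tau>:{s<..t}|lborel. f \<tau>)"
    using prof_eq[of t] prof_eq[of s] st by (simp add: f_def)
  then have "L (prof t) - L (prof s) = L (LINT \<tau>:{s<..t}|lborel. f \<tau>)" by (simp add: L.diff[symmetric])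
  also have "\<dots> = (LINT \<tau>:{s<..t}|lborel. L (f \<tau>))"
    using integral_bounded_linear[OF L fi[of "{s<..t}", unfolded set_integrable_def]]
    by (simp add: set_lebesgue_integral_def L.scaleR)
  finally show "L (prof t) - L (prof s) = (LINT \<tau>:{s<..t}|lborel. L (mult_L2 (\<lambda>_. \<i> * lam) (forcing \<tau>)))"
    by (simp add: f_def)
  show "set_integrable lborel {s<..t} (\<lambda>\<tau>. L (mult_L2 (\<lambda>_. \<i> * lam) (forcing \<tau>)))"
    using integrable_bounded_linear[OF L fi[of "{s<..t}", unfolded set_integrable_def]]
    by (simp add: set_integrable_def L.scaleR f_def)
qed

lemma norm_prof_diff_le:
  assumes st: "0 \<le> s" "s \<le> t" "t \<le> T" and L: "bounded_linear (L :: L2 \<Rightarrow> L2)"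
    and bound: "\<And>\<tau>. s \<le> \<tau> \<Longrightarrow> \<tau> \<le> t \<Longrightarrow> ess_bounded (u \<tau>) (Lnorm \<tau>) \<Longrightarrow> norm (L (mult_L2 (\<lambda>_. \<i> * lam) (forcing \<tau>))) \<le> m * (cmod lam * kap \<tau>)"
  shows "norm (L (prof t) - L (prof s)) \<le> m * (LINT \<tau>:{s<..t}|lborel. cmod lam * kap \<tau>)"
proof -
  note P = prof_diff[OF st L]
  have "norm (L (prof t) - L (prof s)) \<le> (LINT \<tau>|lborel. norm (indicator {s<..t} \<tau> *\<^sub>R L (mult_L2 (\<lambda>_. \<i> * lam) (forcing \<tau>))))"
    unfolding P(2) set_lebesgue_integral_def by (rule integral_norm_bound)
  also have "\<dots> \<le> (LINT \<tau>|lborel. m * (indicator {s<..t} \<tau> *\<^sub>R (cmod lam * kap \<tau>)))"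
  proof (rule integral_mono_AE)
    show "integrable lborel (\<lambda>\<tau>. norm (indicator {s<..t} \<tau> *\<^sub>R L (mult_L2 (\<lambda>_. \<i> * lam) (forcing \<tau>))))"
      using P(1) unfolding set_integrable_def by (rule integrable_norm)
    show "integrable lborel (\<lambda>\<tau>. m * (indicator {s<..t} \<tau> *\<^sub>R (cmod lam * kap \<tau>)))"
      using kap_integrable by (intro integrable_mult_right integrable_mult_indicator) auto
    show "AE \<tau> in lborel. norm (indicator {s<..t} \<tau> *\<^sub>R L (mult_L2 (\<lambda>_. \<i> * lam) (forcing \<tau>))) \<le> m * (indicator {s<..t} \<tau> *\<^sub>R (cmod lam * kap \<tau>))"
      using AE_ess_bounded
    proof eventually_elim
      fix \<tau> assume "\<tau> \<in> {0..T} \<longrightarrow> ess_bounded (u \<tau>) (Lnorm \<tau>)"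
      then show "norm (indicator {s<..t} \<tau> *\<^sub>R L (mult_L2 (\<lambda>_. \<i> * lam) (forcing \<tau>))) \<le> m * (indicator {s<..t} \<tau> *\<^sub>R (cmod lam * kap \<tau>))"
        using bound[of \<tau>] st by (auto simp: indicator_def)
    qed
  qed
  also have "\<dots> = m * (LINT \<tau>:{s<..t}|lborel. cmod lam * kap \<tau>)"
    unfolding set_lebesgue_integral_def by (rule integral_mult_right_zero)
  finally show ?thesis .
qed

lemma norm_prof [simp]: "norm (prof t) = norm (u t)"
  by (simp add: prof_def)

text \<open>A boost with the constant time parameter -b acts on the profile as the boost with
  parameter t - b acts on u(t). Differences of boosted solutions thus become a fixed linear operator
  applied to \<open>prof\<close>.\<close>

lemma boost_prof: "boost e (- b) (prof t) = schroedinger_group (- t) (boost e (t - b) (u t))"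
  by (simp add: prof_def schroedinger_boost)

text \<open>By Galilean invariance the boosted solution solves the same equation, so the difference to
  \<open>u\<close> obeys a Gronwall estimate whose constant does not depend on the boost.\<close>

lemma boost_Gronwall:
  obtains C where "C > 0"
    "\<And>e b s t. 0 \<le> s \<Longrightarrow> s \<le> T \<Longrightarrow> 0 \<le> t \<Longrightarrow> t \<le> T \<Longrightarrow>
       norm (boost e (t - b) (u t) - u t) \<le> C * norm (boost e (s - b) (u s) - u s)"
    "\<And>s t. 0 \<le> s \<Longrightarrow> s \<le> T \<Longrightarrow> 0 \<le> t \<Longrightarrow> t \<le> T \<Longrightarrow> norm (u t) \<le> C * norm (u s)"
proof -
  have k: "integrable lborel (\<lambda>\<tau>. cmod lam * kap \<tau>)" "\<And>x. cmod lam * kap x \<ge> 0"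
    using kap_integrable kap_nonneg by auto
  obtain B where B: "\<And>t. 0 \<le> t \<Longrightarrow> t \<le> T \<Longrightarrow> norm (u t) \<le> B" using u_bounded by blast
  from T have "T \<ge> 0" by simp
  from Gronwall_sup[OF k this] obtain C where C: "C > 0"
    "\<And>\<phi> s t. \<lbrakk>\<And>s t m. 0 \<le> s \<Longrightarrow> s \<le> t \<Longrightarrow> t \<le> T \<Longrightarrow> (\<And>\<tau>. s \<le> \<tau> \<Longrightarrow> \<tau> \<le> t \<Longrightarrow> \<phi> \<tau> \<le> m) \<Longrightarrow>
          \<bar>\<phi> t - \<phi> s\<bar> \<le> m * (LINT \<tau>:{s<..t}|lborel. cmod lam * kap \<tau>);
       \<And>t. 0 \<le> t \<Longrightarrow> t \<le> T \<Longrightarrow> 0 \<le> \<phi> t; \<exists>B. \<forall>t. 0 \<le> t \<longrightarrow> t \<le> T \<longrightarrow> \<phi> t \<le> B;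
       0 \<le> s; s \<le> T; 0 \<le> t; t \<le> T\<rbrakk> \<Longrightarrow> \<phi> t \<le> C * \<phi> s" by blast
  show ?thesis
  proof (rule that[OF C(1)])
    fix s t assume st: "0 \<le> s" "s \<le> T" "0 \<le> t" "t \<le> T"
    show "norm (u t) \<le> C * norm (u s)"
    proof (rule C(2)[OF _ _ _ st])
      fix s t m assume st: "0 \<le> s" "s \<le> t" "t \<le> T" and m: "\<And>\<tau>. s \<le> \<tau> \<Longrightarrow> \<tau> \<le> t \<Longrightarrow> norm (u \<tau>) \<le> m"
      have "norm (prof t - prof s) \<le> m * (LINT \<tau>:{s<..t}|lborel. cmod lam * kap \<tau>)"
      proof (rule norm_prof_diff_le[OF st bounded_linear_ident])
        fix \<tau> assume \<tau>: "s \<le> \<tau>" "\<tau> \<le> t" "ess_bounded (u \<tau>) (Lnorm \<tau>)"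
        have "norm (cubic (u \<tau>)) \<le> 3 * (Lnorm \<tau>)\<^sup>2 * norm (u \<tau>)" by (rule norm_cubic_le[OF \<tau>(3)])
        also have "\<dots> \<le> 3 * (Lnorm \<tau>)\<^sup>2 * m" using m[OF \<tau>(1,2)] by (intro mult_left_mono) auto
        finally show "norm (mult_L2 (\<lambda>_. \<i> * lam) (forcing \<tau>)) \<le> m * (cmod lam * kap \<tau>)"
          using \<tau> st mult_left_mono[of "norm (cubic (u \<tau>))" "3 * (Lnorm \<tau>)\<^sup>2 * m" "cmod lam"]
          by (simp add: forcing_def uc_def kap_def norm_mult mult_ac)
      qed
      then show "\<bar>norm (u t) - norm (u s)\<bar> \<le> m * (LINT \<tau>:{s<..t}|lborel. cmod lam * kap \<tau>)"
        using norm_triangle_ineq3[of "prof t" "prof s"] by simp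
    qed (use B in auto)
  next
    fix e b s t assume st: "0 \<le> s" "s \<le> T" "0 \<le> t" "t \<le> T"
    interpret S: bounded_linear "schroedinger_group a" for a by (rule bounded_linear_schroedinger)
    interpret M: bounded_linear "mult_L2 (\<lambda>_. \<i> * lam)" by (rule bounded_linear_mult_L2[OF bounded_mult_const])
    \<comment> \<open>Linear and independent of time, so it passes through the integral for the
      profile; on the forcing it becomes the difference of the cubic terms of the boosted and the
      original solution.\<close>
    define L where "L f = boost e (- b) f - f" for f
    have L: "bounded_linear L" unfolding L_def
      by (intro bounded_linear_sub bounded_linear_boost bounded_linear_ident)
    define w where "w t = norm (boost e (t - b) (u t) - u t)" for t
    have w: "w t = norm (L (prof t))" for t
      unfolding L_def boost_prof by (simp add: prof_def w_def S.diff[symmetric])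
    have "w t \<le> C * w s"
    proof (rule C(2)[OF _ _ _ st])
      fix s t m assume st: "0 \<le> s" "s \<le> t" "t \<le> T" and m: "\<And>\<tau>. s \<le> \<tau> \<Longrightarrow> \<tau> \<le> t \<Longrightarrow> w \<tau> \<le> m"
      have "norm (L (prof t) - L (prof s)) \<le> m * (LINT \<tau>:{s<..t}|lborel. cmod lam * kap \<tau>)"
      proof (rule norm_prof_diff_le[OF st L])
        fix \<tau> assume \<tau>: "s \<le> \<tau>" "\<tau> \<le> t" "ess_bounded (u \<tau>) (Lnorm \<tau>)"
        have f: "forcing \<tau> = schroedinger_group (- \<tau>) (cubic (u \<tau>))"
          using \<tau> st by (simp add: forcing_def uc_def)
        have "L (mult_L2 (\<lambda>_. \<i> * lam) (forcing \<tau>)) = mult_L2 (\<lambda>_. \<i> * lam) (L (forcing \<tau>))"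
          unfolding L_def boost_mult_const M.diff ..
        then have nL: "norm (L (mult_L2 (\<lambda>_. \<i> * lam) (forcing \<tau>))) = cmod lam * norm (L (forcing \<tau>))"
          by (simp add: norm_mult)
        have "L (forcing \<tau>) = schroedinger_group (- \<tau>) (cubic (boost e (\<tau> - b) (u \<tau>)) - cubic (u \<tau>))"
          unfolding cubic_boost[OF \<tau>(3)] L_def f by (simp add: schroedinger_boost S.diff)
        also have "norm \<dots> = norm (cubic (boost e (\<tau> - b) (u \<tau>)) - cubic (u \<tau>))" by simp
        also have "\<dots> \<le> 3 * (Lnorm \<tau>)\<^sup>2 * w \<tau>"
          unfolding w_def by (intro norm_cubic_diff_le ess_bounded_boost \<tau>)
        also have "\<dots> \<le> 3 * (Lnorm \<tau>)\<^sup>2 * m" using m[OF \<tau>(1,2)] by (intro mult_left_mono) auto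
        finally have "norm (L (forcing \<tau>)) \<le> 3 * (Lnorm \<tau>)\<^sup>2 * m" .
        from mult_left_mono[OF this norm_ge_zero[of lam]]
        show "norm (L (mult_L2 (\<lambda>_. \<i> * lam) (forcing \<tau>))) \<le> m * (cmod lam * kap \<tau>)"
          unfolding nL using \<tau> st by (simp add: kap_def mult_ac)
      qed
      then show "\<bar>w t - w s\<bar> \<le> m * (LINT \<tau>:{s<..t}|lborel. cmod lam * kap \<tau>)"
        unfolding w using norm_triangle_ineq3[of "L (prof t)" "L (prof s)"] by linarith
    next
      show "\<exists>B. \<forall>t. 0 \<le> t \<longrightarrow> t \<le> T \<longrightarrow> w t \<le> B"
      proof (intro exI[of _ "B + B"] allI impI)
        fix t assume "0 \<le> t" "t \<le> T"
        then show "w t \<le> B + B"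
          unfolding w_def using B[of t] norm_triangle_ineq4[of "boost e (t - b) (u t)" "u t"] by simp
      qed
    qed (simp add: w_def)
    then show "norm (boost e (t - b) (u t) - u t) \<le> C * norm (boost e (s - b) (u s) - u s)"
      by (simp add: w_def)
  qed
qed

end

section \<open>H^1 regularity from the two weighted data\<close>

lemma norm_boost_0_diff_le:
  assumes "weighted_L2 f"
  shows "norm (boost e 0 f - f) \<le> \<bar>e\<bar> * sqrt (LINT x|lborel. x\<^sup>2 * (cmod (fun_of f x))\<^sup>2)"
proof -
  define F where "F = fun_of f"
  have F: "square_int F" "f = L2_of F" by (simp_all add: F_def square_int_fun_of L2_of_fun_of)
  have [measurable]: "F \<in> borel_measurable borel" using F(1) by measurable
  have w: "integrable lborel (\<lambda>x. x\<^sup>2 * (cmod (F x))\<^sup>2)" using assms by (simp add: weighted_L2_def F_def)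
  have si: "square_int (\<lambda>x. of_real x * F x)"
    unfolding square_int_def using w by (auto simp: norm_mult power_mult_distrib)
  have sm: "square_int (\<lambda>x. exp (\<i> * of_real (e * x)) * F x)"
    by (rule square_int_mult[OF unimod_bounded[OF unimod_lin(2)] F(1)])
  have "boost e 0 f - f = L2_of (\<lambda>x. exp (\<i> * of_real (e * x)) * F x - F x)"
    unfolding boost_0 F(2) mult_L2_of[OF unimod_bounded[OF unimod_lin(2)] F(1)] L2_of_diff[OF sm F(1)] ..
  also have "norm \<dots> \<le> \<bar>e\<bar> * norm (L2_of (\<lambda>x. of_real x * F x))"
  proof (rule norm_L2_of_mono[OF square_int_diff[OF sm F(1)] si])
    have "cmod (exp (\<i> * of_real (e * x)) * F x - F x) \<le> \<bar>e\<bar> * cmod (of_real x * F x)" for x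
    proof -
      have "cmod (exp (\<i> * of_real (e * x)) - 1) \<le> \<bar>e * x\<bar>"
        using iexp_approx1[of "e * x" 0] by simp
      then have "cmod (exp (\<i> * of_real (e * x)) - 1) * cmod (F x) \<le> \<bar>e * x\<bar> * cmod (F x)"
        by (rule mult_right_mono) simp
      moreover have "exp (\<i> * of_real (e * x)) * F x - F x = (exp (\<i> * of_real (e * x)) - 1) * F x"
        by (simp add: left_diff_distrib)
      ultimately show ?thesis by (simp add: norm_mult abs_mult mult.assoc)
    qed
    then show "AE x in lborel. cmod (exp (\<i> * of_real (e * x)) * F x - F x) \<le> \<bar>e\<bar> * cmod (of_real x * F x)" by simp
  qed simp
  also have "norm (L2_of (\<lambda>x. of_real x * F x)) = sqrt (LINT x|lborel. x\<^sup>2 * (cmod (F x))\<^sup>2)"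
    using norm_L2_of[OF si] by (simp add: norm_mult power_mult_distrib real_sqrt_unique)
  finally show ?thesis by (simp add: F_def)
qed

lemma deriv_sequence:
  fixes f :: "complex \<Rightarrow> complex"
  assumes "(f has_field_derivative D) (at 0)"
  shows "(\<lambda>k. (f (of_real (1 / real (Suc k))) - f 0) * of_real (real (Suc k))) \<longlonglongrightarrow> D"
proof -
  have "((\<lambda>h. (f h - f 0) / h) \<longlongrightarrow> D) (at 0)" using assms by (simp add: DERIV_def)
  moreover have "filterlim (\<lambda>k. complex_of_real (1 / real (Suc k))) (at 0) sequentially"
    unfolding filterlim_at
  proof
    have "(\<lambda>k. complex_of_real (1 / real (Suc k))) \<longlonglongrightarrow> of_real 0"
      by (intro tendsto_of_real LIMSEQ_Suc[OF lim_1_over_n])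
    then show "(\<lambda>k. complex_of_real (1 / real (Suc k))) \<longlonglongrightarrow> 0" by simp
  qed (auto simp del: of_nat_Suc)
  ultimately have "(\<lambda>k. (f (of_real (1 / real (Suc k))) - f 0) / of_real (1 / real (Suc k))) \<longlonglongrightarrow> D"
    by (rule filterlim_compose)
  then show ?thesis by (simp add: divide_inverse del: of_nat_Suc)
qed

context nls_solution
begin

text \<open>A finite-difference form of the identity J(t) - J(t - T) = 2 i T d/dx for the Galilean
  fields J(t) = x + 2 i t d/dx. The weight of u(0) bounds the boost with parameter t, that of u(T)
  the one with parameter t - T, by \<open>boost_Gronwall\<close> run forward and backward. Their
  difference involves only the frequency.\<close>

lemma H1_bound:
  assumes w: "weighted_L2 u0" "weighted_L2 (u T)"
  obtains D where "\<And>t. 0 \<le> t \<Longrightarrow> t \<le> T \<Longrightarrow> square_int (\<lambda>\<xi>. of_real \<xi> * fun_of (fourier_L2 (u t)) \<xi>)"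
    "\<And>t. 0 \<le> t \<Longrightarrow> t \<le> T \<Longrightarrow> norm (L2_of (\<lambda>\<xi>. of_real \<xi> * fun_of (fourier_L2 (u t)) \<xi>)) \<le> D"
proof -
  from boost_Gronwall obtain C where C: "C > 0"
    "\<And>e b s t. 0 \<le> s \<Longrightarrow> s \<le> T \<Longrightarrow> 0 \<le> t \<Longrightarrow> t \<le> T \<Longrightarrow>
       norm (boost e (t - b) (u t) - u t) \<le> C * norm (boost e (s - b) (u s) - u s)" by metis
  define X where "X f = sqrt (LINT x|lborel. x\<^sup>2 * (cmod (fun_of f x))\<^sup>2)" for f
  define D where "D = C * (X u0 + X (u T))"
  have main: "square_int (\<lambda>\<xi>. of_real \<xi> * fun_of (fourier_L2 (u t)) \<xi>) \<and>
      norm (L2_of (\<lambda>\<xi>. of_real \<xi> * fun_of (fourier_L2 (u t)) \<xi>)) \<le> D / (2 * T)"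
    if t: "0 \<le> t" "t \<le> T" for t
  proof -
    interpret F: bounded_linear fourier_L2 by (rule bounded_linear_fourier_L2)
    interpret Tr: bounded_linear "trans_L2 a" for a by (rule bounded_linear_trans_L2)
    define G where "G = fun_of (fourier_L2 (u t))"
    have G: "square_int G" "fourier_L2 (u t) = L2_of G" by (simp_all add: G_def square_int_fun_of L2_of_fun_of)
    have [measurable]: "G \<in> borel_measurable borel" using G(1) by measurable
    define p where "p s e \<xi> = exp (- (\<i> * complex_of_real (2 * e * s * (\<xi> + e) - e\<^sup>2 * s)))" for s e \<xi>
    have up: "unimod (p s e)" for s e unfolding p_def by (intro unimod_exp) measurable
    have fb: "fourier_L2 (boost e s (u t)) = trans_L2 e (mult_L2 (p s e) (fourier_L2 (u t)))" for s e
      unfolding fourier_boost trans_mult_L2[OF unimod_bounded[OF up]] by (simp add: p_def)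
    \<comment> \<open>One less than the quotient of the Fourier phases of the two boosts; t has
      cancelled.\<close>
    define m where "m e \<xi> = exp (- (\<i> * complex_of_real (2 * T * \<xi> * e + T * e\<^sup>2))) - 1" for e \<xi>
    have pm: "p t e \<xi> = exp (- (\<i> * complex_of_real (2 * e * (t - T) * (\<xi> + e) - e\<^sup>2 * (t - T)))) * (m e \<xi> + 1)" for e \<xi>
      unfolding p_def m_def diff_add_cancel by (subst exp_mult_eq[OF refl]) (simp add: algebra_simps power2_eq_square)
    have bm: "bounded_mult (m e)" for e
    proof (rule bounded_multI[where B = 2])
      show "m e \<in> borel_measurable borel" unfolding m_def by measurable
      show "cmod (m e x) \<le> 2" for x unfolding m_def
        by (rule order_trans[OF norm_triangle_ineq4]) simp
    qed
    have le: "norm (mult_L2 (m e) (fourier_L2 (u t))) \<le> \<bar>e\<bar> * D" for e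
    proof -
      have "norm (boost e t (u t) - u t) \<le> C * norm (boost e 0 u0 - u0)"
        using C(2)[of 0 t e 0] t T by (simp add: u_0)
      also have "\<dots> \<le> C * (\<bar>e\<bar> * X u0)"
        unfolding X_def using C(1) by (intro mult_left_mono norm_boost_0_diff_le w) auto
      finally have 1: "norm (boost e t (u t) - u t) \<le> C * (\<bar>e\<bar> * X u0)" .
      have "norm (boost e (t - T) (u t) - u t) \<le> C * norm (boost e 0 (u T) - u T)"
        using C(2)[of T t e T] t T by simp
      also have "\<dots> \<le> C * (\<bar>e\<bar> * X (u T))"
        unfolding X_def using C(1) by (intro mult_left_mono norm_boost_0_diff_le w) auto
      finally have 2: "norm (boost e (t - T) (u t) - u t) \<le> C * (\<bar>e\<bar> * X (u T))" .
      have "mult_L2 (p t e) f - mult_L2 (p (t - T) e) f = mult_L2 (p (t - T) e) (mult_L2 (m e) f)" for f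
      proof -
        have "mult_L2 (p t e) f - mult_L2 (p (t - T) e) f = mult_L2 (\<lambda>\<xi>. p t e \<xi> - p (t - T) e \<xi>) f"
          by (rule mult_L2_diff_left[symmetric]) (intro unimod_bounded up)+
        also have "(\<lambda>\<xi>. p t e \<xi> - p (t - T) e \<xi>) = (\<lambda>\<xi>. p (t - T) e \<xi> * m e \<xi>)"
          unfolding pm by (simp add: fun_eq_iff p_def distrib_left)
        also have "mult_L2 \<dots> f = mult_L2 (p (t - T) e) (mult_L2 (m e) f)"
          by (rule mult_L2_mult[OF unimod_bounded[OF up] bm, symmetric])
        finally show ?thesis .
      qed
      then have "norm (mult_L2 (m e) (fourier_L2 (u t))) = norm (mult_L2 (p t e) (fourier_L2 (u t)) - mult_L2 (p (t - T) e) (fourier_L2 (u t)))"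
        by (simp add: up)
      also have "\<dots> = norm (trans_L2 e (mult_L2 (p t e) (fourier_L2 (u t)) - mult_L2 (p (t - T) e) (fourier_L2 (u t))))" by simp
      also have "\<dots> = norm (fourier_L2 (boost e t (u t) - boost e (t - T) (u t)))"
        unfolding Tr.diff F.diff fb ..
      also have "\<dots> = norm ((boost e t (u t) - u t) - (boost e (t - T) (u t) - u t))" by simp
      also have "\<dots> \<le> norm (boost e t (u t) - u t) + norm (boost e (t - T) (u t) - u t)"
        by (rule norm_triangle_ineq4)
      also have "\<dots> \<le> \<bar>e\<bar> * D" using 1 2 by (simp add: D_def algebra_simps)
      finally show ?thesis .
    qed
    \<comment> \<open>Divides m by e = 1/(k + 1). As m/e tends to -2 i T xi, the factor i/(2T) turns
      the limit into xi times the transform of u(t), and Fatou carries the bound over.\<close>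
    define f where "f k \<xi> = \<i> / of_real (2 * T) * (m (1 / real (Suc k)) \<xi> * of_real (real (Suc k))) * G \<xi>" for k \<xi>
    have fe: "f k = (\<lambda>\<xi>. (\<i> / of_real (2 * T) * of_real (real (Suc k))) * (m (1 / real (Suc k)) \<xi> * G \<xi>))" for k
      by (simp add: f_def fun_eq_iff mult_ac)
    have sif: "square_int (f k)" for k
      unfolding fe by (intro square_int_mult_const square_int_mult bm G)
    have nf: "norm (L2_of (f k)) \<le> D / (2 * T)" for k
    proof -
      have "L2_of (f k) = mult_L2 (\<lambda>_. \<i> / of_real (2 * T) * of_real (real (Suc k))) (mult_L2 (m (1 / real (Suc k))) (fourier_L2 (u t)))"
        unfolding G(2) mult_L2_of[OF bm G(1)] mult_L2_of[OF bounded_mult_const square_int_mult[OF bm G(1)]] fe ..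
      then have "norm (L2_of (f k)) = real (Suc k) / (2 * T) * norm (mult_L2 (m (1 / real (Suc k))) (fourier_L2 (u t)))"
        using T by (simp add: norm_mult norm_divide del: of_nat_Suc)
      also have "\<dots> \<le> real (Suc k) / (2 * T) * (\<bar>1 / real (Suc k)\<bar> * D)"
        using T by (intro mult_left_mono le) auto
      finally show ?thesis by (simp del: of_nat_Suc)
    qed
    have lim: "(\<lambda>k. f k \<xi>) \<longlonglongrightarrow> of_real \<xi> * G \<xi>" for \<xi>
    proof -
      define h where "h z = exp (- (\<i> * (of_real (2 * T * \<xi>) * z + of_real T * z\<^sup>2)))" for z
      have "(h has_field_derivative - (\<i> * of_real (2 * T * \<xi>))) (at 0)"
        unfolding h_def by (auto intro!: derivative_eq_intros)
      from deriv_sequence[OF this]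
      have "(\<lambda>k. m (1 / real (Suc k)) \<xi> * of_real (real (Suc k))) \<longlonglongrightarrow> - (\<i> * of_real (2 * T * \<xi>))"
        by (simp add: h_def m_def)
      then have "(\<lambda>k. f k \<xi>) \<longlonglongrightarrow> \<i> / of_real (2 * T) * (- (\<i> * of_real (2 * T * \<xi>))) * G \<xi>"
        unfolding f_def by (intro tendsto_intros)
      also have "\<i> / of_real (2 * T) * (- (\<i> * of_real (2 * T * \<xi>))) * G \<xi> = of_real \<xi> * G \<xi>"
        using T by simp
      finally show ?thesis .
    qed
    have mG: "(\<lambda>\<xi>. of_real \<xi> * G \<xi>) \<in> borel_measurable borel" by measurable
    from L2_Fatou[OF sif nf AE_I2[OF lim] mG] show ?thesis by (simp add: G_def)
  qed
  show ?thesis by (rule that[of "D / (2 * T)"]) (use main in auto)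
qed

end

section \<open>The Wiener algebra\<close>

text \<open>The Wiener algebra within L2. Which representative of the transform is taken does not
  matter, by \<open>inA_fourier\<close>.\<close>

definition inA :: "L2 \<Rightarrow> bool" where
  "inA f \<longleftrightarrow> integrable lborel (fun_of (fourier_L2 f))"

text \<open>The normalisation makes it an upper bound for the essential supremum and
  submultiplicative, both with constant 1. A transform that is not integrable gets the integral 0,
  so an upper bound is informative only together with \<open>inA\<close>.\<close>

definition Anorm :: "L2 \<Rightarrow> real" where
  "Anorm f = (1 / sqrt (2 * pi)) * (LINT \<xi>|lborel. cmod (fun_of (fourier_L2 f) \<xi>))"

lemma Anorm_nonneg [simp]: "Anorm f \<ge> 0"
  by (simp add: Anorm_def)

lemma inA_fourier:
  assumes G: "square_int G" "fourier_L2 f = L2_of G"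
  shows "inA f \<longleftrightarrow> integrable lborel G"
    and "Anorm f = (1 / sqrt (2 * pi)) * (LINT \<xi>|lborel. cmod (G \<xi>))"
proof -
  have [measurable]: "G \<in> borel_measurable borel" using G by measurable
  note ae = fun_of_L2_of[OF G(1)]
  show "inA f \<longleftrightarrow> integrable lborel G"
    unfolding inA_def G(2) by (rule integrable_cong_AE) (use ae in auto)
  have "(LINT \<xi>|lborel. cmod (fun_of (L2_of G) \<xi>)) = (LINT \<xi>|lborel. cmod (G \<xi>))"
    by (rule integral_cong_AE) (use ae in \<open>auto elim!: eventually_mono\<close>)
  then show "Anorm f = (1 / sqrt (2 * pi)) * (LINT \<xi>|lborel. cmod (G \<xi>))"
    by (simp add: Anorm_def G(2))
qed

lemma inA_cases:
  obtains G where "square_int G" "fourier_L2 f = L2_of G" "inA f \<longleftrightarrow> integrable lborel G"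
    "Anorm f = (1 / sqrt (2 * pi)) * (LINT \<xi>|lborel. cmod (G \<xi>))"
  using inA_fourier[OF square_int_fun_of L2_of_fun_of[symmetric]] square_int_fun_of L2_of_fun_of by metis

lemma inA_add:
  assumes f: "inA f" and g: "inA g"
  shows "inA (f + g)" "Anorm (f + g) \<le> Anorm f + Anorm g"
proof -
  obtain F where F: "square_int F" "fourier_L2 f = L2_of F" "inA f \<longleftrightarrow> integrable lborel F"
    "Anorm f = (1 / sqrt (2 * pi)) * (LINT \<xi>|lborel. cmod (F \<xi>))" by (rule inA_cases)
  obtain G where G: "square_int G" "fourier_L2 g = L2_of G" "inA g \<longleftrightarrow> integrable lborel G"
    "Anorm g = (1 / sqrt (2 * pi)) * (LINT \<xi>|lborel. cmod (G \<xi>))" by (rule inA_cases)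
  have "fourier_L2 (f + g) = L2_of (\<lambda>x. F x + G x)"
    using bounded_linear_fourier_L2 F G by (simp add: linear_simps L2_of_add)
  note H = inA_fourier[OF square_int_add[OF F(1) G(1)] this]
  show "inA (f + g)" using H(1) F(3) G(3) f g by auto
  have "(LINT \<xi>|lborel. cmod (F \<xi> + G \<xi>)) \<le> (LINT \<xi>|lborel. cmod (F \<xi>) + cmod (G \<xi>))"
    using F(3) G(3) f g by (intro integral_mono integrable_cmod Bochner_Integration.integrable_add norm_triangle_ineq) auto
  also have "\<dots> = (LINT \<xi>|lborel. cmod (F \<xi>)) + (LINT \<xi>|lborel. cmod (G \<xi>))"
    using F(3) G(3) f g by (intro Bochner_Integration.integral_add integrable_cmod) auto
  finally show "Anorm (f + g) \<le> Anorm f + Anorm g"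
    unfolding H(2) F(4) G(4) distrib_left[symmetric] by (intro mult_left_mono) auto
qed

lemma inA_mult_const:
  assumes f: "inA f"
  shows "inA (mult_L2 (\<lambda>_. c) f)" "Anorm (mult_L2 (\<lambda>_. c) f) = cmod c * Anorm f"
proof -
  obtain F where F: "square_int F" "fourier_L2 f = L2_of F" "inA f \<longleftrightarrow> integrable lborel F"
    "Anorm f = (1 / sqrt (2 * pi)) * (LINT \<xi>|lborel. cmod (F \<xi>))" by (rule inA_cases)
  have "fourier_L2 (mult_L2 (\<lambda>_. c) f) = L2_of (\<lambda>x. c * F x)"
    unfolding fourier_mult_const F(2) by (rule mult_L2_of[OF bounded_mult_const F(1)])
  note H = inA_fourier[OF square_int_mult_const[OF F(1)] this]
  show "inA (mult_L2 (\<lambda>_. c) f)" using H(1) F(3) f by simp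
  show "Anorm (mult_L2 (\<lambda>_. c) f) = cmod c * Anorm f" unfolding H(2) F(4) by (simp add: norm_mult)
qed

lemma inA_minus: "inA f \<Longrightarrow> inA (- f)" "inA f \<Longrightarrow> Anorm (- f) = Anorm f"
proof -
  have "mult_L2 (\<lambda>_. - 1) f = - f"
  proof (cases f rule: L2_cases)
    case (L2_of F)
    have "mult_L2 (\<lambda>_. - 1) f + f = 0"
      unfolding L2_of(2) mult_L2_of[OF bounded_mult_const L2_of(1)]
      using square_int_mult_const[OF L2_of(1), of "- 1"] by (simp add: L2_of_add L2_of(1) L2_of_zero)
    then show ?thesis by (simp add: eq_neg_iff_add_eq_0)
  qed
  then show "inA f \<Longrightarrow> inA (- f)" "inA f \<Longrightarrow> Anorm (- f) = Anorm f"
    using inA_mult_const[of f "- 1"] by simp_all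
qed

lemma inA_diff:
  assumes "inA f" "inA g"
  shows "inA (f - g)" "Anorm (f - g) \<le> Anorm f + Anorm g"
  using inA_add[of f "- g"] inA_minus[of g] assms by simp_all

text \<open>The modulus of the transform is merely translated. Both the Schroedinger group and the
  boosts have this form, so both preserve \<open>Anorm\<close>; this is the reason for choosing that
  norm.\<close>

lemma inA_unimod_trans:
  assumes "unimod p" "fourier_L2 g = mult_L2 p (trans_L2 e (fourier_L2 f))"
  shows "inA g \<longleftrightarrow> inA f" "Anorm g = Anorm f"
proof -
  obtain F where F: "square_int F" "fourier_L2 f = L2_of F" "inA f \<longleftrightarrow> integrable lborel F"
    "Anorm f = (1 / sqrt (2 * pi)) * (LINT \<xi>|lborel. cmod (F \<xi>))" by (rule inA_cases)
  have [measurable]: "F \<in> borel_measurable borel" "p \<in> borel_measurable borel"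
    using F assms by (auto simp: unimod_def)
  have g: "fourier_L2 g = L2_of (\<lambda>\<xi>. p \<xi> * F (\<xi> - e))"
    unfolding assms(2) F(2) trans_L2_of[OF F(1)]
    by (rule mult_L2_of[OF unimod_bounded[OF assms(1)] square_int_translate[OF F(1)]])
  note H = inA_fourier[OF square_int_mult[OF unimod_bounded[OF assms(1)] square_int_translate[OF F(1)]] g]
  have n: "cmod (p \<xi> * F (\<xi> - e)) = cmod (F (\<xi> - e))" for \<xi>
    using assms(1) by (simp add: unimod_def norm_mult)
  have "integrable lborel (\<lambda>\<xi>. p \<xi> * F (\<xi> - e)) \<longleftrightarrow> integrable lborel (\<lambda>\<xi>. F (\<xi> - e))"
    unfolding integrable_iff_bounded n by (simp add: measurable_lborel1)
  also have "\<dots> \<longleftrightarrow> integrable lborel F"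
    using lborel_integrable_real_affine_iff[of 1 F "- e"] by simp
  finally show "inA g \<longleftrightarrow> inA f" using H(1) F(3) by simp
  show "Anorm g = Anorm f" unfolding H(2) F(4) n using integral_translate(1)[of "\<lambda>x. cmod (F x)" e] by simp
qed

lemma inA_schroedinger [simp]: "inA (schroedinger_group t f) \<longleftrightarrow> inA f" "Anorm (schroedinger_group t f) = Anorm f"
proof -
  have "fourier_L2 (schroedinger_group t f) = mult_L2 (\<lambda>\<xi>. exp (- (\<i> * of_real (t * \<xi>\<^sup>2)))) (trans_L2 0 (fourier_L2 f))"
    by (simp add: fourier_schroedinger)
  from inA_unimod_trans[OF unimod_schroedinger this]
  show "inA (schroedinger_group t f) \<longleftrightarrow> inA f" "Anorm (schroedinger_group t f) = Anorm f" by auto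
qed

lemma inA_boost [simp]: "inA (boost e s f) \<longleftrightarrow> inA f" "Anorm (boost e s f) = Anorm f"
proof -
  have "unimod (\<lambda>\<xi>. exp (- (\<i> * of_real (2 * e * s * \<xi> - e\<^sup>2 * s))))" by (intro unimod_exp) measurable
  from inA_unimod_trans[OF this fourier_boost]
  show "inA (boost e s f) \<longleftrightarrow> inA f" "Anorm (boost e s f) = Anorm f" by auto
qed

lemma inA_inversion:
  assumes G: "square_int G" "fourier_L2 f = L2_of G" "integrable lborel G"
  shows "square_int (\<lambda>x. ft G (- x))" "f = L2_of (\<lambda>x. ft G (- x))"
proof -
  show "square_int (\<lambda>x. ft G (- x))"
    by (intro square_int_reflect Plancherel_L1_L2 G)
  have "f = refl_L2 (fourier_L2 (L2_of G))"
    by (simp add: refl_fourier_fourier_L2 flip: G(2))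
  then show "f = L2_of (\<lambda>x. ft G (- x))"
    using Plancherel_L1_L2(1)[OF G(1,3)] by (simp add: fourier_L2_of G refl_L2_of)
qed

lemma inA_ess_bounded:
  assumes "inA f"
  shows "ess_bounded f (Anorm f)"
proof -
  obtain G where G: "square_int G" "fourier_L2 f = L2_of G" "inA f \<longleftrightarrow> integrable lborel G"
    "Anorm f = (1 / sqrt (2 * pi)) * (LINT \<xi>|lborel. cmod (G \<xi>))" by (rule inA_cases)
  have i: "integrable lborel G" using G(3) assms by simp
  show ?thesis
    unfolding G(4) by (subst inA_inversion(2)[OF G(1,2) i], subst ess_bounded_L2_of[OF inA_inversion(1)[OF G(1,2) i]])
      (intro AE_I2 cmod_ft_le i)
qed

text \<open>Fubini gives integrability, the norm bound and the product formula, with the factor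
  placed so that the product of transforms carries no constant. Cauchy-Schwarz gives a uniform bound
  N for k, and |k|^2 <= N |k| then makes k square integrable.\<close>

lemma convolution:
  assumes a: "square_int a" "integrable lborel a" and b: "square_int b" "integrable lborel b"
  defines "k \<equiv> (\<lambda>z. (1 / sqrt (2 * pi)) *\<^sub>R (LINT x|lborel. a x * b (z - x)))"
  shows "integrable lborel k" "square_int k" "ft k y = ft a y * ft b y"
    "(LINT z|lborel. cmod (k z)) \<le> (1 / sqrt (2 * pi)) * ((LINT x|lborel. cmod (a x)) * (LINT x|lborel. cmod (b x)))"
proof -
  have [measurable]: "a \<in> borel_measurable borel" "b \<in> borel_measurable borel" using a b by measurable
  define K where "K = (\<lambda>y x z. exp (- (\<i> * complex_of_real (y * z))) * (a x * b (z - x)))"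
  have sh: "integrable lborel (\<lambda>z. a x * b (z - x))" for x
    by (intro integrable_mult_right integral_translate(2) b)
  have meas: "(\<lambda>(x, z). K y x z) \<in> borel_measurable (borel \<Otimes>\<^sub>M borel)" for y
    unfolding K_def by measurable
  have nrm: "(LINT z|lborel. norm (K y x z)) = cmod (a x) * (LINT z|lborel. cmod (b z))" for y x
    using integral_translate(1)[of "\<lambda>s. cmod (b s)" x] by (simp add: K_def norm_mult)
  have i2: "integrable lborel (K y x)" for x y
    unfolding K_def by (rule integrable_ft_integrand(1)[OF sh])
  have i1: "integrable lborel (\<lambda>x. LINT z|lborel. norm (K y x z))" for y
    unfolding nrm using integrable_cmod[OF a(2)] by simp
  note fub = Fubini_lborel[OF meas i1 i2]
  from fub(2)[of 0] show k: "integrable lborel k"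
    unfolding k_def by (intro integrable_scaleR_right) (simp add: K_def)
  have meas': "(\<lambda>(x, z). norm (K 0 x z)) \<in> borel_measurable (borel \<Otimes>\<^sub>M borel)"
    unfolding K_def by measurable
  have i1': "integrable lborel (\<lambda>x. LINT z|lborel. norm (norm (K 0 x z)))" using i1[of 0] by simp
  note fub' = Fubini_lborel[OF meas' i1' integrable_norm[OF i2]]
  have "(LINT z|lborel. cmod (k z)) = (1 / sqrt (2 * pi)) * (LINT z|lborel. cmod (LINT x|lborel. K 0 x z))"
    by (simp add: k_def K_def)
  also have "\<dots> \<le> (1 / sqrt (2 * pi)) * (LINT z|lborel. LINT x|lborel. norm (K 0 x z))"
  proof (intro mult_left_mono integral_mono)
    show "integrable lborel (\<lambda>z. cmod (LINT x|lborel. K 0 x z))" by (intro integrable_cmod fub)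
  qed (auto intro: fub' integral_norm_bound)
  also have "(LINT z|lborel. LINT x|lborel. norm (K 0 x z)) = (LINT x|lborel. cmod (a x)) * (LINT x|lborel. cmod (b x))"
    unfolding fub'(1)[symmetric] nrm by simp
  finally show "(LINT z|lborel. cmod (k z)) \<le> (1 / sqrt (2 * pi)) * ((LINT x|lborel. cmod (a x)) * (LINT x|lborel. cmod (b x)))" .
  have "(LINT z|lborel. K y x z) = (LINT z|lborel. exp (- (\<i> * complex_of_real (y * z))) * b z) * (exp (- (\<i> * complex_of_real (y * x))) * a x)" for x
  proof -
    have e: "exp (- (\<i> * complex_of_real (y * z))) = exp (- (\<i> * complex_of_real (y * (z - x)))) * exp (- (\<i> * complex_of_real (y * x)))" for z
      by (subst exp_mult_eq[OF refl]) (simp add: algebra_simps)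
    have "(LINT z|lborel. K y x z) = (LINT z|lborel. (\<lambda>z. (exp (- (\<i> * complex_of_real (y * z))) * b z) * (exp (- (\<i> * complex_of_real (y * x))) * a x)) (z - x))"
      unfolding K_def by (intro Bochner_Integration.integral_cong refl, subst e) (simp only: mult_ac)
    also have "\<dots> = (LINT z|lborel. (exp (- (\<i> * complex_of_real (y * z))) * b z) * (exp (- (\<i> * complex_of_real (y * x))) * a x))"
      by (rule integral_translate(1))
    finally show ?thesis by simp
  qed
  then have "(LINT z|lborel. exp (- (\<i> * complex_of_real (y * z))) * (LINT x|lborel. a x * b (z - x)))
    = (LINT z|lborel. exp (- (\<i> * complex_of_real (y * z))) * b z) * (LINT x|lborel. exp (- (\<i> * complex_of_real (y * x))) * a x)"
    using fub(1)[of y, symmetric] by (simp add: K_def)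
  then show "ft k y = ft a y * ft b y"
    by (simp add: ft_def k_def mult.commute)
  have [measurable]: "k \<in> borel_measurable borel" using borel_measurable_integrable[OF k] by simp
  define N where "N = (1 / sqrt (2 * pi)) * (norm (L2_of a) * norm (L2_of b))"
  have kN: "cmod (k z) \<le> N" for z
  proof -
    have sb: "square_int (\<lambda>x. cnj (b (z - x)))"
    proof -
      have "square_int (\<lambda>x. b (- (x - z)))" using square_int_translate[OF square_int_reflect[OF b(1)], of z] by simp
      then show ?thesis by (simp add: square_int_def)
    qed
    have "norm (L2_of (\<lambda>x. cnj (b (z - x)))) = norm (L2_of b)"
    proof -
      have "(norm (L2_of (\<lambda>x. cnj (b (z - x)))))\<^sup>2 = (LINT x|lborel. (\<lambda>x. (\<lambda>x. (cmod (b x))\<^sup>2) (- x)) (x - z))"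
        unfolding norm_L2_of[OF sb] by simp
      also have "\<dots> = (norm (L2_of b))\<^sup>2"
        unfolding norm_L2_of[OF b(1)]
        using integral_translate(1)[of "\<lambda>x. (cmod (b (- x)))\<^sup>2" z] integral_reflect_lborel(1)[of "\<lambda>x. (cmod (b x))\<^sup>2"]
        by simp
      finally show ?thesis by simp
    qed
    moreover have "cmod (LINT x|lborel. a x * cnj (cnj (b (z - x)))) \<le> norm (L2_of a) * norm (L2_of (\<lambda>x. cnj (b (z - x))))"
      by (rule L2_Cauchy_Schwarz(5)[OF a(1) sb])
    ultimately show ?thesis unfolding N_def k_def by (simp add: divide_right_mono)
  qed
  show "square_int k"
  proof (rule square_int_bound[where h = "\<lambda>z. N * cmod (k z)"])
    show "(cmod (k z))\<^sup>2 \<le> N * cmod (k z)" for z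
      unfolding power2_eq_square by (intro mult_right_mono kN) simp
  qed (use integrable_cmod[OF k] in auto)
qed

section \<open>Products and conjugates in the Wiener algebra\<close>

definition prod_L2 :: "L2 \<Rightarrow> L2 \<Rightarrow> L2" where
  "prod_L2 f g = L2_of (\<lambda>x. fun_of f x * fun_of g x)"

definition cnj_L2 :: "L2 \<Rightarrow> L2" where
  "cnj_L2 f = L2_of (\<lambda>x. cnj (fun_of f x))"

lemma square_int_cnj: "square_int f \<Longrightarrow> square_int (\<lambda>x. cnj (f x))"
  using borel_measurable_cnj[of f lborel] by (simp add: square_int_def)

lemma cnj_L2_of: "square_int f \<Longrightarrow> cnj_L2 (L2_of f) = L2_of (\<lambda>x. cnj (f x))"
  unfolding cnj_L2_def
  by (rule L2_of_cong) (use fun_of_L2_of[of f] in \<open>auto intro!: square_int_cnj square_int_fun_of elim!: eventually_mono\<close>)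

lemma cnj_L2_diff: "cnj_L2 (f - g) = cnj_L2 f - cnj_L2 g"
proof -
  obtain F G where FG: "square_int F" "f = L2_of F" "square_int G" "g = L2_of G"
    by (metis L2_cases)
  then show ?thesis by (simp add: cnj_L2_of L2_of_diff square_int_diff square_int_cnj)
qed

lemma square_int_prod:
  assumes "ess_bounded f m"
  shows "square_int (\<lambda>x. fun_of f x * fun_of g x)"
proof (rule square_int_AE_bound[where h = "\<lambda>x. m\<^sup>2 * (cmod (fun_of g x))\<^sup>2"])
  show "AE x in lborel. (cmod (fun_of f x * fun_of g x))\<^sup>2 \<le> m\<^sup>2 * (cmod (fun_of g x))\<^sup>2"
    using assms unfolding ess_bounded_def
    by eventually_elim (auto simp: norm_mult power_mult_distrib intro!: mult_right_mono power_mono)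
qed (use square_intD[OF square_int_fun_of[of g]] in auto)

lemma prod_L2_of:
  assumes f: "square_int f" and g: "square_int g" and b: "AE x in lborel. cmod (f x) \<le> m"
  shows "square_int (\<lambda>x. f x * g x)" "prod_L2 (L2_of f) (L2_of g) = L2_of (\<lambda>x. f x * g x)"
proof -
  have [measurable]: "f \<in> borel_measurable borel" "g \<in> borel_measurable borel" using f g by measurable
  have ae: "AE x in lborel. fun_of (L2_of f) x * fun_of (L2_of g) x = f x * g x"
    using fun_of_L2_of[OF f] fun_of_L2_of[OF g] by eventually_elim simp
  have s: "square_int (\<lambda>x. fun_of (L2_of f) x * fun_of (L2_of g) x)"
    using b by (intro square_int_prod[where m = m]) (simp add: ess_bounded_L2_of f)
  show s': "square_int (\<lambda>x. f x * g x)" by (rule square_int_cong[OF s _ ae]) measurable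
  show "prod_L2 (L2_of f) (L2_of g) = L2_of (\<lambda>x. f x * g x)"
    unfolding prod_L2_def by (rule L2_of_cong[OF s s' ae])
qed

lemma inA_cnj:
  assumes "inA f"
  shows "inA (cnj_L2 f)" "Anorm (cnj_L2 f) = Anorm f"
proof -
  obtain G where G: "square_int G" "fourier_L2 f = L2_of G" "inA f \<longleftrightarrow> integrable lborel G"
    "Anorm f = (1 / sqrt (2 * pi)) * (LINT \<xi>|lborel. cmod (G \<xi>))" by (rule inA_cases)
  have i: "integrable lborel G" using G(3) assms by simp
  have c: "cnj (ft G (- x)) = ft (\<lambda>x. cnj (G x)) x" for x
    unfolding ft_def by (simp add: exp_cnj flip: Bochner_Integration.integral_cnj)
  have "cnj_L2 f = L2_of (ft (\<lambda>x. cnj (G x)))"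
    by (subst inA_inversion(2)[OF G(1,2) i]) (simp add: cnj_L2_of inA_inversion(1)[OF G(1,2) i] c)
  also have "\<dots> = fourier_L2 (L2_of (\<lambda>x. cnj (G x)))"
    by (rule fourier_L2_of[symmetric]) (use G i in \<open>auto intro: square_int_cnj\<close>)
  finally have "cnj_L2 f = fourier_L2 (L2_of (\<lambda>x. cnj (G x)))" .
  then have "fourier_L2 (cnj_L2 f) = refl_L2 (L2_of (\<lambda>x. cnj (G x)))"
    by (metis refl_L2_refl refl_fourier_fourier_L2)
  also have "\<dots> = L2_of (\<lambda>x. cnj (G (- x)))"
    using G(1) by (simp add: refl_L2_of square_int_cnj)
  finally have e: "fourier_L2 (cnj_L2 f) = L2_of (\<lambda>x. cnj (G (- x)))" .
  note H = inA_fourier[OF square_int_cnj[OF square_int_reflect[OF G(1)]] e]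
  show "inA (cnj_L2 f)" unfolding H(1) using integral_reflect_lborel(2)[OF i] by simp
  show "Anorm (cnj_L2 f) = Anorm f"
    unfolding H(2) G(4) using integral_reflect_lborel(1)[of "\<lambda>x. cmod (G x)"] by simp
qed

lemma inA_prod:
  assumes f: "inA f" and g: "inA g"
  shows "inA (prod_L2 f g)" "Anorm (prod_L2 f g) \<le> Anorm f * Anorm g"
proof -
  obtain F where F: "square_int F" "fourier_L2 f = L2_of F" "inA f \<longleftrightarrow> integrable lborel F"
    "Anorm f = (1 / sqrt (2 * pi)) * (LINT \<xi>|lborel. cmod (F \<xi>))" by (rule inA_cases)
  obtain G where G: "square_int G" "fourier_L2 g = L2_of G" "inA g \<longleftrightarrow> integrable lborel G"
    "Anorm g = (1 / sqrt (2 * pi)) * (LINT \<xi>|lborel. cmod (G \<xi>))" by (rule inA_cases)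
  have i: "integrable lborel F" "integrable lborel G" using F(3) G(3) f g by auto
  define k where "k = (\<lambda>z. (1 / sqrt (2 * pi)) *\<^sub>R (LINT x|lborel. F x * G (z - x)))"
  note C = convolution[OF F(1) i(1) G(1) i(2), folded k_def]
  have C4: "(LINT z|lborel. cmod (k z)) \<le> (1 / sqrt (2 * pi)) * ((LINT x|lborel. cmod (F x)) * (LINT x|lborel. cmod (G x)))"
    unfolding k_def by (rule convolution(4)[OF F(1) i(1) G(1) i(2)])
  have "prod_L2 f g = prod_L2 (L2_of (\<lambda>x. ft F (- x))) (L2_of (\<lambda>x. ft G (- x)))"
    using inA_inversion(2)[OF F(1,2) i(1)] inA_inversion(2)[OF G(1,2) i(2)] by simp
  also have "\<dots> = L2_of (\<lambda>x. ft F (- x) * ft G (- x))"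
    by (rule prod_L2_of(2)[OF inA_inversion(1)[OF F(1,2) i(1)] inA_inversion(1)[OF G(1,2) i(2)] AE_I2[OF cmod_ft_le[OF i(1)]]])
  also have "\<dots> = refl_L2 (fourier_L2 (L2_of k))"
    using C(1,2) Plancherel_L1_L2(1)[OF C(2,1)] by (simp add: fourier_L2_of refl_L2_of C(3))
  finally have e: "fourier_L2 (prod_L2 f g) = L2_of k" by simp
  note H = inA_fourier[OF C(2) e]
  show "inA (prod_L2 f g)" using H(1) C(1) by simp
  have "Anorm (prod_L2 f g) \<le> (1 / sqrt (2 * pi)) * ((1 / sqrt (2 * pi)) * ((LINT x|lborel. cmod (F x)) * (LINT x|lborel. cmod (G x))))"
    unfolding H(2) by (rule mult_left_mono[OF C4]) simp
  also have "\<dots> = Anorm f * Anorm g" unfolding F(4) G(4) by (simp only: mult_ac)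
  finally show "Anorm (prod_L2 f g) \<le> Anorm f * Anorm g" .
qed

lemma prod_L2_commute: "prod_L2 f g = prod_L2 g f"
  by (simp add: prod_L2_def mult.commute)

lemma prod_L2_diff_right:
  assumes "inA f"
  shows "prod_L2 f (g - h) = prod_L2 f g - prod_L2 f h"
proof -
  note s = square_int_prod[OF inA_ess_bounded[OF assms]]
  have ae: "AE x in lborel. fun_of (g - h) x = fun_of g x - fun_of h x"
    using fun_of_L2_of[OF square_int_diff[OF square_int_fun_of square_int_fun_of], of g h]
    by (simp add: L2_of_fun_of flip: L2_of_diff[OF square_int_fun_of square_int_fun_of])
  show ?thesis
    unfolding prod_L2_def L2_of_diff[OF s s]
    by (rule L2_of_cong) (use ae in \<open>auto intro!: s square_int_diff simp: right_diff_distrib elim!: eventually_mono\<close>)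
qed

lemma prod_L2_diff_left:
  "inA f \<Longrightarrow> prod_L2 (g - h) f = prod_L2 g f - prod_L2 h f"
  using prod_L2_diff_right by (simp add: prod_L2_commute)

text \<open>The trilinear form of the cubic term, with the conjugate on the second argument.
  Splitting |f|^2 f into three independent factors is what allows a product rule.\<close>

definition tri_L2 :: "L2 \<Rightarrow> L2 \<Rightarrow> L2 \<Rightarrow> L2" where
  "tri_L2 f g h = prod_L2 (prod_L2 f h) (cnj_L2 g)"

lemma inA_tri:
  assumes "inA f" "inA g" "inA h"
  shows "inA (tri_L2 f g h)" "Anorm (tri_L2 f g h) \<le> Anorm f * Anorm g * Anorm h"
proof -
  note fh = inA_prod[OF assms(1,3)] and cg = inA_cnj[OF assms(2)]
  show "inA (tri_L2 f g h)" unfolding tri_L2_def by (intro inA_prod fh cg)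
  have "Anorm (tri_L2 f g h) \<le> Anorm (prod_L2 f h) * Anorm g"
    unfolding tri_L2_def using inA_prod(2)[OF fh(1) cg(1)] cg(2) by simp
  also have "\<dots> \<le> (Anorm f * Anorm h) * Anorm g" by (intro mult_right_mono fh) simp
  finally show "Anorm (tri_L2 f g h) \<le> Anorm f * Anorm g * Anorm h" by (simp add: mult_ac)
qed

lemma tri_L2_of:
  assumes F: "square_int F" "AE x in lborel. cmod (F x) \<le> a" and G: "square_int G"
    and H: "square_int H" "AE x in lborel. cmod (H x) \<le> c"
  shows "square_int (\<lambda>x. F x * H x * cnj (G x))" "tri_L2 (L2_of F) (L2_of G) (L2_of H) = L2_of (\<lambda>x. F x * H x * cnj (G x))"
proof -
  have b: "AE x in lborel. cmod (F x * H x) \<le> a * c"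
    using F(2) H(2) by eventually_elim (auto simp: norm_mult intro!: mult_mono order_trans[OF norm_ge_zero])
  note s = prod_L2_of[OF F(1) H(1) F(2)]
  show "square_int (\<lambda>x. F x * H x * cnj (G x))"
    by (rule prod_L2_of(1)[OF s(1) square_int_cnj[OF G] b])
  show "tri_L2 (L2_of F) (L2_of G) (L2_of H) = L2_of (\<lambda>x. F x * H x * cnj (G x))"
    unfolding tri_L2_def s(2) cnj_L2_of[OF G] by (rule prod_L2_of(2)[OF s(1) square_int_cnj[OF G] b])
qed

lemma fun_of_L2 [simp]: "square_int (fun_of f)" "L2_of (fun_of f) = f"
  by (simp_all add: square_int_fun_of L2_of_fun_of)

lemma cubic_tri:
  assumes "inA f"
  shows "cubic f = tri_L2 f f f"
proof -
  have b: "AE x in lborel. cmod (fun_of f x) \<le> Anorm f"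
    using inA_ess_bounded[OF assms] by (simp add: ess_bounded_def)
  have "tri_L2 f f f = L2_of (\<lambda>x. fun_of f x * fun_of f x * cnj (fun_of f x))"
    using tri_L2_of(2)[OF _ b _ _ b, of "fun_of f"] by simp
  also have "(\<lambda>x. fun_of f x * fun_of f x * cnj (fun_of f x)) = cubic_fun (fun_of f)"
    unfolding fun_eq_iff complex_norm_square by (simp add: mult_ac)
  finally show ?thesis by (simp add: cubic_def)
qed

text \<open>The three factors contribute the phases w, w and the conjugate of w, whose product is w
  because |w| = 1; translations are multiplicative.\<close>

lemma boost_tri:
  assumes "inA f" "inA g" "inA h"
  shows "boost e s (tri_L2 f g h) = tri_L2 (boost e s f) (boost e s g) (boost e s h)"
proof -
  define w where "w x = exp (\<i> * complex_of_real (e * x - e\<^sup>2 * s))" for x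
  have b: "AE x in lborel. cmod (fun_of f x) \<le> Anorm f" "AE x in lborel. cmod (fun_of h x) \<le> Anorm h"
    using inA_ess_bounded assms by (auto simp: ess_bounded_def)
  have b': "AE x in lborel. cmod (w x * fun_of f (x - 2 * e * s)) \<le> Anorm f"
      "AE x in lborel. cmod (w x * fun_of h (x - 2 * e * s)) \<le> Anorm h"
    using AE_translate[OF b(1), of "2 * e * s"] AE_translate[OF b(2), of "2 * e * s"]
    by (auto simp: norm_mult w_def elim!: eventually_mono)
  note s = square_int_fun_of
  note bF = boost_L2_of[of _ e s, folded w_def] and sF = square_int_boost[of _ e s, folded w_def]
  have bo: "boost e s k = L2_of (\<lambda>x. w x * fun_of k (x - 2 * e * s))" for k
    using bF[OF s[of k]] by simp
  have w1: "w x * cnj (w x) = 1" for x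
    using complex_norm_square[of "w x", symmetric] by (simp add: w_def)
  have "tri_L2 f g h = L2_of (\<lambda>x. fun_of f x * fun_of h x * cnj (fun_of g x))"
    using tri_L2_of(2)[OF s b(1) s s b(2), of g] by simp
  then have "boost e s (tri_L2 f g h) = L2_of (\<lambda>x. w x * (fun_of f (x - 2 * e * s) * fun_of h (x - 2 * e * s) * cnj (fun_of g (x - 2 * e * s))))"
    using bF[OF tri_L2_of(1)[OF s b(1) s s b(2), of g]] by simp
  also have "(\<lambda>x. w x * (fun_of f (x - 2 * e * s) * fun_of h (x - 2 * e * s) * cnj (fun_of g (x - 2 * e * s))))
     = (\<lambda>x. (w x * fun_of f (x - 2 * e * s)) * (w x * fun_of h (x - 2 * e * s)) * cnj (w x * fun_of g (x - 2 * e * s)))"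
  proof
    fix x
    have "(w x * fun_of f (x - 2 * e * s)) * (w x * fun_of h (x - 2 * e * s)) * cnj (w x * fun_of g (x - 2 * e * s))
      = (w x * cnj (w x)) * (w x * (fun_of f (x - 2 * e * s) * fun_of h (x - 2 * e * s) * cnj (fun_of g (x - 2 * e * s))))"
      by (simp only: complex_cnj_mult mult_ac)
    then show "w x * (fun_of f (x - 2 * e * s) * fun_of h (x - 2 * e * s) * cnj (fun_of g (x - 2 * e * s)))
     = (w x * fun_of f (x - 2 * e * s)) * (w x * fun_of h (x - 2 * e * s)) * cnj (w x * fun_of g (x - 2 * e * s))"
      unfolding w1 by simp
  qed
  also have "L2_of \<dots> = tri_L2 (boost e s f) (boost e s g) (boost e s h)"
    unfolding bo by (rule tri_L2_of(2)[OF sF[OF s] b'(1) sF[OF s] sF[OF s] b'(2), symmetric])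
  finally show ?thesis .
qed

lemma tri_diff:
  assumes "inA f" "inA g" "inA h" "inA f'" "inA g'" "inA h'"
  shows "tri_L2 f' g' h' - tri_L2 f g h = tri_L2 (f' - f) g' h' + tri_L2 f (g' - g) h' + tri_L2 f g (h' - h)"
  unfolding tri_L2_def using assms
  by (simp add: prod_L2_diff_left prod_L2_diff_right cnj_L2_diff inA_prod inA_cnj)

section \<open>Boost differences\<close>

definition bdiff :: "real \<Rightarrow> real \<Rightarrow> L2 \<Rightarrow> L2" where
  "bdiff e s f = boost e s f - f"

lemma bounded_linear_bdiff: "bounded_linear (bdiff e s)"
  unfolding bdiff_def by (intro bounded_linear_sub bounded_linear_boost bounded_linear_ident)

lemma bounded_linear_bdiff_power: "bounded_linear (bdiff e s ^^ n)"
proof (induction n)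
  case 0
  then show ?case by (simp add: id_def)
next
  case (Suc n)
  then show ?case unfolding funpow.simps o_def by (rule bounded_linear_compose[OF bounded_linear_bdiff])
qed

lemma bdiff_boost: "bdiff e s (boost e s f) = boost e s (bdiff e s f)"
  using bounded_linear_boost[of e s] by (simp add: bdiff_def linear_simps)

lemma bdiff_power_boost: "(bdiff e s ^^ n) (boost e s f) = boost e s ((bdiff e s ^^ n) f)"
  by (induction n) (simp_all add: bdiff_boost)

lemma schroedinger_bdiff: "schroedinger_group t (bdiff e s f) = bdiff e (s + t) (schroedinger_group t f)"
  using bounded_linear_schroedinger[of t] by (simp add: bdiff_def linear_simps schroedinger_boost)

lemma schroedinger_bdiff_power: "schroedinger_group t ((bdiff e s ^^ n) f) = (bdiff e (s + t) ^^ n) (schroedinger_group t f)"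
  by (induction n) (simp_all add: schroedinger_bdiff)

lemma inA_bdiff_power: "inA f \<Longrightarrow> inA ((bdiff e s ^^ n) f)"
  by (induction n) (auto simp: bdiff_def intro: inA_diff)

text \<open>The exponential generating function of the norms of iterated boost differences. A
  further difference becomes the formal derivative and a boost leaves the series unchanged, so the
  combinatorics of the product rule is left to multiplication of power series.\<close>

definition Aseries :: "real \<Rightarrow> real \<Rightarrow> L2 \<Rightarrow> real fps" where
  "Aseries e s f = Abs_fps (\<lambda>n. Anorm ((bdiff e s ^^ n) f) / fact n)"

lemma Aseries_boost: "Aseries e s (boost e s f) = Aseries e s f"
  by (simp add: Aseries_def bdiff_power_boost)

lemma Aseries_bdiff: "Aseries e s (bdiff e s f) = fps_deriv (Aseries e s f)"
proof (rule fps_ext)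
  fix n
  have "real (Suc n) * (a / fact (Suc n)) = a / fact n" for a :: real
    by (simp del: of_nat_Suc)
  then show "fps_nth (Aseries e s (bdiff e s f)) n = fps_nth (fps_deriv (Aseries e s f)) n"
    by (simp add: Aseries_def funpow_swap1 del: of_nat_Suc fact_Suc)
qed

text \<open>Telescoping gives a discrete product rule in which some factors are boosted. Boosts do
  not change \<open>Aseries\<close>, so after applying the induction hypothesis to the three terms
  their sum is the derivative of the product of the series.\<close>

lemma Anorm_bdiff_power_tri:
  assumes "inA f" "inA g" "inA h"
  shows "Anorm ((bdiff e s ^^ n) (tri_L2 f g h)) / fact n \<le> fps_nth (Aseries e s f * Aseries e s g * Aseries e s h) n"
  using assms
proof (induction n arbitrary: f g h)
  case 0
  then show ?case using inA_tri(2)[of f g h] by (simp add: Aseries_def)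
next
  case (Suc n)
  interpret P: bounded_linear "bdiff e s ^^ n" by (rule bounded_linear_bdiff_power)
  let ?B = "boost e s" and ?D = "bdiff e s" and ?X = "Aseries e s"
  have D: "inA (?D k)" if "inA k" for k using inA_bdiff_power[OF that, where n = 1 and e = e and s = s] by simp
  have "?D (tri_L2 f g h) = tri_L2 (?D f) (?B g) (?B h) + tri_L2 f (?D g) (?B h) + tri_L2 f g (?D h)"
    unfolding bdiff_def boost_tri[OF Suc.prems] by (rule tri_diff) (use Suc.prems in auto)
  then have e: "(?D ^^ Suc n) (tri_L2 f g h)
    = (?D ^^ n) (tri_L2 (?D f) (?B g) (?B h)) + (?D ^^ n) (tri_L2 f (?D g) (?B h)) + (?D ^^ n) (tri_L2 f g (?D h))"
    by (simp only: funpow_Suc_right o_apply P.add)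
  note i1 = inA_bdiff_power[OF inA_tri(1)[of "?D f" "?B g" "?B h"]]
   and i2 = inA_bdiff_power[OF inA_tri(1)[of f "?D g" "?B h"]]
   and i3 = inA_bdiff_power[OF inA_tri(1)[of f g "?D h"]]
  have "Anorm ((?D ^^ Suc n) (tri_L2 f g h)) \<le> Anorm ((?D ^^ n) (tri_L2 (?D f) (?B g) (?B h)))
     + Anorm ((?D ^^ n) (tri_L2 f (?D g) (?B h))) + Anorm ((?D ^^ n) (tri_L2 f g (?D h)))"
    unfolding e
    by (intro order_trans[OF inA_add(2)] add_right_mono inA_add i1 i2 i3) (use Suc.prems D in auto)
  also have "\<dots> / fact n \<le> fps_nth (fps_deriv (?X f) * ?X g * ?X h) n + fps_nth (?X f * fps_deriv (?X g) * ?X h) n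
      + fps_nth (?X f * ?X g * fps_deriv (?X h)) n"
    unfolding add_divide_distrib
    using Suc.IH[of "?D f" "?B g" "?B h"] Suc.IH[of f "?D g" "?B h"] Suc.IH[of f g "?D h"] Suc.prems D
    by (simp add: Aseries_boost Aseries_bdiff)
  also have "\<dots> = fps_nth (fps_deriv (?X f * ?X g * ?X h)) n"
    by (simp add: algebra_simps)
  also have "\<dots> = real (Suc n) * fps_nth (?X f * ?X g * ?X h) (Suc n)"
    by (simp only: fps_deriv_nth) simp
  finally have "Anorm ((?D ^^ Suc n) (tri_L2 f g h)) / fact n \<le> real (Suc n) * fps_nth (?X f * ?X g * ?X h) (Suc n)"
    by (simp add: divide_right_mono)
  then show ?case by (simp add: field_simps del: funpow.simps of_nat_Suc)
qed

section \<open>Sobolev regularity and decay of the data\<close>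

lemma integrable_inverse_1_square:
  "integrable lborel (\<lambda>x::real. 1 / (1 + x\<^sup>2))" "(LINT x|lborel. 1 / (1 + x\<^sup>2)) = pi"
proof -
  have e: "einterval (-\<infinity>) \<infinity> = UNIV" by (auto simp: einterval_def)
  show "integrable lborel (\<lambda>x::real. 1 / (1 + x\<^sup>2))"
    using integrable_inverse_1_plus_square unfolding set_integrable_def e by (simp add: inverse_eq_divide)
  show "(LINT x|lborel. 1 / (1 + x\<^sup>2)) = pi"
    using LBINT_inverse_1_plus_square
    unfolding interval_lebesgue_integral_def set_lebesgue_integral_def e by (simp add: inverse_eq_divide)
qed

lemma integrable_exp_abs:
  assumes k: "k > 0"
  shows "integrable lborel (\<lambda>x::real. exp (- k * \<bar>x\<bar>))"
proof (rule Bochner_Integration.integrable_bound)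
  show "integrable lborel (\<lambda>x::real. (1 + 2 / k\<^sup>2) * (1 / (1 + x\<^sup>2)))"
    by (intro integrable_mult_right integrable_inverse_1_square)
  have "exp (- k * \<bar>x\<bar>) \<le> (1 + 2 / k\<^sup>2) * (1 / (1 + x\<^sup>2))" for x :: real
  proof -
    have "1 + k * \<bar>x\<bar> + (k * \<bar>x\<bar>)\<^sup>2 / 2 \<le> exp (k * \<bar>x\<bar>)"
      by (rule exp_lower_Taylor_quadratic) (use k in auto)
    moreover have "0 \<le> k * \<bar>x\<bar>" "(k * \<bar>x\<bar>)\<^sup>2 = k\<^sup>2 * x\<^sup>2" "0 \<le> k\<^sup>2 * x\<^sup>2" using k by (auto simp: power_mult_distrib)
    ultimately have e: "k\<^sup>2 * x\<^sup>2 / 2 \<le> exp (k * \<bar>x\<bar>)" "1 \<le> exp (k * \<bar>x\<bar>)" by linarith+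
    have "x\<^sup>2 = (2 / k\<^sup>2) * (k\<^sup>2 * x\<^sup>2 / 2)" using k by simp
    also have "\<dots> \<le> (2 / k\<^sup>2) * exp (k * \<bar>x\<bar>)" using e(1) k by (intro mult_left_mono) auto
    finally have "1 + x\<^sup>2 \<le> (1 + 2 / k\<^sup>2) * exp (k * \<bar>x\<bar>)" unfolding distrib_right using e(2) by linarith
    then show ?thesis by (simp add: exp_minus divide_simps add_pos_nonneg mult.commute)
  qed
  then show "AE x in lborel. norm (exp (- k * \<bar>x\<bar>)) \<le> norm ((1 + 2 / k\<^sup>2) * (1 / (1 + x\<^sup>2)))"
    by (auto intro: order_trans[OF _ abs_ge_self])
qed measurable

text \<open>Takes the place of Cauchy-Schwarz under an integral: m is free, so the integrals of the
  two terms can be balanced afterwards.\<close>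

lemma AM_GM_weighted: "m > 0 \<Longrightarrow> a \<le> (m * b + a\<^sup>2 / (m * b)) / 2" if "b > 0" for a b m :: real
proof -
  assume m: "m > 0"
  have "0 \<le> (m * b - a)\<^sup>2" by simp
  then have "2 * (m * b) * a \<le> (m * b)\<^sup>2 + a\<^sup>2" by (simp add: power2_diff)
  moreover have "2 * (m * b) * a = 2 * (a * (m * b))" by simp
  ultimately have "2 * (a * (m * b)) \<le> (m * b)\<^sup>2 + a\<^sup>2" by simp
  then have "2 * a \<le> ((m * b)\<^sup>2 + a\<^sup>2) / (m * b)" using that m by (simp add: pos_le_divide_eq mult.assoc)
  also have "\<dots> = m * b + a\<^sup>2 / (m * b)" using that m by (simp add: power2_eq_square add_divide_distrib)
  finally show ?thesis by simp
qed

lemma H1_energy: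
  assumes G: "square_int G" and xG: "square_int (\<lambda>\<xi>. of_real \<xi> * G \<xi>)"
  shows "integrable lborel (\<lambda>\<xi>. (1 + \<xi>\<^sup>2) * (cmod (G \<xi>))\<^sup>2)"
    and "(LINT \<xi>|lborel. (1 + \<xi>\<^sup>2) * (cmod (G \<xi>))\<^sup>2) = (norm (L2_of G))\<^sup>2 + (norm (L2_of (\<lambda>\<xi>. of_real \<xi> * G \<xi>)))\<^sup>2"
proof -
  have e: "(\<lambda>\<xi>. (1 + \<xi>\<^sup>2) * (cmod (G \<xi>))\<^sup>2) = (\<lambda>\<xi>. (cmod (G \<xi>))\<^sup>2 + (cmod (of_real \<xi> * G \<xi>))\<^sup>2)"
    by (simp add: fun_eq_iff norm_mult power_mult_distrib distrib_right)
  show "integrable lborel (\<lambda>\<xi>. (1 + \<xi>\<^sup>2) * (cmod (G \<xi>))\<^sup>2)"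
    unfolding e by (intro Bochner_Integration.integrable_add square_intD G xG)
  show "(LINT \<xi>|lborel. (1 + \<xi>\<^sup>2) * (cmod (G \<xi>))\<^sup>2) = (norm (L2_of G))\<^sup>2 + (norm (L2_of (\<lambda>\<xi>. of_real \<xi> * G \<xi>)))\<^sup>2"
    unfolding e norm_L2_of[OF G] norm_L2_of[OF xG]
    by (rule Bochner_Integration.integral_add[OF square_intD[OF G] square_intD[OF xG]])
qed

lemma H1_inA:
  assumes G: "square_int G" and xG: "square_int (\<lambda>\<xi>. of_real \<xi> * G \<xi>)"
  shows "integrable lborel G"
    and "(LINT \<xi>|lborel. cmod (G \<xi>)) \<le> (pi + (norm (L2_of G))\<^sup>2 + (norm (L2_of (\<lambda>\<xi>. of_real \<xi> * G \<xi>)))\<^sup>2) / 2"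
proof -
  have [measurable]: "G \<in> borel_measurable borel" using G by measurable
  note E = H1_energy[OF G xG]
  have le: "cmod (G \<xi>) \<le> (1 / (1 + \<xi>\<^sup>2) + (1 + \<xi>\<^sup>2) * (cmod (G \<xi>))\<^sup>2) / 2" for \<xi>
  proof -
    have p: "1 / (1 + \<xi>\<^sup>2) > 0" by (simp add: add_pos_nonneg)
    show ?thesis using AM_GM_weighted[OF p, of 1 "cmod (G \<xi>)"] by (simp add: mult.commute)
  qed
  have i: "integrable lborel (\<lambda>\<xi>. (1 / (1 + \<xi>\<^sup>2) + (1 + \<xi>\<^sup>2) * (cmod (G \<xi>))\<^sup>2) / 2)"
    by (intro integrable_divide_zero Bochner_Integration.integrable_add integrable_inverse_1_square E(1))
  show iG: "integrable lborel G"
    by (rule Bochner_Integration.integrable_bound[OF i]) (use le in \<open>auto intro: order_trans[OF _ abs_ge_self]\<close>)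
  have "(LINT \<xi>|lborel. cmod (G \<xi>)) \<le> (LINT \<xi>|lborel. (1 / (1 + \<xi>\<^sup>2) + (1 + \<xi>\<^sup>2) * (cmod (G \<xi>))\<^sup>2) / 2)"
    by (intro integral_mono integrable_cmod iG i le)
  also have "\<dots> = (pi + ((norm (L2_of G))\<^sup>2 + (norm (L2_of (\<lambda>\<xi>. of_real \<xi> * G \<xi>)))\<^sup>2)) / 2"
    unfolding integral_divide_zero E(2)[symmetric]
    by (subst Bochner_Integration.integral_add) (auto simp: integrable_inverse_1_square E(1))
  finally show "(LINT \<xi>|lborel. cmod (G \<xi>)) \<le> (pi + (norm (L2_of G))\<^sup>2 + (norm (L2_of (\<lambda>\<xi>. of_real \<xi> * G \<xi>)))\<^sup>2) / 2"
    by (simp add: add.assoc)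
qed

lemma iexp_minus_1_le: "cmod (exp (\<i> * of_real s) - 1) \<le> \<bar>s\<bar>"
  using iexp_approx1[of s 0] by simp

text \<open>The squared modulus is at most 4 and at most s^2; adding s^2 times the first bound to
  the second gives the constant 5. The right-hand side, taken at s = h xi, has an explicit integral
  after division by xi^2.\<close>

lemma iexp_minus_1_square_le: "(cmod (exp (\<i> * of_real s) - 1))\<^sup>2 \<le> 5 * s\<^sup>2 / (1 + s\<^sup>2)"
proof -
  define b where "b = cmod (exp (\<i> * of_real s) - 1)"
  have "b \<le> 2" unfolding b_def by (rule order_trans[OF norm_triangle_ineq4]) simp
  then have "b\<^sup>2 \<le> 2\<^sup>2" by (intro power_mono) (auto simp: b_def)
  then have "b\<^sup>2 * s\<^sup>2 \<le> 4 * s\<^sup>2" by (intro mult_right_mono) auto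
  moreover have "b\<^sup>2 \<le> s\<^sup>2" unfolding b_def using power_mono[OF iexp_minus_1_le, of s 2] by simp
  ultimately have "b\<^sup>2 * (1 + s\<^sup>2) \<le> 5 * s\<^sup>2" by (simp add: distrib_left)
  then show ?thesis unfolding b_def by (simp add: pos_le_divide_eq add_pos_nonneg)
qed

text \<open>The Sobolev embedding into Hoelder exponent 1/2: the difference is at most the integral
  of |G| |exp (i h xi) - 1|, which is split between the H^1 energy of G and the integral of h^2 / (1
  + (h xi)^2).\<close>

lemma H1_Hoelder:
  assumes G: "square_int G" and xG: "square_int (\<lambda>\<xi>. of_real \<xi> * G \<xi>)"
  obtains C where "C \<ge> 0" "\<And>x y. cmod (ft G x - ft G y) \<le> C * sqrt \<bar>x - y\<bar>"
proof -
  have [measurable]: "G \<in> borel_measurable borel" using G by measurable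
  note E = H1_energy[OF G xG] and I = H1_inA[OF G xG]
  define E0 where "E0 = (LINT \<xi>|lborel. (1 + \<xi>\<^sup>2) * (cmod (G \<xi>))\<^sup>2)"
  have E0: "E0 \<ge> 0" unfolding E0_def by (intro Bochner_Integration.integral_nonneg) auto
  define C where "C = (1 / sqrt (2 * pi)) * ((E0 + 5 * pi) / 2)"
  have "cmod (ft G x - ft G y) \<le> C * sqrt \<bar>x - y\<bar>" for x y
  proof (cases "x = y")
    case False
    define h where "h = y - x"
    have h: "h \<noteq> 0" using False by (simp add: h_def)
    \<comment> \<open>The balance in the weighted inequality: the energy enters with factor l, and
      the other integral is 5 pi |h| / l = 5 pi l.\<close>
    define l where "l = sqrt \<bar>h\<bar>"
    have l: "l > 0" using h by (simp add: l_def)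
    define b where "b \<xi> = cmod (exp (\<i> * complex_of_real (h * \<xi>)) - 1)" for \<xi>
    have scal: "integrable lborel (\<lambda>\<xi>. 1 / (1 + (h * \<xi>)\<^sup>2))" "(LINT \<xi>|lborel. 1 / (1 + (h * \<xi>)\<^sup>2)) = pi / \<bar>h\<bar>"
    proof -
      show "integrable lborel (\<lambda>\<xi>. 1 / (1 + (h * \<xi>)\<^sup>2))"
        using lborel_integrable_real_affine[OF integrable_inverse_1_square(1) h, of 0] by simp
      have "pi = \<bar>h\<bar> * (LINT \<xi>|lborel. 1 / (1 + (h * \<xi>)\<^sup>2))"
        using lborel_integral_real_affine[OF h, of "\<lambda>x. 1 / (1 + x\<^sup>2)" 0] by (simp add: integrable_inverse_1_square)
      then show "(LINT \<xi>|lborel. 1 / (1 + (h * \<xi>)\<^sup>2)) = pi / \<bar>h\<bar>" using h by (simp add: field_simps)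
    qed
    have le: "cmod (G \<xi>) * b \<xi> \<le> (l * ((1 + \<xi>\<^sup>2) * (cmod (G \<xi>))\<^sup>2) + (5 * h\<^sup>2 / l) * (1 / (1 + (h * \<xi>)\<^sup>2))) / 2" for \<xi>
    proof (cases "G \<xi> = 0")
      case False
      define q where "q = (1 + \<xi>\<^sup>2) * (cmod (G \<xi>))\<^sup>2"
      have q: "q > 0" using False by (simp add: q_def add_pos_nonneg)
      have "(cmod (G \<xi>) * b \<xi>)\<^sup>2 / (l * q) = (b \<xi>)\<^sup>2 / (l * (1 + \<xi>\<^sup>2))"
        using False by (simp add: q_def power_mult_distrib)
      also have "\<dots> \<le> (5 * (h * \<xi>)\<^sup>2 / (1 + (h * \<xi>)\<^sup>2)) / (l * (1 + \<xi>\<^sup>2))"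
        unfolding b_def using l by (intro divide_right_mono iexp_minus_1_square_le) auto
      also have "\<dots> = (5 * h\<^sup>2 / l) * (1 / (1 + (h * \<xi>)\<^sup>2)) * (\<xi>\<^sup>2 / (1 + \<xi>\<^sup>2))"
        by (simp add: power_mult_distrib mult_ac)
      also have "\<dots> \<le> (5 * h\<^sup>2 / l) * (1 / (1 + (h * \<xi>)\<^sup>2)) * 1"
        using l by (intro mult_left_mono) (auto simp: divide_le_eq_1 add_pos_nonneg)
      finally have "(cmod (G \<xi>) * b \<xi>)\<^sup>2 / (l * q) \<le> (5 * h\<^sup>2 / l) * (1 / (1 + (h * \<xi>)\<^sup>2))" by simp
      then show ?thesis using AM_GM_weighted[OF q l, of "cmod (G \<xi>) * b \<xi>"] by (simp add: q_def)
    qed (use l in simp)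
    have i: "integrable lborel (\<lambda>\<xi>. (l * ((1 + \<xi>\<^sup>2) * (cmod (G \<xi>))\<^sup>2) + (5 * h\<^sup>2 / l) * (1 / (1 + (h * \<xi>)\<^sup>2))) / 2)"
      by (intro integrable_divide_zero Bochner_Integration.integrable_add integrable_mult_right scal E(1))
    have ib: "integrable lborel (\<lambda>\<xi>. cmod (G \<xi>) * b \<xi>)"
      by (rule Bochner_Integration.integrable_bound[OF i]) (use le in \<open>auto simp: b_def intro: order_trans[OF _ abs_ge_self]\<close>)
    have "ft G x - ft G y = (1 / sqrt (2 * pi)) *\<^sub>R (LINT \<xi>|lborel. exp (- (\<i> * of_real (x * \<xi>))) * G \<xi> - exp (- (\<i> * of_real (y * \<xi>))) * G \<xi>)"
      unfolding ft_def scaleR_right_diff_distrib[symmetric]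
      by (subst Bochner_Integration.integral_diff, (rule integrable_ft_integrand(1)[OF I(1)])+, rule refl)
    then have "cmod (ft G x - ft G y) = (1 / sqrt (2 * pi)) * cmod (LINT \<xi>|lborel. exp (- (\<i> * of_real (x * \<xi>))) * G \<xi> - exp (- (\<i> * of_real (y * \<xi>))) * G \<xi>)"
      by simp
    also have "\<dots> \<le> (1 / sqrt (2 * pi)) * (LINT \<xi>|lborel. cmod (exp (- (\<i> * of_real (x * \<xi>))) * G \<xi> - exp (- (\<i> * of_real (y * \<xi>))) * G \<xi>))"
      by (intro mult_left_mono integral_norm_bound) simp
    also have "(\<lambda>\<xi>. cmod (exp (- (\<i> * of_real (x * \<xi>))) * G \<xi> - exp (- (\<i> * of_real (y * \<xi>))) * G \<xi>)) = (\<lambda>\<xi>. cmod (G \<xi>) * b \<xi>)"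
    proof
      fix \<xi>
      have "exp (- (\<i> * of_real (y * \<xi>))) * exp (\<i> * complex_of_real (h * \<xi>)) = exp (- (\<i> * of_real (x * \<xi>)))"
        by (rule exp_mult_eq) (simp add: h_def algebra_simps)
      then have "exp (- (\<i> * of_real (x * \<xi>))) * G \<xi> - exp (- (\<i> * of_real (y * \<xi>))) * G \<xi>
          = exp (- (\<i> * of_real (y * \<xi>))) * (G \<xi> * (exp (\<i> * complex_of_real (h * \<xi>)) - 1))"
        by (simp add: algebra_simps del: of_real_mult)
      then show "cmod (exp (- (\<i> * of_real (x * \<xi>))) * G \<xi> - exp (- (\<i> * of_real (y * \<xi>))) * G \<xi>) = cmod (G \<xi>) * b \<xi>"
        by (simp add: norm_mult b_def)
    qed
    also have "(LINT \<xi>|lborel. cmod (G \<xi>) * b \<xi>) \<le> (LINT \<xi>|lborel. (l * ((1 + \<xi>\<^sup>2) * (cmod (G \<xi>))\<^sup>2) + (5 * h\<^sup>2 / l) * (1 / (1 + (h * \<xi>)\<^sup>2))) / 2)"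
      by (intro integral_mono ib i le)
    also have "\<dots> = (l * E0 + (5 * h\<^sup>2 / l) * (pi / \<bar>h\<bar>)) / 2"
      unfolding integral_divide_zero
      by (subst Bochner_Integration.integral_add) (auto simp: scal E(1) E0_def simp del: times_divide_eq_right)
    also have "(5 * h\<^sup>2 / l) * (pi / \<bar>h\<bar>) = 5 * pi * l"
    proof -
      have hl: "\<bar>h\<bar> = l * l" by (simp add: l_def)
      then have "h\<^sup>2 = (l * l) * (l * l)" by (metis abs_mult_self_eq power2_eq_square)
      then show ?thesis unfolding hl using l by simp
    qed
    finally show ?thesis by (simp add: C_def l_def h_def abs_minus_commute distrib_right mult_left_mono field_simps)
  qed simp
  moreover have "C \<ge> 0" using E0 by (simp add: C_def)
  ultimately show ?thesis using that by blast
qed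

section \<open>Exponential decay from zeros on a logarithmic grid\<close>

lemma log_grid_gap:
  fixes \<alpha> c x :: real
  assumes \<alpha>: "0 < \<alpha>" "\<alpha> < 1" and c: "c > 0" and x: "x \<ge> c"
  obtains n :: nat where "c * ln (1 + real n) powr \<alpha> \<le> x" "x - c * ln (1 + real n) powr \<alpha> \<le> 4 * c * exp (- x / c)"
proof -
  define y where "y = (x / c) powr (1 / \<alpha>)"
  have xc: "x / c \<ge> 1" using x c by simp
  have "(x / c) powr 1 \<le> (x / c) powr (1 / \<alpha>)" using xc \<alpha> by (intro powr_mono) auto
  moreover have "(x / c) powr 1 = x / c" using xc by (intro powr_one) linarith
  ultimately have y: "x / c \<le> y" unfolding y_def by linarith
  then have "y \<ge> 1" using xc by linarith
  note y = y this
  have "x > 0" using x c by linarith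
  then have ya: "y powr \<alpha> = x / c" using c \<alpha> by (simp add: y_def powr_powr)
  \<comment> \<open>Since y = (x/c)^(1/\<alpha>), the grid points built from ln N and ln (N + 1)
    enclose x. Their gap is O(1/N) = O(exp (-y)), and y >= x/c because x/c >= 1 and 1/\<alpha> > 1.
    The index used at the end is N - 1, as the grid has ln (1 + n).\<close>
  define N where "N = nat \<lfloor>exp y\<rfloor>"
  have e2: "exp y \<ge> 2" using exp_ge_add_one_self[of y] y by linarith
  have N: "real N \<le> exp y" "exp y < real N + 1" "N \<ge> 2"
    using e2 by (auto simp: N_def le_nat_floor)
  define p q where "p = ln (real N)" and "q = ln (real N + 1)"
  have "ln 2 \<le> p" using N by (simp add: p_def)
  then have p: "p \<ge> 1 / 2" using ln2_ge_two_thirds by linarith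
  have "p \<le> y" using N unfolding p_def by (metis exp_gt_zero ln_exp ln_le_cancel_iff of_nat_0_less_iff pos2 less_le_trans)
  then have 1: "p powr \<alpha> \<le> x / c" using p \<alpha> unfolding ya[symmetric] by (intro powr_mono2) auto
  have "y < q" using N unfolding q_def by (metis exp_gt_zero ln_exp ln_less_cancel_iff less_trans)
  then have 2: "x / c \<le> q powr \<alpha>" using y \<alpha> unfolding ya[symmetric] by (intro powr_mono2) auto
  have qp: "q - p \<le> 1 / real N"
  proof -
    have "1 + 1 / real N = (real N + 1) / real N" using N by (simp add: field_simps)
    moreover have "ln ((real N + 1) / real N) = q - p" unfolding p_def q_def using N by (intro ln_divide_pos) auto
    ultimately have "q - p = ln (1 + 1 / real N)" by simp
    also have "\<dots> \<le> 1 / real N" by (rule ln_add_one_self_le_self) simp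
    finally show ?thesis .
  qed
  have "p \<le> q" using N by (simp add: p_def q_def)
  have pp: "p powr \<alpha> / p \<le> 2"
  proof (cases "p \<ge> 1")
    case True
    then have "p powr \<alpha> \<le> p powr 1" using \<alpha> by (intro powr_mono) auto
    then show ?thesis using True by (simp add: divide_le_eq)
  next
    case False
    then have "p powr \<alpha> \<le> 1 powr \<alpha>" using p \<alpha> by (intro powr_mono2) auto
    then show ?thesis using p by (simp add: divide_le_eq)
  qed
  have "q powr \<alpha> = p powr \<alpha> * (q / p) powr \<alpha>" using p \<open>p \<le> q\<close> by (simp add: powr_divide)
  also have "(q / p) powr \<alpha> \<le> (q / p) powr 1" using p \<open>p \<le> q\<close> \<alpha> by (intro powr_mono) auto
  finally have "q powr \<alpha> \<le> p powr \<alpha> * (q / p)" using p \<open>p \<le> q\<close> by (simp add: mult_left_mono)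
  then have "q powr \<alpha> - p powr \<alpha> \<le> (p powr \<alpha> / p) * (q - p)" using p by (simp add: field_simps)
  also have "\<dots> \<le> 2 * (1 / real N)" using qp pp \<open>p \<le> q\<close> p by (intro mult_mono) auto
  also have "1 / real N \<le> 2 / (real N + 1)" using N by (simp add: field_simps)
  also have "2 / (real N + 1) \<le> 2 / exp y" using N by (intro divide_left_mono) auto
  also have "\<dots> \<le> 2 * exp (- x / c)" using y by (simp add: exp_minus divide_simps)
  finally have 3: "q powr \<alpha> - p powr \<alpha> \<le> 4 * exp (- x / c)" by simp
  show ?thesis
  proof (rule that[of "N - 1"])
    have n: "ln (1 + real (N - 1)) = p" using N by (simp add: p_def of_nat_diff)
    show "c * ln (1 + real (N - 1)) powr \<alpha> \<le> x" unfolding n using 1 c by (simp add: field_simps)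
    have "x / c - p powr \<alpha> \<le> 4 * exp (- x / c)" using 2 3 by linarith
    then have "c * (x / c - p powr \<alpha>) \<le> c * (4 * exp (- x / c))" using c by (intro mult_left_mono) auto
    then show "x - c * ln (1 + real (N - 1)) powr \<alpha> \<le> 4 * c * exp (- x / c)"
      unfolding n using c by (simp add: right_diff_distrib mult_ac)
  qed
qed

text \<open>A zero lies within 4 c exp(-x/c) of x, so Hoelder exponent 1/2 gives half that
  exponential rate.\<close>

lemma grid_zeros_decay:
  fixes v :: "real \<Rightarrow> complex"
  assumes \<alpha>: "0 < \<alpha>" "\<alpha> < 1" and c: "c > 0" and M: "\<And>x. cmod (v x) \<le> M"
    and C: "C \<ge> 0" "\<And>x y. cmod (v x - v y) \<le> C * sqrt \<bar>x - y\<bar>"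
    and z: "\<And>n :: nat. v (c * ln (1 + real n) powr \<alpha>) = 0"
    and x: "x \<ge> 0"
  shows "cmod (v x) \<le> (2 * M + C * sqrt (4 * c)) * exp (- (1 / (2 * c)) * x)"
proof -
  have M0: "M \<ge> 0" using M[of 0] norm_ge_zero order_trans by blast
  define E where "E = exp (- (1 / (2 * c)) * x)"
  show ?thesis
  proof (cases "x \<ge> c")
    case True
    from log_grid_gap[OF \<alpha> c True] obtain n :: nat where
      n: "c * ln (1 + real n) powr \<alpha> \<le> x" "x - c * ln (1 + real n) powr \<alpha> \<le> 4 * c * exp (- x / c)" by blast
    have "cmod (v x) = cmod (v x - v (c * ln (1 + real n) powr \<alpha>))" by (simp add: z)
    also have "\<dots> \<le> C * sqrt \<bar>x - c * ln (1 + real n) powr \<alpha>\<bar>" by (rule C)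
    also have "\<dots> \<le> C * sqrt (4 * c * exp (- x / c))" using n C(1) by (intro mult_left_mono) auto
    also have "exp (- x / c) = E\<^sup>2" using c by (simp add: E_def power2_eq_square flip: exp_add)
    also have "sqrt (4 * c * E\<^sup>2) = sqrt (4 * c) * E" by (simp add: real_sqrt_mult E_def)
    also have "C * (sqrt (4 * c) * E) \<le> (2 * M + C * sqrt (4 * c)) * E"
      using M0 by (simp add: distrib_right E_def)
    finally show ?thesis by (simp add: E_def)
  next
    case False
    \<comment> \<open>Below c no grid point is sought: the exponential is still at least exp (-1/2)
      >= 1/2, so the summand 2 M of the constant covers the sup bound.\<close>
    have "- (1/2) \<le> - (1 / (2 * c)) * x" using False c by (simp add: field_simps)
    then have "exp (- (1/2)) \<le> E" unfolding E_def by (simp only: exp_le_cancel_iff)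
    moreover have "1 / 2 \<le> exp (- (1/2 :: real))" using exp_ge_add_one_self[of "- (1/2) :: real"] by simp
    ultimately have "1 \<le> 2 * E" by linarith
    then have "M * 1 \<le> M * (2 * E)" using M0 by (intro mult_left_mono)
    also have "\<dots> \<le> (2 * M + C * sqrt (4 * c)) * E"
      using C(1) c by (simp add: distrib_right E_def)
    finally show ?thesis using M[of x] by (simp add: E_def)
  qed
qed

text \<open>Bernstein's theorem: a Hoelder exponent above \<open>1/2\<close> in \<open>L\<^sup>2\<close> gives an integrable
  Fourier transform. The dyadic shell \<open>|\<xi>| \<sim> 1/h\<close> is controlled by the translation by \<open>h\<close>.\<close>

lemma shell_bound:
  assumes G: "square_int G" and B: "B > 0" and h: "0 < h" "h \<le> 1"
    and t: "norm (mult_L2 (\<lambda>\<xi>. exp (- (\<i> * of_real (h * \<xi>))) - 1) (L2_of G)) \<le> B * h powr (3/4)"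
  shows "(\<integral>\<^sup>+\<xi>. ennreal (cmod (G \<xi>)) * indicator {\<xi>. 1 / 2 \<le> h * \<bar>\<xi>\<bar> \<and> h * \<bar>\<xi>\<bar> \<le> 1} \<xi> \<partial>lborel) \<le> ennreal (6 * B * h powr (1/4))"
proof -
  have [measurable]: "G \<in> borel_measurable borel" using G by measurable
  define m where "m \<xi> = exp (- (\<i> * complex_of_real (h * \<xi>))) - 1" for \<xi>
  have bm: "bounded_mult m"
  proof (rule bounded_multI[where B = 2])
    show "m \<in> borel_measurable borel" unfolding m_def by measurable
    show "cmod (m x) \<le> 2" for x unfolding m_def by (rule order_trans[OF norm_triangle_ineq4]) simp
  qed
  then have [measurable]: "m \<in> borel_measurable borel" by measurable
  define S where "S = {\<xi>. 1 / 2 \<le> h * \<bar>\<xi>\<bar> \<and> h * \<bar>\<xi>\<bar> \<le> 1}"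
  \<comment> \<open>With s = h xi the multiplier has modulus at least |s| - s^2/2, which is at least
    3/8 for 1/2 <= |s| <= 1.\<close>
  have mS: "1 / 3 \<le> cmod (m \<xi>)" if "\<xi> \<in> S" for \<xi>
  proof -
    define s where "s = h * \<xi>"
    have s: "1 / 2 \<le> \<bar>s\<bar>" "\<bar>s\<bar> \<le> 1" using that h by (auto simp: S_def s_def abs_mult)
    have "cmod (exp (\<i> * of_real (- s)) - (1 + \<i> * of_real (- s))) \<le> s\<^sup>2 / 2"
      using iexp_approx1[of "- s" 1] by (simp add: power2_eq_square)
    then have "cmod (m \<xi> + \<i> * of_real s) \<le> s\<^sup>2 / 2"
      by (simp add: m_def s_def algebra_simps)
    moreover have "cmod (\<i> * of_real s) \<le> cmod (m \<xi> + \<i> * of_real s) + cmod (m \<xi>)"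
      using norm_triangle_ineq4[of "m \<xi> + \<i> * of_real s" "m \<xi>"] by simp
    ultimately have "\<bar>s\<bar> - s\<^sup>2 / 2 \<le> cmod (m \<xi>)" by (simp add: norm_mult)
    moreover have "s\<^sup>2 \<le> \<bar>s\<bar>" using s mult_left_mono[of "\<bar>s\<bar>" 1 "\<bar>s\<bar>"] by (simp add: power2_eq_square)
    moreover have "\<bar>s\<bar> - s\<^sup>2 / 2 \<ge> 3 / 8"
    proof -
      have "0 \<le> (\<bar>s\<bar> - 1 / 2) * (3 / 2 - \<bar>s\<bar>)" using s by (intro mult_nonneg_nonneg) auto
      then show ?thesis by (simp add: algebra_simps power2_eq_square)
    qed
    ultimately show ?thesis by linarith
  qed
  have Sm: "S \<in> sets borel" unfolding S_def by measurable
  \<comment> \<open>Balances the length 2/h of the frequency window against the translation bound: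
    both contributions become multiples of B h^(1/4), with factors 1 and 9/2, hence the 6.\<close>
  define \<mu> where "\<mu> = B * h powr (5/4)"
  have \<mu>: "\<mu> > 0" using B h by (simp add: \<mu>_def)
  have le: "ennreal (cmod (G \<xi>)) * indicator S \<xi> \<le> ennreal (\<mu> / 2) * indicator {- (1 / h)..1 / h} \<xi> + ennreal (9 / (2 * \<mu>)) * ennreal ((cmod (m \<xi> * G \<xi>))\<^sup>2)" for \<xi>
  proof (cases "\<xi> \<in> S")
    case True
    have "h * \<bar>\<xi>\<bar> \<le> 1" using True by (simp add: S_def)
    then have "\<bar>\<xi>\<bar> \<le> 1 / h" using h by (simp add: field_simps)
    then have in_: "\<xi> \<in> {- (1 / h)..1 / h}" by auto
    have "cmod (G \<xi>) \<le> (\<mu> + (cmod (G \<xi>))\<^sup>2 / \<mu>) / 2" using AM_GM_weighted[of 1 \<mu> "cmod (G \<xi>)"] \<mu> by simp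
    also have "(cmod (G \<xi>))\<^sup>2 \<le> (3 * cmod (m \<xi> * G \<xi>))\<^sup>2"
    proof (rule power_mono)
      have "1 * cmod (G \<xi>) \<le> (3 * cmod (m \<xi>)) * cmod (G \<xi>)" using mS[OF True] by (intro mult_right_mono) auto
      then show "cmod (G \<xi>) \<le> 3 * cmod (m \<xi> * G \<xi>)" by (simp add: norm_mult)
    qed simp
    finally have "cmod (G \<xi>) \<le> \<mu> / 2 + 9 / (2 * \<mu>) * (cmod (m \<xi> * G \<xi>))\<^sup>2"
      using \<mu> by (simp add: divide_right_mono power_mult_distrib add_divide_distrib)
    then have "ennreal (cmod (G \<xi>)) \<le> ennreal (\<mu> / 2 + 9 / (2 * \<mu>) * (cmod (m \<xi> * G \<xi>))\<^sup>2)" by (rule ennreal_leI)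
    also have "\<dots> = ennreal (\<mu> / 2) + ennreal (9 / (2 * \<mu>)) * ennreal ((cmod (m \<xi> * G \<xi>))\<^sup>2)"
      using \<mu> ennreal_plus[of "\<mu> / 2" "9 / (2 * \<mu>) * (cmod (m \<xi> * G \<xi>))\<^sup>2"]
        ennreal_mult[of "9 / (2 * \<mu>)" "(cmod (m \<xi> * G \<xi>))\<^sup>2"] by (simp del: times_divide_eq_left)
    finally show ?thesis using True in_ by simp
  qed simp
  have smG: "square_int (\<lambda>\<xi>. m \<xi> * G \<xi>)" by (rule square_int_mult[OF bm G])
  have "(\<integral>\<^sup>+\<xi>. ennreal (cmod (G \<xi>)) * indicator S \<xi> \<partial>lborel)
    \<le> (\<integral>\<^sup>+\<xi>. ennreal (\<mu> / 2) * indicator {- (1 / h)..1 / h} \<xi> + ennreal (9 / (2 * \<mu>)) * ennreal ((cmod (m \<xi> * G \<xi>))\<^sup>2) \<partial>lborel)"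
    by (intro nn_integral_mono le)
  also have "\<dots> = ennreal (\<mu> / 2) * emeasure lborel {- (1 / h)..1 / h} + ennreal (9 / (2 * \<mu>)) * (\<integral>\<^sup>+\<xi>. ennreal ((cmod (m \<xi> * G \<xi>))\<^sup>2) \<partial>lborel)"
    by (subst nn_integral_add) (auto simp: nn_integral_cmult_indicator nn_integral_cmult)
  also have "(\<integral>\<^sup>+\<xi>. ennreal ((cmod (m \<xi> * G \<xi>))\<^sup>2) \<partial>lborel) = ennreal ((norm (L2_of (\<lambda>\<xi>. m \<xi> * G \<xi>)))\<^sup>2)"
    unfolding norm_L2_of[OF smG] by (intro nn_integral_eq_integral square_intD smG) auto
  also have "emeasure lborel {- (1 / h)..1 / h} = ennreal (2 / h)" using h by (simp add: emeasure_lborel_Icc_eq)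
  also have "ennreal (\<mu> / 2) * ennreal (2 / h) + ennreal (9 / (2 * \<mu>)) * ennreal ((norm (L2_of (\<lambda>\<xi>. m \<xi> * G \<xi>)))\<^sup>2)
     = ennreal (\<mu> / h + 9 / (2 * \<mu>) * (norm (L2_of (\<lambda>\<xi>. m \<xi> * G \<xi>)))\<^sup>2)"
    using \<mu> h by (simp add: ennreal_mult[symmetric] ennreal_plus[symmetric] del: ennreal_plus)
  also have "\<dots> \<le> ennreal (6 * B * h powr (1/4))"
  proof (rule ennreal_leI)
    have "(norm (L2_of (\<lambda>\<xi>. m \<xi> * G \<xi>)))\<^sup>2 \<le> (B * h powr (3/4))\<^sup>2"
      using t unfolding mult_L2_of[OF bm[unfolded m_def] G] m_def by (intro power_mono) auto
    also have "\<dots> = B\<^sup>2 * h powr (3/2)" by (simp add: power_mult_distrib power2_eq_square flip: powr_add)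
    finally have "9 / (2 * \<mu>) * (norm (L2_of (\<lambda>\<xi>. m \<xi> * G \<xi>)))\<^sup>2 \<le> 9 / (2 * \<mu>) * (B\<^sup>2 * h powr (3/2))"
      using \<mu> by (intro mult_left_mono) auto
    also have "h powr (3/2) = h powr (5/4) * h powr (1/4)" by (simp flip: powr_add)
    also have "9 / (2 * \<mu>) * (B\<^sup>2 * (h powr (5/4) * h powr (1/4))) = 9 / 2 * (B * h powr (1/4))"
      using B h by (simp add: \<mu>_def power2_eq_square)
    finally have 1: "9 / (2 * \<mu>) * (norm (L2_of (\<lambda>\<xi>. m \<xi> * G \<xi>)))\<^sup>2 \<le> 9 / 2 * (B * h powr (1/4))" .
    have "h powr (5/4) = h powr 1 * h powr (1/4)" unfolding powr_add[symmetric] by simp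
    then have 2: "\<mu> / h = B * h powr (1/4)" using h by (simp add: \<mu>_def)
    have "0 \<le> B * h powr (1/4)" using B by simp
    with 1 2 show "\<mu> / h + 9 / (2 * \<mu>) * (norm (L2_of (\<lambda>\<xi>. m \<xi> * G \<xi>)))\<^sup>2 \<le> 6 * B * h powr (1/4)" by simp
  qed
  finally show ?thesis by (simp add: S_def)
qed

text \<open>With h = 2^-(j+1) the shells cover |xi| >= 1 and contribute a geometric series of ratio
  (1/2)^(1/4); the low frequencies are bounded by the L2 norm. K is universal, so the bound is
  linear in B. The exponent 3/4 is what \<open>exp_decay_Wiener\<close> can supply.\<close>

lemma Bernstein:
  obtains K where "K > 0"
    "\<And>g B. B > 0 \<Longrightarrow> norm g \<le> B \<Longrightarrow> (\<And>h. 0 < h \<Longrightarrow> h \<le> 1 \<Longrightarrow> norm (trans_L2 h g - g) \<le> B * h powr (3/4)) \<Longrightarrow>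
       inA g \<and> Anorm g \<le> K * B"
proof -
  define q :: real where "q = (1/2) powr (1/4)"
  have q: "0 < q" "q < 1" unfolding q_def using powr_less_mono2[of "1/4" "1/2" "1::real"] by auto
  have sq: "summable (\<lambda>j. q ^ Suc j)" using q by (intro summable_ignore_initial_segment[where k = 1, simplified] summable_geometric) auto
  define K where "K = (1 / sqrt (2 * pi)) * (2 + 6 * (\<Sum>j. q ^ Suc j))"
  have K: "K > 0" unfolding K_def using q sq by (intro mult_pos_pos add_pos_nonneg mult_nonneg_nonneg suminf_nonneg) auto
  show ?thesis
  proof (rule that[OF K])
    fix g B
    assume B: "B > 0" and gB: "norm g \<le> B" and t: "\<And>h. 0 < h \<Longrightarrow> h \<le> 1 \<Longrightarrow> norm (trans_L2 h g - g) \<le> B * h powr (3/4)"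
    interpret F: bounded_linear fourier_L2 by (rule bounded_linear_fourier_L2)
    define G where "G = fun_of (fourier_L2 g)"
    have G: "square_int G" "fourier_L2 g = L2_of G" by (simp_all add: G_def)
    have [measurable]: "G \<in> borel_measurable borel" using G by measurable
    have t': "norm (mult_L2 (\<lambda>\<xi>. exp (- (\<i> * of_real (h * \<xi>))) - 1) (L2_of G)) \<le> B * h powr (3/4)"
      if h: "0 < h" "h \<le> 1" for h
    proof -
      have "fourier_L2 (trans_L2 h g - g) = mult_L2 (\<lambda>\<xi>. exp (- (\<i> * of_real (h * \<xi>))) - 1) (L2_of G)"
        unfolding F.diff fourier_trans_L2 mult_L2_diff_left[OF unimod_bounded[OF unimod_lin(1)] bounded_mult_const] mult_L2_one G(2) ..
      then show ?thesis using t[OF h] norm_fourier_L2[of "trans_L2 h g - g"] by simp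
    qed
    define hj where "hj j = (1/2 :: real) ^ Suc j" for j
    define S where "S j = {\<xi>. 1 / 2 \<le> hj j * \<bar>\<xi>\<bar> \<and> hj j * \<bar>\<xi>\<bar> \<le> 1}" for j
    have hj: "0 < hj j" "hj j \<le> 1" "hj j powr (1/4) = q ^ Suc j" for j
    proof -
      show "0 < hj j" by (simp add: hj_def)
      show "hj j \<le> 1" unfolding hj_def by (rule power_le_one) auto
      show "hj j powr (1/4) = q ^ Suc j"
        unfolding hj_def q_def by (simp add: powr_realpow[symmetric] powr_powr mult.commute del: power_Suc)
    qed
    have Sm: "S j \<in> sets borel" for j unfolding S_def by measurable
    have shell: "(\<integral>\<^sup>+\<xi>. ennreal (cmod (G \<xi>)) * indicator (S j) \<xi> \<partial>lborel) \<le> ennreal (6 * B * q ^ Suc j)" for j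
      using shell_bound[OF G(1) B hj(1,2) t'[OF hj(1,2)], of j] unfolding S_def hj(3) .
    have cover: "ennreal (cmod (G \<xi>)) \<le> ennreal (cmod (G \<xi>)) * indicator {-1..1} \<xi> + (\<Sum>j. ennreal (cmod (G \<xi>)) * indicator (S j) \<xi>)" for \<xi>
    proof (cases "\<bar>\<xi>\<bar> \<le> 1")
      case False
      define j where "j = nat \<lfloor>log 2 \<bar>\<xi>\<bar>\<rfloor>"
      have l0: "0 \<le> log 2 \<bar>\<xi>\<bar>" using False by simp
      have j1: "real j \<le> log 2 \<bar>\<xi>\<bar>" "log 2 \<bar>\<xi>\<bar> < real j + 1" using l0 by (auto simp: j_def)
      have xi: "\<bar>\<xi>\<bar> = 2 powr (log 2 \<bar>\<xi>\<bar>)" using False by simp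
      have "2 powr real j \<le> \<bar>\<xi>\<bar>" by (subst xi, rule powr_mono) (use j1 in auto)
      moreover have "\<bar>\<xi>\<bar> \<le> 2 powr (real j + 1)" by (subst xi, rule powr_mono) (use j1 in auto)
      ultimately have "2 ^ j \<le> \<bar>\<xi>\<bar>" "\<bar>\<xi>\<bar> \<le> 2 ^ Suc j" by (simp_all add: powr_realpow powr_add mult.commute)
      then have "\<xi> \<in> S j" by (simp add: S_def hj_def power_one_over field_simps)
      then have "ennreal (cmod (G \<xi>)) = (\<Sum>i\<in>{j}. ennreal (cmod (G \<xi>)) * indicator (S i) \<xi>)" by simp
      also have "\<dots> \<le> (\<Sum>i. ennreal (cmod (G \<xi>)) * indicator (S i) \<xi>)" by (rule sum_le_suminf) auto
      finally show ?thesis by (simp add: add_increasing)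
    next
      case True
      then have "\<xi> \<in> {-1..1}" by auto
      then show ?thesis by (simp add: add_increasing2)
    qed
    have low: "(\<integral>\<^sup>+\<xi>. ennreal (cmod (G \<xi>)) * indicator {-1..1} \<xi> \<partial>lborel) \<le> ennreal (2 * B)"
    proof -
      have "ennreal (cmod (G \<xi>)) * indicator {-1..1} \<xi> \<le> ennreal (B / 2) * indicator {-1..1} \<xi> + ennreal (1 / (2 * B)) * ennreal ((cmod (G \<xi>))\<^sup>2)" for \<xi>
      proof (cases "\<xi> \<in> {-1..1}")
        case True
        have "cmod (G \<xi>) \<le> B / 2 + 1 / (2 * B) * (cmod (G \<xi>))\<^sup>2"
          using AM_GM_weighted[of 1 B "cmod (G \<xi>)"] B by (simp add: add_divide_distrib)
        then have "ennreal (cmod (G \<xi>)) \<le> ennreal (B / 2 + 1 / (2 * B) * (cmod (G \<xi>))\<^sup>2)" by (rule ennreal_leI)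
        also have "\<dots> = ennreal (B / 2) + ennreal (1 / (2 * B)) * ennreal ((cmod (G \<xi>))\<^sup>2)"
          using B ennreal_plus[of "B / 2" "1 / (2 * B) * (cmod (G \<xi>))\<^sup>2"]
            ennreal_mult[of "1 / (2 * B)" "(cmod (G \<xi>))\<^sup>2"] by (simp del: times_divide_eq_left)
        finally show ?thesis using True by simp
      qed simp
      then have "(\<integral>\<^sup>+\<xi>. ennreal (cmod (G \<xi>)) * indicator {-1..1} \<xi> \<partial>lborel)
        \<le> (\<integral>\<^sup>+\<xi>. ennreal (B / 2) * indicator {-1..1} \<xi> + ennreal (1 / (2 * B)) * ennreal ((cmod (G \<xi>))\<^sup>2) \<partial>lborel)"
        by (intro nn_integral_mono)
      also have "\<dots> = ennreal (B / 2) * emeasure lborel {-1..1::real} + ennreal (1 / (2 * B)) * (\<integral>\<^sup>+\<xi>. ennreal ((cmod (G \<xi>))\<^sup>2) \<partial>lborel)"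
        by (subst nn_integral_add) (auto simp: nn_integral_cmult_indicator nn_integral_cmult)
      also have "(\<integral>\<^sup>+\<xi>. ennreal ((cmod (G \<xi>))\<^sup>2) \<partial>lborel) = ennreal ((norm (L2_of G))\<^sup>2)"
        unfolding norm_L2_of[OF G(1)] by (intro nn_integral_eq_integral square_intD G(1)) auto
      also have "emeasure lborel {-1..1::real} = ennreal 2" by (simp add: emeasure_lborel_Icc_eq)
      also have "ennreal (B / 2) * ennreal 2 + ennreal (1 / (2 * B)) * ennreal ((norm (L2_of G))\<^sup>2) = ennreal (B + 1 / (2 * B) * (norm (L2_of G))\<^sup>2)"
      proof -
        have "ennreal (B / 2) * ennreal 2 = ennreal B" using B ennreal_mult[of "B / 2" 2] by simp
        moreover have "ennreal (1 / (2 * B)) * ennreal ((norm (L2_of G))\<^sup>2) = ennreal (1 / (2 * B) * (norm (L2_of G))\<^sup>2)"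
          using B by (intro ennreal_mult[symmetric]) auto
        ultimately show ?thesis using B by (simp only:) (rule ennreal_plus[symmetric]; simp)
      qed
      also have "\<dots> \<le> ennreal (2 * B)"
      proof (rule ennreal_leI)
        have "(norm (L2_of G))\<^sup>2 \<le> B\<^sup>2" using gB norm_fourier_L2[of g] by (intro power_mono) (auto simp flip: G(2))
        then have "1 / (2 * B) * (norm (L2_of G))\<^sup>2 \<le> 1 / (2 * B) * B\<^sup>2" using B by (intro mult_left_mono) auto
        also have "\<dots> = B / 2" by (simp add: power2_eq_square)
        finally show "B + 1 / (2 * B) * (norm (L2_of G))\<^sup>2 \<le> 2 * B" using B by linarith
      qed
      finally show ?thesis .
    qed
    have "(\<integral>\<^sup>+\<xi>. ennreal (cmod (G \<xi>)) \<partial>lborel) \<le> (\<integral>\<^sup>+\<xi>. ennreal (cmod (G \<xi>)) * indicator {-1..1} \<xi> + (\<Sum>j. ennreal (cmod (G \<xi>)) * indicator (S j) \<xi>) \<partial>lborel)"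
      by (intro nn_integral_mono cover)
    also have "\<dots> = (\<integral>\<^sup>+\<xi>. ennreal (cmod (G \<xi>)) * indicator {-1..1} \<xi> \<partial>lborel) + (\<Sum>j. \<integral>\<^sup>+\<xi>. ennreal (cmod (G \<xi>)) * indicator (S j) \<xi> \<partial>lborel)"
    proof -
      have m: "(\<lambda>\<xi>. ennreal (cmod (G \<xi>)) * indicator (S j) \<xi>) \<in> borel_measurable lborel" for j
        using Sm[of j] by measurable
      have "(\<integral>\<^sup>+\<xi>. (\<Sum>j. ennreal (cmod (G \<xi>)) * indicator (S j) \<xi>) \<partial>lborel) = (\<Sum>j. \<integral>\<^sup>+\<xi>. ennreal (cmod (G \<xi>)) * indicator (S j) \<xi> \<partial>lborel)"
        by (rule nn_integral_suminf[OF m])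
      moreover have "(\<lambda>\<xi>. \<Sum>j. ennreal (cmod (G \<xi>)) * indicator (S j) \<xi>) \<in> borel_measurable lborel"
        by (rule borel_measurable_suminf_order[OF m])
      ultimately show ?thesis by (subst nn_integral_add) simp_all
    qed
    also have "\<dots> \<le> ennreal (2 * B) + (\<Sum>j. ennreal (6 * B * q ^ Suc j))"
      by (intro add_mono low suminf_le shell) auto
    also have "(\<Sum>j. ennreal (6 * B * q ^ Suc j)) = ennreal (\<Sum>j. 6 * B * q ^ Suc j)"
      using B q by (intro suminf_ennreal2 summable_mult sq) auto
    also have "(\<Sum>j. 6 * B * q ^ Suc j) = 6 * B * (\<Sum>j. q ^ Suc j)" by (rule suminf_mult[OF sq])
    also have "ennreal (2 * B) + ennreal (6 * B * (\<Sum>j. q ^ Suc j)) = ennreal (2 * B + 6 * B * (\<Sum>j. q ^ Suc j))"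
      using B q sq by (intro ennreal_plus[symmetric] mult_nonneg_nonneg suminf_nonneg) auto
    also have "2 * B + 6 * B * (\<Sum>j. q ^ Suc j) = (2 + 6 * (\<Sum>j. q ^ Suc j)) * B" by (simp only: algebra_simps)
    finally have fin: "(\<integral>\<^sup>+\<xi>. ennreal (cmod (G \<xi>)) \<partial>lborel) \<le> ennreal ((2 + 6 * (\<Sum>j. q ^ Suc j)) * B)" .
    have iG: "integrable lborel G"
      by (rule integrableI_bounded) (use le_less_trans[OF fin ennreal_less_top] in auto)
    have "ennreal (LINT \<xi>|lborel. cmod (G \<xi>)) \<le> ennreal ((2 + 6 * (\<Sum>j. q ^ Suc j)) * B)"
      using fin by (subst nn_integral_eq_integral[symmetric]) (auto intro: integrable_cmod iG)
    then have "(LINT \<xi>|lborel. cmod (G \<xi>)) \<le> (2 + 6 * (\<Sum>j. q ^ Suc j)) * B"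
      using B q sq by (subst (asm) ennreal_le_iff) (auto intro!: mult_nonneg_nonneg add_nonneg_nonneg suminf_nonneg)
    then have "(1 / sqrt (2 * pi)) * (LINT \<xi>|lborel. cmod (G \<xi>)) \<le> (1 / sqrt (2 * pi)) * ((2 + 6 * (\<Sum>j. q ^ Suc j)) * B)"
      by (rule mult_left_mono) simp
    then have "Anorm g \<le> K * B" by (simp only: Anorm_def K_def G_def mult.assoc)
    then show "inA g \<and> Anorm g \<le> K * B" using iG by (simp add: inA_def G_def)
  qed
qed

section \<open>Boost differences of exponentially decaying data\<close>

lemma power_diff_norm_le:
  fixes z w :: complex
  assumes "cmod z \<le> r" "cmod w \<le> r"
  shows "cmod (z ^ Suc n - w ^ Suc n) \<le> real (Suc n) * r ^ n * cmod (z - w)"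
proof (induction n)
  case (Suc n)
  have r: "r \<ge> 0" using assms(1) norm_ge_zero order_trans by blast
  have "z ^ Suc (Suc n) - w ^ Suc (Suc n) = z * (z ^ Suc n - w ^ Suc n) + (z - w) * w ^ Suc n"
    by (simp add: algebra_simps)
  also have "cmod \<dots> \<le> cmod z * cmod (z ^ Suc n - w ^ Suc n) + cmod (z - w) * cmod (w ^ Suc n)"
    by (rule order_trans[OF norm_triangle_ineq]) (simp add: norm_mult)
  also have "\<dots> \<le> r * (real (Suc n) * r ^ n * cmod (z - w)) + cmod (z - w) * r ^ Suc n"
    using assms r Suc by (intro add_mono mult_mono) (auto simp: norm_power norm_mult intro!: power_mono mult_mono)
  finally show ?case by (simp add: algebra_simps)
qed simp

lemma power_le_exp: "x \<ge> 0 \<Longrightarrow> x ^ n \<le> fact n * exp (x :: real)"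
proof -
  assume x: "x \<ge> 0"
  have "(\<Sum>i\<in>{n}. x ^ i /\<^sub>R fact i) \<le> exp x"
    unfolding exp_def by (rule sum_le_suminf) (use x summable_exp[of x] in \<open>auto simp: divide_inverse mult.commute\<close>)
  then have "x ^ n / fact n \<le> exp x" by (simp add: divide_inverse mult.commute)
  then have "x ^ n \<le> exp x * fact n" by (subst (asm) pos_divide_le_eq) auto
  then show ?thesis by (simp only: mult.commute)
qed

lemma bdiff_0_L2_of:
  assumes F: "square_int F"
  shows "square_int (\<lambda>x. (exp (\<i> * of_real (e * x)) - 1) ^ n * F x)"
    "(bdiff e 0 ^^ n) (L2_of F) = L2_of (\<lambda>x. (exp (\<i> * of_real (e * x)) - 1) ^ n * F x)"
proof -
  define m where "m x = exp (\<i> * complex_of_real (e * x)) - 1" for x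
  have bm: "bounded_mult m"
    unfolding m_def by (intro bounded_mult_diff unimod_bounded[OF unimod_lin(2)] bounded_mult_const)
  have "square_int (\<lambda>x. m x ^ n * F x) \<and> (bdiff e 0 ^^ n) (L2_of F) = L2_of (\<lambda>x. m x ^ n * F x)"
  proof (induction n)
    case 0
    then show ?case using F by simp
  next
    case (Suc n)
    then have s: "square_int (\<lambda>x. m x ^ n * F x)" and e: "(bdiff e 0 ^^ n) (L2_of F) = L2_of (\<lambda>x. m x ^ n * F x)" by auto
    have "bdiff e 0 f = mult_L2 m f" for f
      unfolding bdiff_def boost_0 m_def mult_L2_diff_left[OF unimod_bounded[OF unimod_lin(2)] bounded_mult_const] by simp
    then have "(bdiff e 0 ^^ Suc n) (L2_of F) = mult_L2 m (L2_of (\<lambda>x. m x ^ n * F x))" by (simp add: e)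
    also have "\<dots> = L2_of (\<lambda>x. m x ^ Suc n * F x)" by (simp add: mult_L2_of[OF bm s] mult.assoc)
    finally show ?case using square_int_mult[OF bm s] by (simp add: mult.assoc)
  qed
  then show "square_int (\<lambda>x. (exp (\<i> * of_real (e * x)) - 1) ^ n * F x)"
    "(bdiff e 0 ^^ n) (L2_of F) = L2_of (\<lambda>x. (exp (\<i> * of_real (e * x)) - 1) ^ n * F x)"
    by (simp_all add: m_def)
qed

text \<open>At time parameter 0 the n-th boost difference is multiplication by e^n b with b = ((exp
  (i e x) - 1)/e)^n. Uniformly in e, b is at most |x|^n and its increments behave like those of x^n,
  so both are bounded by n!/\<delta>^n times an exponential weight W. \<open>Bernstein\<close> is
  applied to b v; its modulus of continuity needs that of v in the weighted norm, which is obtained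
  by interpolation.\<close>

lemma exp_decay_Wiener:
  fixes v :: "real \<Rightarrow> complex"
  assumes [measurable]: "v \<in> borel_measurable borel" and k: "k > 0"
    and vK: "\<And>x. cmod (v x) \<le> K * exp (- k * \<bar>x\<bar>)"
    and f: "f = L2_of v" and C: "\<And>h. 0 < h \<Longrightarrow> h \<le> 1 \<Longrightarrow> norm (trans_L2 h f - f) \<le> C * h"
  obtains C0 \<delta> where "C0 > 0" "\<delta> > 0"
    "\<And>e n. 0 < e \<Longrightarrow> inA ((bdiff e 0 ^^ n) f) \<and> Anorm ((bdiff e 0 ^^ n) f) \<le> C0 * fact n * (e / \<delta>) ^ n"
proof -
  obtain KB where KB: "KB > 0"
    "\<And>g B. B > 0 \<Longrightarrow> norm g \<le> B \<Longrightarrow> (\<And>h. 0 < h \<Longrightarrow> h \<le> 1 \<Longrightarrow> norm (trans_L2 h g - g) \<le> B * h powr (3/4)) \<Longrightarrow>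
       inA g \<and> Anorm g \<le> KB * B" using Bernstein by metis
  have K0: "K \<ge> 0" using order_trans[OF norm_ge_zero vK[of 0]] by simp
  \<comment> \<open>The interpolation below uses the eighth power of W, and W^8 times the square of
    the decay bound must keep a factor exp (-k |x|). The summand 1 in W absorbs translations by h <=
    1.\<close>
  define \<delta> where "\<delta> = k / 8"
  have \<delta>: "\<delta> > 0" using k by (simp add: \<delta>_def)
  define W where "W x = exp (\<delta> * (\<bar>x\<bar> + 1))" for x :: real
  have W0: "W x > 0" for x by (simp add: W_def)
  have [measurable]: "W \<in> borel_measurable borel" unfolding W_def by measurable
  have ie: "integrable lborel (\<lambda>x::real. c * exp (- k * \<bar>x\<bar>))" for c
    by (intro integrable_mult_right integrable_exp_abs k)
  have W8: "W x ^ 8 = exp k * exp (k * \<bar>x\<bar>)" for x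
    by (simp add: W_def \<delta>_def distrib_left add.commute flip: exp_of_nat_mult exp_add)
  have W2: "(W x)\<^sup>2 \<le> W x ^ 8" for x
    by (rule power_increasing) (use \<delta> in \<open>auto simp: W_def\<close>)
  have dec: "W x ^ 8 * (a * exp (- k * \<bar>x\<bar>))\<^sup>2 = a\<^sup>2 * exp k * exp (- k * \<bar>x\<bar>)" for a x
  proof -
    have "exp (k * \<bar>x\<bar>) * (exp (- k * \<bar>x\<bar>))\<^sup>2 = exp (- k * \<bar>x\<bar>)"
      by (simp add: power2_eq_square flip: exp_add)
    then show ?thesis by (simp add: W8 power_mult_distrib)
  qed
  have siW: "square_int (\<lambda>x. of_real (W x) * w x)" if [measurable]: "w \<in> borel_measurable borel" and w: "\<And>x. cmod (w x) \<le> a * exp (- k * \<bar>x\<bar>)" for w a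
  proof (rule square_int_bound[OF _ ie])
    show "(cmod (of_real (W x) * w x))\<^sup>2 \<le> a\<^sup>2 * exp k * exp (- k * \<bar>x\<bar>)" for x
    proof -
      have "(cmod (of_real (W x) * w x))\<^sup>2 = (W x)\<^sup>2 * (cmod (w x))\<^sup>2" by (simp add: norm_mult power_mult_distrib)
      also have "\<dots> \<le> W x ^ 8 * (a * exp (- k * \<bar>x\<bar>))\<^sup>2"
        using w[of x] W2 W0[of x] by (intro mult_mono power_mono) auto
      finally show ?thesis unfolding dec .
    qed
  qed measurable
  have sv: "square_int v"
  proof (rule square_int_bound[OF _ ie])
    show "(cmod (v x))\<^sup>2 \<le> K\<^sup>2 * exp (- k * \<bar>x\<bar>)" for x
    proof -
      have "(cmod (v x))\<^sup>2 \<le> (K * exp (- k * \<bar>x\<bar>))\<^sup>2" by (intro power_mono vK) auto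
      also have "\<dots> \<le> K\<^sup>2 * (exp (- k * \<bar>x\<bar>) * 1)"
        unfolding power_mult_distrib power2_eq_square[of "exp _"] using k by (intro mult_left_mono) auto
      finally show ?thesis by simp
    qed
  qed measurable
  define I1 where "I1 = norm (L2_of (\<lambda>x. of_real (W x) * v x))"
  define K' where "K' = K * (1 + exp k)"
  define Q where "Q = (LINT x|lborel. K'\<^sup>2 * exp k * exp (- k * \<bar>x\<bar>))"
  have Q0: "Q \<ge> 0" unfolding Q_def by (intro Bochner_Integration.integral_nonneg) auto
  define C2 where "C2 = sqrt (C\<^sup>2 + Q) + (\<delta> + 1) * I1 + 1"
  have "I1 \<ge> 0" by (simp add: I1_def)
  then have C2: "C2 > 0" using \<delta> Q0 by (simp add: C2_def add_nonneg_pos)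
  have diffW: "square_int (\<lambda>x. of_real (W x) * (v (x - h) - v x))"
    "norm (L2_of (\<lambda>x. of_real (W x) * (v (x - h) - v x))) \<le> sqrt (C\<^sup>2 + Q) * h powr (3/4)" if h: "0 < h" "h \<le> 1" for h
  proof -
    define D where "D x = v (x - h) - v x" for x
    have [measurable]: "D \<in> borel_measurable borel" unfolding D_def by measurable
    have sD: "square_int D" unfolding D_def by (intro square_int_diff square_int_translate sv)
    have DK: "cmod (D x) \<le> K' * exp (- k * \<bar>x\<bar>)" for x
    proof -
      have "cmod (D x) \<le> K * exp (- k * \<bar>x - h\<bar>) + K * exp (- k * \<bar>x\<bar>)"
        unfolding D_def using vK[of x] vK[of "x - h"] by (intro order_trans[OF norm_triangle_ineq4] add_mono)
      moreover have "exp (- k * \<bar>x - h\<bar>) \<le> exp k * exp (- k * \<bar>x\<bar>)"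
      proof -
        have "k * \<bar>x\<bar> \<le> k * (1 + \<bar>x - h\<bar>)" using h k by (intro mult_left_mono) auto
        then show ?thesis by (simp add: algebra_simps flip: exp_add)
      qed
      from mult_left_mono[OF this K0]
      have "K * exp (- k * \<bar>x - h\<bar>) \<le> K * (exp k * exp (- k * \<bar>x\<bar>))" .
      ultimately show ?thesis by (simp add: K'_def algebra_simps)
    qed
    show s: "square_int (\<lambda>x. of_real (W x) * (v (x - h) - v x))"
      using siW[OF _ DK] by (simp add: D_def)
    have nD: "(LINT x|lborel. (cmod (D x))\<^sup>2) \<le> (C * h)\<^sup>2"
    proof -
      have "L2_of D = trans_L2 h f - f"
        unfolding f trans_L2_of[OF sv] L2_of_diff[OF square_int_translate[OF sv] sv] D_def ..
      then show ?thesis unfolding norm_L2_of[OF sD, symmetric] using C[OF h] by (intro power_mono) auto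
    qed
    \<comment> \<open>Interpolation between the unweighted Lipschitz bound C h and pure decay. By
      W^2 <= \<mu> + W^8/\<mu>^3 the two parts contribute C^2 h^2 \<mu> and Q/\<mu>^3, and this
      \<mu> makes both of order h^(3/2). The price is the exponent 3/4 in place of 1.\<close>
    define \<mu> where "\<mu> = h powr (- (1/2))"
    have \<mu>: "\<mu> > 0" using h by (simp add: \<mu>_def)
    have Y: "X \<le> \<mu> + X ^ 4 / \<mu> ^ 3" if "X \<ge> 0" for X
    proof (cases "X \<le> \<mu>")
      case True
      then show ?thesis using that \<mu> by (simp add: add_increasing2)
    next
      case False
      then have "X * \<mu> ^ 3 \<le> X * X ^ 3" using that \<mu> by (intro mult_left_mono power_mono) auto
      then have "X \<le> X ^ 4 / \<mu> ^ 3" using \<mu> by (simp add: pos_le_divide_eq power_numeral_reduce)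
      then show ?thesis using \<mu> by simp
    qed
    have pw: "(cmod (of_real (W x) * D x))\<^sup>2 \<le> \<mu> * (cmod (D x))\<^sup>2 + (1 / \<mu> ^ 3) * (K'\<^sup>2 * exp k * exp (- k * \<bar>x\<bar>))" for x
    proof -
      have "(cmod (of_real (W x) * D x))\<^sup>2 = (W x)\<^sup>2 * (cmod (D x))\<^sup>2" by (simp add: norm_mult power_mult_distrib)
      also have "\<dots> \<le> (\<mu> + ((W x)\<^sup>2) ^ 4 / \<mu> ^ 3) * (cmod (D x))\<^sup>2" by (intro mult_right_mono Y) auto
      also have "((W x)\<^sup>2) ^ 4 = W x ^ 8" by (simp flip: power_mult)
      also have "(\<mu> + W x ^ 8 / \<mu> ^ 3) * (cmod (D x))\<^sup>2 = \<mu> * (cmod (D x))\<^sup>2 + (1 / \<mu> ^ 3) * (W x ^ 8 * (cmod (D x))\<^sup>2)"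
        by (simp add: distrib_right)
      also have "W x ^ 8 * (cmod (D x))\<^sup>2 \<le> W x ^ 8 * (K' * exp (- k * \<bar>x\<bar>))\<^sup>2"
        using DK[of x] W0[of x] by (intro mult_left_mono power_mono) auto
      finally show ?thesis unfolding dec using \<mu> by (simp add: divide_right_mono)
    qed
    have i1: "integrable lborel (\<lambda>x. \<mu> * (cmod (D x))\<^sup>2)"
      by (rule integrable_mult_right) (rule square_intD[OF sD])
    have i2: "integrable lborel (\<lambda>x. (1 / \<mu> ^ 3) * (K'\<^sup>2 * exp k * exp (- k * \<bar>x\<bar>)))"
      by (rule integrable_mult_right) (rule ie)
    have "(norm (L2_of (\<lambda>x. of_real (W x) * D x)))\<^sup>2 \<le> (LINT x|lborel. \<mu> * (cmod (D x))\<^sup>2 + (1 / \<mu> ^ 3) * (K'\<^sup>2 * exp k * exp (- k * \<bar>x\<bar>)))"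
      unfolding norm_L2_of[OF s[folded D_def]]
      by (rule integral_mono[OF square_intD[OF s[folded D_def]] Bochner_Integration.integrable_add[OF i1 i2] pw])
    also have "\<dots> = \<mu> * (LINT x|lborel. (cmod (D x))\<^sup>2) + (1 / \<mu> ^ 3) * Q"
      unfolding Q_def Bochner_Integration.integral_add[OF i1 i2] by (simp only: integral_mult_right_zero)
    also have "\<dots> \<le> \<mu> * (C * h)\<^sup>2 + (1 / \<mu> ^ 3) * Q"
      using nD \<mu> by (intro add_right_mono mult_left_mono) auto
    also have "\<mu> * (C * h)\<^sup>2 = C\<^sup>2 * h powr (3/2)"
    proof -
      have "h powr (3/2) = h powr (- (1/2)) * (h powr 1 * h powr 1)"
        unfolding powr_add[symmetric] by simp
      then show ?thesis using h by (simp add: \<mu>_def power_mult_distrib power2_eq_square)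
    qed
    also have "1 / \<mu> ^ 3 = h powr (3/2)"
    proof -
      have "\<mu> ^ 3 = h powr (- (3/2))" unfolding \<mu>_def power3_eq_cube powr_add[symmetric] by simp
      then show ?thesis by (simp add: powr_minus_divide)
    qed
    also have "C\<^sup>2 * h powr (3/2) + h powr (3/2) * Q = (sqrt (C\<^sup>2 + Q) * h powr (3/4))\<^sup>2"
      using Q0 by (simp add: power_mult_distrib power2_eq_square[of "h powr _"] distrib_right mult.commute flip: powr_add)
    finally show "norm (L2_of (\<lambda>x. of_real (W x) * (v (x - h) - v x))) \<le> sqrt (C\<^sup>2 + Q) * h powr (3/4)"
      unfolding D_def by (rule power2_le_imp_le) (use Q0 in auto)
  qed
  have main: "inA ((bdiff e 0 ^^ n) f) \<and> Anorm ((bdiff e 0 ^^ n) f) \<le> KB * C2 * fact n * (e / \<delta>) ^ n" if e: "0 < e" for e n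
  proof -
    define d where "d x = (exp (\<i> * complex_of_real (e * x)) - 1) / of_real e" for x
    have [measurable]: "d \<in> borel_measurable borel" unfolding d_def by measurable
    have dx: "cmod (d x) \<le> \<bar>x\<bar>" for x
      unfolding d_def using iexp_minus_1_le[of "e * x"] e by (simp add: norm_divide abs_mult pos_divide_le_eq mult.commute)
    have dd: "cmod (d (x - h) - d x) \<le> h" if "0 < h" for x h
    proof -
      have "exp (\<i> * complex_of_real (e * x)) * exp (\<i> * of_real (- (e * h))) = exp (\<i> * of_real (e * (x - h)))"
        by (rule exp_mult_eq) (simp add: algebra_simps)
      then have "d (x - h) - d x = exp (\<i> * complex_of_real (e * x)) * (exp (\<i> * of_real (- (e * h))) - 1) / of_real e"
        unfolding d_def right_diff_distrib by (simp add: diff_divide_distrib del: of_real_mult)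
      then have "cmod (d (x - h) - d x) = cmod (exp (\<i> * of_real (- (e * h))) - 1) / e"
        using e by (simp add: norm_divide norm_mult del: of_real_mult of_real_minus)
      also have "\<dots> \<le> (e * h) / e" using e that iexp_minus_1_le[of "- (e * h)"] by (intro divide_right_mono) auto
      finally show ?thesis using e by simp
    qed
    define N where "N = fact n / \<delta> ^ n"
    have N0: "N > 0" using \<delta> by (simp add: N_def)
    have rW: "(\<bar>x\<bar> + 1) ^ j \<le> fact j / \<delta> ^ j * W x" for j x
    proof -
      have "(\<delta> * (\<bar>x\<bar> + 1)) ^ j \<le> fact j * W x" unfolding W_def by (rule power_le_exp) (use \<delta> in simp)
      then have "(\<bar>x\<bar> + 1) ^ j * \<delta> ^ j \<le> fact j * W x" by (simp only: power_mult_distrib mult.commute)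
      then have "(\<bar>x\<bar> + 1) ^ j \<le> fact j * W x / \<delta> ^ j" using \<delta> by (subst pos_le_divide_eq) auto
      then show ?thesis by simp
    qed
    define b where "b x = d x ^ n" for x
    have bW: "cmod (b y) \<le> N * W x" if "\<bar>y\<bar> \<le> \<bar>x\<bar> + 1" for x y
    proof -
      have "cmod (b y) \<le> (\<bar>x\<bar> + 1) ^ n" unfolding b_def norm_power using dx[of y] that by (intro power_mono) auto
      then show ?thesis using rW[of x n] by (simp add: N_def)
    qed
    have bL: "cmod (b (x - h) - b x) \<le> (N * \<delta> * h) * W x" if h: "0 < h" "h \<le> 1" for x h
    proof (cases n)
      case 0
      then show ?thesis using N0 \<delta> h W0[of x] by (simp add: b_def)
    next
      case (Suc j)
      have "cmod (b (x - h) - b x) \<le> real (Suc j) * (\<bar>x\<bar> + 1) ^ j * cmod (d (x - h) - d x)"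
        unfolding b_def Suc using dx[of x] dx[of "x - h"] h by (intro power_diff_norm_le) auto
      also have "\<dots> \<le> real (Suc j) * (fact j / \<delta> ^ j * W x) * h"
        using dd[OF h(1)] rW W0[of x] \<delta> by (intro mult_mono mult_nonneg_nonneg) auto
      also have "\<dots> = (N * \<delta> * h) * W x" using \<delta> by (simp add: N_def Suc)
      finally show ?thesis .
    qed
    have [measurable]: "b \<in> borel_measurable borel" unfolding b_def by measurable
    define Wv where "Wv x = of_real (W x) * v x" for x
    have sWv: "square_int Wv" unfolding Wv_def by (rule siW[OF _ vK]) measurable
    have sg: "square_int (\<lambda>x. b x * v x)"
    proof (rule square_int_bound[where h = "\<lambda>x. N\<^sup>2 * (cmod (Wv x))\<^sup>2"])
      show "(cmod (b x * v x))\<^sup>2 \<le> N\<^sup>2 * (cmod (Wv x))\<^sup>2" for x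
      proof -
        have "cmod (b x) * cmod (v x) \<le> (N * W x) * cmod (v x)" by (intro mult_right_mono bW) auto
        then have "cmod (b x * v x) \<le> N * cmod (Wv x)" using W0[of x] by (simp add: Wv_def norm_mult)
        then have "(cmod (b x * v x))\<^sup>2 \<le> (N * cmod (Wv x))\<^sup>2" by (intro power_mono) auto
        then show ?thesis by (simp add: power_mult_distrib)
      qed
    qed (use square_intD[OF sWv] in auto)
    define g where "g = L2_of (\<lambda>x. b x * v x)"
    have gn: "norm g \<le> N * C2"
    proof -
      have "norm g \<le> N * norm (L2_of Wv)"
        unfolding g_def
      proof (rule norm_L2_of_mono[OF sg sWv])
        have "cmod (b x * v x) \<le> N * cmod (Wv x)" for x
        proof -
          have "cmod (b x) * cmod (v x) \<le> (N * W x) * cmod (v x)" by (intro mult_right_mono bW) auto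
          then show ?thesis using W0[of x] by (simp add: Wv_def norm_mult)
        qed
        then show "AE x in lborel. cmod (b x * v x) \<le> N * cmod (Wv x)" by simp
      qed (use N0 in simp)
      also have "norm (L2_of Wv) \<le> C2" using \<open>I1 \<ge> 0\<close> \<delta> Q0 unfolding C2_def I1_def Wv_def by (simp add: distrib_right add_increasing)
      finally show ?thesis using N0 by simp
    qed
    have gt: "norm (trans_L2 h g - g) \<le> N * C2 * h powr (3/4)" if h: "0 < h" "h \<le> 1" for h
    proof -
      note DW = diffW[OF h]
      \<comment> \<open>Product rule for the increment of b v: in p the increment falls on v, in r
        on b. The Lipschitz term r is weakened to h^(3/4) to match p.\<close>
      define p where "p x = b (x - h) * (v (x - h) - v x)" for x
      define r where "r x = (b (x - h) - b x) * v x" for x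
      have [measurable]: "p \<in> borel_measurable borel" "r \<in> borel_measurable borel" unfolding p_def r_def by measurable
      have p: "cmod (p x) \<le> N * cmod (of_real (W x) * (v (x - h) - v x))" for x
      proof -
        have "cmod (b (x - h)) * cmod (v (x - h) - v x) \<le> (N * W x) * cmod (v (x - h) - v x)"
          using h by (intro mult_right_mono bW) auto
        then show ?thesis using W0[of x] by (simp add: p_def norm_mult)
      qed
      have r: "cmod (r x) \<le> (N * \<delta> * h) * cmod (Wv x)" for x
      proof -
        have "cmod (b (x - h) - b x) * cmod (v x) \<le> ((N * \<delta> * h) * W x) * cmod (v x)"
          by (intro mult_right_mono bL h) auto
        then show ?thesis using W0[of x] by (simp add: r_def Wv_def norm_mult)
      qed
      have sp: "square_int p"
      proof (rule square_int_bound[where h = "\<lambda>x. N\<^sup>2 * (cmod (of_real (W x) * (v (x - h) - v x)))\<^sup>2"])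
        show "(cmod (p x))\<^sup>2 \<le> N\<^sup>2 * (cmod (of_real (W x) * (v (x - h) - v x)))\<^sup>2" for x
          using power_mono[OF p[of x], of 2] by (simp add: power_mult_distrib)
      qed (use square_intD[OF DW(1)] in auto)
      have sr: "square_int r"
      proof (rule square_int_bound[where h = "\<lambda>x. (N * \<delta> * h)\<^sup>2 * (cmod (Wv x))\<^sup>2"])
        show "(cmod (r x))\<^sup>2 \<le> (N * \<delta> * h)\<^sup>2 * (cmod (Wv x))\<^sup>2" for x
          using power_mono[OF r[of x], of 2] by (simp add: power_mult_distrib)
      qed (use square_intD[OF sWv] in auto)
      have "trans_L2 h g - g = L2_of (\<lambda>x. b (x - h) * v (x - h) - b x * v x)"
        unfolding g_def trans_L2_of[OF sg] L2_of_diff[OF square_int_translate[OF sg] sg] ..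
      also have "(\<lambda>x. b (x - h) * v (x - h) - b x * v x) = (\<lambda>x. p x + r x)"
        by (simp add: p_def r_def fun_eq_iff algebra_simps)
      finally have "norm (trans_L2 h g - g) \<le> norm (L2_of p) + norm (L2_of r)"
        unfolding L2_of_add[OF sp sr, symmetric] using norm_triangle_ineq by simp
      also have "norm (L2_of p) \<le> N * norm (L2_of (\<lambda>x. of_real (W x) * (v (x - h) - v x)))"
        by (rule norm_L2_of_mono[OF sp DW(1) AE_I2[OF p]]) (use N0 in simp)
      also have "\<dots> \<le> N * (sqrt (C\<^sup>2 + Q) * h powr (3/4))" using N0 by (intro mult_left_mono DW) auto
      also have "norm (L2_of r) \<le> (N * \<delta> * h) * norm (L2_of Wv)"
        by (rule norm_L2_of_mono[OF sr sWv AE_I2[OF r]]) (use N0 \<delta> h in simp)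
      also have "\<dots> \<le> (N * \<delta> * h powr (3/4)) * I1"
      proof -
        have "h powr 1 \<le> h powr (3/4)" using h by (intro powr_mono') auto
        then show ?thesis using N0 \<delta> h unfolding I1_def Wv_def
          by (intro mult_right_mono mult_left_mono) auto
      qed
      finally have "norm (trans_L2 h g - g) \<le> (N * h powr (3/4)) * (sqrt (C\<^sup>2 + Q) + \<delta> * I1)"
        by (simp add: algebra_simps)
      also have "\<dots> \<le> (N * h powr (3/4)) * C2"
        using N0 \<open>I1 \<ge> 0\<close> by (intro mult_left_mono) (auto simp: C2_def distrib_right)
      finally show ?thesis by (simp add: mult_ac)
    qed
    have "N * C2 > 0" using N0 C2 by simp
    from KB(2)[OF this gn gt] have g: "inA g" "Anorm g \<le> KB * (N * C2)" by auto
    have "(bdiff e 0 ^^ n) f = L2_of (\<lambda>x. of_real (e ^ n) * (b x * v x))"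
      unfolding f bdiff_0_L2_of(2)[OF sv]
      using e by (simp add: b_def d_def power_divide mult.assoc del: of_real_mult)
    also have "\<dots> = mult_L2 (\<lambda>_. of_real (e ^ n)) g"
      unfolding g_def by (rule mult_L2_of[OF bounded_mult_const sg, symmetric])
    finally have eq: "(bdiff e 0 ^^ n) f = mult_L2 (\<lambda>_. of_real (e ^ n)) g" .
    have "Anorm ((bdiff e 0 ^^ n) f) = e ^ n * Anorm g"
      unfolding eq inA_mult_const(2)[OF g(1)] using e by (simp add: norm_power)
    also have "\<dots> \<le> e ^ n * (KB * (N * C2))" using g(2) e by (intro mult_left_mono) auto
    also have "\<dots> = KB * C2 * fact n * (e / \<delta>) ^ n" by (simp add: N_def power_divide)
    finally show ?thesis unfolding eq using inA_mult_const(1)[OF g(1)] by auto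
  qed
  show ?thesis by (rule that[of "KB * C2" \<delta>]) (use main KB C2 \<delta> in auto)
qed

section \<open>Propagation of exponential decay of the profile\<close>

text \<open>\<open>Anorm\<close> as a supremum over square integrable test functions bounded by 1.
  Each test is a continuous functional on L2, so it can be moved inside a Bochner integral taken in
  L2, although \<open>Anorm\<close> itself is not continuous there.\<close>

lemma inA_dual:
  assumes G: "square_int G" "fourier_L2 g = L2_of G"
    and dual: "\<And>\<psi>. square_int \<psi> \<Longrightarrow> (\<And>x. cmod (\<psi> x) \<le> 1) \<Longrightarrow> fourier_L2 g \<bullet> L2_of \<psi> \<le> sqrt (2 * pi) * C"
  shows "inA g" "Anorm g \<le> C"
proof -
  have [measurable]: "G \<in> borel_measurable borel" using G by measurable
  have C: "C \<ge> 0"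
  proof -
    have "0 \<le> sqrt (2 * pi) * C" using dual[of "\<lambda>_. 0"] by (simp add: square_int_zero L2_of_zero)
    moreover have "sqrt (2 * pi) > 0" by simp
    ultimately show ?thesis by (metis zero_le_mult_iff not_less)
  qed
  have I: "(LINT \<xi>|lborel. cmod (cutoff n G \<xi>)) \<le> sqrt (2 * pi) * C" for n
  proof -
    \<comment> \<open>The extremal test function is the phase of G, cut off to be square integrable;
      Fatou removes the cutoff.\<close>
    define \<psi> where "\<psi> = cutoff n (\<lambda>\<xi>. sgn (G \<xi>))"
    have [measurable]: "(\<lambda>\<xi>. sgn (G \<xi>)) \<in> borel_measurable borel" unfolding sgn_div_norm by measurable
    have le: "cmod (\<psi> x) \<le> indicator {- real n..real n} x" for x
      by (auto simp: \<psi>_def cutoff_def indicator_def norm_sgn)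
    have s: "square_int \<psi>"
    proof (rule square_int_bound[where h = "\<lambda>x. indicator {- real n..real n} x"])
      show "integrable lborel (\<lambda>x. indicator {- real n..real n} x :: real)"
        by (intro integrable_real_indicator) (auto simp: emeasure_lborel_Icc_eq)
      show "(cmod (\<psi> x))\<^sup>2 \<le> indicator {- real n..real n} x" for x
        using power_mono[OF le[of x], of 2] by (auto simp: indicator_def power2_eq_square split: if_splits)
      show "\<psi> \<in> borel_measurable lborel" unfolding \<psi>_def by measurable
    qed
    have "G \<xi> \<bullet> \<psi> \<xi> = cmod (cutoff n G \<xi>)" for \<xi>
      by (cases "G \<xi> = 0") (simp_all add: \<psi>_def cutoff_def indicator_def sgn_div_norm dot_square_norm power2_eq_square)
    then have "(LINT \<xi>|lborel. cmod (cutoff n G \<xi>)) = fourier_L2 g \<bullet> L2_of \<psi>"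
      unfolding G(2) inner_L2_of[OF G(1) s] by simp
    also have "\<dots> \<le> sqrt (2 * pi) * C"
      by (rule dual[OF s]) (rule order_trans[OF le], simp add: indicator_def)
    finally show ?thesis .
  qed
  have nn: "(\<integral>\<^sup>+\<xi>. ennreal (cmod (cutoff n G \<xi>)) \<partial>lborel) \<le> ennreal (sqrt (2 * pi) * C)" for n
    by (subst nn_integral_eq_integral) (auto intro: integrable_cmod integrable_cutoff G(1) ennreal_leI I)
  have "(\<integral>\<^sup>+\<xi>. ennreal (cmod (G \<xi>)) \<partial>lborel) = (\<integral>\<^sup>+\<xi>. liminf (\<lambda>n. ennreal (cmod (cutoff n G \<xi>))) \<partial>lborel)"
    by (intro nn_integral_cong lim_imp_Liminf[symmetric] tendsto_intros cutoff_tendsto) simp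
  also have "\<dots> \<le> liminf (\<lambda>n. \<integral>\<^sup>+\<xi>. ennreal (cmod (cutoff n G \<xi>)) \<partial>lborel)"
    by (intro nn_integral_liminf) measurable
  also have "\<dots> \<le> liminf (\<lambda>n::nat. ennreal (sqrt (2 * pi) * C))"
    by (intro Liminf_mono always_eventually allI nn)
  also have "\<dots> = ennreal (sqrt (2 * pi) * C)" by (simp add: Liminf_const)
  finally have fin: "(\<integral>\<^sup>+\<xi>. ennreal (cmod (G \<xi>)) \<partial>lborel) \<le> ennreal (sqrt (2 * pi) * C)" .
  have iG: "integrable lborel G"
    by (rule integrableI_bounded) (use le_less_trans[OF fin ennreal_less_top] in auto)
  note H = inA_fourier[OF G]
  show "inA g" using H(1) iG by simp
  have "ennreal (LINT \<xi>|lborel. cmod (G \<xi>)) \<le> ennreal (sqrt (2 * pi) * C)"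
    using fin by (subst nn_integral_eq_integral[symmetric]) (auto intro: integrable_cmod iG)
  then have "(LINT \<xi>|lborel. cmod (G \<xi>)) \<le> sqrt (2 * pi) * C"
    using C by (subst (asm) ennreal_le_iff) auto
  then show "Anorm g \<le> C" unfolding H(2) by (simp add: pos_divide_le_eq mult.commute)
qed

lemma inA_inner_le:
  assumes f: "inA f" and \<psi>: "square_int \<psi>" "\<And>x. cmod (\<psi> x) \<le> 1"
  shows "fourier_L2 f \<bullet> L2_of \<psi> \<le> sqrt (2 * pi) * Anorm f"
proof -
  obtain G where G: "square_int G" "fourier_L2 f = L2_of G" "inA f \<longleftrightarrow> integrable lborel G"
    "Anorm f = (1 / sqrt (2 * pi)) * (LINT \<xi>|lborel. cmod (G \<xi>))" by (rule inA_cases)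
  have "fourier_L2 f \<bullet> L2_of \<psi> = (LINT \<xi>|lborel. G \<xi> \<bullet> \<psi> \<xi>)" unfolding G(2) by (rule inner_L2_of[OF G(1) \<psi>(1)])
  also have "\<dots> \<le> (LINT \<xi>|lborel. cmod (G \<xi>))"
  proof (rule integral_mono)
    show "integrable lborel (\<lambda>\<xi>. G \<xi> \<bullet> \<psi> \<xi>)" by (rule square_int_inner[OF G(1) \<psi>(1)])
    show "integrable lborel (\<lambda>\<xi>. cmod (G \<xi>))" using G(3) f by (auto intro: integrable_cmod)
    show "G \<xi> \<bullet> \<psi> \<xi> \<le> cmod (G \<xi>)" for \<xi>
    proof -
      have "G \<xi> \<bullet> \<psi> \<xi> \<le> cmod (G \<xi>) * cmod (\<psi> \<xi>)" by (rule norm_cauchy_schwarz)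
      also have "\<dots> \<le> cmod (G \<xi>) * 1" using \<psi>(2) by (intro mult_left_mono) auto
      finally show ?thesis by simp
    qed
  qed
  finally show ?thesis by (simp add: G(4))
qed

text \<open>Minkowski's inequality by duality. The constant bound m spares any measurability of
  \<tau> \<mapsto> \<open>Anorm (F \<tau>)\<close>, which suits the supremum form of the Gronwall
  lemmas.\<close>

lemma Anorm_integral:
  assumes st: "s \<le> t" and F: "set_integrable lborel {s<..t} F" and m: "m \<ge> 0"
    and b: "\<And>\<tau>. s < \<tau> \<Longrightarrow> \<tau> \<le> t \<Longrightarrow> inA (F \<tau>) \<and> Anorm (F \<tau>) \<le> m"
  shows "inA (LINT \<tau>:{s<..t}|lborel. F \<tau>)" "Anorm (LINT \<tau>:{s<..t}|lborel. F \<tau>) \<le> (t - s) * m"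
proof -
  define g where "g = (LINT \<tau>:{s<..t}|lborel. F \<tau>)"
  interpret FL: bounded_linear fourier_L2 by (rule bounded_linear_fourier_L2)
  have dual: "fourier_L2 g \<bullet> L2_of \<psi> \<le> sqrt (2 * pi) * ((t - s) * m)"
    if \<psi>: "square_int \<psi>" "\<And>x. cmod (\<psi> x) \<le> 1" for \<psi>
  proof -
    have L: "bounded_linear (\<lambda>f. fourier_L2 f \<bullet> L2_of \<psi>)"
      by (intro bounded_linear_compose[OF bounded_linear_inner_left] bounded_linear_fourier_L2)
    note FI = F[unfolded set_integrable_def]
    have "fourier_L2 g \<bullet> L2_of \<psi> = (LINT \<tau>|lborel. fourier_L2 (indicator {s<..t} \<tau> *\<^sub>R F \<tau>) \<bullet> L2_of \<psi>)"
      unfolding g_def set_lebesgue_integral_def by (rule integral_bounded_linear[OF L FI, symmetric])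
    also have "\<dots> \<le> (LINT \<tau>|lborel. indicator {s<..t} \<tau> * (sqrt (2 * pi) * m))"
    proof (rule integral_mono)
      show "integrable lborel (\<lambda>\<tau>. fourier_L2 (indicator {s<..t} \<tau> *\<^sub>R F \<tau>) \<bullet> L2_of \<psi>)"
        by (rule integrable_bounded_linear[OF L FI])
      show "integrable lborel (\<lambda>\<tau>. indicator {s<..t} \<tau> * (sqrt (2 * pi) * m))"
        by (intro integrable_mult_left integrable_real_indicator) (auto simp: st emeasure_lborel_Ioc)
      show "fourier_L2 (indicator {s<..t} \<tau> *\<^sub>R F \<tau>) \<bullet> L2_of \<psi> \<le> indicator {s<..t} \<tau> * (sqrt (2 * pi) * m)" for \<tau>
      proof (cases "\<tau> \<in> {s<..t}")
        case True
        then have "fourier_L2 (F \<tau>) \<bullet> L2_of \<psi> \<le> sqrt (2 * pi) * Anorm (F \<tau>)"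
          using b by (intro inA_inner_le \<psi>) auto
        also have "\<dots> \<le> sqrt (2 * pi) * m" using b True by (intro mult_left_mono) auto
        finally show ?thesis using True by simp
      qed (simp add: FL.zero)
    qed
    also have "\<dots> = (t - s) * (sqrt (2 * pi) * m)" using st by simp
    finally show ?thesis by (simp add: mult_ac)
  qed
  have G: "square_int (fun_of (fourier_L2 g))" "fourier_L2 g = L2_of (fun_of (fourier_L2 g))" by simp_all
  from inA_dual[OF G dual] show "inA (LINT \<tau>:{s<..t}|lborel. F \<tau>)" "Anorm (LINT \<tau>:{s<..t}|lborel. F \<tau>) \<le> (t - s) * m"
    by (simp_all add: g_def)
qed

text \<open>On steps of length d with d L <= 1/2 and d <= 1 the supremum argument gives \<phi> q <=
  2 \<phi> p + 2 g, and iteration gives powers of 4. K depends on L and T only, so one constant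
  serves all orders of differences and all boosts.\<close>

lemma Gronwall_source:
  fixes L T :: real
  assumes L: "L \<ge> 0" and T: "T \<ge> 0"
  obtains K where "K \<ge> 1"
    "\<And>\<phi> g t. \<lbrakk>g \<ge> 0; \<And>t. 0 \<le> t \<Longrightarrow> t \<le> T \<Longrightarrow> 0 \<le> \<phi> t; \<exists>B. \<forall>t. 0 \<le> t \<longrightarrow> t \<le> T \<longrightarrow> \<phi> t \<le> B;
       \<And>s t m. 0 \<le> s \<Longrightarrow> s \<le> t \<Longrightarrow> t \<le> T \<Longrightarrow> (\<And>\<tau>. s \<le> \<tau> \<Longrightarrow> \<tau> \<le> t \<Longrightarrow> \<phi> \<tau> \<le> m) \<Longrightarrow> \<phi> t \<le> \<phi> s + (t - s) * (L * m + g);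
       0 \<le> t; t \<le> T\<rbrakk> \<Longrightarrow> \<phi> t \<le> K * (\<phi> 0 + g)"
proof -
  define d where "d = 1 / (2 * L + 1)"
  have d: "0 < d" "d \<le> 1" "d * L \<le> 1 / 2" using L by (auto simp: d_def divide_simps)
  obtain n0 where n0: "T \<le> real n0 * d"
    using real_arch_simple[of "T / d"] d(1) by (auto simp: field_simps)
  show ?thesis
  proof (rule that[of "4 ^ n0"])
    fix \<phi> :: "real \<Rightarrow> real" and g t :: real
    assume g: "g \<ge> 0" and nn: "\<And>t. 0 \<le> t \<Longrightarrow> t \<le> T \<Longrightarrow> 0 \<le> \<phi> t"
      and bd: "\<exists>B. \<forall>t. 0 \<le> t \<longrightarrow> t \<le> T \<longrightarrow> \<phi> t \<le> B"
      and step: "\<And>s t m. 0 \<le> s \<Longrightarrow> s \<le> t \<Longrightarrow> t \<le> T \<Longrightarrow> (\<And>\<tau>. s \<le> \<tau> \<Longrightarrow> \<tau> \<le> t \<Longrightarrow> \<phi> \<tau> \<le> m) \<Longrightarrow> \<phi> t \<le> \<phi> s + (t - s) * (L * m + g)"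
      and t: "0 \<le> t" "t \<le> T"
    obtain B where B: "\<And>t. 0 \<le> t \<Longrightarrow> t \<le> T \<Longrightarrow> \<phi> t \<le> B" using bd by blast
    have close: "\<phi> q \<le> 2 * \<phi> p + 2 * g" if pq: "0 \<le> p" "p \<le> q" "q \<le> T" "q - p \<le> d" for p q
    proof -
      define m where "m = Sup (\<phi> ` {p..q})"
      have bdd: "bdd_above (\<phi> ` {p..q})" using B pq by (auto intro!: bdd_aboveI[of _ B])
      have le_m: "\<phi> r \<le> m" if "p \<le> r" "r \<le> q" for r unfolding m_def using bdd that by (intro cSup_upper) auto
      have m0: "m \<ge> 0" using le_m[of p] nn[of p] pq by linarith
      have "\<phi> r \<le> \<phi> p + m / 2 + g" if r: "p \<le> r" "r \<le> q" for r
      proof -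
        have "\<phi> r \<le> \<phi> p + (r - p) * (L * m + g)" by (rule step) (use r pq le_m in auto)
        also have "\<dots> \<le> \<phi> p + d * (L * m + g)"
          using r pq L m0 g by (intro add_left_mono mult_right_mono) auto
        also have "d * (L * m + g) = (d * L) * m + d * g" by (simp add: algebra_simps)
        also have "\<dots> \<le> (1 / 2) * m + 1 * g" using d m0 g by (intro add_mono mult_right_mono) auto
        finally show ?thesis by simp
      qed
      then have "m \<le> \<phi> p + m / 2 + g" unfolding m_def using pq by (intro cSup_least) (auto simp: m_def)
      then show ?thesis using le_m[of q] pq by simp
    qed
    have iter: "\<phi> q \<le> 4 ^ n * (\<phi> 0 + g)" if "0 \<le> q" "q \<le> T" "q \<le> real n * d" for n q
      using that
    proof (induction n arbitrary: q)
      case 0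
      then show ?case using g by simp
    next
      case (Suc n)
      have h: "0 \<le> 4 ^ n * (\<phi> 0 + g)" using nn[of 0] g T by simp
      have g4: "g \<le> 4 ^ n * (\<phi> 0 + g)"
      proof -
        have "1 * g \<le> 4 ^ n * (\<phi> 0 + g)" using nn[of 0] g T by (intro mult_mono) auto
        then show ?thesis by simp
      qed
      define p where "p = max 0 (q - d)"
      have p: "0 \<le> p" "p \<le> q" "q - p \<le> d" "p \<le> real n * d"
        using Suc.prems d(1) by (auto simp: p_def algebra_simps)
      have "\<phi> q \<le> 2 * \<phi> p + 2 * g" using p Suc.prems by (intro close) auto
      also have "\<dots> \<le> 2 * (4 ^ n * (\<phi> 0 + g)) + 2 * (4 ^ n * (\<phi> 0 + g))"
        using Suc.IH[of p] p Suc.prems g4 by (intro add_mono mult_left_mono) auto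
      finally show ?case by (simp add: mult.commute)
    qed
    show "\<phi> t \<le> 4 ^ n0 * (\<phi> 0 + g)" by (rule iter) (use t n0 in auto)
  qed simp
qed

section \<open>Power series majorants and the induction over the order\<close>

lemma sum_inverse_squares_le: "(\<Sum>i=1..Suc n. 1 / (real i)\<^sup>2) \<le> 2 - 1 / real (Suc n)"
proof (induction n)
  case (Suc n)
  define x where "x = real (Suc n)"
  have x: "x > 0" by (simp add: x_def)
  have "1 / x - 1 / (x + 1) = 1 / (x * (x + 1))" using x by (simp add: field_simps)
  moreover have "1 / (x + 1)\<^sup>2 \<le> 1 / (x * (x + 1))"
    using x by (intro divide_left_mono) (auto simp: power2_eq_square)
  moreover have r: "real (Suc (Suc n)) = x + 1" by (simp add: x_def)
  moreover have S: "(\<Sum>i=1..Suc (Suc n). 1 / (real i)\<^sup>2) = (\<Sum>i=1..Suc n. 1 / (real i)\<^sup>2) + 1 / (real (Suc (Suc n)))\<^sup>2"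
    by simp
  ultimately show ?case using Suc unfolding S r x_def[symmetric] by linarith
qed simp

text \<open>From 1/(i (n - i)) = (1/i + 1/(n - i))/n. The sequence 1/n^2 is reproduced by
  convolution up to a constant, so majorants r^n/n^2 are stable under products, which plain
  geometric ones are not.\<close>

lemma sum_convolution_squares_le:
  assumes "n \<ge> 1"
  shows "(\<Sum>i=1..n-1. 1 / ((real i)\<^sup>2 * (real (n - i))\<^sup>2)) \<le> 8 / (real n)\<^sup>2"
proof -
  have S: "(\<Sum>i=1..n-1. 1 / (real i)\<^sup>2) \<le> 2"
  proof (cases "n - 1")
    case (Suc m)
    then show ?thesis using sum_inverse_squares_le[of m] by (simp add: divide_nonneg_nonneg del: of_nat_Suc) (smt (verit) divide_nonneg_nonneg of_nat_0_le_iff)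
  qed simp
  have S': "(\<Sum>i=1..n-1. 1 / (real (n - i))\<^sup>2) = (\<Sum>i=1..n-1. 1 / (real i)\<^sup>2)"
    by (rule sum.reindex_bij_witness[of _ "\<lambda>i. n - i" "\<lambda>i. n - i"]) auto
  have "(\<Sum>i=1..n-1. 1 / ((real i)\<^sup>2 * (real (n - i))\<^sup>2)) \<le> (\<Sum>i=1..n-1. (2 / (real n)\<^sup>2) * (1 / (real i)\<^sup>2 + 1 / (real (n - i))\<^sup>2))"
  proof (rule sum_mono)
    fix i assume i: "i \<in> {1..n-1}"
    define a b where "a = real i" and "b = real (n - i)"
    have ab: "a > 0" "b > 0" "real n = a + b" using i by (auto simp: a_def b_def of_nat_diff)
    have "1 / (a\<^sup>2 * b\<^sup>2) = (1 / (a + b)\<^sup>2) * (1 / a + 1 / b)\<^sup>2"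
    proof -
      have "1 / a + 1 / b = (a + b) / (a * b)" using ab by (simp add: field_simps)
      then show ?thesis using ab by (simp add: power_divide power_mult_distrib)
    qed
    also have "\<dots> \<le> (1 / (a + b)\<^sup>2) * (2 * ((1 / a)\<^sup>2 + (1 / b)\<^sup>2))"
    proof (rule mult_left_mono)
      have "(p + q)\<^sup>2 \<le> 2 * (p\<^sup>2 + q\<^sup>2)" for p q :: real
        using sum_squares_bound[of p q] by (simp add: power2_sum)
      then show "(1 / a + 1 / b)\<^sup>2 \<le> 2 * ((1 / a)\<^sup>2 + (1 / b)\<^sup>2)" .
    qed simp
    finally show "1 / ((real i)\<^sup>2 * (real (n - i))\<^sup>2) \<le> (2 / (real n)\<^sup>2) * (1 / (real i)\<^sup>2 + 1 / (real (n - i))\<^sup>2)"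
      unfolding ab(3) a_def[symmetric] b_def[symmetric] by (simp add: power_divide)
  qed
  also have "\<dots> = (2 / (real n)\<^sup>2) * ((\<Sum>i=1..n-1. 1 / (real i)\<^sup>2) + (\<Sum>i=1..n-1. 1 / (real (n - i))\<^sup>2))"
    by (simp only: sum_distrib_left[symmetric] sum.distrib)
  also have "\<dots> \<le> (2 / (real n)\<^sup>2) * (2 + 2)" unfolding S' using S by (intro mult_left_mono add_mono) auto
  finally show ?thesis by simp
qed

text \<open>As both constant terms vanish, the n-th coefficient of the product involves only
  coefficients of order below n. This is exactly what strong induction provides.\<close>

lemma fps_mult_square_majorant:
  fixes d e :: "real fps"
  assumes d0: "fps_nth d 0 = 0" "fps_nth e 0 = 0" and n: "n \<ge> 1"
    and dn: "\<And>i. 1 \<le> i \<Longrightarrow> i < n \<Longrightarrow> 0 \<le> fps_nth d i \<and> fps_nth d i \<le> a * r ^ i / (real i)\<^sup>2"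
    and en: "\<And>i. 1 \<le> i \<Longrightarrow> i < n \<Longrightarrow> 0 \<le> fps_nth e i \<and> fps_nth e i \<le> b * r ^ i / (real i)\<^sup>2"
    and ab: "a \<ge> 0" "b \<ge> 0" "r \<ge> 0"
  shows "0 \<le> fps_nth (d * e) n" "fps_nth (d * e) n \<le> 8 * a * b * r ^ n / (real n)\<^sup>2"
proof -
  have e: "fps_nth (d * e) n = (\<Sum>i=1..n-1. fps_nth d i * fps_nth e (n - i))"
    unfolding fps_mult_nth using n d0
    by (intro sum.mono_neutral_right) (auto, metis One_nat_def diff_is_0_eq le_antisym not_less_eq_eq Suc_pred le_zero_eq)
  show "0 \<le> fps_nth (d * e) n"
    unfolding e using dn en by (intro sum_nonneg mult_nonneg_nonneg) auto
  have "fps_nth (d * e) n \<le> (\<Sum>i=1..n-1. (a * b * r ^ n) * (1 / ((real i)\<^sup>2 * (real (n - i))\<^sup>2)))"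
    unfolding e
  proof (rule sum_mono)
    fix i assume i: "i \<in> {1..n-1}"
    then have "fps_nth d i * fps_nth e (n - i) \<le> (a * r ^ i / (real i)\<^sup>2) * (b * r ^ (n - i) / (real (n - i))\<^sup>2)"
      using dn[of i] en[of "n - i"] ab by (intro mult_mono) auto
    also have "\<dots> = (a * b * (r ^ i * r ^ (n - i))) * (1 / ((real i)\<^sup>2 * (real (n - i))\<^sup>2))" by simp
    also have "r ^ i * r ^ (n - i) = r ^ n" unfolding power_add[symmetric] using i by auto
    finally show "fps_nth d i * fps_nth e (n - i) \<le> (a * b * r ^ n) * (1 / ((real i)\<^sup>2 * (real (n - i))\<^sup>2))" .
  qed
  also have "\<dots> = (a * b * r ^ n) * (\<Sum>i=1..n-1. 1 / ((real i)\<^sup>2 * (real (n - i))\<^sup>2))" by (rule sum_distrib_left[symmetric])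
  also have "\<dots> \<le> (a * b * r ^ n) * (8 / (real n)\<^sup>2)"
    using ab by (intro mult_left_mono sum_convolution_squares_le n) auto
  finally show "fps_nth (d * e) n \<le> 8 * a * b * r ^ n / (real n)\<^sup>2" by (simp add: mult_ac)
qed

text \<open>In the cube of a power series the top coefficient occurs only linearly; this is what makes
  the induction over the order of the boost differences close.\<close>

lemma fps_cube_majorant:
  fixes X :: "real fps"
  assumes n: "n \<ge> 1" and X0: "0 \<le> fps_nth X 0" "fps_nth X 0 \<le> M" and Xn: "0 \<le> fps_nth X n"
    and X: "\<And>i. 1 \<le> i \<Longrightarrow> i < n \<Longrightarrow> 0 \<le> fps_nth X i \<and> fps_nth X i \<le> \<rho> * r ^ i / (real i)\<^sup>2"
    and r: "r \<ge> 0" "\<rho> \<ge> 0"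
  shows "fps_nth (X * X * X) n \<le> 3 * M\<^sup>2 * fps_nth X n + (24 * M * \<rho>\<^sup>2 + 64 * \<rho> ^ 3) * r ^ n / (real n)\<^sup>2"
proof -
  define c where "c = fps_nth X 0"
  define d where "d = X - fps_const c"
  have d0: "fps_nth d 0 = 0" by (simp add: d_def c_def)
  have dn: "fps_nth d i = fps_nth X i" if "i \<ge> 1" for i using that by (simp add: d_def)
  have M: "c \<ge> 0" "c \<le> M" using X0 by (simp_all add: c_def)
  have d2: "0 \<le> fps_nth (d * d) m \<and> fps_nth (d * d) m \<le> (8 * \<rho>\<^sup>2) * r ^ m / (real m)\<^sup>2" if "1 \<le> m" "m \<le> n" for m
    using fps_mult_square_majorant[OF d0 d0 that(1), of \<rho> r \<rho>] X that r dn by (simp add: power2_eq_square)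
  have d3: "fps_nth (d * (d * d)) n \<le> 8 * \<rho> * (8 * \<rho>\<^sup>2) * r ^ n / (real n)\<^sup>2"
    by (rule fps_mult_square_majorant(2)[OF d0 _ n]) (use d0 d2 X r dn in auto)
  have "X = fps_const c + d" by (simp add: d_def)
  then have "X * X * X = fps_const c * (fps_const c * fps_const c)
     + (fps_const (c * c) * d + fps_const (c * c) * d + fps_const (c * c) * d)
     + (fps_const c * (d * d) + fps_const c * (d * d) + fps_const c * (d * d)) + d * (d * d)"
    by (simp only: fps_const_mult[symmetric] algebra_simps)
  then have "fps_nth (X * X * X) n = c * (c * fps_nth (fps_const c) n)
     + (c * c * fps_nth d n + c * c * fps_nth d n + c * c * fps_nth d n)
     + (c * fps_nth (d * d) n + c * fps_nth (d * d) n + c * fps_nth (d * d) n) + fps_nth (d * (d * d)) n"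
    by (simp only: fps_add_nth fps_mult_left_const_nth)
  then have "fps_nth (X * X * X) n = 3 * c\<^sup>2 * fps_nth X n + 3 * c * fps_nth (d * d) n + fps_nth (d * (d * d)) n"
    using n dn[OF n] by (simp add: power2_eq_square)
  also have "\<dots> \<le> 3 * M\<^sup>2 * fps_nth X n + 3 * M * (8 * \<rho>\<^sup>2 * r ^ n / (real n)\<^sup>2) + 8 * \<rho> * (8 * \<rho>\<^sup>2) * r ^ n / (real n)\<^sup>2"
    using M Xn d2[OF n] d3 by (intro add_mono mult_mono mult_left_mono power_mono) auto
  finally show ?thesis by (simp add: power2_eq_square power3_eq_cube add_divide_distrib algebra_simps)
qed

lemma square_le_4_power: "(real n)\<^sup>2 \<le> 4 ^ n"
proof -
  have "real n \<le> 2 ^ n" using of_nat_less_two_power[of n] by (rule less_imp_le)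
  then have "(real n)\<^sup>2 \<le> (2 ^ n)\<^sup>2" by (intro power_mono) auto
  also have "\<dots> = (2\<^sup>2) ^ n" by (simp only: power_mult[symmetric] mult.commute)
  finally show ?thesis by simp
qed

text \<open>Crude and without decay in e; it supplies the finiteness of the supremum required by
  \<open>Gronwall_source\<close>.\<close>

lemma Anorm_bdiff_power_le:
  assumes "inA f"
  shows "Anorm ((bdiff e s ^^ n) f) \<le> 2 ^ n * Anorm f"
proof (induction n)
  case (Suc n)
  note i = inA_bdiff_power[OF assms, where n = n and e = e and s = s]
  have "Anorm ((bdiff e s ^^ Suc n) f) \<le> Anorm ((bdiff e s ^^ n) f) + Anorm ((bdiff e s ^^ n) f)"
    using inA_diff(2)[of "boost e s ((bdiff e s ^^ n) f)" "(bdiff e s ^^ n) f"] i by (simp add: bdiff_def)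
  with Suc show ?case by simp
qed simp

context nls_solution
begin

lemma bdiff_prof: "(bdiff e 0 ^^ n) (prof t) = schroedinger_group (- t) ((bdiff e t ^^ n) (u t))"
  by (simp add: prof_def schroedinger_bdiff_power)

text \<open>Taking the differences back to time t turns them into differences of
  \<open>cubic (u t)\<close>, to which the trilinear estimate applies.\<close>

lemma bdiff_forcing_bound:
  assumes t: "0 \<le> t" "t \<le> T" and A: "inA (u t)"
  shows "inA ((bdiff e 0 ^^ n) (mult_L2 (\<lambda>_. \<i> * lam) (forcing t)))"
    and "Anorm ((bdiff e 0 ^^ n) (mult_L2 (\<lambda>_. \<i> * lam) (forcing t))) / fact n
      \<le> cmod lam * fps_nth (Aseries e t (u t) * Aseries e t (u t) * Aseries e t (u t)) n"
proof -
  have c: "cubic (u t) = tri_L2 (u t) (u t) (u t)" by (rule cubic_tri[OF A])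
  have f: "forcing t = schroedinger_group (- t) (cubic (u t))" using t by (simp add: forcing_def uc_def)
  have bm: "(bdiff e s ^^ n) (mult_L2 (\<lambda>_. c) g) = mult_L2 (\<lambda>_. c) ((bdiff e s ^^ n) g)" for c g s
  proof (induction n)
    case (Suc n)
    interpret M: bounded_linear "mult_L2 (\<lambda>_. c)" by (rule bounded_linear_mult_L2[OF bounded_mult_const])
    show ?case using Suc by (simp add: bdiff_def boost_mult_const M.diff)
  qed simp
  have i: "inA ((bdiff e t ^^ n) (cubic (u t)))" unfolding c by (intro inA_bdiff_power inA_tri A)
  have e: "(bdiff e 0 ^^ n) (mult_L2 (\<lambda>_. \<i> * lam) (forcing t)) = mult_L2 (\<lambda>_. \<i> * lam) (schroedinger_group (- t) ((bdiff e t ^^ n) (cubic (u t))))"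
    unfolding bm f by (simp add: schroedinger_bdiff_power)
  show "inA ((bdiff e 0 ^^ n) (mult_L2 (\<lambda>_. \<i> * lam) (forcing t)))"
    unfolding e using i by (intro inA_mult_const) simp
  have "Anorm ((bdiff e 0 ^^ n) (mult_L2 (\<lambda>_. \<i> * lam) (forcing t))) = cmod lam * Anorm ((bdiff e t ^^ n) (cubic (u t)))"
    unfolding e using i by (subst inA_mult_const(2)) (auto simp: norm_mult)
  then show "Anorm ((bdiff e 0 ^^ n) (mult_L2 (\<lambda>_. \<i> * lam) (forcing t))) / fact n
      \<le> cmod lam * fps_nth (Aseries e t (u t) * Aseries e t (u t) * Aseries e t (u t)) n"
    using mult_left_mono[OF Anorm_bdiff_power_tri[OF A A A, where e = e and s = t and n = n] norm_ge_zero[of lam]] by (simp add: c)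
qed

text \<open>Strong induction on n for the bound \<rho> (R e)^n / n^2. In the cube of the series the
  n-th coefficient appears linearly with factor 3 M^2 and goes into the Gronwall constant; the
  remainder involves lower orders only and is at least quadratic in \<rho>. Order 0 is excluded
  because it is bounded by M and need not be small.\<close>

lemma bdiff_prof_bound:
  assumes A: "\<And>t. 0 \<le> t \<Longrightarrow> t \<le> T \<Longrightarrow> inA (u t) \<and> Anorm (u t) \<le> M"
    and data: "\<And>e n. 0 < e \<Longrightarrow> Anorm ((bdiff e 0 ^^ n) u0) \<le> C0 * fact n * (e / \<delta>) ^ n" "\<delta> > 0" "C0 > 0"
  obtains \<rho> R where "\<rho> > 0" "R > 0"
    "\<And>e n t. 0 < e \<Longrightarrow> 1 \<le> n \<Longrightarrow> 0 \<le> t \<Longrightarrow> t \<le> T \<Longrightarrow> Anorm ((bdiff e 0 ^^ n) (prof t)) \<le> fact n * (\<rho> * (R * e) ^ n)"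
proof -
  have M: "M \<ge> 0" using A[of 0] T Anorm_nonneg[of "u 0"] by linarith
  define L where "L = cmod lam * (3 * M\<^sup>2)"
  have L: "L \<ge> 0" by (simp add: L_def)
  from T have T0: "T \<ge> 0" by simp
  obtain K where K: "K \<ge> 1"
    "\<And>\<phi> g t. \<lbrakk>g \<ge> 0; \<And>t. 0 \<le> t \<Longrightarrow> t \<le> T \<Longrightarrow> 0 \<le> \<phi> t; \<exists>B. \<forall>t. 0 \<le> t \<longrightarrow> t \<le> T \<longrightarrow> \<phi> t \<le> B;
       \<And>s t m. 0 \<le> s \<Longrightarrow> s \<le> t \<Longrightarrow> t \<le> T \<Longrightarrow> (\<And>\<tau>. s \<le> \<tau> \<Longrightarrow> \<tau> \<le> t \<Longrightarrow> \<phi> \<tau> \<le> m) \<Longrightarrow> \<phi> t \<le> \<phi> s + (t - s) * (L * m + g);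
       0 \<le> t; t \<le> T\<rbrakk> \<Longrightarrow> \<phi> t \<le> K * (\<phi> 0 + g)"
    using Gronwall_source[OF L T0] by blast
  define Z where "Z = K * cmod lam * (24 * M + 64)"
  have Z: "Z \<ge> 0" using K M by (simp add: Z_def)
  \<comment> \<open>So small that the source, quadratic in \<rho>, takes at most half of the target
    after multiplication by K.\<close>
  define \<rho> where "\<rho> = 1 / (1 + 2 * Z)"
  have \<rho>: "0 < \<rho>" "\<rho> \<le> 1" "\<rho> * Z \<le> 1 / 2" using Z by (auto simp: \<rho>_def divide_simps)
  define q where "q = 2 * K * C0 / \<rho>"
  have q: "q \<ge> 0" using K data \<rho> by (simp add: q_def)
  \<comment> \<open>So large that the data take at most the other half, for all n >= 1: 4^n absorbs
    n^2 and (1 + q)^n absorbs the constant 2 K C0 / \<rho>.\<close>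
  define R where "R = 4 * (1 + q) / \<delta>"
  have R: "R > 0" using q data by (simp add: R_def)
  have Rn: "K * (C0 / \<delta> ^ n) \<le> \<rho> * R ^ n / (2 * (real n)\<^sup>2)" if n: "n \<ge> 1" for n
  proof -
    have "1 + q \<le> (1 + q) ^ n" using q n by (intro self_le_power) auto
    then have q1: "q \<le> (1 + q) ^ n" by linarith
    have "K * C0 * (2 * (real n)\<^sup>2) = \<rho> * (q * (real n)\<^sup>2)" using \<rho> by (simp add: q_def)
    also have "\<dots> \<le> \<rho> * ((1 + q) ^ n * 4 ^ n)"
      using \<rho> q q1 square_le_4_power[of n] by (intro mult_left_mono mult_mono) auto
    also have "\<dots> = \<rho> * R ^ n * \<delta> ^ n"
    proof -
      have "R ^ n * \<delta> ^ n = 4 ^ n * (1 + q) ^ n"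
        unfolding R_def power_divide power_mult_distrib using data(2) by simp
      then show ?thesis by (simp add: mult.commute mult.left_commute)
    qed
    finally have "K * C0 * (2 * (real n)\<^sup>2) \<le> \<rho> * R ^ n * \<delta> ^ n" .
    then show ?thesis using data(2) n by (simp add: divide_simps mult_ac)
  qed
  have main: "Anorm ((bdiff e 0 ^^ n) (prof t)) / fact n \<le> \<rho> * (R * e) ^ n / (real n)\<^sup>2"
    if e: "e > 0" and "n \<ge> 1" "0 \<le> t" "t \<le> T" for e n t
    using that(2-4)
  proof (induction n arbitrary: t rule: less_induct)
    case (less n)
    define \<phi> where "\<phi> t = Anorm ((bdiff e 0 ^^ n) (prof t)) / fact n" for t
    define g where "g = cmod lam * ((24 * M * \<rho>\<^sup>2 + 64 * \<rho> ^ 3) * (R * e) ^ n / (real n)\<^sup>2)"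
    have inp: "inA (prof t)" if "0 \<le> t" "t \<le> T" for t using A[OF that] by (simp add: prof_def)
    have X: "fps_nth (Aseries e t (u t)) i = Anorm ((bdiff e 0 ^^ i) (prof t)) / fact i" for i t
      by (simp add: Aseries_def bdiff_prof)
    have "\<phi> t \<le> K * (\<phi> 0 + g)"
    proof (rule K(2)[OF _ _ _ _ less.prems(2,3)])
      show "g \<ge> 0" using M \<rho> R e by (simp add: g_def)
      show "\<exists>B. \<forall>t. 0 \<le> t \<longrightarrow> t \<le> T \<longrightarrow> \<phi> t \<le> B"
      proof (intro exI[of _ "2 ^ n * M / fact n"] allI impI)
        fix t assume t: "0 \<le> t" "t \<le> T"
        have "Anorm ((bdiff e 0 ^^ n) (prof t)) \<le> 2 ^ n * Anorm (prof t)" by (rule Anorm_bdiff_power_le[OF inp[OF t]])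
        also have "\<dots> \<le> 2 ^ n * M" using A[OF t] by (intro mult_left_mono) (auto simp: prof_def)
        finally show "\<phi> t \<le> 2 ^ n * M / fact n" unfolding \<phi>_def by (intro divide_right_mono) auto
      qed
      fix s t m assume st: "0 \<le> s" "s \<le> t" "t \<le> T" and m: "\<And>\<tau>. s \<le> \<tau> \<Longrightarrow> \<tau> \<le> t \<Longrightarrow> \<phi> \<tau> \<le> m"
      define F where "F \<tau> = (bdiff e 0 ^^ n) (mult_L2 (\<lambda>_. \<i> * lam) (forcing \<tau>))" for \<tau>
      have g0: "g \<ge> 0" using M \<rho> R e by (simp add: g_def)
      have m0: "m \<ge> 0" using m[of s] st order_trans[of 0 "\<phi> s" m] by (simp add: \<phi>_def)
      have Fb: "inA (F \<tau>) \<and> Anorm (F \<tau>) \<le> fact n * (L * m + g)" if \<tau>: "s < \<tau>" "\<tau> \<le> t" for \<tau>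
      proof -
        have \<tau>T: "0 \<le> \<tau>" "\<tau> \<le> T" using \<tau> st by auto
        note Au = A[OF \<tau>T]
        note B = bdiff_forcing_bound[OF \<tau>T conjunct1[OF Au], where e = e and n = n, folded F_def]
        have "fps_nth (Aseries e \<tau> (u \<tau>) * Aseries e \<tau> (u \<tau>) * Aseries e \<tau> (u \<tau>)) n
           \<le> 3 * M\<^sup>2 * fps_nth (Aseries e \<tau> (u \<tau>)) n + (24 * M * \<rho>\<^sup>2 + 64 * \<rho> ^ 3) * (R * e) ^ n / (real n)\<^sup>2"
        proof (rule fps_cube_majorant[OF less.prems(1)])
          show "fps_nth (Aseries e \<tau> (u \<tau>)) 0 \<le> M" using Au by (simp add: Aseries_def)
          show "0 \<le> fps_nth (Aseries e \<tau> (u \<tau>)) i \<and> fps_nth (Aseries e \<tau> (u \<tau>)) i \<le> \<rho> * (R * e) ^ i / (real i)\<^sup>2"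
            if "1 \<le> i" "i < n" for i
            using less.IH[OF that(2,1) \<tau>T] unfolding X by simp
        qed (use \<rho> R e in \<open>auto simp: Aseries_def\<close>)
        also have "fps_nth (Aseries e \<tau> (u \<tau>)) n = \<phi> \<tau>" by (simp add: X \<phi>_def)
        also have "3 * M\<^sup>2 * \<phi> \<tau> \<le> 3 * M\<^sup>2 * m" using m[of \<tau>] \<tau> by (intro mult_left_mono) auto
        finally have "cmod lam * fps_nth (Aseries e \<tau> (u \<tau>) * Aseries e \<tau> (u \<tau>) * Aseries e \<tau> (u \<tau>)) n
          \<le> cmod lam * (3 * M\<^sup>2 * m + (24 * M * \<rho>\<^sup>2 + 64 * \<rho> ^ 3) * (R * e) ^ n / (real n)\<^sup>2)"
          by (intro mult_left_mono) auto
        also have "\<dots> = L * m + g" by (simp add: L_def g_def distrib_left)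
        finally have "Anorm (F \<tau>) / fact n \<le> L * m + g" using B(2) by simp
        then have "Anorm (F \<tau>) \<le> fact n * (L * m + g)" by (simp add: pos_divide_le_eq mult.commute)
        with B(1) show ?thesis by simp
      qed
      note P = prof_diff[OF st bounded_linear_bdiff_power[where n = n and e = e and s = 0], folded F_def]
      have Lm: "fact n * (L * m + g) \<ge> 0" using L m0 g0 by simp
      note I = Anorm_integral[OF st(2) P(1) Lm Fb]
      have "(bdiff e 0 ^^ n) (prof t) = (bdiff e 0 ^^ n) (prof s) + (LINT \<tau>:{s<..t}|lborel. F \<tau>)"
        using P(2) by (simp add: algebra_simps)
      then have "Anorm ((bdiff e 0 ^^ n) (prof t)) \<le> Anorm ((bdiff e 0 ^^ n) (prof s)) + Anorm (LINT \<tau>:{s<..t}|lborel. F \<tau>)"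
        using inA_add(2)[OF inA_bdiff_power[OF inp[of s]] I(1)] st by simp
      also have "\<dots> \<le> Anorm ((bdiff e 0 ^^ n) (prof s)) + (t - s) * (fact n * (L * m + g))"
        using I(2) by simp
      finally show "\<phi> t \<le> \<phi> s + (t - s) * (L * m + g)"
        unfolding \<phi>_def by (simp add: divide_simps mult_ac)
    qed (simp add: \<phi>_def)
    also have "K * (\<phi> 0 + g) \<le> K * (C0 * (e / \<delta>) ^ n + g)"
    proof (rule mult_left_mono)
      show "\<phi> 0 + g \<le> C0 * (e / \<delta>) ^ n + g"
        using data(1)[OF e, of n] by (simp add: \<phi>_def prof_0 pos_divide_le_eq mult_ac)
    qed (use K in simp)
    also have "K * (C0 * (e / \<delta>) ^ n + g) = (K * (C0 / \<delta> ^ n)) * e ^ n + K * g"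
      by (simp add: power_divide distrib_left)
    also have "\<dots> \<le> (\<rho> * R ^ n / (2 * (real n)\<^sup>2)) * e ^ n + \<rho> * (R * e) ^ n / (2 * (real n)\<^sup>2)"
    proof (rule add_mono)
      show "(K * (C0 / \<delta> ^ n)) * e ^ n \<le> (\<rho> * R ^ n / (2 * (real n)\<^sup>2)) * e ^ n"
        using Rn[OF less.prems(1)] e by (intro mult_right_mono) auto
      have "24 * M * \<rho>\<^sup>2 + 64 * \<rho> ^ 3 \<le> 24 * M * \<rho>\<^sup>2 + 64 * \<rho>\<^sup>2"
        using \<rho> by (intro add_left_mono mult_left_mono power_decreasing) auto
      also have "\<dots> = \<rho> * \<rho> * (24 * M + 64)" by (simp add: power2_eq_square algebra_simps)
      finally have "K * cmod lam * (24 * M * \<rho>\<^sup>2 + 64 * \<rho> ^ 3) \<le> K * cmod lam * (\<rho> * \<rho> * (24 * M + 64))"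
        using K(1) by (intro mult_left_mono) auto
      also have "\<dots> = \<rho> * (\<rho> * Z)" by (simp add: Z_def)
      also have "\<dots> \<le> \<rho> * (1 / 2)" using \<rho> by (intro mult_left_mono) auto
      finally have "(K * cmod lam * (24 * M * \<rho>\<^sup>2 + 64 * \<rho> ^ 3)) * ((R * e) ^ n / (real n)\<^sup>2) \<le> (\<rho> * (1 / 2)) * ((R * e) ^ n / (real n)\<^sup>2)"
        using R e by (intro mult_right_mono) auto
      then show "K * g \<le> \<rho> * (R * e) ^ n / (2 * (real n)\<^sup>2)" by (simp add: g_def)
    qed
    also have "\<dots> = \<rho> * (R * e) ^ n / (real n)\<^sup>2" by (simp add: power_mult_distrib field_simps)
    finally show ?case by (simp add: \<phi>_def)
  qed
  show ?thesis
  proof (rule that[OF \<rho>(1) R])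
    fix e t :: real and n :: nat
    assume e: "0 < e" and n: "1 \<le> n" and t: "0 \<le> t" "t \<le> T"
    have "\<rho> * (R * e) ^ n / (real n)\<^sup>2 \<le> \<rho> * (R * e) ^ n / 1"
      using n \<rho> R e by (intro divide_left_mono) auto
    with main[OF e n t] have "Anorm ((bdiff e 0 ^^ n) (prof t)) / fact n \<le> \<rho> * (R * e) ^ n" by simp
    then show "Anorm ((bdiff e 0 ^^ n) (prof t)) \<le> fact n * (\<rho> * (R * e) ^ n)"
      by (simp add: pos_divide_le_eq mult.commute)
  qed
qed

end

section \<open>Zeros of bounded holomorphic functions in a strip\<close>

text \<open>Divide out one zero at a time: a Moebius map moves a to 0, Schwarz's lemma removes the
  factor z without enlarging the bound M, and the map is undone. The removed factor has modulus |a|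
  at 0.\<close>

lemma finite_Blaschke:
  assumes "finite S" "S \<subseteq> ball 0 1" "h holomorphic_on ball 0 1" "M > 0"
    "\<And>z. z \<in> ball 0 1 \<Longrightarrow> cmod (h z) \<le> M" "\<And>a. a \<in> S \<Longrightarrow> h a = 0"
  shows "cmod (h 0) \<le> M * (\<Prod>a\<in>S. cmod a)"
  using assms
proof (induction S arbitrary: h rule: finite_induct)
  case empty
  then show ?case by simp
next
  case (insert a S)
  let ?\<phi> = "Moebius_function 0"
  have a: "cmod a < 1" "cmod (- a) < 1" using insert.prems by auto
  have maps: "?\<phi> c z \<in> ball 0 1" if "z \<in> ball 0 1" "cmod c < 1" for c z
    using Moebius_function_norm_lt_1[OF that(2), of z 0] that by simp
  define g where "g = (\<lambda>z. h (?\<phi> (- a) z))"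
  have hg: "g holomorphic_on ball 0 1"
    unfolding g_def
    by (rule holomorphic_on_compose_gen[unfolded o_def, OF Moebius_function_holomorphic[OF a(2)] insert.prems(2)])
       (use maps a in auto)
  have g0: "g 0 = 0" using insert.prems(5) by (simp add: g_def Moebius_function_of_zero)
  obtain k where k: "k holomorphic_on ball 0 1" "\<And>z. cmod z < 1 \<Longrightarrow> g z = z * k z" "deriv g 0 = k 0"
    using Schwarz3[OF hg g0] by metis
  have kM: "cmod (k z) \<le> M" if z: "z \<in> ball 0 1" for z
  proof (rule field_le_epsilon)
    fix e :: real assume e: "e > 0"
    \<comment> \<open>Schwarz's lemma asks for values strictly inside the disc, hence the margin
      e.\<close>
    define M' where "M' = M + e"
    have M': "M' > 0" "M < M'" using insert.prems(3) e by (auto simp: M'_def)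
    have h1: "(\<lambda>z. g z / of_real M') holomorphic_on ball 0 1" by (intro holomorphic_intros hg) (use M' in auto)
    have b: "cmod (g z / of_real M') < 1" if "cmod z < 1" for z
    proof -
      have "cmod (g z) \<le> M" unfolding g_def using maps[of z "- a"] a that by (intro insert.prems) auto
      then show ?thesis using M' by (simp add: norm_divide)
    qed
    have z1: "cmod z < 1" using z by simp
    have h0: "g 0 / of_real M' = 0" using g0 by simp
    have S: "cmod (g z / of_real M') \<le> cmod z" "cmod (deriv (\<lambda>z. g z / of_real M') 0) \<le> 1"
      by (rule Schwarz_Lemma[OF h1 h0 b z1]; assumption)+
    show "cmod (k z) \<le> M + e"
    proof (cases "z = 0")
      case False
      have "cmod z * cmod (k z) / M' \<le> cmod z" using S(1) k(2)[OF z1] M' by (simp add: norm_divide norm_mult)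
      then have "cmod z * cmod (k z) \<le> cmod z * M'" using M' by (simp add: pos_divide_le_eq)
      then show ?thesis using False by (simp add: M'_def)
    next
      case True
      have "g field_differentiable at 0" using hg holomorphic_on_imp_differentiable_at[of g "ball 0 1" 0] by simp
      then have "deriv (\<lambda>z. g z / of_real M') 0 = deriv g 0 / of_real M'" by (rule deriv_cdivide_right)
      then have "cmod (k 0) / M' \<le> 1" using S(2) k(3) M' by (simp add: norm_divide)
      then show ?thesis using M' True by (simp add: divide_le_eq M'_def)
    qed
  qed
  define q where "q = (\<lambda>z. k (?\<phi> a z))"
  have hq: "q holomorphic_on ball 0 1"
    unfolding q_def
    by (rule holomorphic_on_compose_gen[unfolded o_def, OF Moebius_function_holomorphic[OF a(1)] k(1)])
       (use maps a in auto)
  have fac: "h z = ?\<phi> a z * q z" if "z \<in> ball 0 1" for z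
  proof -
    have "?\<phi> (- a) (?\<phi> a z) = z" using a that by (intro Moebius_function_compose) auto
    then have "h z = g (?\<phi> a z)" by (simp add: g_def)
    also have "\<dots> = ?\<phi> a z * k (?\<phi> a z)" using maps[OF that a(1)] by (intro k(2)) simp
    finally show ?thesis by (simp add: q_def)
  qed
  have "cmod (q 0) \<le> M * (\<Prod>a\<in>S. cmod a)"
  proof (rule insert.IH)
    show "cmod (q z) \<le> M" if "z \<in> ball 0 1" for z unfolding q_def by (intro kM maps that a)
    show "q b = 0" if b: "b \<in> S" for b
    proof -
      have bb: "b \<in> ball 0 1" using b insert.prems by auto
      have "h b = 0" using b insert.prems by auto
      moreover have "?\<phi> a b \<noteq> 0"
      proof
        assume "?\<phi> a b = 0"
        moreover have "?\<phi> (- a) (?\<phi> a b) = b" using a bb by (intro Moebius_function_compose) auto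
        ultimately have "b = a" by (simp add: Moebius_function_of_zero)
        then show False using b insert.hyps by simp
      qed
      ultimately show ?thesis using fac[OF bb] by simp
    qed
  qed (use insert.prems hq in auto)
  moreover have "h 0 = - a * q 0" using fac[of 0] by (simp add: Moebius_function_of_zero)
  ultimately have "cmod (h 0) \<le> cmod a * (M * (\<Prod>a\<in>S. cmod a))" by (simp add: norm_mult mult_left_mono)
  then show ?case using insert.hyps by (simp add: mult.left_commute)
qed

text \<open>Equal to tanh (pi y / (4 d)): the conformal map of the strip |Im z| < d onto the unit
  disc that fixes 0, restricted to the real line.\<close>

definition strip_disc :: "real \<Rightarrow> real \<Rightarrow> real" where
  "strip_disc d y = (exp (pi * y / (2 * d)) - 1) / (exp (pi * y / (2 * d)) + 1)"

lemma strip_disc_bound: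
  assumes d: "d > 0"
  shows "\<bar>strip_disc d y\<bar> < 1" "exp (- (pi / (2 * d)) * \<bar>y\<bar>) \<le> 1 - \<bar>strip_disc d y\<bar>"
proof -
  define E where "E = exp (pi * y / (2 * d))"
  have E: "E > 0" by (simp add: E_def)
  have w: "strip_disc d y = (E - 1) / (E + 1)" by (simp add: strip_disc_def E_def)
  show "\<bar>strip_disc d y\<bar> < 1" unfolding w using E by (auto simp: abs_less_iff divide_simps)
  show "exp (- (pi / (2 * d)) * \<bar>y\<bar>) \<le> 1 - \<bar>strip_disc d y\<bar>"
  proof (cases "y \<ge> 0")
    case True
    then have E1: "E \<ge> 1" using d by (simp add: E_def)
    have "exp (- (pi / (2 * d)) * \<bar>y\<bar>) = 1 / E" using True by (simp add: E_def exp_minus inverse_eq_divide)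
    also have "\<dots> \<le> 2 / (E + 1)" using E1 by (simp add: divide_simps)
    also have "\<dots> = 1 - (E - 1) / (E + 1)" using E by (simp add: divide_simps)
    finally show ?thesis unfolding w using E1 by simp
  next
    case False
    then have "pi * y / (2 * d) \<le> 0" using d by (simp add: divide_nonpos_pos mult_nonneg_nonpos)
    then have E1: "E \<le> 1" by (simp add: E_def)
    have "exp (- (pi / (2 * d)) * \<bar>y\<bar>) = E" using False by (simp add: E_def)
    also have "\<dots> = E * 1" by simp
    also have "\<dots> \<le> E * (2 / (E + 1))" using E E1 by (intro mult_left_mono) (auto simp: divide_simps)
    also have "\<dots> = 1 - (1 - E) / (E + 1)" using E by (simp add: divide_simps)
    finally have "exp (- (pi / (2 * d)) * \<bar>y\<bar>) \<le> 1 - (1 - E) / (E + 1)" .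
    moreover have "\<bar>(E - 1) / (E + 1)\<bar> = (1 - E) / (E + 1)" using E E1 by (simp add: abs_divide)
    ultimately show ?thesis unfolding w by simp
  qed
qed

lemma Re_cayley_pos:
  assumes "w \<in> ball 0 1"
  shows "Re ((1 + w) / (1 - w)) > 0"
proof -
  have n: "cmod w < 1" using assms by simp
  then have w1: "1 - w \<noteq> 0" by auto
  have "(cmod w)\<^sup>2 < 1" using n by (simp add: power_less_one_iff)
  then have "(Re w)\<^sup>2 + (Im w)\<^sup>2 < 1" by (simp add: cmod_power2)
  moreover have "Re ((1 + w) / (1 - w)) = (1 - ((Re w)\<^sup>2 + (Im w)\<^sup>2)) / (cmod (1 - w))\<^sup>2"
  proof -
    have "Re (1 + w) * Re (1 - w) + Im (1 + w) * Im (1 - w) = 1 - ((Re w)\<^sup>2 + (Im w)\<^sup>2)"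
      by (simp add: power2_eq_square algebra_simps)
    then show ?thesis by (simp only: Re_divide cmod_power2)
  qed
  ultimately show ?thesis using w1 by (simp add: divide_pos_pos)
qed

text \<open>\<open>finite_Blaschke\<close> transported to the strip by the inverse conformal map
  \<psi>, which takes 0 to p. Each zero x has modulus at most 1 - t, hence at most exp (-t), with t
  = exp (-(pi/(2d)) |x - p|), so the product becomes the exponential of a sum.\<close>

lemma strip_zeros_bound:
  assumes d: "d > 0" and G: "G holomorphic_on {z. \<bar>Im z\<bar> < d}" and M: "M > 0" "\<And>z. \<bar>Im z\<bar> < d \<Longrightarrow> cmod (G z) \<le> M"
    and X: "finite X" "\<And>x. x \<in> X \<Longrightarrow> G (of_real x) = 0"
  shows "cmod (G (of_real p)) \<le> M * exp (- (\<Sum>x\<in>X. exp (- (pi / (2 * d)) * \<bar>x - p\<bar>)))"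
proof -
  define \<psi> where "\<psi> w = of_real p + of_real (2 * d / pi) * Ln ((1 + w) / (1 - w))" for w
  have strip: "\<bar>Im (\<psi> w)\<bar> < d" if "w \<in> ball 0 1" for w :: complex
  proof -
    have "(1 + w) / (1 - w) \<noteq> 0" using Re_cayley_pos[OF that] by (metis less_irrefl zero_complex.sel(1))
    from Re_Ln_pos_lt[OF this] have "\<bar>Im (Ln ((1 + w) / (1 - w)))\<bar> < pi / 2"
      using Re_cayley_pos[OF that] by simp
    then have "(2 * d / pi) * \<bar>Im (Ln ((1 + w) / (1 - w)))\<bar> < (2 * d / pi) * (pi / 2)"
      using d by (intro mult_strict_left_mono) auto
    then show ?thesis using d by (simp add: \<psi>_def abs_mult)
  qed
  have h\<psi>: "\<psi> holomorphic_on ball 0 1"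
  proof -
    have "(1 + w) / (1 - w) \<notin> \<real>\<^sub>\<le>\<^sub>0" if "w \<in> ball 0 1" for w :: complex
      using Re_cayley_pos[OF that] by (auto elim!: nonpos_Reals_cases)
    moreover have "1 - w \<noteq> 0" if "w \<in> ball 0 1" for w :: complex using that by auto
    ultimately show ?thesis unfolding \<psi>_def by (intro holomorphic_intros) auto
  qed
  define h where "h = (\<lambda>w. G (\<psi> w))"
  have hh: "h holomorphic_on ball 0 1"
    unfolding h_def by (rule holomorphic_on_compose_gen[unfolded o_def, OF h\<psi> G]) (use strip in auto)
  define w where "w x = complex_of_real (strip_disc d (x - p))" for x
  have \<psi>w: "\<psi> (w x) = of_real x" for x
  proof -
    define E where "E = exp (pi * (x - p) / (2 * d))"
    have E: "E > 0" by (simp add: E_def)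
    have "(1 + w x) / (1 - w x) = of_real ((1 + (E - 1) / (E + 1)) / (1 - (E - 1) / (E + 1)))"
      by (simp add: w_def strip_disc_def E_def)
    also have "(1 + (E - 1) / (E + 1)) / (1 - (E - 1) / (E + 1)) = E" using E by (simp add: divide_simps)
    finally have "Ln ((1 + w x) / (1 - w x)) = of_real (ln E)" using E by (simp add: Ln_of_real)
    then show ?thesis using d by (simp add: \<psi>_def E_def)
  qed
  have wb: "w x \<in> ball 0 1" for x using strip_disc_bound(1)[OF d] by (simp add: w_def)
  have injw: "inj_on w X" by (rule inj_on_inverseI[where g = "\<lambda>z. Re (\<psi> z)"]) (simp add: \<psi>w)
  have "cmod (h 0) \<le> M * (\<Prod>a\<in>w ` X. cmod a)"
  proof (rule finite_Blaschke[OF _ _ hh M(1)])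
    show "cmod (h z) \<le> M" if "z \<in> ball 0 1" for z unfolding h_def by (intro M strip that)
  qed (use X wb \<psi>w in \<open>auto simp: h_def\<close>)
  also have "h 0 = G (of_real p)" by (simp add: h_def \<psi>_def)
  also have "(\<Prod>a\<in>w ` X. cmod a) = (\<Prod>x\<in>X. cmod (w x))" by (simp add: prod.reindex[OF injw])
  also have "\<dots> \<le> (\<Prod>x\<in>X. exp (- exp (- (pi / (2 * d)) * \<bar>x - p\<bar>)))"
  proof (rule prod_mono)
    fix x
    have "cmod (w x) \<le> 1 + - exp (- (pi / (2 * d)) * \<bar>x - p\<bar>)"
      using strip_disc_bound(2)[OF d, of "x - p"] by (simp add: w_def)
    also have "\<dots> \<le> exp (- exp (- (pi / (2 * d)) * \<bar>x - p\<bar>))" by (rule exp_ge_add_one_self)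
    finally show "0 \<le> cmod (w x) \<and> cmod (w x) \<le> exp (- exp (- (pi / (2 * d)) * \<bar>x - p\<bar>))" by simp
  qed
  also have "\<dots> = exp (- (\<Sum>x\<in>X. exp (- (pi / (2 * d)) * \<bar>x - p\<bar>)))"
    using X(1) by (simp add: exp_sum sum_negf[symmetric])
  finally show ?thesis using M by (simp add: mult_left_mono)
qed

text \<open>As \<alpha> < 1, pi/(2d) times the n-th grid point is eventually at most ln (1 + n),
  whatever d and c are. The Blaschke terms are then at least a constant times 1/(n + 1), and a
  nonzero value at p would bound the harmonic series.\<close>

theorem strip_log_grid_uniqueness:
  fixes \<alpha> c d :: real
  assumes d: "d > 0" and G: "G holomorphic_on {z. \<bar>Im z\<bar> < d}" and M: "\<And>z. \<bar>Im z\<bar> < d \<Longrightarrow> cmod (G z) \<le> M"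
    and \<alpha>: "0 < \<alpha>" "\<alpha> < 1" and c: "c > 0"
    and zeros: "\<And>n :: nat. G (of_real (c * ln (1 + real n) powr \<alpha>)) = 0"
  shows "G (of_real p) = 0"
proof (rule ccontr)
  assume "G (of_real p) \<noteq> 0"
  then have Gp: "cmod (G (of_real p)) > 0" by simp
  have "cmod (G (of_real p)) \<le> M" using M[of "of_real p"] d by simp
  with Gp have M0: "M > 0" by linarith
  define x where "x n = c * ln (1 + real n) powr \<alpha>" for n
  have inj: "inj x"
  proof (rule linorder_injI)
    fix m n :: nat assume "m < n"
    then have "ln (1 + real m) powr \<alpha> < ln (1 + real n) powr \<alpha>" using \<alpha> by (intro powr_less_mono2) auto
    then show "x m \<noteq> x n" using c by (simp add: x_def)
  qed
  define A where "A = pi * c / (2 * d)"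
  have A: "A > 0" using c d by (simp add: A_def)
  \<comment> \<open>The threshold above which A <= L^(1 - \<alpha>), that is, A L^\<alpha> <=
    L.\<close>
  define L0 where "L0 = A powr (1 / (1 - \<alpha>))"
  obtain n0 :: nat where n0: "exp L0 \<le> real n0" using real_arch_simple by blast
  have lower: "exp (- (pi / (2 * d)) * \<bar>p\<bar>) * (1 / real (Suc n)) \<le> exp (- (pi / (2 * d)) * \<bar>x n - p\<bar>)" if n: "n \<ge> n0" for n
  proof -
    define L where "L = ln (1 + real n)"
    have "exp L0 \<le> 1 + real n" using n0 n by linarith
    then have L: "L0 \<le> L" unfolding L_def by (subst ln_ge_iff) auto
    have L0p: "L0 > 0" using A by (simp add: L0_def)
    have "A = L0 powr (1 - \<alpha>)" using A \<alpha> by (simp add: L0_def powr_powr)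
    also have "\<dots> \<le> L powr (1 - \<alpha>)" using L L0p \<alpha> by (intro powr_mono2) auto
    finally have "A * L powr \<alpha> \<le> L powr (1 - \<alpha>) * L powr \<alpha>" by (intro mult_right_mono) auto
    also have "\<dots> = L" using L L0p by (simp flip: powr_add)
    finally have AL: "A * L powr \<alpha> \<le> L" .
    have "x n \<ge> 0" using c by (simp add: x_def)
    then have "\<bar>x n - p\<bar> \<le> x n + \<bar>p\<bar>" by linarith
    then have "(pi / (2 * d)) * \<bar>x n - p\<bar> \<le> (pi / (2 * d)) * (x n + \<bar>p\<bar>)" using d by (intro mult_left_mono) auto
    also have "\<dots> = A * L powr \<alpha> + (pi / (2 * d)) * \<bar>p\<bar>" by (simp add: A_def x_def L_def distrib_left)
    also have "\<dots> \<le> L + (pi / (2 * d)) * \<bar>p\<bar>" using AL by simp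
    finally have "- (pi / (2 * d)) * \<bar>p\<bar> + - L \<le> - (pi / (2 * d)) * \<bar>x n - p\<bar>" by simp
    then have "exp (- (pi / (2 * d)) * \<bar>p\<bar> + - L) \<le> exp (- (pi / (2 * d)) * \<bar>x n - p\<bar>)" by (simp only: exp_le_cancel_iff)
    moreover have "exp (- L) = 1 / real (Suc n)" by (simp add: L_def exp_minus inverse_eq_divide)
    ultimately show ?thesis by (simp only: exp_add)
  qed
  define \<kappa> where "\<kappa> = exp (- (pi / (2 * d)) * \<bar>p\<bar>)"
  have \<kappa>: "\<kappa> > 0" by (simp add: \<kappa>_def)
  have bound: "\<kappa> * (\<Sum>n=n0..<N. 1 / real (Suc n)) \<le> M / cmod (G (of_real p))" for N
  proof -
    define X where "X = x ` {n0..<N}"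
    have "cmod (G (of_real p)) \<le> M * exp (- (\<Sum>x\<in>X. exp (- (pi / (2 * d)) * \<bar>x - p\<bar>)))"
      by (rule strip_zeros_bound[OF d G M0 M]) (auto simp: X_def x_def zeros simp del: of_real_mult)
    also have "(\<Sum>x\<in>X. exp (- (pi / (2 * d)) * \<bar>x - p\<bar>)) = (\<Sum>n=n0..<N. exp (- (pi / (2 * d)) * \<bar>x n - p\<bar>))"
      unfolding X_def by (subst sum.reindex) (auto intro: inj_on_subset[OF inj])
    finally have *: "cmod (G (of_real p)) \<le> M * exp (- (\<Sum>n=n0..<N. exp (- (pi / (2 * d)) * \<bar>x n - p\<bar>)))" .
    define S where "S = (\<Sum>n=n0..<N. exp (- (pi / (2 * d)) * \<bar>x n - p\<bar>))"
    have "\<kappa> * (\<Sum>n=n0..<N. 1 / real (Suc n)) \<le> S"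
      unfolding sum_distrib_left S_def \<kappa>_def using lower by (intro sum_mono) auto
    \<comment> \<open>Any bound on the partial sums will do, so the logarithm of M/|G p| is replaced
      by M/|G p| itself.\<close>
    also have "S \<le> exp S" using exp_ge_add_one_self[of S] by linarith
    also have "exp S \<le> M / cmod (G (of_real p))"
      using * Gp unfolding S_def[symmetric] by (simp add: exp_minus pos_le_divide_eq divide_inverse[symmetric] mult.commute)
    finally show ?thesis .
  qed
  define B where "B = M / cmod (G (of_real p)) / \<kappa> + (\<Sum>n<n0. 1 / real (Suc n))"
  have "(\<Sum>n<N. 1 / real (Suc n)) \<le> B" for N
  proof -
    have "(\<Sum>n<N. 1 / real (Suc n)) \<le> (\<Sum>n\<in>{..<n0} \<union> {n0..<N}. 1 / real (Suc n))"
      by (intro sum_mono2) auto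
    also have "\<dots> = (\<Sum>n<n0. 1 / real (Suc n)) + (\<Sum>n=n0..<N. 1 / real (Suc n))"
      by (rule sum.union_disjoint) auto
    also have "(\<Sum>n=n0..<N. 1 / real (Suc n)) \<le> M / cmod (G (of_real p)) / \<kappa>"
      using bound[of N] unfolding pos_le_divide_eq[OF \<kappa>] by (simp only: mult.commute)
    finally show ?thesis by (simp add: B_def add.commute)
  qed
  then have "summable (\<lambda>n. 1 / real (Suc n))"
    by (intro summableI_nonneg_bounded[where x = B]) auto
  then have "summable (\<lambda>n. inverse (real n))"
    by (subst summable_Suc_iff[symmetric]) (simp add: inverse_eq_divide)
  then show False using not_summable_harmonic[where 'a = real] by simp
qed

section \<open>Holomorphic extension at the final time\<close>

text \<open>Sum the exponential series at half the critical rate 1/R: the factorials cancel and a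
  geometric series of ratio 1/2 remains.\<close>

lemma factorial_moments_exp:
  fixes a b \<rho> R :: real
  assumes "\<And>n. a ^ n * b \<le> fact n * (\<rho> * R ^ n)" "a \<ge> 0" "R > 0"
  shows "exp (a / (2 * R)) * b \<le> 2 * \<rho>"
proof -
  have "(\<lambda>n. (a / (2 * R)) ^ n /\<^sub>R fact n) sums exp (a / (2 * R))" by (rule exp_converges)
  then have 1: "(\<lambda>n. (a / (2 * R)) ^ n /\<^sub>R fact n * b) sums (exp (a / (2 * R)) * b)" by (rule sums_mult2)
  have 2: "(\<lambda>n. \<rho> * (1 / 2) ^ n) sums (\<rho> * 2)" using sums_mult[OF geometric_sums[of "1/2 :: real"], of \<rho>] by simp
  have le: "(a / (2 * R)) ^ n /\<^sub>R fact n * b \<le> \<rho> * (1 / 2) ^ n" for n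
  proof -
    have "(a / (2 * R)) ^ n /\<^sub>R fact n * b = (a ^ n * b) / (fact n * (2 * R) ^ n)"
      by (simp only: real_scaleR_def power_divide) (simp add: field_simps)
    also have "\<dots> \<le> (fact n * (\<rho> * R ^ n)) / (fact n * (2 * R) ^ n)"
      using assms by (intro divide_right_mono) auto
    also have "\<dots> = \<rho> * (1 / 2) ^ n" using assms(3) by (simp add: power_mult_distrib power_divide)
    finally show ?thesis .
  qed
  from sums_le[OF le 1 2] show ?thesis by (simp only: mult.commute)
qed

lemma norm_exp_minus_1_le: "cmod (exp \<zeta> - 1) \<le> cmod \<zeta> * exp (cmod \<zeta>)"
proof -
  have "cmod (exp \<zeta> - exp 0) \<le> exp (cmod \<zeta>) * cmod (\<zeta> - 0)"
  proof (rule field_differentiable_bound[where S = "cball 0 (cmod \<zeta>)"])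
    show "(exp has_field_derivative exp z) (at z within cball 0 (cmod \<zeta>))" for z
      by (rule DERIV_subset[OF DERIV_exp]) simp
    show "cmod (exp z) \<le> exp (cmod \<zeta>)" if "z \<in> cball 0 (cmod \<zeta>)" for z
      using norm_exp[of z] that by (auto intro: order_trans)
  qed auto
  then show ?thesis by (simp add: mult.commute)
qed

lemma exp_transform_holomorphic:
  fixes F :: "real \<Rightarrow> complex"
  assumes [measurable]: "F \<in> borel_measurable borel" and F: "integrable lborel (\<lambda>\<eta>. cmod (F \<eta>) * exp (d * \<bar>\<eta>\<bar>))"
  defines "\<Phi> \<equiv> \<lambda>z. LINT \<eta>|lborel. F \<eta> * exp (\<i> * z * of_real \<eta>)"
  shows "\<Phi> holomorphic_on {z. \<bar>Im z\<bar> < d}"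
    and "\<And>z. \<bar>Im z\<bar> < d \<Longrightarrow> cmod (\<Phi> z) \<le> (LINT \<eta>|lborel. cmod (F \<eta>) * exp (d * \<bar>\<eta>\<bar>))"
proof -
  have ne: "cmod (exp (\<i> * z * of_real \<eta>)) \<le> exp (\<bar>Im z\<bar> * \<bar>\<eta>\<bar>)" for z \<eta>
    using abs_ge_minus_self[of "Im z * \<eta>"] by (simp add: abs_mult)
  have le: "cmod (F \<eta> * exp (\<i> * z * of_real \<eta>)) \<le> cmod (F \<eta>) * exp (d * \<bar>\<eta>\<bar>)" if "\<bar>Im z\<bar> < d" for z \<eta>
  proof -
    have "exp (\<bar>Im z\<bar> * \<bar>\<eta>\<bar>) \<le> exp (d * \<bar>\<eta>\<bar>)" using that by (simp add: mult_right_mono)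
    with ne[of z \<eta>] have "cmod (exp (\<i> * z * of_real \<eta>)) \<le> exp (d * \<bar>\<eta>\<bar>)" by linarith
    then show ?thesis unfolding norm_mult[of "F \<eta>"] by (rule mult_left_mono) simp
  qed
  have int: "integrable lborel (\<lambda>\<eta>. F \<eta> * exp (\<i> * z * of_real \<eta>))" if "\<bar>Im z\<bar> < d" for z
    by (rule Bochner_Integration.integrable_bound[OF F])
       (use le[OF that] in \<open>auto intro: order_trans[OF _ abs_ge_self]\<close>)
  show "cmod (\<Phi> z) \<le> (LINT \<eta>|lborel. cmod (F \<eta>) * exp (d * \<bar>\<eta>\<bar>))" if z: "\<bar>Im z\<bar> < d" for z
  proof -
    have "cmod (\<Phi> z) \<le> (LINT \<eta>|lborel. cmod (F \<eta> * exp (\<i> * z * of_real \<eta>)))"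
      unfolding \<Phi>_def by (rule integral_norm_bound)
    also have "\<dots> \<le> (LINT \<eta>|lborel. cmod (F \<eta>) * exp (d * \<bar>\<eta>\<bar>))"
      by (intro integral_mono integrable_norm int z F le)
    finally show ?thesis .
  qed
  have op: "open {z. \<bar>Im z\<bar> < d}" by (intro open_Collect_less continuous_intros)
  show "\<Phi> holomorphic_on {z. \<bar>Im z\<bar> < d}"
    unfolding holomorphic_on_open[OF op]
  proof (intro allI ballI)
    fix z0 assume "z0 \<in> {z. \<bar>Im z\<bar> < d}"
    then have z0: "\<bar>Im z0\<bar> < d" by simp
    \<comment> \<open>Half of the distance to the boundary of the strip. One r accommodates the
      difference quotient, the other dominates the factor |eta| by exp (r |eta|)/r.\<close>
    define r where "r = (d - \<bar>Im z0\<bar>) / 2"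
    have r: "r > 0" "\<bar>Im z0\<bar> + r + r = d" using z0 by (auto simp: r_def)
    have rb: "\<bar>Im z\<bar> < d" if "z \<in> ball z0 r" for z
    proof -
      have "\<bar>Im z\<bar> \<le> \<bar>Im z0\<bar> + \<bar>Im (z - z0)\<bar>" by simp
      also have "\<bar>Im (z - z0)\<bar> \<le> cmod (z - z0)" by (rule abs_Im_le_cmod)
      finally show ?thesis using that r by (simp add: dist_norm norm_minus_commute)
    qed
    define D where "D = (LINT \<eta>|lborel. F \<eta> * (\<i> * of_real \<eta> * exp (\<i> * z0 * of_real \<eta>)))"
    have "((\<lambda>z. (\<Phi> z - \<Phi> z0) / (z - z0)) \<longlongrightarrow> D) (at z0 within ball z0 r)"
      unfolding tendsto_at_iff_sequentially
    proof (intro allI impI)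
      fix X :: "nat \<Rightarrow> complex" assume X: "\<forall>i. X i \<in> ball z0 r - {z0}" "X \<longlonglongrightarrow> z0"
      define s where "s i \<eta> = F \<eta> * ((exp (\<i> * X i * of_real \<eta>) - exp (\<i> * z0 * of_real \<eta>)) / (X i - z0))" for i \<eta>
      have e: "(\<Phi> (X i) - \<Phi> z0) / (X i - z0) = (LINT \<eta>|lborel. s i \<eta>)" for i
      proof -
        have "\<Phi> (X i) - \<Phi> z0 = (LINT \<eta>|lborel. F \<eta> * exp (\<i> * X i * of_real \<eta>) - F \<eta> * exp (\<i> * z0 * of_real \<eta>))"
          unfolding \<Phi>_def by (rule Bochner_Integration.integral_diff[symmetric]) (use X rb z0 in \<open>auto intro!: int\<close>)
        then show ?thesis by (simp add: s_def right_diff_distrib[symmetric])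
      qed
      have "(\<lambda>i. LINT \<eta>|lborel. s i \<eta>) \<longlonglongrightarrow> D"
        unfolding D_def
      proof (rule integral_dominated_convergence[where w = "\<lambda>\<eta>. (1 / r) * (cmod (F \<eta>) * exp (d * \<bar>\<eta>\<bar>))"])
        show "integrable lborel (\<lambda>\<eta>. (1 / r) * (cmod (F \<eta>) * exp (d * \<bar>\<eta>\<bar>)))"
          using F by (rule integrable_mult_right)
        show "AE \<eta> in lborel. (\<lambda>i. s i \<eta>) \<longlonglongrightarrow> F \<eta> * (\<i> * of_real \<eta> * exp (\<i> * z0 * of_real \<eta>))"
        proof (rule AE_I2)
          fix \<eta>
          have "((\<lambda>z. exp (\<i> * z * of_real \<eta>)) has_field_derivative \<i> * of_real \<eta> * exp (\<i> * z0 * of_real \<eta>)) (at z0 within ball z0 r)"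
            by (auto intro!: derivative_eq_intros)
          then have "((\<lambda>z. (exp (\<i> * z * of_real \<eta>) - exp (\<i> * z0 * of_real \<eta>)) / (z - z0)) \<longlongrightarrow> \<i> * of_real \<eta> * exp (\<i> * z0 * of_real \<eta>)) (at z0 within ball z0 r)"
            by (simp add: has_field_derivative_iff)
          then have "(\<lambda>i. (exp (\<i> * X i * of_real \<eta>) - exp (\<i> * z0 * of_real \<eta>)) / (X i - z0)) \<longlonglongrightarrow> \<i> * of_real \<eta> * exp (\<i> * z0 * of_real \<eta>)"
            using X unfolding tendsto_at_iff_sequentially o_def by blast
          then show "(\<lambda>i. s i \<eta>) \<longlonglongrightarrow> F \<eta> * (\<i> * of_real \<eta> * exp (\<i> * z0 * of_real \<eta>))"
            unfolding s_def by (rule tendsto_mult_left)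
        qed
        fix i
        define w where "w = X i - z0"
        have w: "w \<noteq> 0" "cmod w \<le> r" using X(1) by (auto simp: w_def dist_norm norm_minus_commute less_imp_le)
        show "AE \<eta> in lborel. norm (s i \<eta>) \<le> (1 / r) * (cmod (F \<eta>) * exp (d * \<bar>\<eta>\<bar>))"
        proof (rule AE_I2)
          fix \<eta>
          have "exp (\<i> * X i * of_real \<eta>) = exp (\<i> * z0 * of_real \<eta>) * exp (\<i> * w * of_real \<eta>)"
            unfolding exp_add[symmetric] by (simp add: w_def algebra_simps)
          then have "s i \<eta> = F \<eta> * (exp (\<i> * z0 * of_real \<eta>) * (exp (\<i> * w * of_real \<eta>) - 1) / w)"
            by (simp add: s_def w_def right_diff_distrib)
          then have "norm (s i \<eta>) = cmod (F \<eta>) * (cmod (exp (\<i> * z0 * of_real \<eta>)) * cmod (exp (\<i> * w * of_real \<eta>) - 1) / cmod w)"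
            by (simp only: norm_mult norm_divide)
          also have "\<dots> \<le> cmod (F \<eta>) * (exp (\<bar>Im z0\<bar> * \<bar>\<eta>\<bar>) * (cmod (\<i> * w * of_real \<eta>) * exp (cmod (\<i> * w * of_real \<eta>))) / cmod w)"
            by (intro mult_left_mono divide_right_mono mult_mono ne norm_exp_minus_1_le) auto
          also have "cmod (\<i> * w * of_real \<eta>) = cmod w * \<bar>\<eta>\<bar>" by (simp add: norm_mult)
          also have "exp (\<bar>Im z0\<bar> * \<bar>\<eta>\<bar>) * ((cmod w * \<bar>\<eta>\<bar>) * exp (cmod w * \<bar>\<eta>\<bar>)) / cmod w
             = exp (\<bar>Im z0\<bar> * \<bar>\<eta>\<bar>) * exp (cmod w * \<bar>\<eta>\<bar>) * \<bar>\<eta>\<bar>" using w by simp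
          also have "\<dots> \<le> exp (\<bar>Im z0\<bar> * \<bar>\<eta>\<bar>) * exp (r * \<bar>\<eta>\<bar>) * ((1 / r) * exp (r * \<bar>\<eta>\<bar>))"
          proof (intro mult_mono)
            show "exp (cmod w * \<bar>\<eta>\<bar>) \<le> exp (r * \<bar>\<eta>\<bar>)" using w by (simp add: mult_right_mono)
            have "r * \<bar>\<eta>\<bar> \<le> exp (r * \<bar>\<eta>\<bar>)" using exp_ge_add_one_self[of "r * \<bar>\<eta>\<bar>"] by linarith
            then show "\<bar>\<eta>\<bar> \<le> (1 / r) * exp (r * \<bar>\<eta>\<bar>)" using r by (simp add: pos_le_divide_eq mult.commute)
          qed (use r in auto)
          also have "\<dots> = (1 / r) * exp (d * \<bar>\<eta>\<bar>)"
            unfolding r(2)[symmetric] distrib_right exp_add by (simp only: mult_ac)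
          finally have "norm (s i \<eta>) \<le> cmod (F \<eta>) * ((1 / r) * exp (d * \<bar>\<eta>\<bar>))" by (simp add: mult_left_mono)
          then show "norm (s i \<eta>) \<le> (1 / r) * (cmod (F \<eta>) * exp (d * \<bar>\<eta>\<bar>))" by (simp only: mult.left_commute)
        qed
      qed (auto simp: s_def)
      then show "((\<lambda>z. (\<Phi> z - \<Phi> z0) / (z - z0)) \<circ> X) \<longlonglongrightarrow> D" unfolding o_def e .
    qed
    then have "(\<Phi> has_field_derivative D) (at z0 within ball z0 r)" by (simp add: has_field_derivative_iff)
    then have "(\<Phi> has_field_derivative D) (at z0)" using at_within_open[of z0 "ball z0 r"] r by simp
    then show "\<exists>f'. (\<Phi> has_field_derivative f') (at z0)" by blast
  qed
qed

lemma H1_trans_le: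
  assumes G: "square_int G" "fourier_L2 f = L2_of G" and xG: "square_int (\<lambda>\<xi>. of_real \<xi> * G \<xi>)"
  shows "norm (trans_L2 h f - f) \<le> \<bar>h\<bar> * norm (L2_of (\<lambda>\<xi>. of_real \<xi> * G \<xi>))"
proof -
  interpret F: bounded_linear fourier_L2 by (rule bounded_linear_fourier_L2)
  have bm: "bounded_mult (\<lambda>\<xi>. exp (- (\<i> * of_real (h * \<xi>))) - 1)"
    by (intro bounded_mult_diff unimod_bounded[OF unimod_lin(1)] bounded_mult_const)
  have "fourier_L2 (trans_L2 h f - f) = L2_of (\<lambda>\<xi>. (exp (- (\<i> * of_real (h * \<xi>))) - 1) * G \<xi>)"
    unfolding F.diff fourier_trans_L2 G(2) mult_L2_of[OF bm G(1), symmetric]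
      mult_L2_diff_left[OF unimod_bounded[OF unimod_lin(1)] bounded_mult_const] by simp
  then have "norm (trans_L2 h f - f) = norm (L2_of (\<lambda>\<xi>. (exp (- (\<i> * of_real (h * \<xi>))) - 1) * G \<xi>))"
    by (metis norm_fourier_L2)
  also have "\<dots> \<le> \<bar>h\<bar> * norm (L2_of (\<lambda>\<xi>. of_real \<xi> * G \<xi>))"
  proof (rule norm_L2_of_mono[OF square_int_mult[OF bm G(1)] xG])
    have "cmod (exp (- (\<i> * of_real (h * \<xi>))) - 1) \<le> \<bar>h * \<xi>\<bar>" for \<xi>
      using iexp_minus_1_le[of "- (h * \<xi>)"] by simp
    then have "cmod (exp (- (\<i> * of_real (h * \<xi>))) - 1) * cmod (G \<xi>) \<le> \<bar>h * \<xi>\<bar> * cmod (G \<xi>)" for \<xi>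
      by (rule mult_right_mono) simp
    then show "AE \<xi> in lborel. cmod ((exp (- (\<i> * of_real (h * \<xi>))) - 1) * G \<xi>) \<le> \<bar>h\<bar> * cmod (of_real \<xi> * G \<xi>)"
      by (simp add: norm_mult abs_mult mult.assoc)
  qed simp
  finally show ?thesis .
qed

section \<open>From boost differences to exponential weights and back\<close>

lemma boost_difference_limit:
  "(\<lambda>k. (exp (\<i> * of_real (1 / real (Suc k) * x)) - 1) * of_real (real (Suc k))) \<longlonglongrightarrow> \<i> * of_real x"
proof -
  have "((\<lambda>z. exp (\<i> * (z * of_real x))) has_field_derivative \<i> * of_real x) (at 0)"
    by (auto intro!: derivative_eq_intros)
  from deriv_sequence[OF this] show ?thesis by (simp del: of_nat_Suc)
qed

text \<open>\<open>exp (- i x\<^sup>2 / 4T)\<close> conjugates boosts at time \<open>T\<close> into translations.\<close>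

definition chirp :: "real \<Rightarrow> real \<Rightarrow> complex" where
  "chirp T x = exp (- (\<i> * of_real (x\<^sup>2 / (4 * T))))"

lemma unimod_chirp: "unimod (chirp T)"
  unfolding chirp_def by (intro unimod_exp) measurable

text \<open>Completing the square: -x^2/(4T) + e x - e^2 T = -(x - 2 e T)^2/(4T).\<close>

lemma chirp_boost:
  assumes T: "T > 0"
  shows "mult_L2 (chirp T) (boost e T f) = trans_L2 (2 * e * T) (mult_L2 (chirp T) f)"
proof -
  have "chirp T x * exp (\<i> * of_real (e * x - e\<^sup>2 * T)) = chirp T (x - 2 * e * T)" for x
  proof -
    have r: "- (x\<^sup>2 / (4 * T)) + (e * x - e\<^sup>2 * T) = - ((x - 2 * e * T)\<^sup>2 / (4 * T))"
      using T by (simp add: power2_eq_square field_simps)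
    have "- (\<i> * of_real (x\<^sup>2 / (4 * T))) + \<i> * of_real (e * x - e\<^sup>2 * T) = \<i> * of_real (- (x\<^sup>2 / (4 * T)) + (e * x - e\<^sup>2 * T))"
      by (simp only: of_real_add of_real_minus distrib_left mult_minus_right)
    also have "\<dots> = - (\<i> * of_real ((x - 2 * e * T)\<^sup>2 / (4 * T)))"
      unfolding r by (simp only: of_real_minus mult_minus_right)
    finally show ?thesis unfolding chirp_def by (rule exp_mult_eq)
  qed
  then show ?thesis
    unfolding boost_def trans_mult_L2[OF unimod_bounded[OF unimod_chirp]]
      mult_L2_mult[OF unimod_bounded[OF unimod_chirp] unimod_bounded[OF unimod_boost]] by simp
qed

lemma chirp_bdiff_power:
  assumes T: "T > 0"
  shows "((\<lambda>g. trans_L2 (2 * e * T) g - g) ^^ n) (mult_L2 (chirp T) f) = mult_L2 (chirp T) ((bdiff e T ^^ n) f)"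
proof (induction n)
  case (Suc n)
  interpret M: bounded_linear "mult_L2 (chirp T)" by (rule bounded_linear_mult_L2[OF unimod_bounded[OF unimod_chirp]])
  show ?case using Suc by (simp add: bdiff_def M.diff chirp_boost[OF T])
qed simp

lemma fourier_trans_diff_power:
  assumes G: "square_int G" "fourier_L2 g = L2_of G"
  shows "square_int (\<lambda>\<eta>. (exp (- (\<i> * of_real (h * \<eta>))) - 1) ^ n * G \<eta>)"
    and "fourier_L2 (((\<lambda>g. trans_L2 h g - g) ^^ n) g) = L2_of (\<lambda>\<eta>. (exp (- (\<i> * of_real (h * \<eta>))) - 1) ^ n * G \<eta>)"
proof -
  interpret F: bounded_linear fourier_L2 by (rule bounded_linear_fourier_L2)
  define m where "m = (\<lambda>\<eta>. exp (- (\<i> * complex_of_real (h * \<eta>))) - 1)"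
  have bm: "bounded_mult m"
    unfolding m_def by (intro bounded_mult_diff unimod_bounded[OF unimod_lin(1)] bounded_mult_const)
  have step: "fourier_L2 (trans_L2 h f - f) = mult_L2 m (fourier_L2 f)" for f
    unfolding F.diff fourier_trans_L2 m_def mult_L2_diff_left[OF unimod_bounded[OF unimod_lin(1)] bounded_mult_const] by simp
  have "square_int (\<lambda>\<eta>. m \<eta> ^ n * G \<eta>) \<and> fourier_L2 (((\<lambda>g. trans_L2 h g - g) ^^ n) g) = L2_of (\<lambda>\<eta>. m \<eta> ^ n * G \<eta>)"
  proof (induction n)
    case 0
    then show ?case using G by simp
  next
    case (Suc n)
    then have s: "square_int (\<lambda>\<eta>. m \<eta> ^ n * G \<eta>)" by simp
    show ?case using Suc square_int_mult[OF bm s] by (simp add: step mult_L2_of[OF bm s] mult.assoc)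
  qed
  then show "square_int (\<lambda>\<eta>. (exp (- (\<i> * of_real (h * \<eta>))) - 1) ^ n * G \<eta>)"
    "fourier_L2 (((\<lambda>g. trans_L2 h g - g) ^^ n) g) = L2_of (\<lambda>\<eta>. (exp (- (\<i> * of_real (h * \<eta>))) - 1) ^ n * G \<eta>)"
    by (simp_all add: m_def)
qed

text \<open>The terms of the exponential series at rate a/2 have L2 norms at most C (1/2)^n, so the
  partial sums are bounded and Fatou applies to their pointwise limit.\<close>

lemma L2_exp_weight:
  assumes G: "square_int G" and a: "a > 0"
    and mom: "\<And>n. square_int (\<lambda>\<eta>. of_real (\<bar>\<eta>\<bar> ^ n) * G \<eta>)"
      "\<And>n. norm (L2_of (\<lambda>\<eta>. of_real (\<bar>\<eta>\<bar> ^ n) * G \<eta>)) \<le> fact n * (C * (1 / a) ^ n)"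
  shows "square_int (\<lambda>\<eta>. of_real (exp (a / 2 * \<bar>\<eta>\<bar>)) * G \<eta>)"
proof -
  have [measurable]: "G \<in> borel_measurable borel" using G by measurable
  define c where "c n = (a / 2) ^ n / fact n" for n
  define s where "s N \<eta> = (\<Sum>n<N. of_real (c n) * (of_real (\<bar>\<eta>\<bar> ^ n) * G \<eta>))" for N \<eta>
  have C: "C \<ge> 0" using order_trans[OF norm_ge_zero mom(2)[of 0]] by simp
  have s: "square_int (s N) \<and> norm (L2_of (s N)) \<le> (\<Sum>n<N. C * (1 / 2) ^ n)" for N
  proof (induction N)
    case 0
    then show ?case by (simp add: s_def[abs_def] square_int_zero L2_of_zero)
  next
    case (Suc N)
    let ?t = "\<lambda>\<eta>. of_real (c N) * (of_real (\<bar>\<eta>\<bar> ^ N) * G \<eta>)"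
    have t: "square_int ?t" by (rule square_int_mult_const[OF mom(1)])
    have "L2_of ?t = mult_L2 (\<lambda>_. of_real (c N)) (L2_of (\<lambda>\<eta>. of_real (\<bar>\<eta>\<bar> ^ N) * G \<eta>))"
      by (rule mult_L2_of[OF bounded_mult_const mom(1), symmetric])
    moreover have "c N \<ge> 0" using a by (simp add: c_def)
    ultimately have "norm (L2_of ?t) = c N * norm (L2_of (\<lambda>\<eta>. of_real (\<bar>\<eta>\<bar> ^ N) * G \<eta>))"
      by (simp only: norm_mult_L2_const norm_of_real abs_of_nonneg)
    also have "\<dots> \<le> c N * (fact N * (C * (1 / a) ^ N))" using a by (intro mult_left_mono mom) (simp add: c_def)
    also have "\<dots> = C * (1 / 2) ^ N" using a by (simp add: c_def power_divide)
    finally have nt: "norm (L2_of ?t) \<le> C * (1 / 2) ^ N" .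
    have e: "s (Suc N) = (\<lambda>\<eta>. s N \<eta> + ?t \<eta>)" by (simp add: s_def fun_eq_iff)
    have "norm (L2_of (s (Suc N))) \<le> norm (L2_of (s N)) + norm (L2_of ?t)"
      unfolding e L2_of_add[OF conjunct1[OF Suc] t, symmetric] by (rule norm_triangle_ineq)
    then show ?case using Suc nt square_int_add[OF conjunct1[OF Suc] t] unfolding e by simp
  qed
  have "(\<Sum>n<N. C * (1 / 2) ^ n) \<le> C * 2" for N
  proof -
    have "(\<lambda>n. C * (1 / 2) ^ n) sums (C * 2)" using sums_mult[OF geometric_sums[of "1/2 :: real"], of C] by simp
    then show ?thesis unfolding sums_iff using C sum_le_suminf[of "\<lambda>n. C * (1 / 2) ^ n" "{..<N}"] by fastforce
  qed
  then have n2: "norm (L2_of (s N)) \<le> C * 2" for N using s[of N] order_trans by blast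
  have lim: "(\<lambda>N. s N \<eta>) \<longlonglongrightarrow> of_real (exp (a / 2 * \<bar>\<eta>\<bar>)) * G \<eta>" for \<eta>
  proof -
    have "(\<lambda>n. (a / 2 * \<bar>\<eta>\<bar>) ^ n /\<^sub>R fact n) sums exp (a / 2 * \<bar>\<eta>\<bar>)" by (rule exp_converges)
    moreover have "(a / 2 * \<bar>\<eta>\<bar>) ^ n /\<^sub>R fact n = c n * \<bar>\<eta>\<bar> ^ n" for n
      unfolding c_def power_mult_distrib[of "a / 2"] real_scaleR_def by (simp only: divide_inverse mult_ac)
    ultimately have "(\<lambda>N. \<Sum>n<N. c n * \<bar>\<eta>\<bar> ^ n) \<longlonglongrightarrow> exp (a / 2 * \<bar>\<eta>\<bar>)"
      by (simp only: sums_def)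
    then have "(\<lambda>N. of_real (\<Sum>n<N. c n * \<bar>\<eta>\<bar> ^ n) * G \<eta>) \<longlonglongrightarrow> of_real (exp (a / 2 * \<bar>\<eta>\<bar>)) * G \<eta>"
      by (intro tendsto_intros)
    then show ?thesis by (simp add: s_def sum_distrib_right mult.assoc)
  qed
  have "(\<lambda>\<eta>. of_real (exp (a / 2 * \<bar>\<eta>\<bar>)) * G \<eta>) \<in> borel_measurable borel" by measurable
  from L2_Fatou(1)[OF conjunct1[OF s] n2 AE_I2[OF lim] this] show ?thesis .
qed

text \<open>\<open>Anorm\<close> dominates the essential supremum, so the bounds hold for |exp (i e
  x) - 1|^n |f(x)| almost everywhere. The values e = 1/(k + 1) are countably many and share one null
  set; dividing by e^n and letting k grow gives factorial bounds on |x|^n |f(x)|.\<close>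

lemma bdiff_bound_decay:
  assumes R: "R > 0"
    and A: "\<And>e n. 0 < e \<Longrightarrow> inA ((bdiff e 0 ^^ n) f) \<and> Anorm ((bdiff e 0 ^^ n) f) \<le> fact n * (\<rho> * (R * e) ^ n)"
  shows "AE x in lborel. exp (\<bar>x\<bar> / (2 * R)) * cmod (fun_of f x) \<le> 2 * \<rho>"
proof -
  define F where "F = fun_of f"
  have F: "square_int F" "f = L2_of F" by (simp_all add: F_def)
  have "AE x in lborel. cmod ((exp (\<i> * of_real (1 / real (Suc k) * x)) - 1) ^ n * F x)
      \<le> fact n * (\<rho> * (R * (1 / real (Suc k))) ^ n)" for n k
  proof -
    have e: "1 / real (Suc k) > 0" by simp
    note b = bdiff_0_L2_of[OF F(1), where e = "1 / real (Suc k)" and n = n, folded F(2)]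
    note A' = A[OF e, of n]
    from inA_ess_bounded[OF conjunct1[OF A']]
    have "AE x in lborel. cmod ((exp (\<i> * of_real (1 / real (Suc k) * x)) - 1) ^ n * F x) \<le> Anorm ((bdiff (1 / real (Suc k)) 0 ^^ n) f)"
      unfolding b(2) ess_bounded_L2_of[OF b(1)] .
    then show ?thesis by (rule eventually_mono) (rule order_trans[OF _ conjunct2[OF A']])
  qed
  then have "AE x in lborel. \<forall>n k. cmod ((exp (\<i> * of_real (1 / real (Suc k) * x)) - 1) ^ n * F x)
      \<le> fact n * (\<rho> * (R * (1 / real (Suc k))) ^ n)" unfolding AE_all_countable by blast
  then show ?thesis
  proof eventually_elim
    fix x
    assume *: "\<forall>n k. cmod ((exp (\<i> * of_real (1 / real (Suc k) * x)) - 1) ^ n * F x) \<le> fact n * (\<rho> * (R * (1 / real (Suc k))) ^ n)"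
    have "\<bar>x\<bar> ^ n * cmod (F x) \<le> fact n * (\<rho> * R ^ n)" for n
    proof -
      let ?q = "\<lambda>k. (exp (\<i> * of_real (1 / real (Suc k) * x)) - 1) * of_real (real (Suc k))"
      have "cmod (?q k ^ n * F x) \<le> fact n * (\<rho> * R ^ n)" for k
      proof -
        have "?q k ^ n * F x = of_real (real (Suc k) ^ n) * ((exp (\<i> * of_real (1 / real (Suc k) * x)) - 1) ^ n * F x)"
          unfolding power_mult_distrib of_real_power by (simp only: mult_ac)
        then have "cmod (?q k ^ n * F x) = real (Suc k) ^ n * cmod ((exp (\<i> * of_real (1 / real (Suc k) * x)) - 1) ^ n * F x)"
          by (simp only: norm_mult[of "of_real _"] norm_of_real abs_of_nonneg zero_le_power of_nat_0_le_iff)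
        also have "\<dots> \<le> real (Suc k) ^ n * (fact n * (\<rho> * (R * (1 / real (Suc k))) ^ n))"
          by (rule mult_left_mono[OF *[rule_format]]) simp
        also have "\<dots> = fact n * (\<rho> * R ^ n)" by (simp add: power_divide del: of_nat_Suc)
        finally show ?thesis .
      qed
      moreover have "(\<lambda>k. cmod (?q k ^ n * F x)) \<longlonglongrightarrow> cmod ((\<i> * of_real x) ^ n * F x)"
        by (intro tendsto_norm tendsto_mult tendsto_power tendsto_const boost_difference_limit)
      ultimately have "cmod ((\<i> * of_real x) ^ n * F x) \<le> fact n * (\<rho> * R ^ n)" by (intro LIMSEQ_le_const2) auto
      then show ?thesis by (simp add: norm_mult norm_power)
    qed
    from factorial_moments_exp[OF this _ R] show "exp (\<bar>x\<bar> / (2 * R)) * cmod (fun_of f x) \<le> 2 * \<rho>"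
      by (simp add: F_def)
  qed
qed

text \<open>Half of the decay rate keeps the weighted function square integrable, the other half
  dominates |e x|^n by n! (e/d)^n. The result is again stated for boost differences because that
  form can be moved from the profile to u(T) isometrically.\<close>

lemma exp_decay_bdiff_norm:
  assumes d: "d > 0" and K: "AE x in lborel. exp (2 * d * \<bar>x\<bar>) * cmod (fun_of f x) \<le> K"
  obtains C where "\<And>e n. 0 < e \<Longrightarrow> norm ((bdiff e 0 ^^ n) f) \<le> fact n * (C * (e / d) ^ n)"
proof -
  define F where "F = fun_of f"
  have F: "square_int F" "f = L2_of F" by (simp_all add: F_def)
  then have [measurable]: "F \<in> borel_measurable borel" by measurable
  define g where "g x = of_real (exp (d * \<bar>x\<bar>)) * F x" for x
  have [measurable]: "g \<in> borel_measurable borel" unfolding g_def by measurable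
  have g: "square_int g"
  proof (rule square_int_AE_bound)
    show "integrable lborel (\<lambda>x. K\<^sup>2 * exp (- (2 * d) * \<bar>x\<bar>))"
      by (intro integrable_mult_right integrable_exp_abs) (use d in auto)
    show "AE x in lborel. (cmod (g x))\<^sup>2 \<le> K\<^sup>2 * exp (- (2 * d) * \<bar>x\<bar>)"
      using K
    proof eventually_elim
      fix x assume "exp (2 * d * \<bar>x\<bar>) * cmod (fun_of f x) \<le> K"
      then have "(exp (2 * d * \<bar>x\<bar>) * cmod (F x))\<^sup>2 \<le> K\<^sup>2" unfolding F_def by (intro power_mono) auto
      then have "exp (- (2 * d) * \<bar>x\<bar>) * (exp (2 * d * \<bar>x\<bar>) * cmod (F x))\<^sup>2 \<le> exp (- (2 * d) * \<bar>x\<bar>) * K\<^sup>2"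
        by (rule mult_left_mono) simp
      moreover have "exp (- (2 * d) * \<bar>x\<bar>) * (exp (2 * d * \<bar>x\<bar>))\<^sup>2 = (exp (d * \<bar>x\<bar>))\<^sup>2"
        unfolding power2_eq_square exp_add[symmetric] by (simp add: algebra_simps)
      ultimately show "(cmod (g x))\<^sup>2 \<le> K\<^sup>2 * exp (- (2 * d) * \<bar>x\<bar>)"
        by (simp only: g_def norm_mult norm_of_real abs_exp_cancel power_mult_distrib mult.assoc[symmetric] mult.commute[of _ "K\<^sup>2"])
    qed
  qed simp
  have "norm ((bdiff e 0 ^^ n) f) \<le> fact n * (norm (L2_of g) * (e / d) ^ n)" if e: "e > 0" for e n
  proof -
    note b = bdiff_0_L2_of[OF F(1), where e = e and n = n, folded F(2)]
    have "norm (L2_of (\<lambda>x. (exp (\<i> * of_real (e * x)) - 1) ^ n * F x)) \<le> fact n * (e / d) ^ n * norm (L2_of g)"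
    proof (rule norm_L2_of_mono[OF b(1) g AE_I2])
      fix x
      have "cmod ((exp (\<i> * of_real (e * x)) - 1) ^ n) \<le> \<bar>e * x\<bar> ^ n"
        unfolding norm_power by (rule power_mono[OF iexp_minus_1_le]) simp
      also have "\<bar>e * x\<bar> = e / d * (d * \<bar>x\<bar>)" using d e by (simp add: abs_mult)
      also have "(e / d * (d * \<bar>x\<bar>)) ^ n \<le> (e / d) ^ n * (fact n * exp (d * \<bar>x\<bar>))"
        unfolding power_mult_distrib[of "e / d"] by (rule mult_left_mono[OF power_le_exp]) (use d e in auto)
      finally have "cmod ((exp (\<i> * of_real (e * x)) - 1) ^ n) * cmod (F x) \<le> (e / d) ^ n * (fact n * exp (d * \<bar>x\<bar>)) * cmod (F x)"
        by (rule mult_right_mono) simp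
      also have "\<dots> = fact n * (e / d) ^ n * cmod (g x)"
        unfolding g_def norm_mult norm_of_real abs_exp_cancel by (simp only: mult_ac)
      finally show "cmod ((exp (\<i> * of_real (e * x)) - 1) ^ n * F x) \<le> fact n * (e / d) ^ n * cmod (g x)"
        unfolding norm_mult .
    qed (use d e in auto)
    then show ?thesis unfolding b(2) by (simp only: mult_ac)
  qed
  then show thesis by (rule that)
qed

text \<open>After multiplication by the chirp, boost differences are differences of translations by
  2 e T, hence multipliers (exp (-2 i e T eta) - 1)^n in frequency. Letting e tend to 0 bounds the
  moments of G with rate 2 T d. This gives the weight exp (T d |eta|) in L2, and half of it is spent
  on passing to L1 by Cauchy-Schwarz.\<close>

lemma chirp_fourier_integrable:
  assumes T: "T > 0" and d: "d > 0"
    and b: "\<And>e n. 0 < e \<Longrightarrow> norm ((bdiff e T ^^ n) f) \<le> fact n * (C * (e / d) ^ n)"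
    and G: "square_int G" "fourier_L2 (mult_L2 (chirp T) f) = L2_of G"
  shows "integrable lborel (\<lambda>\<eta>. cmod (G \<eta>) * exp (T * d / 2 * \<bar>\<eta>\<bar>))"
proof -
  have [measurable]: "G \<in> borel_measurable borel" using G by measurable
  have mom: "square_int (\<lambda>\<eta>. of_real (\<bar>\<eta>\<bar> ^ n) * G \<eta>) \<and>
      norm (L2_of (\<lambda>\<eta>. of_real (\<bar>\<eta>\<bar> ^ n) * G \<eta>)) \<le> fact n * (C * (1 / (2 * T * d)) ^ n)" for n
  proof -
    define fk where "fk k \<eta> = ((exp (\<i> * of_real (1 / real (Suc k) * (- (2 * T * \<eta>)))) - 1) * of_real (real (Suc k))) ^ n * G \<eta>" for k \<eta>
    define g where "g \<eta> = (\<i> * of_real (- (2 * T * \<eta>))) ^ n * G \<eta>" for \<eta>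
    have [measurable]: "g \<in> borel_measurable borel" unfolding g_def by measurable
    have fk: "square_int (fk k) \<and> norm (L2_of (fk k)) \<le> fact n * (C * (1 / d) ^ n)" for k
    proof -
      define e where "e = 1 / real (Suc k)"
      have e: "e > 0" by (simp add: e_def)
      define h where "h = 2 * e * T"
      note q = fourier_trans_diff_power[OF G, where h = h and n = n]
      have c: "1 / real (Suc k) * (- (2 * T * \<eta>)) = - (h * \<eta>)" for \<eta> by (simp add: h_def e_def)
      have fk: "fk k = (\<lambda>\<eta>. of_real (real (Suc k) ^ n) * ((exp (- (\<i> * of_real (h * \<eta>))) - 1) ^ n * G \<eta>))"
        unfolding fk_def c
        unfolding power_mult_distrib of_real_power of_real_minus mult_minus_right by (simp only: mult_ac)
      have "norm (L2_of (\<lambda>\<eta>. (exp (- (\<i> * of_real (h * \<eta>))) - 1) ^ n * G \<eta>)) = norm ((bdiff e T ^^ n) f)"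
        using arg_cong[OF q(2), of norm] unfolding h_def chirp_bdiff_power[OF T] norm_fourier_L2 norm_mult_L2_unimod[OF unimod_chirp] ..
      also have "\<dots> \<le> fact n * (C * (e / d) ^ n)" by (rule b[OF e])
      finally have le: "norm (L2_of (\<lambda>\<eta>. (exp (- (\<i> * of_real (h * \<eta>))) - 1) ^ n * G \<eta>)) \<le> fact n * (C * (e / d) ^ n)" .
      have "norm (L2_of (fk k)) = real (Suc k) ^ n * norm (L2_of (\<lambda>\<eta>. (exp (- (\<i> * of_real (h * \<eta>))) - 1) ^ n * G \<eta>))"
        unfolding fk mult_L2_of[OF bounded_mult_const q(1), symmetric] norm_mult_L2_const norm_of_real by simp
      also have "\<dots> \<le> real (Suc k) ^ n * (fact n * (C * (e / d) ^ n))" by (rule mult_left_mono[OF le]) simp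
      also have "\<dots> = fact n * (C * (1 / d) ^ n)" by (simp add: e_def power_divide power_mult_distrib del: of_nat_Suc)
      finally show ?thesis using square_int_mult_const[OF q(1)] unfolding fk by blast
    qed
    have lim: "(\<lambda>k. fk k \<eta>) \<longlonglongrightarrow> g \<eta>" for \<eta>
      unfolding fk_def g_def by (intro tendsto_mult tendsto_power tendsto_const boost_difference_limit)
    note gF = L2_Fatou[OF conjunct1[OF fk] conjunct2[OF fk] AE_I2[OF lim] \<open>g \<in> borel_measurable borel\<close>]
    have eq: "cmod (of_real (\<bar>\<eta>\<bar> ^ n) * G \<eta>) = (1 / (2 * T)) ^ n * cmod (g \<eta>)" for \<eta>
      using T by (simp add: g_def norm_mult norm_power abs_mult power_mult_distrib power_divide)
    have s: "square_int (\<lambda>\<eta>. of_real (\<bar>\<eta>\<bar> ^ n) * G \<eta>)"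
    proof (rule square_int_bound)
      show "integrable lborel (\<lambda>\<eta>. ((1 / (2 * T)) ^ n)\<^sup>2 * (cmod (g \<eta>))\<^sup>2)"
        by (rule integrable_mult_right[OF square_intD[OF gF(1)]])
      show "(cmod (of_real (\<bar>\<eta>\<bar> ^ n) * G \<eta>))\<^sup>2 \<le> ((1 / (2 * T)) ^ n)\<^sup>2 * (cmod (g \<eta>))\<^sup>2" for \<eta>
        unfolding eq power_mult_distrib ..
    qed measurable
    have "norm (L2_of (\<lambda>\<eta>. of_real (\<bar>\<eta>\<bar> ^ n) * G \<eta>)) \<le> (1 / (2 * T)) ^ n * norm (L2_of g)"
      by (rule norm_L2_of_mono[OF s gF(1) AE_I2]) (use T eq in auto)
    also have "\<dots> \<le> (1 / (2 * T)) ^ n * (fact n * (C * (1 / d) ^ n))"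
      by (rule mult_left_mono[OF gF(2)]) (use T in auto)
    also have "\<dots> = fact n * (C * (1 / (2 * T * d)) ^ n)"
      by (simp add: power_divide power_mult_distrib)
    finally show ?thesis using s by blast
  qed
  have "2 * T * d > 0" using T d by simp
  from L2_exp_weight[OF G(1) this conjunct1[OF mom] conjunct2[OF mom]]
  have s1: "square_int (\<lambda>\<eta>. of_real (exp (T * d * \<bar>\<eta>\<bar>)) * G \<eta>)" by simp
  have s2: "square_int (\<lambda>\<eta>. of_real (exp (- (T * d / 2) * \<bar>\<eta>\<bar>)))"
  proof (rule square_int_bound)
    show "integrable lborel (\<lambda>\<eta>. exp (- (T * d) * \<bar>\<eta>\<bar>))"
      by (rule integrable_exp_abs) (use T d in auto)
    show "(cmod (of_real (exp (- (T * d / 2) * \<bar>\<eta>\<bar>))))\<^sup>2 \<le> exp (- (T * d) * \<bar>\<eta>\<bar>)" for \<eta>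
      unfolding norm_of_real abs_exp_cancel power2_eq_square exp_add[symmetric] by simp
  qed measurable
  have "exp (T * d * \<bar>\<eta>\<bar>) * exp (- (T * d / 2) * \<bar>\<eta>\<bar>) = exp (T * d / 2 * \<bar>\<eta>\<bar>)" for \<eta>
    unfolding exp_add[symmetric] by (simp add: field_simps)
  then have "cmod (of_real (exp (T * d * \<bar>\<eta>\<bar>)) * G \<eta>) * cmod (of_real (exp (- (T * d / 2) * \<bar>\<eta>\<bar>))) = cmod (G \<eta>) * exp (T * d / 2 * \<bar>\<eta>\<bar>)" for \<eta>
    unfolding norm_mult norm_of_real abs_exp_cancel by (metis mult.assoc mult.commute)
  with L2_Cauchy_Schwarz(1)[OF s1 s2] show ?thesis by (simp only:)
qed

text \<open>Inversion writes f as a unimodular factor times the restriction of a holomorphic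
  function \<Phi> to the real line. This product is continuous, hence it is
  \<open>continuous_rep f\<close>, and since the factor never vanishes the zeros of f are zeros of
  \<Phi>.\<close>

lemma chirp_grid_zeros_imp_0:
  assumes T: "T > 0" and d: "d > 0" and G: "square_int G" "fourier_L2 (mult_L2 (chirp T) f) = L2_of G"
    and int: "integrable lborel (\<lambda>\<eta>. cmod (G \<eta>) * exp (d * \<bar>\<eta>\<bar>))"
    and \<alpha>: "0 < \<alpha>" "\<alpha> < 1" and c: "c > 0"
    and z: "\<And>n :: nat. continuous_rep f (c * ln (1 + real n) powr \<alpha>) = 0"
  shows "f = 0"
proof -
  have [measurable]: "G \<in> borel_measurable borel" using G by measurable
  define \<Phi> where "\<Phi> z = (LINT \<eta>|lborel. G \<eta> * exp (\<i> * z * of_real \<eta>))" for z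
  note hol = exp_transform_holomorphic[OF \<open>G \<in> borel_measurable borel\<close> int, folded \<Phi>_def]
  have iG: "integrable lborel G"
  proof (rule Bochner_Integration.integrable_bound[OF int])
    have "cmod (G \<eta>) * 1 \<le> cmod (G \<eta>) * exp (d * \<bar>\<eta>\<bar>)" for \<eta>
      using d by (intro mult_left_mono) auto
    then show "AE \<eta> in lborel. norm (G \<eta>) \<le> norm (cmod (G \<eta>) * exp (d * \<bar>\<eta>\<bar>))" by simp
  qed simp
  have ft: "ft G (- x) = (1 / sqrt (2 * pi)) *\<^sub>R \<Phi> (of_real x)" for x
    unfolding ft_def \<Phi>_def by (intro arg_cong[where f = "scaleR _"] Bochner_Integration.integral_cong) (simp_all add: mult_ac)
  define ch where "ch x = exp (\<i> * complex_of_real (x\<^sup>2 / (4 * T)))" for x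
  have ch: "unimod ch" unfolding ch_def by (intro unimod_exp) measurable
  have "ch x * chirp T x = 1" for x
    unfolding ch_def chirp_def by (subst exp_mult_eq[where c = 0]) auto
  then have "f = mult_L2 ch (mult_L2 (chirp T) f)"
    by (simp add: mult_L2_mult[OF unimod_bounded[OF ch] unimod_bounded[OF unimod_chirp]])
  also have "mult_L2 (chirp T) f = L2_of (\<lambda>x. ft G (- x))" by (rule inA_inversion(2)[OF G iG])
  also have "mult_L2 ch \<dots> = L2_of (\<lambda>x. ch x * ft G (- x))"
    by (rule mult_L2_of[OF unimod_bounded[OF ch] inA_inversion(1)[OF G iG]])
  finally have f: "f = L2_of (\<lambda>x. ch x * ft G (- x))" .
  have s: "square_int (\<lambda>x. ch x * ft G (- x))"
    by (rule square_int_mult[OF unimod_bounded[OF ch] inA_inversion(1)[OF G iG]])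
  have "continuous_on UNIV (\<lambda>x. \<Phi> (complex_of_real x))"
    by (rule continuous_on_compose2[OF holomorphic_on_imp_continuous_on[OF hol(1)]])
       (use d in \<open>auto intro!: continuous_intros\<close>)
  then have "continuous_on UNIV (\<lambda>x. ch x * ft G (- x))"
    unfolding ft ch_def using T by (intro continuous_intros) auto
  moreover have "AE x in lborel. ch x * ft G (- x) = fun_of f x"
    using fun_of_L2_of[OF s] unfolding f[symmetric] by (auto elim: eventually_mono)
  ultimately have rep: "continuous_rep f = (\<lambda>x. ch x * ft G (- x))" by (rule continuous_rep_eq)
  have "\<Phi> (of_real (c * ln (1 + real n) powr \<alpha>)) = 0" for n :: nat
    using z[of n] unfolding rep ft by (simp add: ch_def)
  from strip_log_grid_uniqueness[OF d hol \<alpha> c this]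
  have "\<Phi> (of_real p) = 0" for p by simp
  then show ?thesis unfolding f ft by (simp add: L2_of_zero)
qed

text \<open>H^1 gives the continuous representative, its Hoelder bound and the Lipschitz bound for
  translations in L2. The zeros on the two half lines give decay on each, the negative one by
  reflection.\<close>

lemma grid_zeros_initial_decay:
  assumes xG: "square_int (\<lambda>\<xi>. of_real \<xi> * fun_of (fourier_L2 f) \<xi>)"
    and \<alpha>: "0 < \<alpha>" "\<alpha> < 1" and c: "c > 0"
    and z: "\<And>n :: nat. continuous_rep f (c * ln (1 + real n) powr \<alpha>) = 0"
      "\<And>n :: nat. continuous_rep f (- (c * ln (1 + real n) powr \<alpha>)) = 0"
  obtains C0 \<delta> where "C0 > 0" "\<delta> > 0"
    "\<And>e n. 0 < e \<Longrightarrow> inA ((bdiff e 0 ^^ n) f) \<and> Anorm ((bdiff e 0 ^^ n) f) \<le> C0 * fact n * (e / \<delta>) ^ n"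
proof -
  define G where "G = fun_of (fourier_L2 f)"
  have G: "square_int G" "fourier_L2 f = L2_of G" by (simp_all add: G_def)
  note xG' = xG[folded G_def]
  have iG: "integrable lborel G" by (rule H1_inA(1)[OF G(1) xG'])
  define v where "v x = ft G (- x)" for x
  note inv = inA_inversion[OF G iG, folded v_def]
  obtain C where C: "C \<ge> 0" "\<And>x y. cmod (ft G x - ft G y) \<le> C * sqrt \<bar>x - y\<bar>"
    using H1_Hoelder[OF G(1) xG'] by blast
  have C1: "cmod (v x - v y) \<le> C * sqrt \<bar>x - y\<bar>" for x y
    using C(2)[of "- x" "- y"] by (simp add: v_def abs_minus_commute)
  define M where "M = (1 / sqrt (2 * pi)) * (LINT x|lborel. cmod (G x))"
  have M: "cmod (v x) \<le> M" for x unfolding v_def M_def by (rule cmod_ft_le[OF iG])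
  have "continuous_on UNIV v"
    unfolding continuous_on_def
  proof
    fix x
    have "((\<lambda>y. C * sqrt \<bar>y - x\<bar>) \<longlongrightarrow> C * sqrt \<bar>x - x\<bar>) (at x)" by (intro tendsto_intros)
    then have "((\<lambda>y. C * sqrt \<bar>y - x\<bar>) \<longlongrightarrow> 0) (at x)" by simp
    from Lim_null_comparison[OF always_eventually[OF allI[OF C1]] this]
    show "(v \<longlongrightarrow> v x) (at x within UNIV)" by (simp only: LIM_zero_iff)
  qed
  moreover have "AE x in lborel. v x = fun_of f x"
    using fun_of_L2_of[OF inv(1)] unfolding inv(2)[symmetric] by (auto elim: eventually_mono)
  ultimately have rep: "continuous_rep f = v" by (rule continuous_rep_eq)
  define K where "K = 2 * M + C * sqrt (4 * c)"
  have K: "cmod (v x) \<le> K * exp (- (1 / (2 * c)) * \<bar>x\<bar>)" for x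
  proof (cases "x \<ge> 0")
    case True
    from grid_zeros_decay[OF \<alpha> c M C(1) C1 z(1)[unfolded rep] this] show ?thesis using True by (simp add: K_def)
  next
    case False
    have C2: "cmod (v (- x) - v (- y)) \<le> C * sqrt \<bar>x - y\<bar>" for x y
      using C1[of "- x" "- y"] by (simp add: abs_minus_commute)
    have "- x \<ge> 0" using False by simp
    from grid_zeros_decay[where v = "\<lambda>x. v (- x)", OF \<alpha> c M C(1) C2 z(2)[unfolded rep] this]
    show ?thesis using False by (simp add: K_def)
  qed
  define N where "N = norm (L2_of (\<lambda>\<xi>. of_real \<xi> * G \<xi>))"
  have tr: "norm (trans_L2 h f - f) \<le> N * h" if "0 < h" "h \<le> 1" for h
    using H1_trans_le[OF G xG', of h] that by (simp add: N_def mult.commute)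
  have vm: "v \<in> borel_measurable borel" using inv(1) by measurable
  have k: "1 / (2 * c) > 0" using c by simp
  show thesis
    by (rule exp_decay_Wiener[OF vm k K inv(2) tr]) (use that in auto)
qed

context nls_solution
begin

lemma u_inA_bound:
  assumes w: "weighted_L2 u0" "weighted_L2 (u T)"
  obtains M where "\<And>t. 0 \<le> t \<Longrightarrow> t \<le> T \<Longrightarrow> square_int (\<lambda>\<xi>. of_real \<xi> * fun_of (fourier_L2 (u t)) \<xi>)"
    "\<And>t. 0 \<le> t \<Longrightarrow> t \<le> T \<Longrightarrow> inA (u t) \<and> Anorm (u t) \<le> M"
proof -
  obtain D where D: "\<And>t. 0 \<le> t \<Longrightarrow> t \<le> T \<Longrightarrow> square_int (\<lambda>\<xi>. of_real \<xi> * fun_of (fourier_L2 (u t)) \<xi>)"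
    "\<And>t. 0 \<le> t \<Longrightarrow> t \<le> T \<Longrightarrow> norm (L2_of (\<lambda>\<xi>. of_real \<xi> * fun_of (fourier_L2 (u t)) \<xi>)) \<le> D"
    using H1_bound[OF w] by blast
  obtain B where B: "\<And>t. 0 \<le> t \<Longrightarrow> t \<le> T \<Longrightarrow> norm (u t) \<le> B" using u_bounded by blast
  have "inA (u t) \<and> Anorm (u t) \<le> (1 / sqrt (2 * pi)) * ((pi + B\<^sup>2 + D\<^sup>2) / 2)" if t: "0 \<le> t" "t \<le> T" for t
  proof -
    note H = H1_inA[OF fun_of_L2(1) D(1)[OF t]]
    have "(norm (u t))\<^sup>2 \<le> B\<^sup>2" by (rule power_mono[OF B[OF t]]) simp
    moreover have "(norm (L2_of (\<lambda>\<xi>. of_real \<xi> * fun_of (fourier_L2 (u t)) \<xi>)))\<^sup>2 \<le> D\<^sup>2"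
      by (rule power_mono[OF D(2)[OF t]]) simp
    ultimately have "(LINT \<xi>|lborel. cmod (fun_of (fourier_L2 (u t)) \<xi>)) \<le> (pi + B\<^sup>2 + D\<^sup>2) / 2"
      by (intro order_trans[OF H(2)[unfolded fun_of_L2 norm_fourier_L2]] divide_right_mono add_mono) auto
    then show ?thesis using H(1) unfolding inA_def Anorm_def by (intro conjI mult_left_mono) auto
  qed
  with D(1) show thesis by (rule that)
qed

theorem grid_zeros_imp_zero:
  assumes w: "weighted_L2 u0" "weighted_L2 (u T)"
    and \<alpha>: "0 < \<alpha>" "\<alpha> < 1" and c: "c1 > 0" "c2 > 0"
    and z0: "\<And>n :: nat. continuous_rep u0 (c1 * ln (1 + real n) powr \<alpha>) = 0"
      "\<And>n :: nat. continuous_rep u0 (- (c1 * ln (1 + real n) powr \<alpha>)) = 0"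
    and zT: "\<And>n :: nat. continuous_rep (u T) (c2 * ln (1 + real n) powr \<alpha>) = 0"
    and t: "0 \<le> t" "t \<le> T"
  shows "u t = 0"
proof -
  from T have T0: "0 \<le> T" by simp
  obtain M where M: "\<And>t. 0 \<le> t \<Longrightarrow> t \<le> T \<Longrightarrow> square_int (\<lambda>\<xi>. of_real \<xi> * fun_of (fourier_L2 (u t)) \<xi>)"
    "\<And>t. 0 \<le> t \<Longrightarrow> t \<le> T \<Longrightarrow> inA (u t) \<and> Anorm (u t) \<le> M"
    using u_inA_bound[OF w] by blast
  have xG0: "square_int (\<lambda>\<xi>. of_real \<xi> * fun_of (fourier_L2 u0) \<xi>)" using M(1)[OF order_refl T0] by (simp add: u_0)
  obtain C0 \<delta> where C0: "C0 > 0" "\<delta> > 0"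
    "\<And>e n. 0 < e \<Longrightarrow> inA ((bdiff e 0 ^^ n) u0) \<and> Anorm ((bdiff e 0 ^^ n) u0) \<le> C0 * fact n * (e / \<delta>) ^ n"
    using grid_zeros_initial_decay[OF xG0 \<alpha> c(1) z0] by blast
  obtain \<rho> R where R: "\<rho> > 0" "R > 0"
    "\<And>e n t. 0 < e \<Longrightarrow> 1 \<le> n \<Longrightarrow> 0 \<le> t \<Longrightarrow> t \<le> T \<Longrightarrow> Anorm ((bdiff e 0 ^^ n) (prof t)) \<le> fact n * (\<rho> * (R * e) ^ n)"
    using bdiff_prof_bound[OF M(2) conjunct2[OF C0(3)] C0(2,1)] by blast
  \<comment> \<open>\<open>bdiff_prof_bound\<close> starts at order 1; order 0 is covered by the
    bound M on the Wiener norm.\<close>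
  define \<rho>' where "\<rho>' = max \<rho> M"
  have A: "inA ((bdiff e 0 ^^ n) (prof T)) \<and> Anorm ((bdiff e 0 ^^ n) (prof T)) \<le> fact n * (\<rho>' * (R * e) ^ n)"
    if e: "0 < e" for e n
  proof (intro conjI)
    show "inA ((bdiff e 0 ^^ n) (prof T))"
      unfolding bdiff_prof using M(2)[OF T0 order_refl] by (simp add: inA_bdiff_power)
    show "Anorm ((bdiff e 0 ^^ n) (prof T)) \<le> fact n * (\<rho>' * (R * e) ^ n)"
    proof (cases n)
      case 0
      then show ?thesis using M(2)[OF T0 order_refl] by (simp add: prof_def \<rho>'_def le_max_iff_disj)
    next
      case (Suc m)
      have "Anorm ((bdiff e 0 ^^ n) (prof T)) \<le> fact n * (\<rho> * (R * e) ^ n)"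
        using R(3)[OF e _ T0 order_refl, of n] Suc by simp
      also have "\<dots> \<le> fact n * (\<rho>' * (R * e) ^ n)"
        using R(2) e by (intro mult_left_mono mult_right_mono) (auto simp: \<rho>'_def)
      finally show ?thesis .
    qed
  qed
  \<comment> \<open>Matches the decay rate 1/(2R) from \<open>bdiff_bound_decay\<close> with the
    rate 2 d expected by \<open>exp_decay_bdiff_norm\<close>.\<close>
  define d where "d = 1 / (4 * R)"
  have d: "d > 0" "2 * d * \<bar>x\<bar> = \<bar>x\<bar> / (2 * R)" for x using R(2) by (simp_all add: d_def)
  have "AE x in lborel. exp (2 * d * \<bar>x\<bar>) * cmod (fun_of (prof T) x) \<le> 2 * \<rho>'"
    unfolding d(2) by (rule bdiff_bound_decay[OF R(2) A])
  then obtain C where C: "\<And>e n. 0 < e \<Longrightarrow> norm ((bdiff e 0 ^^ n) (prof T)) \<le> fact n * (C * (e / d) ^ n)"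
    using exp_decay_bdiff_norm[OF d(1)] by blast
  have C': "norm ((bdiff e T ^^ n) (u T)) \<le> fact n * (C * (e / d) ^ n)" if "0 < e" for e n
    using C[OF that, of n] unfolding bdiff_prof norm_schroedinger .
  define G where "G = fun_of (fourier_L2 (mult_L2 (chirp T) (u T)))"
  have G: "square_int G" "fourier_L2 (mult_L2 (chirp T) (u T)) = L2_of G" by (simp_all add: G_def)
  have "T * d / 2 > 0" using T d(1) by simp
  from chirp_grid_zeros_imp_0[OF T this G chirp_fourier_integrable[OF T d(1) C' G] \<alpha> c(2) zT]
  have uT: "u T = 0" .
  \<comment> \<open>The second Gronwall bound holds in both directions of time, so u(T) = 0 is
    carried back to every t.\<close>
  show ?thesis
  proof (rule boost_Gronwall)
    fix C assume "\<And>s t. 0 \<le> s \<Longrightarrow> s \<le> T \<Longrightarrow> 0 \<le> t \<Longrightarrow> t \<le> T \<Longrightarrow> norm (u t) \<le> C * norm (u s)"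
    from this[OF T0 order_refl t] show ?thesis by (simp add: uT)
  qed
qed

end

theorem theorem2:
  fixes lam :: complex and T \<alpha> c1 c2 :: real
    and u0 :: L2 and u :: "real \<Rightarrow> L2"
  assumes "T > 0"
    and "nls_strong_solution lam T u0 u"
    and "weighted_L2 u0" and "weighted_L2 (u T)"
    and "0 < \<alpha>" and "\<alpha> < 1" and "c1 > 0" and "c2 > 0"
    and "\<And>n :: nat. continuous_rep u0 (c1 * ln (1 + real n) powr \<alpha>) = 0"
    and "\<And>n :: nat. continuous_rep u0 (- (c1 * ln (1 + real n) powr \<alpha>)) = 0"
    and "\<And>n :: nat. continuous_rep (u T) (c2 * ln (1 + real n) powr \<alpha>) = 0"
    and "\<And>n :: nat. continuous_rep (u T) (- (c2 * ln (1 + real n) powr \<alpha>)) = 0"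
  shows "\<forall>t\<in>{0..T}. u t = 0"
proof -
  interpret nls_solution lam T u0 u by unfold_locales (use assms in auto)
  show ?thesis using grid_zeros_imp_zero[OF assms(3-11)] by simp
qed

end
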